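(* Let $\lambda$ and $\mu$ be partitions of $n$. The cocharge Kostka-Foulkes polynomial satisfies $$\widetilde{K}_{\lambda,\mu}(q)=\sum_S q^{\mathrm{cocharge}(S)},$$ where $S$ runs over the standard tableaux of shape $\lambda$ such that $\mathrm{cattype}(S)\trianglerighteq\mu$.
   Context: Tableaux are in English notation. For a partition $\mu$, $n(\mu)=\sum_i(i-1)\mu_i$. $K_{\lambda,\mu}(q)$ is the Kostka-Foulkes polynomial (coefficients of the expansion of Schur functions in Hall-Littlewood functions: $s_\lambda(x)=\sum_\mu K_{\lambda,\mu}(q)P_\mu(x;q)$), and $\widetilde{K}_{\lambda,\mu}(q)=q^{n(\mu)}K_{\lambda,\mu}(q^{-1})$. $\trianglerighteq$ is the dominance order on partitions of $n$. The row-reading word of a tableau is $\cdots w^2w^1$ where $w^i$ is its $i$-th row read left to right. For a word $u$, $P(u)$ is the unique column strict tableau of partition shape whose row-reading word is Knuth equivalent to $u$; a tableau inside $P(\cdot)$ stands for its row-reading word. Cocharge of a standard tableau $S$ with $n$ cells: let $u$ be its row-reading word (a permutation of $1,\dots,n$). Put $c_1=0$ and, for $i\ge2$, $c_i=c_{i-1}$ if $i$ appears to the left of $i-1$ in $u$ and $c_i=c_{i-1}+1$ if $i$ appears to the right of $i-1$. Then $\mathrm{charge}(S)=c_1+\dots+c_n$ and $\mathrm{cocharge}(S)=\binom n2-\mathrm{charge}(S)$. Catabolism type: for a standard tableau $S$, $\mathrm{Cat}(S)=P(S_nS_s)$ where $S_n$ is the first row of $S$ and $S_s$ is the rest of $S$.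 Let $d_1(S)$ be the maximal $i$ such that $1,2,\dots,i$ all lie in the first row of $S$. Then $\mathrm{cattype}(S)$ is the sequence whose first part is $d_1(S)$ and whose $(i+1)$-st part is $d_1(\mathrm{Cat}^{i}(S))-d_1(\mathrm{Cat}^{i-1}(S))$ for $i\ge1$; it is a partition of $n$. *)

theory Defs
  imports
    "HOL-Computational_Algebra.Computational_Algebra"
    "HOL-Combinatorics.Permutations"
    "HOL-Library.Poly_Mapping"
    "HOL-Library.More_List"
begin

section \<open>Partitions\<close>

definition is_partition :: "nat list \<Rightarrow> bool" where
  "is_partition mu \<longleftrightarrow> sorted_wrt (\<ge>) mu \<and> 0 \<notin> set mu"

definition partitions :: "nat \<Rightarrow> nat list set" where
  "partitions n = {mu. is_partition mu \<and> sum_list mu = n}"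

text \<open>Positions are counted from 0, so the weight \<open>i - 1\<close> of the \<open>i\<close>-th part becomes the index.\<close>

definition n_stat :: "nat list \<Rightarrow> nat" where
  "n_stat mu = (\<Sum>i<length mu. i * mu ! i)"

text \<open>
  Dominance order, for partitions of the same number regarded as sequences of parts
  continued by zeros; \<open>nth_default 0 mu\<close> is the sequence of a list \<open>mu\<close>.
\<close>

definition dominates :: "(nat \<Rightarrow> nat) \<Rightarrow> (nat \<Rightarrow> nat) \<Rightarrow> bool" where
  "dominates a b \<longleftrightarrow> (\<forall>k. (\<Sum>i<k. b i) \<le> (\<Sum>i<k. a i))"


section \<open>Tableaux\<close>

text \<open>A tableau (English notation) is the list of its rows, from top to bottom.\<close>

type_synonym tableau = "nat list list"

definition shape :: "tableau \<Rightarrow> nat list" where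
  "shape T = map length T"

definition column_strict :: "tableau \<Rightarrow> bool" where
  "column_strict T \<longleftrightarrow> is_partition (shape T) \<and> (\<forall>r\<in>set T. sorted r) \<and>
     (\<forall>i j. Suc i < length T \<longrightarrow> j < length (T ! Suc i) \<longrightarrow> T ! i ! j < T ! Suc i ! j)"

definition reading_word :: "tableau \<Rightarrow> nat list" where
  "reading_word T = concat (rev T)"

definition standard :: "tableau \<Rightarrow> bool" where
  "standard T \<longleftrightarrow> column_strict T \<and> distinct (reading_word T) \<and>
     set (reading_word T) = {1..length (reading_word T)}"

definition standard_tableaux :: "nat list \<Rightarrow> tableau set" where
  "standard_tableaux lam = {T. standard T \<and> shape T = lam}"

inductive knuth_move :: "nat list \<Rightarrow> nat list \<Rightarrow> bool" where
  "x < y \<Longrightarrow> y \<le> z \<Longrightarrow> knuth_move (u @ [y, x, z] @ v) (u @ [y, z, x] @ v)"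
| "x \<le> y \<Longrightarrow> y < z \<Longrightarrow> knuth_move (u @ [x, z, y] @ v) (u @ [z, x, y] @ v)"

definition knuth_equiv :: "nat list \<Rightarrow> nat list \<Rightarrow> bool" where
  "knuth_equiv = equivclp knuth_move"

definition P_tableau :: "nat list \<Rightarrow> tableau" where
  "P_tableau u = (THE T. column_strict T \<and> knuth_equiv (reading_word T) u)"


section \<open>Cocharge\<close>

definition left_of :: "nat list \<Rightarrow> nat \<Rightarrow> nat \<Rightarrow> bool" where
  "left_of u a b \<longleftrightarrow> (\<exists>k l. k < l \<and> l < length u \<and> u ! k = a \<and> u ! l = b)"

text \<open>The value at 0 is a dummy: the letters are \<open>1, \<dots>, n\<close>.\<close>

fun charge_label :: "nat list \<Rightarrow> nat \<Rightarrow> nat" where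
  "charge_label u 0 = 0"
| "charge_label u (Suc 0) = 0"
| "charge_label u (Suc (Suc i)) =
     (if left_of u (Suc (Suc i)) (Suc i) then charge_label u (Suc i)
      else charge_label u (Suc i) + 1)"

definition charge :: "tableau \<Rightarrow> nat" where
  "charge S = (let u = reading_word S in \<Sum>i=1..length u. charge_label u i)"

text \<open>The subtraction does not truncate, since the label of \<open>i\<close> is at most \<open>i - 1\<close>.\<close>

definition cocharge :: "tableau \<Rightarrow> nat" where
  "cocharge S = (length (reading_word S) choose 2) - charge S"


section \<open>Catabolism type\<close>

fun first_row :: "tableau \<Rightarrow> nat list" where
  "first_row [] = []"
| "first_row (r # T) = r"

definition Cat :: "tableau \<Rightarrow> tableau" where
  "Cat S = P_tableau (first_row S @ reading_word (tl S))"

definition d1 :: "tableau \<Rightarrow> nat" where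
  "d1 S = (GREATEST i. {1..i} \<subseteq> set (first_row S))"

text \<open>
  The catabolism type as a sequence of parts indexed from 0. The word defining \<open>Cat S\<close>
  begins with \<open>1, \<dots>, d1 S\<close>, so \<open>d1\<close> is nondecreasing along iterates and the subtraction
  does not truncate.
\<close>

definition cattype :: "tableau \<Rightarrow> nat \<Rightarrow> nat" where
  "cattype S i =
     (case i of 0 \<Rightarrow> d1 S | Suc j \<Rightarrow> d1 ((Cat ^^ Suc j) S) - d1 ((Cat ^^ j) S))"


section \<open>Schur and Hall--Littlewood functions in \<open>N\<close> variables\<close>

text \<open>
  Both are evaluated at elements \<open>x 0, \<dots>, x (N - 1)\<close> of an arbitrary field; they are
  used below with independent indeterminates.
\<close>

definition schur :: "nat \<Rightarrow> nat list \<Rightarrow> (nat \<Rightarrow> 'a::field) \<Rightarrow> 'a" where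
  "schur N lam x =
     (\<Sum>T \<in> {T. column_strict T \<and> shape T = lam \<and> set (reading_word T) \<subseteq> {..<N}}.
        prod_list (map x (reading_word T)))"

definition hl_v :: "nat \<Rightarrow> 'a::field \<Rightarrow> 'a" where
  "hl_v m t = (\<Prod>i=1..m. (1 - t ^ i) / (1 - t))"

text \<open>
  The normalising factor is the product of \<open>hl_v m\<^sub>i\<close> over all \<open>i \<ge> 0\<close>, where \<open>m\<^sub>i\<close> is the
  number of parts equal to \<open>i\<close> of \<open>mu\<close> padded by zeros to length \<open>N\<close>.
\<close>

definition hl_norm :: "nat \<Rightarrow> nat list \<Rightarrow> 'a::field \<Rightarrow> 'a" where
  "hl_norm N mu t = hl_v (N - length mu) t * (\<Prod>i\<in>set mu. hl_v (count_list mu i) t)"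

text \<open>
  The symmetrisation formula for \<open>P\<^sub>\<mu>(x\<^sub>1, \<dots>, x\<^sub>N; t)\<close>, meaningful for \<open>length mu \<le> N\<close>.
\<close>

definition hall_littlewood_P :: "nat \<Rightarrow> nat list \<Rightarrow> (nat \<Rightarrow> 'a::field) \<Rightarrow> 'a \<Rightarrow> 'a" where
  "hall_littlewood_P N mu x t =
     (\<Sum>w | w permutes {..<N}.
        (\<Prod>i<N. x (w i) ^ nth_default 0 mu i) *
        (\<Prod>(i, j) \<in> {(i, j). i < j \<and> j < N}. (x (w i) - t * x (w j)) / (x (w i) - x (w j))))
     / hl_norm N mu t"


section \<open>Kostka--Foulkes polynomials\<close>

text \<open>
  The field of rational functions in indeterminates indexed by the natural numbers over the
  ring of integer polynomials in \<open>q\<close>.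
\<close>

type_synonym ratfun = "((nat \<Rightarrow>\<^sub>0 nat) \<Rightarrow>\<^sub>0 int poly) fract"

definition const_rf :: "int poly \<Rightarrow> ratfun" where
  "const_rf p = to_fract (Poly_Mapping.single 0 p)"

definition var_rf :: "nat \<Rightarrow> ratfun" where
  "var_rf i = to_fract (Poly_Mapping.single (Poly_Mapping.single i 1) 1)"

definition q_rf :: ratfun where
  "q_rf = const_rf [:0, 1:]"

text \<open>
  \<open>K\<close> gives the coefficients of the Schur function of \<open>lam\<close> in the Hall--Littlewood
  functions. An identity between homogeneous symmetric functions of degree \<open>n\<close> in infinitely
  many variables means the same identity in \<open>N\<close> variables for all \<open>N \<ge> n\<close>.
  Outside the partitions of \<open>n\<close> the family is normalised to 0.
\<close>

definition hl_expansion :: "nat list \<Rightarrow> (nat list \<Rightarrow> int poly) \<Rightarrow> bool" where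
  "hl_expansion lam K \<longleftrightarrow>
     (\<forall>mu. mu \<notin> partitions (sum_list lam) \<longrightarrow> K mu = 0) \<and>
     (\<forall>N \<ge> sum_list lam. schur N lam var_rf =
        (\<Sum>mu\<in>partitions (sum_list lam). const_rf (K mu) * hall_littlewood_P N mu var_rf q_rf))"

definition kostka_foulkes :: "nat list \<Rightarrow> nat list \<Rightarrow> int poly" where
  "kostka_foulkes lam = (THE K. hl_expansion lam K)"

text \<open>
  The cocharge version involves \<open>q\<^sup>-\<^sup>1\<close>, so it is defined in the field of rational functions in
  the single indeterminate \<open>q\<close>.
\<close>

definition q_var :: "int poly fract" where
  "q_var = to_fract [:0, 1:]"

definition cocharge_kostka_foulkes :: "nat list \<Rightarrow> nat list \<Rightarrow> int poly fract" where
  "cocharge_kostka_foulkes lam mu =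
     q_var ^ n_stat mu * poly (map_poly of_int (kostka_foulkes lam mu)) (inverse q_var)"

end

theory Submission
  imports Defs "HOL-Library.FuncSet" "HOL-Combinatorics.Permutations" "Jordan_Normal_Form.Determinant"
begin

text \<open>
  The condition \<open>cattype S \<trianglerighteq> \<mu>\<close> depends only on the Knuth class of the reading word: it says
  that the word can be emptied by repeatedly rotating the first row behind the rest and removing
  the \<open>\<mu>\<^sub>i\<close> smallest letters from it (\<open>catable\<close>). The crucial point is that, for \<open>m\<close> at least all
  parts of \<open>\<mu>\<close>, this condition is invariant under the monodromy \<open>rX \<mapsto> r'X'\<close> obtained by
  putting a block \<open>K\<close> of \<open>m\<close> small letters in between, with \<open>XKr\<close> and \<open>X'Kr'\<close> Knuth equivalent
  (\<open>rot_closed_catable\<close>).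

  Tableaux are read as colourings of the letters by rows. Sign-reversing involutions make it
  harmless to drop the column conditions when an alternating function of the shifted row lengths
  is summed, so the first row can be split off and moved below the others. For the sums
  \<open>L\<^sub>\<mu>(g) = \<Sum>\<^sub>S t\<^bsup>n(\<mu>) - cocharge S\<^esup> g(shape S)\<close> this yields
  \<open>L\<^bsub>(m, \<mu>)\<^esub>(g) = L\<^sub>\<mu>(B\<^sub>m g)\<close>, where \<open>B\<^sub>m\<close> adds a row and removes a horizontal strip.
  The coefficients \<open>r\<^sub>\<mu>\<close> of the unnormalised Hall--Littlewood functions in the alternants satisfy
  \<open>r\<^bsub>(m, \<mu>)\<^esub> = D\<^sub>m r\<^sub>\<mu>\<close> for an adjoint operator \<open>D\<^sub>m\<close>. The commutation relation between
  \<open>B\<^sub>n\<close> and \<open>D\<^sub>m\<close> gives \<open>L\<^sub>\<nu>(r\<^sub>\<mu>) = 0\<close> for \<open>\<nu> \<noteq> \<mu>\<close>, and \<open>L\<^sub>\<mu>(r\<^sub>\<mu>)\<close> is the normalising factor of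
  \<open>P\<^sub>\<mu>\<close>; inverting this matrix identity expands Schur functions in the \<open>P\<^sub>\<mu>\<close>.
\<close>

section \<open>The plactic congruence on words with distinct letters\<close>

text \<open>Moving the increasing end of a word to the front does not respect Knuth equivalence in
  general, and this shapes both halves of the proof. In the first half, \<open>catable\<close>
  quantifies over all ways of cutting a word of the class into rows; that the choice does not matter
  is proved by induction on the parts, and the inductive step brings in letters below all given
  ones, which is why the words are words of integers. In the second half, the rotated first row does
  not fit below the other rows as a tableau. The sums are therefore spread over arbitrary colourings
  and tested against alternating functions of the row lengths plus the staircase. A colouring that
  is not a tableau cancels against another one of the same Knuth class, so conditions and weights
  that depend on the class alone survive the passage in both directions. The number of rows is fixed
  at some N \<ge> n, with zeros appended to \<mu>: each step of the recursion consumes one part and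
  one row, and the row that disappears is empty.\<close>

inductive pl_step :: "'a::linorder list \<Rightarrow> 'a list \<Rightarrow> bool" where
  pl_yxz: "x < y \<Longrightarrow> y < z \<Longrightarrow> pl_step (u @ [y, x, z] @ v) (u @ [y, z, x] @ v)"
| pl_xzy: "x < y \<Longrightarrow> y < z \<Longrightarrow> pl_step (u @ [x, z, y] @ v) (u @ [z, x, y] @ v)"

definition pl :: "'a::linorder list \<Rightarrow> 'a list \<Rightarrow> bool" (infix "\<simeq>" 50) where
  "pl = equivclp pl_step"

lemma pl_refl [simp, intro]: "w \<simeq> w"
  by (simp add: pl_def)

lemma pl_sym: "u \<simeq> v \<Longrightarrow> v \<simeq> u"
  unfolding pl_def by (rule equivclp_sym)

lemma pl_trans [trans]: "u \<simeq> v \<Longrightarrow> v \<simeq> w \<Longrightarrow> u \<simeq> w"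
  unfolding pl_def by (rule equivclp_trans)

lemma pl_stepI: "pl_step u v \<Longrightarrow> u \<simeq> v"
  unfolding pl_def by blast

lemma pl_induct [consumes 1, case_names refl step sym trans]:
  assumes "u \<simeq> v" and "\<And>w. P w w" and "\<And>u v. pl_step u v \<Longrightarrow> P u v"
    and "\<And>u v. P u v \<Longrightarrow> P v u" and "\<And>u v w. P u v \<Longrightarrow> P v w \<Longrightarrow> P u w"
  shows "P u v"
  using assms(1) unfolding pl_def
proof (induction rule: equivclp_induct)
  case base
  show ?case by (rule assms(2))
next
  case (step y z)
  then show ?case using assms(3-5) by metis
qed

lemma pl_step_append: "pl_step u v \<Longrightarrow> pl_step (a @ u @ b) (a @ v @ b)"
proof (induction rule: pl_step.induct)
  case (pl_yxz x y z u v)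
  from pl_step.pl_yxz[OF this, of "a @ u" "v @ b"] show ?case by simp
next
  case (pl_xzy x y z u v)
  from pl_step.pl_xzy[OF this, of "a @ u" "v @ b"] show ?case by simp
qed

lemma pl_append: "u \<simeq> v \<Longrightarrow> a @ u @ b \<simeq> a @ v @ b"
  by (induction rule: pl_induct) (auto intro: pl_stepI pl_step_append pl_sym pl_trans)

lemma pl_append_left: "u \<simeq> v \<Longrightarrow> a @ u \<simeq> a @ v"
  using pl_append[of u v a "[]"] by simp

lemma pl_append_right: "u \<simeq> v \<Longrightarrow> u @ b \<simeq> v @ b"
  using pl_append[of u v "[]" b] by simp

lemma pl_mset: "u \<simeq> v \<Longrightarrow> mset u = mset v"
  by (induction rule: pl_induct) (auto elim!: pl_step.cases)

lemma pl_set: "u \<simeq> v \<Longrightarrow> set u = set v"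
  using pl_mset by (metis set_mset_mset)

lemma pl_length: "u \<simeq> v \<Longrightarrow> length u = length v"
  using pl_mset by (metis size_mset)

lemma pl_distinct: "u \<simeq> v \<Longrightarrow> distinct u = distinct v"
  using pl_mset by (metis mset_eq_imp_distinct_iff)

lemma pl_Nil [simp]: "[] \<simeq> w \<longleftrightarrow> w = []" "w \<simeq> [] \<longleftrightarrow> w = []"
  using pl_length by force+

text \<open>A move interchanges the smallest and the largest of its three letters. If one of these
  is filtered out, both sides become equal; if both stay, convexity keeps the middle letter and the
  move survives.\<close>

lemma pl_filter:
  assumes convex: "\<And>x y z. P x \<Longrightarrow> P z \<Longrightarrow> x < y \<Longrightarrow> y < z \<Longrightarrow> P y" and "u \<simeq> v"
  shows "filter P u \<simeq> filter P v"
  using assms(2)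
proof (induction rule: pl_induct)
  case (step u v)
  then show ?case
  proof cases
    case (pl_yxz x y z a b)
    show ?thesis
    proof (cases "P x \<and> P z")
      case True
      with convex pl_yxz have "P y" by blast
      with True pl_yxz pl_step.pl_yxz[of x y z "filter P a" "filter P b"] show ?thesis
        by (auto intro: pl_stepI)
    qed (auto simp: pl_yxz)
  next
    case (pl_xzy x y z a b)
    show ?thesis
    proof (cases "P x \<and> P z")
      case True
      with convex pl_xzy have "P y" by blast
      with True pl_xzy pl_step.pl_xzy[of x y z "filter P a" "filter P b"] show ?thesis
        by (auto intro: pl_stepI)
    qed (auto simp: pl_xzy)
  qed
qed (auto intro: pl_sym pl_trans)

abbreviation inc :: "'a::linorder list \<Rightarrow> bool" where
  "inc \<equiv> sorted_wrt (<)"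

lemma inc_distinct: "inc x \<Longrightarrow> distinct x"
  by (simp add: strict_sorted_iff)

lemma inc_set_eq: "inc x \<Longrightarrow> inc y \<Longrightarrow> set x = set y \<Longrightarrow> x = y"
  by (simp add: strict_sorted_equal)

lemma pl_step_not_inc: "pl_step u v \<Longrightarrow> \<not> inc u \<and> \<not> inc v"
  by (induction rule: pl_step.induct) (auto simp: sorted_wrt_append)

text \<open>Both sides of a move contain a descent, so an increasing word is alone in its class.
  This turns equivalences into equations in many places below.\<close>

lemma pl_inc_eq:
  assumes "u \<simeq> v" "inc u"
  shows "v = u"
proof -
  from assms(1) have "inc u \<or> inc v \<Longrightarrow> u = v"
    by (induction rule: pl_induct) (auto dest: pl_step_not_inc)
  with assms(2) show ?thesis by blast
qed

subsection \<open>Row insertion\<close>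

text \<open>Row insertion. The bumped letter is returned as a list with at most one element, so that
  the letters bumped by a whole word can be concatenated.\<close>

fun ins :: "'a::linorder \<Rightarrow> 'a list \<Rightarrow> 'a list \<times> 'a list" where
  "ins a [] = ([a], [])"
| "ins a (b # x) = (if a < b then (a # x, [b]) else (b # fst (ins a x), snd (ins a x)))"

fun rb :: "'a::linorder list \<Rightarrow> 'a list \<Rightarrow> 'a list \<times> 'a list" where
  "rb x [] = (x, [])"
| "rb x (a # w) = (fst (rb (fst (ins a x)) w), snd (ins a x) @ snd (rb (fst (ins a x)) w))"

text \<open>For distinct letters, \<open>row_of w\<close> is the first row of the insertion tableau
  of \<open>w\<close>, and \<open>bmp w\<close> is a word whose insertion tableau consists of the
  other rows.\<close>

definition row_of :: "'a::linorder list \<Rightarrow> 'a list" where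
  "row_of w = fst (rb [] w)"

definition bmp :: "'a::linorder list \<Rightarrow> 'a list" where
  "bmp w = snd (rb [] w)"

lemma rb_append:
  "rb x (u @ v) = (fst (rb (fst (rb x u)) v), snd (rb x u) @ snd (rb (fst (rb x u)) v))"
  by (induction u arbitrary: x) auto

lemma mset_ins: "mset (snd (ins a x) @ fst (ins a x)) = mset (a # x)"
  by (induction x) auto

lemma set_ins: "set (snd (ins a x)) \<union> set (fst (ins a x)) = insert a (set x)"
  using mset_ins[of a x] by (metis list.simps(15) set_append set_mset_mset)

lemma set_ins_sub: "b \<in> set (fst (ins a x)) \<Longrightarrow> b = a \<or> b \<in> set x"
  using set_ins[of a x] by auto

lemma inc_ins: "inc x \<Longrightarrow> a \<notin> set x \<Longrightarrow> inc (fst (ins a x))"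
proof (induction x)
  case (Cons b x)
  then show ?case using set_ins_sub[of _ a x] by (auto simp: sorted_wrt_append) (use not_less_iff_gr_or_eq in fastforce)
qed simp

lemma mem_ins: "a \<in> set (fst (ins a x))"
  by (induction x) auto

lemma length_snd_ins: "length (snd (ins a x)) \<le> 1"
  by (induction x) auto

lemma snd_ins_cases: "snd (ins a x) = [] \<or> (\<exists>e. snd (ins a x) = [e] \<and> a < e \<and> e \<in> set x)"
  by (induction x) auto

lemma ins_append_end: "(\<forall>b\<in>set x. b < a) \<Longrightarrow> ins a x = (x @ [a], [])"
  by (induction x) auto

text \<open>The new letter travels left past every entry but the first: for neighbours y < z of the
  row and a < y, the words y z a and y a z are one move apart.\<close>

lemma pl_insert_smaller:
  assumes "inc (b # x)" "a < b"
  shows "(b # x) @ [a] \<simeq> [b, a] @ x"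
  using assms
proof (induction x rule: rev_induct)
  case (snoc z x)
  then have IH: "b # x @ [a] \<simeq> [b, a] @ x" by (auto simp: sorted_wrt_append)
  obtain u y where uy: "b # x = u @ [y]" by (metis append_butlast_last_id list.distinct(1))
  have y: "a < y" "y < z"
  proof -
    have "y \<in> set (b # x)" by (simp add: uy)
    with snoc.prems show "a < y" "y < z" by (auto simp: sorted_wrt_append)
  qed
  from pl_yxz[OF y, of u "[]"] have "u @ [y, z, a] \<simeq> u @ [y, a, z]"
    using pl_stepI pl_sym by fastforce
  then have "b # x @ [z, a] \<simeq> b # x @ [a, z]"
    using uy by (metis append.assoc append_Cons append_Nil)
  also have "b # x @ [a, z] \<simeq> [b, a] @ x @ [z]"
    using pl_append_right[OF IH, of "[z]"] by simp
  finally show ?case by simp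
qed auto

lemma pl_ins: "inc x \<Longrightarrow> a \<notin> set x \<Longrightarrow> x @ [a] \<simeq> snd (ins a x) @ fst (ins a x)"
proof (induction x)
  case (Cons b x)
  show ?case
  proof (cases "a < b")
    case True
    then show ?thesis using pl_insert_smaller[OF Cons.prems(1) True] by simp
  next
    case False
    with Cons.prems have "b < a" by auto
    from Cons have IH: "x @ [a] \<simeq> snd (ins a x) @ fst (ins a x)" by auto
    from snd_ins_cases[of a x] show ?thesis
    proof
      assume "snd (ins a x) = []"
      with IH False show ?thesis using pl_append_left[of _ _ "[b]"] by fastforce
    next
      assume "\<exists>e. snd (ins a x) = [e] \<and> a < e \<and> e \<in> set x"
      then obtain e where e: "snd (ins a x) = [e]" "a < e" "e \<in> set x" by blast
      obtain c x' where c: "fst (ins a x) = c # x'" using mem_ins[of a x] by (cases "fst (ins a x)") auto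
      have "inc (c # x')" using inc_ins[of x a] Cons.prems c by auto
      moreover have "a \<in> set (c # x')" using mem_ins[of a x] c by simp
      ultimately have "c \<le> a" by auto
      then have ce: "c < e" using e by simp
      have bc: "b < c"
        using set_ins_sub[of c a x] c \<open>b < a\<close> Cons.prems by auto
      have "(b # x) @ [a] \<simeq> [b, e, c] @ x'"
        using pl_append_left[OF IH, of "[b]"] e c by simp
      also have "[b, e, c] @ x' \<simeq> [e, b, c] @ x'"
        using pl_xzy[OF bc ce, of "[]" x'] pl_stepI by fastforce
      finally show ?thesis using False e c by simp
    qed
  qed
qed auto

lemma mset_rb: "mset (snd (rb x w) @ fst (rb x w)) = mset (x @ w)"
proof (induction w arbitrary: x)
  case (Cons a w)
  have "mset (snd (rb x (a # w)) @ fst (rb x (a # w))) = mset (snd (ins a x)) + mset (fst (ins a x) @ w)"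
    using Cons[of "fst (ins a x)"] by (simp add: ac_simps)
  also have "\<dots> = mset (x @ a # w)" using mset_ins[of a x] by (simp add: ac_simps)
  finally show ?case .
qed simp

lemma set_rb: "set (snd (rb x w)) \<union> set (fst (rb x w)) = set x \<union> set w"
  using mset_rb[of x w] by (metis set_append set_mset_mset)

lemma set_fst_ins_subset: "set (fst (ins a x)) \<subseteq> insert a (set x)"
  using set_ins_sub by fastforce

lemma inc_rb: "inc x \<Longrightarrow> distinct (x @ w) \<Longrightarrow> inc (fst (rb x w))"
proof (induction w arbitrary: x)
  case (Cons a w)
  then have i: "inc (fst (ins a x))" by (intro inc_ins) auto
  have "distinct (fst (ins a x) @ w)"
    using inc_distinct[OF i] set_fst_ins_subset[of a x] Cons.prems by auto
  with Cons.IH i show ?case by simp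
qed simp

lemma pl_rb: "inc x \<Longrightarrow> distinct (x @ w) \<Longrightarrow> x @ w \<simeq> snd (rb x w) @ fst (rb x w)"
proof (induction w arbitrary: x)
  case (Cons a w)
  then have i: "inc (fst (ins a x))" by (intro inc_ins) auto
  have d: "distinct (fst (ins a x) @ w)"
    using inc_distinct[OF i] set_fst_ins_subset[of a x] Cons.prems by auto
  have "(x @ [a]) @ w \<simeq> (snd (ins a x) @ fst (ins a x)) @ w"
    using Cons.prems by (intro pl_append_right pl_ins) auto
  then have "x @ a # w \<simeq> snd (ins a x) @ (fst (ins a x) @ w)" by simp
  also have "\<dots> \<simeq> snd (ins a x) @ (snd (rb (fst (ins a x)) w) @ fst (rb (fst (ins a x)) w))"
    by (intro pl_append_left Cons.IH i d)
  finally show ?case by simp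
qed simp

lemma inc_row_of: "distinct w \<Longrightarrow> inc (row_of w)"
  unfolding row_of_def by (rule inc_rb) auto

lemma pl_bmp_row: "distinct w \<Longrightarrow> w \<simeq> bmp w @ row_of w"
  unfolding row_of_def bmp_def using pl_rb[of "[]" w] by simp

lemma mset_bmp_row: "mset (bmp w @ row_of w) = mset w"
  unfolding row_of_def bmp_def using mset_rb[of "[]" w] by simp

lemma set_bmp_row: "set (bmp w) \<union> set (row_of w) = set w"
  by (metis mset_bmp_row set_append set_mset_mset)

lemma distinct_bmp_row: "distinct w \<Longrightarrow> distinct (bmp w @ row_of w)"
  using mset_bmp_row mset_eq_imp_distinct_iff by blast

lemma length_bmp_row: "length (bmp w) + length (row_of w) = length w"
  by (metis mset_bmp_row length_append size_mset)

lemma snd_ins_mem: "snd (ins a x) = [e] \<Longrightarrow> e \<in> set x \<and> a < e"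
  using snd_ins_cases[of a x] by auto

lemma ins_ins_less:
  assumes "inc T" "y < z" "y \<notin> set T" "z \<notin> set T"
  shows "snd (ins y T) = [] \<Longrightarrow> snd (ins z (fst (ins y T))) = []"
    and "snd (ins y T) = [e] \<Longrightarrow> snd (ins z (fst (ins y T))) = [f] \<Longrightarrow> e < f"
  using assms by (induction T) (auto split: if_splits simp: ins_append_end dest: snd_ins_mem)

lemma ins_ins_greater:
  assumes "inc T" "y < z" "y \<notin> set T" "z \<notin> set T"
  shows "\<exists>e. snd (ins y (fst (ins z T))) = [e]"
    and "snd (ins z T) = [f] \<Longrightarrow> snd (ins y (fst (ins z T))) = [e] \<Longrightarrow> e < f"
  using assms by (induction T) (auto split: if_splits dest: snd_ins_mem)

lemma snd_ins_Nil_or: "snd (ins a x) = [] \<or> (\<exists>e. snd (ins a x) = [e])"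
  using snd_ins_cases[of a x] by auto

lemma pl_yxz': "x < y \<Longrightarrow> y < z \<Longrightarrow> [y, x, z] \<simeq> [y, z, x]"
  using pl_yxz[of x y z "[]" "[]"] by (auto intro: pl_stepI)

lemma pl_xzy': "x < y \<Longrightarrow> y < z \<Longrightarrow> [x, z, y] \<simeq> [z, x, y]"
  using pl_xzy[of x y z "[]" "[]"] by (auto intro: pl_stepI)

text \<open>The induction follows the row. An entry smaller than all three letters is passed by each
  of them; otherwise both sides leave the same row, and the bumped words coincide or are again the
  two sides of a move.\<close>

lemma rb_yxz:
  assumes "inc T" "x < y" "y < z" "x \<notin> set T" "y \<notin> set T" "z \<notin> set T"
  shows "fst (rb T [y, x, z]) = fst (rb T [y, z, x]) \<and> snd (rb T [y, x, z]) \<simeq> snd (rb T [y, z, x])"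
  using assms
proof (induction T)
  case Nil
  then show ?case by auto
next
  case (Cons b T)
  have xz: "x < z" using Cons.prems by simp
  have neq: "x \<noteq> b" "y \<noteq> b" "z \<noteq> b" using Cons.prems by auto
  have T: "inc T" "x \<notin> set T" "y \<notin> set T" "z \<notin> set T" using Cons.prems by auto
  consider "b < x" | "x < b" "b < y" | "y < b" "b < z" | "z < b"
    using neq by (metis linorder_cases)
  then show ?case
  proof cases
    case 1
    then show ?thesis using Cons.IH T Cons.prems by auto
  next
    case 2
    then have b: "\<not> y < b" "\<not> z < b" "\<not> y < x" "\<not> z < x" using Cons.prems by auto
    consider "snd (ins y T) = []" | e where "snd (ins y T) = [e]" using snd_ins_Nil_or by blast
    then show ?thesis
    proof cases
      case 1
      with ins_ins_less(1)[OF T(1) Cons.prems(3) T(3,4)] 2 b show ?thesis by auto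
    next
      fix e assume e: "snd (ins y T) = [e]"
      then have "b < e" using Cons.prems snd_ins_mem by fastforce
      consider "snd (ins z (fst (ins y T))) = []" | f where "snd (ins z (fst (ins y T))) = [f]"
        using snd_ins_Nil_or by blast
      then show ?thesis
      proof cases
        case 1
        with e 2 b show ?thesis by auto
      next
        fix f assume f: "snd (ins z (fst (ins y T))) = [f]"
        then have "e < f" using ins_ins_less(2)[OF T(1) Cons.prems(3) T(3,4) e] by blast
        \<comment> \<open>Here x bumps b, while y and z bump e and f further right: the bumped words
          are e b f and e f b.\<close>
        with e f 2 b \<open>b < e\<close> pl_yxz'[of b e f] show ?thesis by auto
      qed
    qed
  next
    case 3
    then have b: "\<not> z < y" "\<not> z < x" using Cons.prems xz by auto
    consider "snd (ins z T) = []" | f where "snd (ins z T) = [f]" using snd_ins_Nil_or by blast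
    then show ?thesis
    proof cases
      case 1
      with 3 b Cons.prems show ?thesis by auto
    next
      fix f assume f: "snd (ins z T) = [f]"
      then have "b < f" using Cons.prems snd_ins_mem by fastforce
      with f 3 b Cons.prems pl_yxz'[of y b f] show ?thesis by auto
    qed
  next
    case 4
    then have b: "y < b" "x < b" "\<not> z < y" "\<not> z < x" using Cons.prems xz by auto
    show ?thesis
    proof (cases "T = []")
      case True
      with 4 b Cons.prems(2,3) xz show ?thesis by simp
    next
      case False
      then obtain c T' where T': "T = c # T'" by (cases T) auto
      then have "b < c" "z < c" using Cons.prems(1) 4 by auto
      with 4 b Cons.prems(2,3) T' pl_yxz'[of y b c] show ?thesis by simp
    qed
  qed
qed

lemma rb_xzy:
  assumes "inc T" "x < y" "y < z" "x \<notin> set T" "y \<notin> set T" "z \<notin> set T"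
  shows "fst (rb T [x, z, y]) = fst (rb T [z, x, y]) \<and> snd (rb T [x, z, y]) \<simeq> snd (rb T [z, x, y])"
  using assms
proof (induction T)
  case Nil
  then show ?case by auto
next
  case (Cons b T)
  have xz: "x < z" using Cons.prems by simp
  have neq: "x \<noteq> b" "y \<noteq> b" "z \<noteq> b" using Cons.prems by auto
  have T: "inc T" "x \<notin> set T" "y \<notin> set T" "z \<notin> set T" using Cons.prems by auto
  consider "b < x" | "x < b" "b < z" | "z < b"
    using neq by (metis linorder_cases)
  then show ?case
  proof cases
    case 1
    then show ?thesis using Cons.IH T Cons.prems by auto
  next
    case 2
    then have b: "\<not> z < b" "\<not> z < x" "\<not> y < x" using Cons.prems xz by auto
    obtain e where e: "snd (ins y (fst (ins z T))) = [e]"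
      using ins_ins_greater(1)[OF T(1) Cons.prems(3) T(3,4)] by blast
    consider "snd (ins z T) = []" | f where "snd (ins z T) = [f]" using snd_ins_Nil_or by blast
    then show ?thesis
    proof cases
      case 1
      with 2 b e show ?thesis by auto
    next
      fix f assume f: "snd (ins z T) = [f]"
      have "e < f" using ins_ins_greater(2)[OF T(1) Cons.prems(3) T(3,4) f e] .
      have "b < e"
        using snd_ins_mem[OF e] set_ins_sub[of e z T] 2 Cons.prems by auto
      then show ?thesis using e f 2 b \<open>e < f\<close> pl_xzy'[of b e f] by auto
    qed
  next
    case 3
    then have b: "y < b" "x < b" "\<not> z < x" "\<not> y < x" using Cons.prems xz by auto
    show ?thesis
    proof (cases "T = []")
      case True
      with 3 b Cons.prems(2,3) xz show ?thesis by simp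
    next
      case False
      then obtain c T' where T': "T = c # T'" by (cases T) auto
      then have "b < c" "z < c" "y < c" using Cons.prems(1) 3 b by auto
      \<comment> \<open>The move changes its kind: the bumped words are b c z and b z c, with z < b
        < c.\<close>
      with 3 b Cons.prems(2,3) T' xz pl_yxz'[of z b c] show ?thesis by (simp add: pl_sym)
    qed
  qed
qed

lemma rb_pl_step:
  assumes "pl_step w w'" "inc T" "distinct (T @ w)"
  shows "fst (rb T w) = fst (rb T w') \<and> snd (rb T w) \<simeq> snd (rb T w')"
  using assms(1)
proof cases
  case (pl_yxz x y z u v)
  let ?T = "fst (rb T u)"
  have i: "inc ?T" using assms pl_yxz by (intro inc_rb) auto
  have "set ?T \<subseteq> set T \<union> set u" using set_rb[of T u] by auto
  with assms(3) pl_yxz have n: "x \<notin> set ?T" "y \<notin> set ?T" "z \<notin> set ?T" by auto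
  note R = rb_yxz[OF i pl_yxz(3,4) n]
  have eq: "rb T (u @ t @ v) = (fst (rb (fst (rb ?T t)) v), snd (rb T u) @ snd (rb ?T t) @ snd (rb (fst (rb ?T t)) v))" for t
    by (simp add: rb_append)
  show ?thesis
    unfolding pl_yxz eq fst_conv snd_conv using R by (auto intro!: pl_append simp del: rb.simps)
next
  case (pl_xzy x y z u v)
  let ?T = "fst (rb T u)"
  have i: "inc ?T" using assms pl_xzy by (intro inc_rb) auto
  have "set ?T \<subseteq> set T \<union> set u" using set_rb[of T u] by auto
  with assms(3) pl_xzy have n: "x \<notin> set ?T" "y \<notin> set ?T" "z \<notin> set ?T" by auto
  note R = rb_xzy[OF i pl_xzy(3,4) n]
  have eq: "rb T (u @ t @ v) = (fst (rb (fst (rb ?T t)) v), snd (rb T u) @ snd (rb ?T t) @ snd (rb (fst (rb ?T t)) v))" for t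
    by (simp add: rb_append)
  show ?thesis
    unfolding pl_xzy eq fst_conv snd_conv using R by (auto intro!: pl_append simp del: rb.simps)
qed

text \<open>Insertion is well defined on Knuth classes, one row at a time. Uniqueness of the tableau
  in a class is not presupposed; it follows from this by peeling off rows.\<close>

lemma pl_row_bmp:
  assumes "w \<simeq> w'" "distinct w"
  shows "row_of w = row_of w' \<and> bmp w \<simeq> bmp w'"
proof -
  from assms(1) have "distinct w = distinct w' \<and> (distinct w \<longrightarrow> row_of w = row_of w' \<and> bmp w \<simeq> bmp w')"
  proof (induction rule: pl_induct)
    case (step u v)
    then show ?case using rb_pl_step[of u v "[]"] pl_distinct[OF pl_stepI[OF step]]
      by (simp add: row_of_def bmp_def)
  next
    case (sym u v)
    then show ?case by (auto intro: pl_sym)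
  next
    case (trans u v w)
    then show ?case by (auto intro: pl_trans)
  qed auto
  with assms(2) show ?thesis by blast
qed

lemmas pl_row = pl_row_bmp[THEN conjunct1] and pl_bmp = pl_row_bmp[THEN conjunct2]

subsection \<open>Column-strictness of adjacent rows\<close>

text \<open>The condition for \<open>v\<close> to stand directly below \<open>x\<close> in a
  tableau. The lower row is the first argument, as it comes first in the reading word.\<close>

fun nrm :: "'a::linorder list \<Rightarrow> 'a list \<Rightarrow> bool" where
  "nrm [] x = True"
| "nrm (v # vs) [] = False"
| "nrm (v # vs) (a # x) = (a < v \<and> nrm vs x)"

lemma nrm_iff: "nrm v x \<longleftrightarrow> length v \<le> length x \<and> (\<forall>j<length v. x ! j < v ! j)"
proof (induction v x rule: nrm.induct)
  case (3 v vs a x)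
  then show ?case by (auto simp: less_Suc_eq_0_disj nth_Cons')
qed auto

lemma nrm_ins_le:
  "inc xs \<Longrightarrow> a \<notin> set xs \<Longrightarrow> nrm vs xs \<Longrightarrow> nrm vs (fst (ins a xs))"
proof (induction vs xs arbitrary: a rule: nrm.induct)
  case (3 v vs b xs)
  then show ?case by (cases "a < b") auto
qed auto

text \<open>The bumped letter e stood above a larger entry or above none, so it enters the lower row
  in its old column or further left. There the upper entry is at most a, hence smaller than
  e.\<close>

lemma nrm_ins:
  assumes "inc x" "inc v" "a \<notin> set x" "a \<notin> set v" "set x \<inter> set v = {}" "nrm v x" "snd (ins a x) = [e]"
  shows "nrm (fst (ins e v)) (fst (ins a x))"
  using assms
proof (induction v x rule: nrm.induct)
  case (1 x)
  then show ?case
  proof (cases x)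
    case (Cons b xs)
    then show ?thesis using 1 snd_ins_mem[of a xs e] by (auto split: if_splits)
  qed simp
next
  case (3 v vs b x)
  show ?case
  proof (cases "a < b")
    case True
    then show ?thesis using 3 by auto
  next
    case False
    then have ab: "b < a" using 3 by auto
    have e: "snd (ins a x) = [e]" using 3 False by simp
    then have "b < e" using 3 snd_ins_mem by fastforce
    have en: "e \<noteq> v" using 3 snd_ins_mem[OF e] by auto
    have IH: "nrm (fst (ins e vs)) (fst (ins a x))" using 3 False e by auto
    have "nrm vs (fst (ins a x))" using 3 by (intro nrm_ins_le) auto
    then show ?thesis using IH False \<open>b < e\<close> en 3 by auto
  qed
qed auto

lemma bmp_snoc: "bmp (w @ [a]) = bmp w @ snd (ins a (row_of w))"
  by (simp add: bmp_def row_of_def rb_append)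

lemma row_of_snoc: "row_of (w @ [a]) = fst (ins a (row_of w))"
  by (simp add: row_of_def rb_append)

lemma nrm_row_bmp: "distinct w \<Longrightarrow> nrm (row_of (bmp w)) (row_of w)"
proof (induction w rule: rev_induct)
  case Nil
  then show ?case by (simp add: row_of_def bmp_def)
next
  case (snoc a w)
  then have d: "distinct w" "a \<notin> set w" and IH: "nrm (row_of (bmp w)) (row_of w)" by auto
  have i: "inc (row_of w)" by (rule inc_row_of[OF d(1)])
  have dd: "distinct (bmp w @ row_of w)" by (rule distinct_bmp_row[OF d(1)])
  then have i2: "inc (row_of (bmp w))" by (intro inc_row_of) auto
  have s: "set (row_of (bmp w)) \<subseteq> set (bmp w)" "set (row_of w) \<subseteq> set w" "set (bmp w) \<subseteq> set w"
    using set_bmp_row[of "bmp w"] set_bmp_row[of w] by auto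
  consider "snd (ins a (row_of w)) = []" | e where "snd (ins a (row_of w)) = [e]"
    using snd_ins_Nil_or by blast
  then show ?case
  proof cases
    case 1
    then show ?thesis using IH nrm_ins_le[OF i _ IH] s d by (auto simp: bmp_snoc row_of_snoc)
  next
    fix e assume e: "snd (ins a (row_of w)) = [e]"
    have "nrm (fst (ins e (row_of (bmp w)))) (fst (ins a (row_of w)))"
      using i i2 s d dd IH e by (intro nrm_ins) auto
    then show ?thesis using e by (simp add: bmp_snoc row_of_snoc)
  qed
qed

lemma rb_prefix:
  "(\<forall>a\<in>set w. \<forall>b\<in>set p. b < a) \<Longrightarrow> inc p \<Longrightarrow> rb (p @ x) w = (p @ fst (rb x w), snd (rb x w))"
proof (induction w arbitrary: x)
  case (Cons a w)
  have "ins a (p @ x) = (p @ fst (ins a x), snd (ins a x))" if "\<forall>b\<in>set p. b < a" for a and x :: "'a list"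
    using that by (induction p) auto
  with Cons show ?case by simp
qed simp

text \<open>Each letter of \<open>x\<close> bumps the letter of \<open>v\<close> in its own column.
  The tail \<open>W\<close> covers a lower row whose left part forms a rectangle with
  \<open>x\<close>; surplus letters of \<open>x\<close> would start to bump \<open>W\<close>, hence
  the alternative in the last hypothesis.\<close>

lemma rb_nrm_gen:
  assumes "nrm v x" "inc v" "inc x" "\<forall>a\<in>set v. \<forall>b\<in>set W. a < b" "length v = length x \<or> W = []"
  shows "rb (v @ W) x = (x @ W, v)"
  using assms
proof (induction v x rule: nrm.induct)
  case (1 x)
  then show ?case
  proof (cases "x = []")
    case False
    then have W: "W = []" using 1 by auto
    have "rb p x = (p @ x, [])" if "inc (p @ x)" for p using that
    proof (induction x arbitrary: p)
      case (Cons a x)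
      then have "ins a p = (p @ [a], [])" by (intro ins_append_end) (auto simp: sorted_wrt_append)
      then show ?case using Cons.IH[of "p @ [a]"] Cons.prems by simp
    qed simp
    from this[of "[]"] 1 W show ?thesis by simp
  qed simp
next
  case (3 v vs a x)
  have "ins a ((v # vs) @ W) = (a # vs @ W, [v])" using 3 by simp
  moreover have "rb ([a] @ vs @ W) x = ([a] @ fst (rb (vs @ W) x), snd (rb (vs @ W) x))"
    using 3 by (intro rb_prefix) auto
  ultimately show ?case using 3 by simp
qed auto

lemma rb_nrm: "nrm v x \<Longrightarrow> inc v \<Longrightarrow> inc x \<Longrightarrow> rb v x = (x, v)"
  using rb_nrm_gen[of v x "[]"] by simp

lemma row_bmp_append_row:
  assumes "nrm (row_of w) x" "inc x" "distinct w"
  shows "row_of (w @ x) = x" "bmp (w @ x) = bmp w @ row_of w"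
  using rb_nrm[OF assms(1) inc_row_of[OF assms(3)] assms(2)]
  by (simp_all add: row_of_def bmp_def rb_append)

lemma rb_Nil_inc: "inc x \<Longrightarrow> rb [] x = (x, [])"
  using rb_nrm[of "[]" x] by simp

lemma row_inc [simp]: "inc x \<Longrightarrow> row_of x = x" and bmp_inc [simp]: "inc x \<Longrightarrow> bmp x = []"
  by (simp_all add: row_of_def bmp_def rb_Nil_inc)

lemma row_bmp_two:
  assumes "nrm v x" "inc x" "inc v"
  shows "row_of (v @ x) = x" "bmp (v @ x) = v"
  using row_bmp_append_row[of v x] assms by (simp_all add: inc_distinct)

lemma rb_inc_append: "inc (p @ x) \<Longrightarrow> rb p x = (p @ x, [])"
proof (induction x arbitrary: p)
  case (Cons a x)
  then have "ins a p = (p @ [a], [])" by (intro ins_append_end) (auto simp: sorted_wrt_append)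
  then show ?case using Cons.IH[of "p @ [a]"] Cons.prems by simp
qed simp

lemma row_bmp_append:
  "row_of (X @ y) = fst (rb (row_of X) y)" "bmp (X @ y) = bmp X @ snd (rb (row_of X) y)"
  by (simp_all add: row_of_def bmp_def rb_append)

lemma row_bmp_Cons_min:
  assumes "\<forall>a\<in>set w. v < a"
  shows "row_of (v # w) = v # row_of w" "bmp (v # w) = bmp w"
  using rb_prefix[of w "[v]" "[]"] assms by (simp_all add: row_of_def bmp_def)

lemma rb_smaller:
  "inc T \<Longrightarrow> distinct (T @ w) \<Longrightarrow>
    (\<forall>e\<in>set (snd (rb T w)). \<exists>a\<in>set (fst (rb T w)). a < e) \<and> (\<forall>b\<in>set T. \<exists>a\<in>set (fst (rb T w)). a \<le> b)"
proof (induction w rule: rev_induct)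
  case (snoc a w)
  let ?R = "fst (rb T w)"
  have le: "\<exists>c\<in>set (fst (ins a R)). c \<le> b" if "b \<in> set R" for b and R :: "'a list"
    using that by (induction R) auto
  have e: "\<exists>c\<in>set (fst (ins a ?R)). c < e" if "e \<in> set (snd (ins a ?R))" for e
    using that mem_ins[of a ?R] snd_ins_cases[of a ?R] by auto
  have IH: "\<forall>e\<in>set (snd (rb T w)). \<exists>a\<in>set ?R. a < e" "\<forall>b\<in>set T. \<exists>a\<in>set ?R. a \<le> b"
    using snoc by auto
  have "\<exists>c\<in>set (fst (ins a ?R)). c < f" if "f \<in> set (snd (rb T w))" for f
    using IH(1) le that by (meson order_le_less_trans)
  moreover have "\<exists>c\<in>set (fst (ins a ?R)). c \<le> b" if "b \<in> set T" for b
    using IH(2) le that by (meson order_trans)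
  ultimately show ?case using e by (auto simp: rb_append)
qed auto

lemma bmp_smaller: "distinct w \<Longrightarrow> e \<in> set (bmp w) \<Longrightarrow> \<exists>a\<in>set (row_of w). a < e"
  using rb_smaller[of "[]" w] by (auto simp: row_of_def bmp_def)

section \<open>Restriction of words and rows to their small letters\<close>

definition down :: "('a::linorder \<Rightarrow> bool) \<Rightarrow> bool" where
  "down P \<longleftrightarrow> (\<forall>x y. P y \<longrightarrow> x < y \<longrightarrow> P x)"

lemma downD: "down P \<Longrightarrow> P y \<Longrightarrow> x < y \<Longrightarrow> P x"
  by (auto simp: down_def)

lemma pl_filter_down: "down P \<Longrightarrow> u \<simeq> v \<Longrightarrow> filter P u \<simeq> filter P v"
  by (rule pl_filter) (auto dest: downD)

lemma inc_split_down: "inc l \<Longrightarrow> down P \<Longrightarrow> filter P l @ filter (\<lambda>a. \<not> P a) l = l"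
proof (induction l)
  case (Cons a l)
  show ?case
  proof (cases "P a")
    case False
    then have "filter P l = []" using Cons.prems by (auto simp: filter_empty_conv dest: downD)
    with Cons False show ?thesis by auto
  qed (use Cons in auto)
qed simp

text \<open>If the small letters stand in increasing order, none of them is bumped: a bumped one
  would precede a smaller letter of the first row in a word equivalent to, hence equal to, the
  increasing one.\<close>

lemma filter_row_inc:
  assumes "down P" "distinct w" "inc (filter P w)"
  shows "filter P (bmp w) = []" "filter P (row_of w) = filter P w"
proof -
  have "filter P w \<simeq> filter P (bmp w) @ filter P (row_of w)"
    using pl_filter_down[OF assms(1) pl_bmp_row[OF assms(2)]] by simp
  then have eq: "filter P (bmp w) @ filter P (row_of w) = filter P w"
    using pl_inc_eq assms(3) by blast
  show "filter P (bmp w) = []"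
  proof (rule ccontr)
    assume "filter P (bmp w) \<noteq> []"
    then obtain e where e: "e \<in> set (bmp w)" "P e" by (auto simp: filter_empty_conv)
    then obtain a where a: "a \<in> set (row_of w)" "a < e" using bmp_smaller assms(2) by blast
    then have "P a" using downD assms(1) e by blast
    with a e have "e < a" using assms(3) unfolding eq[symmetric] by (auto simp: sorted_wrt_append)
    with a show False by simp
  qed
  with eq show "filter P (row_of w) = filter P w" by simp
qed

lemma nrm_filter: "nrm v x \<Longrightarrow> inc v \<Longrightarrow> inc x \<Longrightarrow> down P \<Longrightarrow> nrm (filter P v) (filter P x)"
proof (induction v x rule: nrm.induct)
  case (3 v vs a x)
  show ?case
  proof (cases "P v")
    case True
    then have "P a" using 3 downD by fastforce
    with True 3 show ?thesis by auto
  next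
    case False
    then have "filter P (v # vs) = []" using 3 by (auto simp: filter_empty_conv dest: downD)
    then show ?thesis by simp
  qed
qed auto

text \<open>A tableau of two rows stays a tableau when it is cut down to its small letters, and it
  is then the normal form of the restricted word.\<close>

lemma filter_nrm_row_bmp:
  assumes "down P" "distinct w" "inc (bmp w)"
  shows "row_of (filter P w) = filter P (row_of w)" "bmp (filter P w) \<simeq> filter P (bmp w)"
proof -
  have d: "distinct (filter P w)" using assms by simp
  have eq: "filter P w \<simeq> filter P (bmp w) @ filter P (row_of w)"
    using pl_filter_down[OF assms(1) pl_bmp_row[OF assms(2)]] by simp
  have n: "nrm (filter P (bmp w)) (filter P (row_of w))"
    using nrm_row_bmp[OF assms(2)] assms by (intro nrm_filter) (auto simp: inc_row_of)
  have i: "inc (filter P (bmp w))" "inc (filter P (row_of w))"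
    using assms inc_row_of[OF assms(2)] by (auto intro: sorted_wrt_filter)
  show "row_of (filter P w) = filter P (row_of w)" "bmp (filter P w) \<simeq> filter P (bmp w)"
    using pl_row[OF eq d] pl_bmp[OF eq d] row_bmp_two[OF n i(2,1)] by simp_all
qed

section \<open>Normalising words that consist of two or three increasing rows\<close>

lemma set_rb_inc_sub: "inc x \<Longrightarrow> set x \<subseteq> set (fst (rb T x))"
proof (induction x rule: rev_induct)
  case (snoc a x)
  have "b \<in> set (fst (ins a R))" if "b < a" "b \<in> set R" for b and R :: "'a list"
    using that by (induction R) auto
  then show ?case using snoc mem_ins[of a "fst (rb T x)"]
    by (auto simp: rb_append sorted_wrt_append)
qed simp

lemma inc_snd_rb: "inc T \<Longrightarrow> inc y \<Longrightarrow> distinct (T @ y) \<Longrightarrow> inc (snd (rb T y))"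
proof (induction T arbitrary: y)
  case Nil
  then show ?case by (simp add: rb_inc_append)
next
  case (Cons b T)
  show ?case
  proof (cases y)
    case (Cons a y')
    show ?thesis
    proof (cases "a < b")
      case True
      have rb: "rb (a # T) y' = (a # fst (rb T y'), snd (rb T y'))"
        using rb_prefix[of y' "[a]" T] Cons.prems Cons by simp
      have "distinct (T @ y')" "inc T" "inc y'" using Cons.prems Cons by auto
      then have i: "inc (snd (rb T y'))" by (intro Cons.IH) auto
      have "mset (snd (rb T y') @ fst (rb T y')) = mset (T @ y')" by (rule mset_rb)
      then have "distinct (snd (rb T y') @ fst (rb T y'))"
        using \<open>distinct (T @ y')\<close> mset_eq_imp_distinct_iff by blast
      with set_rb_inc_sub[OF \<open>inc y'\<close>, of T] set_rb[of T y']
      have "set (snd (rb T y')) \<subseteq> set T" by auto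
      with i Cons.prems show ?thesis unfolding Cons using True rb by auto
    next
      case False
      then have "b < a" using Cons.prems Cons by auto
      moreover have "\<forall>x\<in>set y'. a < x" using Cons.prems Cons by auto
      ultimately have "\<forall>x\<in>set y. b < x" using Cons by (auto dest: less_trans)
      then have "rb (b # T) y = ([b] @ fst (rb T y), snd (rb T y))"
        using rb_prefix[of y "[b]" T] by simp
      then show ?thesis using Cons.IH[of y] Cons.prems by simp
    qed
  qed simp
qed

text \<open>An entry of the upper row is never bumped by the later, larger ones. So the lower row
  can only become shorter, and it keeps its length only if nothing changes at all, which is what the
  termination of \<open>three_rows\<close> rests on.\<close>

lemma two_rows:
  assumes "inc x" "inc y" "distinct (x @ y)"
  shows "inc (bmp (x @ y))" "inc (row_of (x @ y))" "nrm (bmp (x @ y)) (row_of (x @ y))"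
    "x @ y \<simeq> bmp (x @ y) @ row_of (x @ y)" "set y \<subseteq> set (row_of (x @ y))"
    "length (bmp (x @ y)) \<le> length x"
    "length (bmp (x @ y)) = length x \<Longrightarrow> bmp (x @ y) = x \<and> row_of (x @ y) = y"
proof -
  show i: "inc (bmp (x @ y))" using assms by (simp add: row_bmp_append inc_snd_rb)
  show j: "inc (row_of (x @ y))" by (rule inc_row_of[OF assms(3)])
  show "nrm (bmp (x @ y)) (row_of (x @ y))" using nrm_row_bmp[OF assms(3)] i by simp
  show "x @ y \<simeq> bmp (x @ y) @ row_of (x @ y)" by (rule pl_bmp_row[OF assms(3)])
  show s: "set y \<subseteq> set (row_of (x @ y))" using assms by (simp add: row_bmp_append set_rb_inc_sub)
  have c: "card (set y) = length y" "card (set (row_of (x @ y))) = length (row_of (x @ y))"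
    using assms inc_distinct[OF j] by (auto simp: distinct_card)
  then have "length y \<le> length (row_of (x @ y))" using s by (metis card_mono List.finite_set)
  then show "length (bmp (x @ y)) \<le> length x" using length_bmp_row[of "x @ y"] by simp
  assume "length (bmp (x @ y)) = length x"
  then have "length (row_of (x @ y)) = length y" using length_bmp_row[of "x @ y"] by simp
  with c s have "set y = set (row_of (x @ y))" by (metis card_subset_eq List.finite_set)
  then have r: "row_of (x @ y) = y" using inc_set_eq j assms(2) by metis
  have "set (bmp (x @ y)) = set x"
    using set_bmp_row[of "x @ y"] distinct_bmp_row[OF assms(3)] assms(3) r by auto
  then have "bmp (x @ y) = x" using inc_set_eq i assms(1) by metis
  with r show "bmp (x @ y) = x \<and> row_of (x @ y) = y" by simp
qed

text \<open>Replacing two adjacent rows by their tableau moves letters upward until the three rows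
  form a tableau themselves. A quantity that both kinds of replacement preserve is therefore a
  function of the Knuth class. \<open>Inv\<close> singles out the triples for which the replacements
  can be justified.\<close>

lemma three_rows:
  fixes Phi Inv :: "'a::linorder list \<Rightarrow> 'a list \<Rightarrow> 'a list \<Rightarrow> bool"
  assumes N1: "\<And>a x y. inc a \<Longrightarrow> inc x \<Longrightarrow> inc y \<Longrightarrow> distinct (a @ x @ y) \<Longrightarrow> Inv a x y \<Longrightarrow>
      Inv (bmp (a @ x)) (row_of (a @ x)) y \<and> Phi (bmp (a @ x)) (row_of (a @ x)) y = Phi a x y"
    and N2: "\<And>a x y. inc a \<Longrightarrow> inc x \<Longrightarrow> inc y \<Longrightarrow> distinct (a @ x @ y) \<Longrightarrow> Inv a x y \<Longrightarrow>
      Inv a (bmp (x @ y)) (row_of (x @ y)) \<and> Phi a (bmp (x @ y)) (row_of (x @ y)) = Phi a x y"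
    and "inc a" "inc x" "inc y" "distinct (a @ x @ y)" "Inv a x y"
  shows "\<exists>a'. inc a' \<and> a' \<simeq> bmp (bmp (a @ x @ y)) \<and>
    Phi a x y = Phi a' (row_of (bmp (a @ x @ y))) (row_of (a @ x @ y))"
  using assms(3-7)
\<comment> \<open>A letter that moves up by one row lowers this number by exactly one.\<close>
proof (induction "2 * length a + length x" arbitrary: a x y rule: less_induct)
  case less
  let ?w = "a @ x @ y"
  \<comment> \<open>After a replacement the result for the new triple carries over, because rows and
    bumped words depend on the class of the concatenation only.\<close>
  have pl_conc: ?case if w': "a1 @ x1 @ y1 \<simeq> ?w" and E: "\<exists>a'. inc a' \<and> a' \<simeq> bmp (bmp (a1 @ x1 @ y1)) \<and>
    Phi a1 x1 y1 = Phi a' (row_of (bmp (a1 @ x1 @ y1))) (row_of (a1 @ x1 @ y1))"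
    and P: "Phi a1 x1 y1 = Phi a x y" for a1 x1 y1
  proof -
    let ?v = "a1 @ x1 @ y1"
    have d: "distinct ?v" "distinct (bmp ?v)"
      using pl_distinct[OF w'] less.prems distinct_bmp_row[of ?v] by auto
    have 1: "row_of ?v = row_of ?w" "bmp ?v \<simeq> bmp ?w" using pl_row_bmp[OF w' d(1)] by auto
    have 2: "row_of (bmp ?v) = row_of (bmp ?w)" "bmp (bmp ?v) \<simeq> bmp (bmp ?w)"
      using pl_row_bmp[OF 1(2) d(2)] by auto
    from E obtain a' where a': "inc a'" "a' \<simeq> bmp (bmp ?v)" "Phi a1 x1 y1 = Phi a' (row_of (bmp ?v)) (row_of ?v)"
      by blast
    with 1 2 P show ?thesis by (metis pl_trans)
  qed
  have da: "distinct (a @ x)" and dx: "distinct (x @ y)" using less.prems by auto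
  note A = two_rows[OF less.prems(1,2) da] and X = two_rows[OF less.prems(2,3) dx]
  consider "length (bmp (a @ x)) < length a" | "length (bmp (a @ x)) = length a" "length (bmp (x @ y)) < length x"
    | "length (bmp (a @ x)) = length a" "length (bmp (x @ y)) = length x"
    using A(6) X(6) by linarith
  then show ?case
  proof cases
    case 1
    let ?a = "bmp (a @ x)" and ?x = "row_of (a @ x)"
    have "length ?x + length ?a = length a + length x" using length_bmp_row[of "a @ x"] by simp
    then have m: "2 * length ?a + length ?x < 2 * length a + length x" using 1 by simp
    have pl: "?a @ ?x @ y \<simeq> ?w" using pl_append_right[OF pl_sym[OF A(4)], of y] by simp
    have d: "distinct (?a @ ?x @ y)" using pl_distinct[OF pl] less.prems by simp
    have I: "Inv ?a ?x y" "Phi ?a ?x y = Phi a x y" using N1 less.prems by auto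
    show ?thesis by (rule pl_conc[OF pl less.hyps[OF m A(1,2) less.prems(3) d I(1)] I(2)])
  next
    case 2
    let ?x = "bmp (x @ y)" and ?y = "row_of (x @ y)"
    have m: "2 * length a + length ?x < 2 * length a + length x" using 2 by simp
    have pl: "a @ ?x @ ?y \<simeq> ?w" using pl_append_left[OF pl_sym[OF X(4)], of a] by simp
    have d: "distinct (a @ ?x @ ?y)" using pl_distinct[OF pl] less.prems by simp
    have I: "Inv a ?x ?y" "Phi a ?x ?y = Phi a x y" using N2 less.prems by auto
    show ?thesis by (rule pl_conc[OF pl less.hyps[OF m less.prems(1) X(1,2) d I(1)] I(2)])
  next
    case 3
    then have ax: "bmp (a @ x) = a" "row_of (a @ x) = x" and xy: "bmp (x @ y) = x" "row_of (x @ y) = y"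
      using A(7) X(7) by auto
    then have n: "nrm x y" using X(3) by simp
    have "row_of ((a @ x) @ y) = y" "bmp ((a @ x) @ y) = a @ x"
      using row_bmp_append_row[of "a @ x" y] n less.prems(3) da ax by auto
    then show ?thesis using ax less.prems(1) by auto
  qed
qed

lemma three_rows_eq:
  fixes Phi Inv :: "'a::linorder list \<Rightarrow> 'a list \<Rightarrow> 'a list \<Rightarrow> bool"
  assumes N1: "\<And>a x y. inc a \<Longrightarrow> inc x \<Longrightarrow> inc y \<Longrightarrow> distinct (a @ x @ y) \<Longrightarrow> Inv a x y \<Longrightarrow>
      Inv (bmp (a @ x)) (row_of (a @ x)) y \<and> Phi (bmp (a @ x)) (row_of (a @ x)) y = Phi a x y"
    and N2: "\<And>a x y. inc a \<Longrightarrow> inc x \<Longrightarrow> inc y \<Longrightarrow> distinct (a @ x @ y) \<Longrightarrow> Inv a x y \<Longrightarrow>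
      Inv a (bmp (x @ y)) (row_of (x @ y)) \<and> Phi a (bmp (x @ y)) (row_of (x @ y)) = Phi a x y"
    and 1: "inc a" "inc x" "inc y" "distinct (a @ x @ y)" "Inv a x y"
    and 2: "inc a'" "inc x'" "inc y'" "Inv a' x' y'" and pl: "a @ x @ y \<simeq> a' @ x' @ y'"
  shows "Phi a x y = Phi a' x' y'"
proof -
  let ?w = "a @ x @ y" and ?v = "a' @ x' @ y'"
  have d: "distinct ?v" "distinct (bmp ?w)"
    using pl_distinct[OF pl] 1(4) distinct_bmp_row[of ?w] by auto
  obtain b where b: "inc b" "b \<simeq> bmp (bmp ?w)" "Phi a x y = Phi b (row_of (bmp ?w)) (row_of ?w)"
    using three_rows[of Inv Phi, OF N1 N2 1] by blast
  obtain b' where b': "inc b'" "b' \<simeq> bmp (bmp ?v)" "Phi a' x' y' = Phi b' (row_of (bmp ?v)) (row_of ?v)"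
    using three_rows[of Inv Phi, OF N1 N2 2(1-3) d(1) 2(4)] by blast
  have e1: "row_of ?w = row_of ?v" "bmp ?w \<simeq> bmp ?v" using pl_row_bmp[OF pl 1(4)] by auto
  have e2: "row_of (bmp ?w) = row_of (bmp ?v)" "bmp (bmp ?w) \<simeq> bmp (bmp ?v)"
    using pl_row_bmp[OF e1(2) d(2)] by auto
  have "b \<simeq> b'" using b(2) e2(2) b'(2) pl_sym pl_trans by metis
  then have "b' = b" using pl_inc_eq b(1) by blast
  with b(3) b'(3) e1 e2 show ?thesis by simp
qed

section \<open>Catabolizable words\<close>

text \<open>The letters may be any ordered set: \<open>b\<close> consists of the m smallest ones and
  starts the increasing end \<open>b @ s\<close>. The existential quantifier over the class makes
  Knuth invariance immediate; that all choices give the same answer is the content of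
  \<open>catable_block\<close>.\<close>

primrec catable :: "nat list \<Rightarrow> 'a::linorder list \<Rightarrow> bool" where
  "catable [] w \<longleftrightarrow> w = []"
| "catable (m # mu) w \<longleftrightarrow> distinct w \<and> (\<exists>Y b s. w \<simeq> Y @ b @ s \<and> inc (b @ s) \<and> length b = m \<and>
     (\<forall>a\<in>set Y. \<forall>c\<in>set b. c < a) \<and> catable mu (s @ Y))"

lemma catable_pl: "w \<simeq> w' \<Longrightarrow> catable mu w = catable mu w'"
proof (cases mu)
  case (Cons m nu)
  assume pl: "w \<simeq> w'"
  have "w \<simeq> v \<longleftrightarrow> w' \<simeq> v" for v using pl pl_sym pl_trans by blast
  with pl_distinct[OF pl] show ?thesis unfolding Cons catable.simps by simp
qed auto

text \<open>Both words come from the one class of \<open>W @ x @ K @ r\<close>, by moving an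
  increasing end that starts with \<open>K\<close> to the front and deleting \<open>K\<close>. Of
  what precedes \<open>K\<close>, only the last row \<open>x\<close> takes part in the
  change.\<close>

definition rot_closed :: "nat \<Rightarrow> ('a::linorder list \<Rightarrow> bool) \<Rightarrow> bool" where
  "rot_closed m P \<longleftrightarrow> (\<forall>K x r W. length K = m \<longrightarrow> inc x \<longrightarrow> inc (K @ r) \<longrightarrow>
     (\<forall>k\<in>set K. \<forall>a\<in>set (x @ W). k < a) \<longrightarrow> distinct (r @ W @ x) \<longrightarrow>
     P (r @ W @ x) = P (drop m (row_of (x @ K @ r)) @ W @ bmp (x @ K @ r)))"

definition below :: "'a::linorder list \<Rightarrow> 'a \<Rightarrow> bool" where
  "below b a \<longleftrightarrow> (\<exists>k\<in>set b. a \<le> k)"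

lemma down_below: "down (below b)"
  unfolding down_def below_def by (meson less_imp_le order_trans)

lemma filter_below_append:
  "\<forall>k\<in>set K. \<forall>a\<in>set w. k < a \<Longrightarrow> filter (below K) w = []"
  by (fastforce simp: filter_empty_conv below_def not_le)

lemma filter_below_self: "filter (below (K @ b)) K = K"
  by (auto simp: filter_id_conv below_def)

lemma row_of_block:
  assumes "distinct w" "filter (below K) w = K" "inc K"
  shows "row_of w = K @ drop (length K) (row_of w)" "filter (below K) (bmp w) = []"
proof -
  have i: "inc (row_of w)" by (rule inc_row_of[OF assms(1)])
  have f: "filter (below K) (row_of w) = K" "filter (below K) (bmp w) = []"
    using filter_row_inc[OF down_below assms(1), of K] assms by simp_all
  then have "row_of w = K @ filter (\<lambda>a. \<not> below K a) (row_of w)"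
    using inc_split_down[OF i down_below, of K] by simp
  then show "row_of w = K @ drop (length K) (row_of w)"
    by (metis append_eq_conv_conj)
  show "filter (below K) (bmp w) = []" by (rule f(2))
qed

lemma row_of_cyc_block:
  assumes "inc (K @ r)" "\<forall>k\<in>set K. \<forall>a\<in>set x. k < a" "distinct (x @ K @ r)"
  shows "row_of (x @ K @ r) = K @ drop (length K) (row_of (x @ K @ r))"
proof (rule row_of_block(1)[OF assms(3)])
  have "filter (below K) x = []" "filter (below K) r = []"
    using assms by (auto intro!: filter_below_append simp: sorted_wrt_append)
  then show "filter (below K) (x @ K @ r) = K" using filter_below_self[of K "[]"] by simp
  show "inc K" using assms by (simp add: sorted_wrt_append)
qed

lemma distinct_block:
  assumes "inc (K @ r)" "\<forall>k\<in>set K. \<forall>a\<in>set X. k < a" "distinct (r @ X)"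
  shows "distinct (X @ K @ r)"
  using assms inc_distinct[OF assms(1)] by auto

text \<open>Inserting \<open>K @ r\<close> sees only the first row of the tableau of
  \<open>X\<close>; the letters of \<open>X\<close> below it play the part of
  \<open>W\<close>.\<close>

lemma rot_closedD:
  assumes "rot_closed m P" and P: "\<And>w w'. w \<simeq> w' \<Longrightarrow> P w = P w'" and "length K = m" "inc (K @ r)"
    "\<forall>k\<in>set K. \<forall>a\<in>set X. k < a" "distinct (r @ X)"
  shows "P (r @ X) = P (drop m (row_of (X @ K @ r)) @ bmp (X @ K @ r))"
proof -
  let ?x = "row_of X" and ?W = "bmp X"
  have dX: "distinct X" using assms by simp
  have pl: "X \<simeq> ?W @ ?x" by (rule pl_bmp_row[OF dX])
  then have "P (r @ X) = P (r @ ?W @ ?x)" by (intro P pl_append_left)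
  also have "\<dots> = P (drop m (row_of (?x @ K @ r)) @ ?W @ bmp (?x @ K @ r))"
  proof (rule assms(1)[unfolded rot_closed_def, rule_format, OF assms(3) inc_row_of[OF dX] assms(4)])
    show "k < a" if "k \<in> set K" "a \<in> set (?x @ ?W)" for k a
      using that assms(5) pl_set[OF pl] by auto
    show "distinct (r @ ?W @ ?x)" using pl_distinct[OF pl_append_left[OF pl, of r]] assms(6) by simp
  qed
  finally show ?thesis
    using inc_row_of[OF dX] by (simp add: row_bmp_append)
qed

text \<open>Two decompositions share the same \<open>b\<close>, because the m smallest letters of a
  word are determined. By \<open>rot_closed\<close> each rotated word may be replaced by the one
  that comes from the tableau of the class, and that one is common to both.\<close>

lemma catable_block:
  fixes mu :: "nat list"
  assumes rc: "rot_closed m (catable mu :: 'a::linorder list \<Rightarrow> bool)"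
    and b: "length b = m" "inc (b @ s)" "\<forall>k\<in>set b. \<forall>a\<in>set Y. k < a" "distinct (s @ Y)"
  shows "catable (m # mu) (Y @ b @ s) \<longleftrightarrow> catable mu (s @ (Y :: 'a list))"
proof
  have d: "distinct (Y @ b @ s)" by (rule distinct_block[OF b(2-4)])
  assume "catable (m # mu) (Y @ b @ s)"
  then obtain Y' b' s' where *: "Y @ b @ s \<simeq> Y' @ b' @ s'" "inc (b' @ s')" "length b' = m"
    "\<forall>a\<in>set Y'. \<forall>c\<in>set b'. c < a" "catable mu (s' @ Y')" by auto
  have d': "distinct (Y' @ b' @ s')" using pl_distinct[OF *(1)] d by simp
  have "set b = set b'"
  proof (rule ccontr)
    assume "set b \<noteq> set b'"
    moreover have cd: "card (set b) = card (set b')"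
      using d d' b *(3) by (simp add: distinct_card)
    ultimately have "\<not> set b \<subseteq> set b'" "\<not> set b' \<subseteq> set b"
      using card_subset_eq by (metis List.finite_set)+
    then obtain c c' where c: "c \<in> set b" "c \<notin> set b'" "c' \<in> set b'" "c' \<notin> set b" by blast
    then have "c \<in> set Y' \<union> set s'" "c' \<in> set Y \<union> set s" using pl_set[OF *(1)] by auto
    then have "c' < c" "c < c'" using c b *(2,4) by (auto simp: sorted_wrt_append)
    then show False by simp
  qed
  then have bb: "b' = b" using inc_set_eq b(2) *(2) by (auto simp: sorted_wrt_append)
  have "catable mu (s' @ Y') = catable mu (drop m (row_of (Y' @ b @ s')) @ bmp (Y' @ b @ s'))"
    using * bb d' by (intro rot_closedD[OF rc catable_pl]) auto
  also have "\<dots> = catable mu (drop m (row_of (Y @ b @ s)) @ bmp (Y @ b @ s))"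
    using pl_row_bmp[OF *(1) d] bb by (intro catable_pl) (auto intro: pl_append_left pl_sym)
  also have "\<dots> = catable mu (s @ Y)"
    using b by (intro rot_closedD[OF rc catable_pl, symmetric]) auto
  finally show "catable mu (s @ Y)" using *(5) by simp
next
  assume "catable mu (s @ Y)"
  then show "catable (m # mu) (Y @ b @ s)"
    unfolding catable.simps using distinct_block[OF b(2-4)] b by blast
qed

lemma nrm_block:
  assumes "length x \<le> length K" "\<forall>k\<in>set K. \<forall>a\<in>set x. k < a"
  shows "nrm x (K @ r)"
  using assms
proof (induction x arbitrary: K)
  case (Cons a x)
  then obtain k K' where "K = k # K'" by (cases K) auto
  with Cons show ?case by auto
qed simp

text \<open>Restricting a decomposition to its smallest letters leaves the increasing word
  \<open>b\<close>, which is alone in its class; so these letters already stand in this order in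
  \<open>w\<close>.\<close>

lemma catable_filter_below:
  assumes "catable (length b # mu) w" "inc b" "set b \<subseteq> set w" "\<forall>a\<in>set w. a \<in> set b \<or> (\<forall>k\<in>set b. k < a)"
  shows "filter (below b) w = b"
proof -
  from assms(1) obtain Y b' s where *: "w \<simeq> Y @ b' @ s" "inc (b' @ s)" "length b' = length b"
    "\<forall>a\<in>set Y. \<forall>c\<in>set b'. c < a" and d: "distinct w" by auto
  have d': "distinct (Y @ b' @ s)" using pl_distinct[OF *(1)] d by simp
  have "set b = set b'"
  proof (rule ccontr)
    assume "set b \<noteq> set b'"
    moreover have cd: "card (set b) = card (set b')"
      using d' *(3) inc_distinct[OF assms(2)] by (simp add: distinct_card)
    ultimately have "\<not> set b \<subseteq> set b'" "\<not> set b' \<subseteq> set b"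
      using card_subset_eq by (metis List.finite_set)+
    then obtain c c' where c: "c \<in> set b" "c \<notin> set b'" "c' \<in> set b'" "c' \<notin> set b" by blast
    then have "c \<in> set Y \<union> set s" "c' \<in> set w" using pl_set[OF *(1)] assms(3) by auto
    then have "c' < c" "c < c'" using c assms(4) *(2,4) by (auto simp: sorted_wrt_append)
    then show False by simp
  qed
  then have bb: "b' = b" using inc_set_eq assms(2) *(2) by (auto simp: sorted_wrt_append)
  have "filter (below b) (Y @ b @ s) = b"
    using *(2,4) filter_below_append[of b Y] filter_below_append[of b s] filter_below_self[of b "[]"] bb
    by (auto simp: sorted_wrt_append)
  with pl_filter_down[OF down_below *(1), of b] have "filter (below b) w \<simeq> b" using bb by simp
  then show ?thesis using pl_inc_eq[OF pl_sym assms(2)] by blast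
qed

text \<open>Among the letters in \<open>B\<close>, the block \<open>L\<close> bumps out exactly the
  equally long block \<open>K\<close>, so the small letters of \<open>r\<close> slide into the upper
  row. The equivalence of \<open>r' @ v'\<close> with \<open>r @ v\<close> comes from restricting to
  the letters above \<open>K\<close>, which removes both blocks.\<close>

lemma three_block_rows:
  fixes B :: "'a::linorder \<Rightarrow> bool"
  assumes "inc (K @ r)" "inc (L @ v)" "length K = length L" "\<forall>k\<in>set K. \<forall>l\<in>set L. l < k"
    and Kv: "\<forall>k\<in>set K. \<forall>a\<in>set (r @ v). k < a" and d: "distinct ((K @ r) @ (L @ v))"
    and B: "down B" "\<forall>k\<in>set K. B k" "inc (filter B (r @ v))"
  defines "w \<equiv> (K @ r) @ (L @ v)"
  obtains r' v' where "bmp w = K @ r'" "row_of w = L @ v'" "filter B r' = []" "r' @ v' \<simeq> r @ v"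
proof -
  let ?rb = "filter B r" and ?vb = "filter B v"
  have Lv: "\<forall>l\<in>set L. \<forall>a\<in>set (r @ v). l < a" if "K \<noteq> []"
    using that assms(4) Kv by (metis less_trans hd_in_set)
  have L: "filter B L = L" "filter B K = K"
    using assms(3,4) B downD by (cases K; fastforce simp: filter_id_conv)+
  have dw: "distinct w" using d by (simp add: w_def)
  have fw: "filter B w = (K @ ?rb) @ L @ ?vb" using L by (simp add: w_def)
  have i: "inc (K @ ?rb)" "inc K" "inc L" "inc (L @ ?rb @ ?vb)"
    using assms(1,2) Lv B(3) \<open>length K = length L\<close> by (cases "K = []"; auto simp: sorted_wrt_append intro: sorted_wrt_filter)+
  have "nrm K (L @ [])" using assms(3,4) by (intro nrm_block) auto
  then have "rb (K @ ?rb) L = (L @ ?rb, K)"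
    using i assms(3) by (intro rb_nrm_gen) (auto simp: sorted_wrt_append)
  then have fwr: "row_of (filter B w) = L @ ?rb @ ?vb" "bmp (filter B w) = K"
    unfolding fw row_bmp_append[of "K @ ?rb" "L @ ?vb"] row_inc[OF i(1)] bmp_inc[OF i(1)]
    using i rb_inc_append[of "L @ ?rb" ?vb] by (simp_all add: rb_append)
  have ib: "inc (bmp w)" "inc (row_of w)"
    using two_rows(1,2)[OF assms(1,2) d] by (simp_all add: w_def)
  have f: "filter B (row_of w) = L @ ?rb @ ?vb" "filter B (bmp w) \<simeq> K"
    using filter_nrm_row_bmp[OF B(1) dw ib(1)] fwr pl_sym by auto
  then have f2: "filter B (bmp w) = K" using pl_inc_eq[OF pl_sym i(2)] by blast
  define r1 where "r1 = filter (\<lambda>a. \<not> B a) (bmp w)"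
  define v1 where "v1 = ?rb @ ?vb @ filter (\<lambda>a. \<not> B a) (row_of w)"
  have eq: "bmp w = K @ r1" "row_of w = L @ v1"
    using inc_split_down[OF ib(1) B(1)] inc_split_down[OF ib(2) B(1)] f(1) f2
    by (simp_all add: r1_def v1_def)
  have fr1: "filter B r1 = []" by (simp add: r1_def)
  define U where "U = (\<lambda>a. \<forall>k\<in>set K. k < a)"
  have plU: "filter U w \<simeq> filter U (bmp w @ row_of w)"
    by (rule pl_filter[OF _ pl_bmp_row[OF dw]]) (auto simp: U_def dest: less_trans)
  have UKL: "filter U K = []" "filter U L = []"
    unfolding U_def using assms(3,4) by (cases K; force simp: filter_empty_conv not_less)+
  have Urv: "U a" if "a \<in> set (r @ v)" for a
    using Kv that by (auto simp: U_def)
  then have "filter U r = r" "filter U v = v" by (auto intro!: filter_True)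
  then have Uw: "filter U w = r @ v" using UKL by (simp add: w_def)
  have "distinct (K @ L @ r1 @ v1)" "set (K @ L @ r1 @ v1) = set w"
    using distinct_bmp_row[OF dw] set_bmp_row[of w] unfolding eq by auto
  moreover have "set w = set (K @ L @ r @ v)" by (auto simp: w_def)
  ultimately have "set (r1 @ v1) \<subseteq> set (r @ v)" by auto
  then have "filter U (r1 @ v1) = r1 @ v1" using Urv by (intro filter_True) blast
  moreover have "filter U (bmp w @ row_of w) = filter U (r1 @ v1)"
    unfolding eq by (simp add: UKL)
  ultimately have "r1 @ v1 \<simeq> r @ v" using plU Uw pl_sym by simp
  then show thesis using that[of r1 v1] eq fr1 by auto
qed

declare catable.simps(2) [simp del]

text \<open>The letters \<open>b\<close> removed by the next step must stand in increasing order,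
  and passing through \<open>K\<close> does not disturb them: at most m' \<le> m of them lie in
  \<open>x\<close>, and these already fit below \<open>K\<close>. The cases differ in where
  \<open>b\<close> lies, and each is reduced to the preceding one by normalising pairs of adjacent
  rows.\<close>

lemma rot_closed_Cons:
  fixes mu :: "nat list"
  assumes rc: "rot_closed m' (catable mu :: int list \<Rightarrow> bool)" and mm: "m' \<le> m"
  shows "rot_closed m (catable (m' # mu) :: int list \<Rightarrow> bool)"
  unfolding rot_closed_def
proof (intro allI impI)
  fix K x r W :: "int list"
  assume K: "length K = m" and x0: "inc x" and Kr0: "inc (K @ r)"
    and K0: "\<forall>k\<in>set K. \<forall>a\<in>set (x @ W). k < a" and d0: "distinct (r @ W @ x)"
  define Z where "Z = set (r @ W @ x)"
  define b where "b = take m' (sorted_list_of_set Z)"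
  define B where "B = below (K @ b)"
  define ok where "ok = (\<lambda>r W x. set (r @ W @ x) = Z \<and> distinct (r @ W @ x) \<and> inc x \<and> inc (K @ r))"
  let ?c = "catable (m' # mu) :: int list \<Rightarrow> bool"
  have KZ: "\<forall>k\<in>set K. \<forall>a\<in>Z. k < a"
    using K0 Kr0 by (auto simp: Z_def sorted_wrt_append)
  have finZ: "finite Z" by (simp add: Z_def)
  have down: "down B" by (simp add: B_def down_below)
  have BK: "\<forall>k\<in>set K. B k" by (auto simp: B_def below_def)
  have ib: "inc b" unfolding b_def by (metis strict_sorted_list_of_set sorted_wrt_take)
  have bZ: "set b \<subseteq> Z" unfolding b_def using finZ set_take_subset by fastforce
  have bsplit: "\<forall>a\<in>Z. a \<in> set b \<or> (\<forall>k\<in>set b. k < a)"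
  proof
    fix a assume "a \<in> Z"
    then have "a \<in> set (b @ drop m' (sorted_list_of_set Z))" unfolding b_def using finZ by simp
    moreover have "inc (b @ drop m' (sorted_list_of_set Z))" unfolding b_def by simp
    ultimately show "a \<in> set b \<or> (\<forall>k\<in>set b. k < a)" by (auto simp: sorted_wrt_append)
  qed
  have BZ: "B a \<longleftrightarrow> a \<in> set b" if "a \<in> Z" for a
    using that bsplit KZ by (fastforce simp: B_def below_def)
  have fB: "filter B w = filter (below b) w" if "set w \<subseteq> Z" for w
    using that bsplit by (intro filter_cong refl) (fastforce simp: BZ below_def)
  have setbw: "set (filter B w) = set w \<inter> set b" if "set w \<subseteq> Z" for w
    using that BZ by auto
  define nx where "nx = (\<lambda>x r. bmp (x @ K @ r))"
  define nr where "nr = (\<lambda>x r. drop m (row_of (x @ K @ r)))"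
  have step: "distinct (x @ K @ r)" "row_of (x @ K @ r) = K @ nr x r" "ok (nr x r) W (nx x r)"
    "x @ K @ r \<simeq> nx x r @ K @ nr x r" "filter B (nx x r) = filter B x" "filter B (nr x r) = filter B r"
    if "ok r W x" "length b = m'" for r W x
  proof -
    have Kx: "\<forall>k\<in>set K. \<forall>a\<in>set x. k < a" and Kr: "inc (K @ r)" and ix: "inc x"
      and drx: "distinct (r @ x)" and dW: "distinct W" "set W \<inter> set (r @ x) = {}"
      using that KZ by (auto simp: ok_def)
    show d: "distinct (x @ K @ r)" by (rule distinct_block[OF Kr Kx drx])
    show row: "row_of (x @ K @ r) = K @ nr x r"
      using row_of_cyc_block[OF Kr Kx d] K by (simp add: nr_def)
    show pl: "x @ K @ r \<simeq> nx x r @ K @ nr x r"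
      using pl_bmp_row[OF d] row by (simp add: nx_def)
    note t = two_rows[OF ix Kr d]
    have "distinct (nx x r @ K @ nr x r)" using pl_distinct[OF pl] d by simp
    moreover have "set (nx x r @ K @ nr x r) = set (x @ K @ r)" using pl_set[OF pl] by simp
    ultimately have st: "set (nx x r @ nr x r) = set (r @ x)" "distinct (nx x r @ nr x r)"
      using d by auto
    then show "ok (nr x r) W (nx x r)"
      using that(1) t(1,2) dW row unfolding ok_def by (auto simp: nx_def)
    let ?w = "x @ K @ r" and ?xb = "filter B x" and ?rb = "filter B r"
    have fK: "filter B K = K" using BK by (simp add: filter_id_conv)
    have fw: "filter B ?w = ?xb @ K @ ?rb" using fK by simp
    have "set ?xb \<subseteq> set b" using setbw[of x] that(1) by (auto simp: ok_def)
    moreover have "distinct ?xb" using inc_distinct[OF ix] by simp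
    ultimately have "length ?xb \<le> length b"
      using inc_distinct[OF ib] by (metis card_mono distinct_card List.finite_set)
    \<comment> \<open>This is where \<open>mm\<close> enters: the letters of \<open>b\<close> in
      \<open>x\<close> are no more than the letters of \<open>K\<close>.\<close>
    then have "nrm ?xb (K @ ?rb)" using that(2) K mm Kx by (intro nrm_block) auto
    moreover have ii: "inc ?xb" "inc (K @ ?rb)"
      using ix Kr by (auto simp: sorted_wrt_append intro: sorted_wrt_filter)
    ultimately have rw: "row_of (filter B ?w) = K @ ?rb" "bmp (filter B ?w) = ?xb"
      using row_bmp_two fw by metis+
    have f: "filter B (row_of ?w) = K @ ?rb" "filter B (bmp ?w) \<simeq> ?xb"
      using filter_nrm_row_bmp[OF down d t(1)] rw pl_sym by auto
    show "filter B (nx x r) = ?xb" using pl_inc_eq[OF pl_sym[OF f(2)] ii(1)] by (simp add: nx_def)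
    show "filter B (nr x r) = ?rb" using f(1) row fK by simp
  qed
  text \<open>All of the block \<open>b\<close> lies in the last row.\<close>
  have case1: "?c (r @ W @ x) = ?c (nr x r @ W @ nx x r)"
    if "ok r W x" "length b = m'" "filter B r = []" "filter B W = []" for r W x
  proof -
    note s = step[OF that(1,2)]
    have "set b \<subseteq> set x"
      using that setbw[of r] setbw[of W] bZ by (auto simp: ok_def)
    then have fx: "filter B x = b"
      using that setbw[of x] ib by (intro inc_set_eq) (auto simp: ok_def intro: sorted_wrt_filter)
    let ?xi = "filter (\<lambda>a. \<not> B a) x" and ?xi' = "filter (\<lambda>a. \<not> B a) (nx x r)"
    have x: "x = b @ ?xi" using inc_split_down[OF _ down, of x] that fx by (auto simp: ok_def)
    have x': "nx x r = b @ ?xi'"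
      using inc_split_down[OF _ down, of "nx x r"] s(3,5) fx by (auto simp: ok_def)
    let ?U = "\<lambda>a. \<not> B a"
    \<comment> \<open>The complement of a down-set is convex. Once \<open>K\<close> and
      \<open>b\<close> are filtered out, the two words are exactly what is left after removing
      \<open>b\<close> and rotating.\<close>
    have "filter ?U (x @ K @ r) \<simeq> filter ?U (nx x r @ K @ nr x r)"
      by (rule pl_filter[OF _ s(4)]) (use down downD in blast)
    moreover have "filter ?U K = []" using BK by (simp add: filter_empty_conv)
    moreover have "filter ?U r = r" "filter ?U (nr x r) = nr x r"
      using that(3) s(6) by (auto simp: filter_id_conv filter_empty_conv)
    ultimately have pl: "?xi @ r \<simeq> ?xi' @ nr x r" by simp
    have b1: "\<forall>k\<in>set b. \<forall>a\<in>set (r @ W). k < a"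
      using that(1,3,4) BZ bsplit by (fastforce simp: ok_def filter_empty_conv)
    have b2: "\<forall>k\<in>set b. \<forall>a\<in>set (nr x r @ W). k < a"
      using s(3,6) that(3,4) BZ bsplit by (fastforce simp: ok_def filter_empty_conv)
    have i1: "inc (b @ ?xi)" using x that(1) by (simp add: ok_def)
    have i2: "inc (b @ ?xi')" using x' s(3) by (simp add: ok_def)
    have d1: "distinct (?xi @ r @ W)" using that(1) by (auto simp: ok_def)
    have d2: "distinct (?xi' @ nr x r @ W)" using s(3) by (auto simp: ok_def)
    have "?c (r @ W @ x) = ?c ((r @ W) @ b @ ?xi)" using x by simp
    also have "\<dots> = catable mu (?xi @ (r @ W))"
      by (rule catable_block[OF rc that(2) i1 b1]) (use d1 in simp)
    also have "\<dots> = catable mu (?xi' @ (nr x r @ W))"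
      using pl_append_right[OF pl, of W] by (intro catable_pl) simp
    also have "\<dots> = ?c ((nr x r @ W) @ b @ ?xi')"
      by (rule catable_block[OF rc that(2) i2 b2, symmetric]) (use d2 in simp)
    also have "\<dots> = ?c (nr x r @ W @ nx x r)" using x' by simp
    finally show ?thesis .
  qed
  text \<open>The block \<open>b\<close> may also meet the middle rows.\<close>
  have case2: "?c (r @ W @ x) = ?c (nr x r @ W @ nx x r)"
    if o: "ok r W x" and lb: "length b = m'" and fr: "filter B r = []" and iW: "inc (filter B (W @ x))" for r W x
  proof -
    note s = step[OF o lb]
    define V where "V = bmp W"
    define a where "a = row_of W"
    have dW: "distinct W" using o by (simp add: ok_def)
    have plW: "W \<simeq> V @ a" unfolding V_def a_def by (rule pl_bmp_row[OF dW])
    have ia: "inc a" unfolding a_def by (rule inc_row_of[OF dW])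
    have VB: "filter B V = []" unfolding V_def
      using filter_row_inc(1)[OF down dW] iW by (simp add: sorted_wrt_append)
    have fa: "filter B a = filter B W" unfolding a_def
      using filter_row_inc(2)[OF down dW] iW by (simp add: sorted_wrt_append)
    \<comment> \<open>The triple is \<open>a\<close>, \<open>x\<close>, \<open>K @ r\<close>.
      Normalising the first pair is a Knuth equivalence inside the rotated word, of which
      \<open>a @ x\<close> is a factor; normalising the second pair is the first case, applicable
      because \<open>V\<close>, \<open>a\<close> and \<open>r\<close> hold no letter of
      \<open>b\<close>.\<close>
    define Inv where "Inv = (\<lambda>a x y. \<exists>r. y = K @ r \<and> ok r (V @ a) x \<and> filter B r = [] \<and> filter B a = [])"
    define Phi where "Phi = (\<lambda>a x y. ?c (drop m y @ V @ a @ x))"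
    have N1: "ok r (V @ bmp (a @ x)) (row_of (a @ x)) \<and> filter B (bmp (a @ x)) = [] \<and>
        Phi (bmp (a @ x)) (row_of (a @ x)) (K @ r) = Phi a x (K @ r)"
      if "ok r (V @ a) x" "inc (filter B (a @ x))" for a x r
    proof -
      have d: "distinct (a @ x)" using that by (auto simp: ok_def)
      have pl: "bmp (a @ x) @ row_of (a @ x) \<simeq> a @ x" using pl_bmp_row[OF d] pl_sym by blast
      have "set (bmp (a @ x) @ row_of (a @ x)) = set (a @ x)" "distinct (bmp (a @ x) @ row_of (a @ x))"
        using pl_set[OF pl] pl_distinct[OF pl] d by auto
      then have "ok r (V @ bmp (a @ x)) (row_of (a @ x))"
        using that(1) inc_row_of[OF d] by (auto simp: ok_def)
      moreover have "filter B (bmp (a @ x)) = []" by (rule filter_row_inc(1)[OF down d that(2)])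
      moreover have "Phi (bmp (a @ x)) (row_of (a @ x)) (K @ r) = Phi a x (K @ r)"
        unfolding Phi_def using K by (intro catable_pl pl_append_left pl) 
      ultimately show ?thesis by blast
    qed
    have N1': "Inv (bmp (a @ x)) (row_of (a @ x)) y \<and> Phi (bmp (a @ x)) (row_of (a @ x)) y = Phi a x y"
      if "Inv a x y" for a x y
    proof -
      from that obtain r where r: "y = K @ r" "ok r (V @ a) x" "filter B r = []" "filter B a = []"
        by (auto simp: Inv_def)
      have "inc (filter B (a @ x))" using r by (auto simp: ok_def intro: sorted_wrt_filter)
      from N1[OF r(2) this] show ?thesis using r by (auto simp: Inv_def)
    qed
    have N2': "Inv a (bmp (x @ y)) (row_of (x @ y)) \<and> Phi a (bmp (x @ y)) (row_of (x @ y)) = Phi a x y"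
      if "Inv a x y" for a x y
    proof -
      from that obtain r where r: "y = K @ r" "ok r (V @ a) x" "filter B r = []" "filter B a = []"
        by (auto simp: Inv_def)
      note s' = step[OF r(2) lb]
      have "?c (r @ (V @ a) @ x) = ?c (nr x r @ (V @ a) @ nx x r)"
        by (rule case1[OF r(2) lb r(3)]) (simp add: VB r(4))
      then show ?thesis using r s' K by (auto simp: Inv_def Phi_def nx_def)
    qed
    have okV: "ok r (V @ a) x" "ok (nr x r) (V @ a) (nx x r)"
      using o s(3) pl_set[OF plW] pl_distinct[OF plW] by (auto simp: ok_def)
    \<comment> \<open>One normalisation of \<open>a @ x\<close> collects all of \<open>b\<close> in
      the last row and so establishes \<open>Inv\<close>.\<close>
    have start: "?c (r @ W @ x) = Phi (bmp (a @ x)) (row_of (a @ x)) (K @ r)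
        \<and> Inv (bmp (a @ x)) (row_of (a @ x)) (K @ r)"
      if o: "ok r (V @ a) x" and fr: "filter B r = []" and fx: "inc (filter B (W @ x))" for r x
    proof -
      have "?c (r @ W @ x) = Phi a x (K @ r)"
      proof -
        have "?c (r @ W @ x) = ?c (r @ (V @ a) @ x)"
          by (intro catable_pl pl_append_left pl_append_right plW)
        then show ?thesis unfolding Phi_def using K by (simp del: catable.simps)
      qed
      with N1[OF o] fx fa fr show ?thesis by (auto simp: Inv_def)
    qed
    have 1: "?c (r @ W @ x) = Phi (bmp (a @ x)) (row_of (a @ x)) (K @ r)"
      "Inv (bmp (a @ x)) (row_of (a @ x)) (K @ r)" using start[OF okV(1) fr iW] by auto
    have 2: "?c (nr x r @ W @ nx x r) = Phi (bmp (a @ nx x r)) (row_of (a @ nx x r)) (K @ nr x r)"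
      "Inv (bmp (a @ nx x r)) (row_of (a @ nx x r)) (K @ nr x r)"
      using start[OF okV(2)] s(5,6) fr iW by auto
    have da: "distinct (a @ x)" "distinct (a @ nx x r)" using okV by (auto simp: ok_def)
    have ia: "inc (bmp (a @ x))" "inc (bmp (a @ nx x r))"
      using two_rows(1)[OF ia _ da(1)] two_rows(1)[OF ia _ da(2)] okV by (auto simp: ok_def)
    have iK: "inc (K @ r)" "inc (K @ nr x r)" using okV by (auto simp: ok_def)
    have dall: "distinct (bmp (a @ x) @ row_of (a @ x) @ K @ r)"
    proof -
      have pl: "bmp (a @ x) @ row_of (a @ x) @ K @ r \<simeq> a @ x @ K @ r"
        using pl_append_right[OF pl_sym[OF pl_bmp_row[OF da(1)]], of "K @ r"] by simp
      have "distinct (a @ x @ K @ r)"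
        using s(1) okV(1) KZ by (auto simp: ok_def)
      with pl_distinct[OF pl] show ?thesis by simp
    qed
    have "Phi (bmp (a @ x)) (row_of (a @ x)) (K @ r) =
        Phi (bmp (a @ nx x r)) (row_of (a @ nx x r)) (K @ nr x r)"
    proof (rule three_rows_eq[of Inv Phi])
      have "(bmp (a @ x) @ row_of (a @ x)) @ K @ r \<simeq> (a @ x) @ K @ r"
        using pl_append_right pl_sym pl_bmp_row[OF da(1)] by blast
      also have "(a @ x) @ K @ r \<simeq> a @ nx x r @ K @ nr x r"
        using pl_append_left[OF s(4), of a] by simp
      also have "a @ nx x r @ K @ nr x r \<simeq> (bmp (a @ nx x r) @ row_of (a @ nx x r)) @ K @ nr x r"
        using pl_append_right[OF pl_bmp_row[OF da(2)], of "K @ nr x r"] by simp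
      finally show "bmp (a @ x) @ row_of (a @ x) @ K @ r \<simeq>
        bmp (a @ nx x r) @ row_of (a @ nx x r) @ K @ nr x r" by simp
    qed (use N1' N2' 1 2 ia iK dall inc_row_of[OF da(1)] inc_row_of[OF da(2)] in auto)
    with 1 2 show ?thesis by simp
  qed
  text \<open>The general case: an auxiliary row \<open>L\<close> below the block \<open>K\<close> pulls \<open>b\<close> out of \<open>r\<close>.\<close>
  have case3: "?c (r @ W @ x) = ?c (nr x r @ W @ nx x r)"
    if o: "ok r W x" and lb: "length b = m'" and iW: "inc (filter B (r @ W @ x))" for r W x
  proof -
    note s = step[OF o lb]
    \<comment> \<open>\<open>L\<close> consists of m consecutive integers below all letters in play;
      in an alphabet with a least letter there might be no room for it.\<close>
    define c where "c = Min (insert 0 (set K \<union> Z))"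
    define L where "L = [c - int m .. c - 1]"
    have Lm: "length L = m" by (simp add: L_def)
    have iL: "inc L" by (simp add: L_def strict_sorted_iff)
    have cK: "c \<le> k" if "k \<in> set K \<union> Z" for k
      unfolding c_def using that finZ by (intro Min_le) auto
    then have LK: "\<forall>l\<in>set L. \<forall>k\<in>set K \<union> Z. l < k" by (force simp: L_def)
    \<comment> \<open>Now the triple is \<open>x\<close>, \<open>K @ r\<close>,
      \<open>L @ v\<close>, and \<open>Phi\<close> deletes both blocks. The row \<open>v\<close>
      takes up the letters of \<open>b\<close> that were in \<open>r\<close>, so that the second
      case applies to the first pair.\<close>
    define Inv where "Inv = (\<lambda>x y z. \<exists>r v. y = K @ r \<and> z = L @ v \<and> ok r (v @ W) x \<and> filter B r = []
      \<and> inc (filter B (v @ W @ x)) \<and> inc z)"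
    define Phi where "Phi = (\<lambda>x y z. ?c (drop m y @ drop m z @ W @ x))"
    have M: "\<exists>r' v'. bmp ((K @ r) @ (L @ v)) = K @ r' \<and> row_of ((K @ r) @ (L @ v)) = L @ v'
       \<and> filter B r' = [] \<and> r' @ v' \<simeq> r @ v \<and> ok r' (v' @ W) x \<and> inc (filter B (v' @ W @ x)) \<and>
       ?c (r' @ v' @ W @ x) = ?c (r @ v @ W @ x) \<and> inc (L @ v')"
      if o: "ok r (v @ W) x" and f: "inc (filter B (r @ v @ W @ x))" and iv: "inc (L @ v)" for r v x
    proof -
      have Kr: "inc (K @ r)" using o by (simp add: ok_def)
      have vZ: "set v \<subseteq> Z" "set r \<subseteq> Z" using o by (auto simp: ok_def)
      have d: "distinct ((K @ r) @ (L @ v))"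
        using o LK KZ vZ inc_distinct[OF Kr] inc_distinct[OF iv] by (auto simp: ok_def)
      have ll: "length K = length L" "\<forall>k\<in>set K. \<forall>l\<in>set L. l < k" "\<forall>k\<in>set K. \<forall>a\<in>set (r @ v). k < a"
        using K Lm LK KZ vZ by auto
      have frv: "inc (filter B (r @ v))" using f by (auto simp: sorted_wrt_append)
      from three_block_rows[OF Kr iv ll d down BK frv]
      obtain r' v' where rv: "bmp ((K @ r) @ (L @ v)) = K @ r'" "row_of ((K @ r) @ (L @ v)) = L @ v'"
        "filter B r' = []" "r' @ v' \<simeq> r @ v" by blast
      have sd: "set (r' @ v') = set (r @ v)" "distinct (r' @ v') = distinct (r @ v)"
        using pl_set[OF rv(4)] pl_distinct[OF rv(4)] by auto
      have t: "inc (K @ r')" "inc (L @ v')" using two_rows(1,2)[OF Kr iv d] rv by auto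
      have "ok r' (v' @ W) x" using o sd t(1) by (auto simp: ok_def)
      moreover have "filter B (r' @ v') = filter B (r @ v)"
        using pl_inc_eq[OF pl_sym[OF pl_filter_down[OF down rv(4)]] frv] .
      then have "filter B (v' @ W @ x) = filter B (r @ v @ W @ x)" using rv(3) by simp
      moreover have "?c ((r' @ v') @ W @ x) = ?c ((r @ v) @ W @ x)"
        by (intro catable_pl pl_append_right rv(4))
      ultimately show ?thesis using rv t f by auto
    qed
    have N1': "Inv (bmp (x @ y)) (row_of (x @ y)) z \<and> Phi (bmp (x @ y)) (row_of (x @ y)) z = Phi x y z"
      if "Inv x y z" for x y z
    proof -
      from that obtain r v where r: "y = K @ r" "z = L @ v" "ok r (v @ W) x" "filter B r = []"
        "inc (filter B (v @ W @ x))" "inc z" by (auto simp: Inv_def)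
      note s' = step[OF r(3) lb]
      have "?c (r @ (v @ W) @ x) = ?c (nr x r @ (v @ W) @ nx x r)"
        by (rule case2[OF r(3) lb r(4)]) (use r in simp)
      then show ?thesis using r s' K Lm by (auto simp: Inv_def Phi_def nx_def)
    qed
    have N2': "Inv x (bmp (y @ z)) (row_of (y @ z)) \<and> Phi x (bmp (y @ z)) (row_of (y @ z)) = Phi x y z"
      if "Inv x y z" for x y z
    proof -
      from that obtain r v where r: "y = K @ r" "z = L @ v" "ok r (v @ W) x" "filter B r = []"
        "inc (filter B (v @ W @ x))" "inc z" by (auto simp: Inv_def)
      have "inc (filter B (r @ v @ W @ x))" "inc (L @ v)" using r by auto
      from M[OF r(3) this] obtain r' v' where m: "bmp (y @ z) = K @ r'" "row_of (y @ z) = L @ v'"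
        "filter B r' = []" "ok r' (v' @ W) x" "inc (filter B (v' @ W @ x))"
        "?c (r' @ v' @ W @ x) = ?c (r @ v @ W @ x)" "inc (L @ v')" unfolding r(1,2) by blast
      have "Inv x (K @ r') (L @ v')" unfolding Inv_def using m by blast
      moreover have "Phi x (K @ r') (L @ v') = Phi x y z" using m(6) K Lm by (simp add: Phi_def r(1,2))
      ultimately show ?thesis using m(1,2) by simp
    qed
    have start: "?c (r @ W @ x) = Phi x (bmp ((K @ r) @ L)) (row_of ((K @ r) @ L)) \<and>
        Inv x (bmp ((K @ r) @ L)) (row_of ((K @ r) @ L)) \<and>
        inc (bmp ((K @ r) @ L)) \<and> inc (row_of ((K @ r) @ L)) \<and>
        (K @ r) @ L \<simeq> bmp ((K @ r) @ L) @ row_of ((K @ r) @ L) \<and> distinct (x @ (K @ r) @ L)"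
      if o: "ok r W x" and f: "inc (filter B (r @ W @ x))" for r x
    proof -
      have Kr: "inc (K @ r)" using o by (simp add: ok_def)
      have sZ: "set (x @ r) \<subseteq> Z" using o by (auto simp: ok_def)
      then have d: "distinct (x @ (K @ r) @ L)"
        using o LK KZ inc_distinct[OF Kr] inc_distinct[OF iL] by (auto simp: ok_def)
      have "inc (filter B (r @ [] @ W @ x))" "ok r ([] @ W) x" "inc (L @ [])" using o f iL by auto
      from M[OF this(2,1,3)] obtain r' v' where m: "bmp ((K @ r) @ L) = K @ r'" "row_of ((K @ r) @ L) = L @ v'"
        "filter B r' = []" "ok r' (v' @ W) x" "inc (filter B (v' @ W @ x))"
        "?c (r' @ v' @ W @ x) = ?c (r @ W @ x)" "inc (L @ v')" by auto
      have "Inv x (K @ r') (L @ v')" unfolding Inv_def using m by blast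
      moreover have "Phi x (K @ r') (L @ v') = ?c (r @ W @ x)" using m(6) K Lm by (simp add: Phi_def)
      ultimately show ?thesis using d m(1,2,7) two_rows(1,4)[OF Kr iL] by simp
    qed
    have f2: "inc (filter B (nr x r @ W @ nx x r))" using iW s(5,6) by simp
    note a = start[OF o iW] and a' = start[OF s(3) f2]
    have "Phi x (bmp ((K @ r) @ L)) (row_of ((K @ r) @ L)) =
      Phi (nx x r) (bmp ((K @ nr x r) @ L)) (row_of ((K @ nr x r) @ L))"
    proof (rule three_rows_eq[of Inv Phi])
      have pa: "x @ bmp ((K @ r) @ L) @ row_of ((K @ r) @ L) \<simeq> x @ (K @ r) @ L"
        using a pl_append_left pl_sym by blast
      also have "x @ (K @ r) @ L \<simeq> nx x r @ (K @ nr x r) @ L"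
        using pl_append_right[OF s(4), of L] by simp
      also have "\<dots> \<simeq> nx x r @ bmp ((K @ nr x r) @ L) @ row_of ((K @ nr x r) @ L)"
        using a' pl_append_left by blast
      finally show "x @ bmp ((K @ r) @ L) @ row_of ((K @ r) @ L) \<simeq>
        nx x r @ bmp ((K @ nr x r) @ L) @ row_of ((K @ nr x r) @ L)" .
      show "distinct (x @ bmp ((K @ r) @ L) @ row_of ((K @ r) @ L))"
        using a pl_distinct[OF pa] by simp
    qed (use N1' N2' a a' o s(3) in \<open>auto simp: ok_def\<close>)
    with a a' show ?thesis by simp
  qed
  have o0: "ok r W x" using x0 Kr0 d0 by (simp add: ok_def Z_def)
  have goal: "?c (r @ W @ x) = ?c (nr x r @ W @ nx x r)"
  proof (cases "length b = m'")
    case True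
    note s = step[OF o0 True]
    show ?thesis
    proof (cases "inc (filter B (r @ W @ x))")
      case True
      then show ?thesis using case3[OF o0 \<open>length b = m'\<close>] by blast
    next
      case False
      \<comment> \<open>If the letters of \<open>b\<close> are out of order, the passage through
        \<open>K\<close> keeps them so, and both sides are false.\<close>
      have "\<not> ?c w" if "filter B w = filter B (r @ W @ x)" "set w = Z" for w
      proof
        assume "?c w"
        then have "filter (below b) w = b"
          using catable_filter_below[of b mu w] \<open>length b = m'\<close> ib bZ bsplit that by auto
        then show False using False fB[of w] that ib by auto
      qed
      then show ?thesis using s(3,5,6) o0 by (auto simp: ok_def)
    qed
  next
    case False
    have cz: "card Z < m'"
      using False finZ by (auto simp: b_def)
    have d: "x @ K @ r \<simeq> nx x r @ K @ nr x r" "distinct (x @ K @ r)"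
    proof -
      have "\<forall>k\<in>set K. \<forall>a\<in>set x. k < a" "distinct (r @ x)" using K0 d0 by auto
      note dd = distinct_block[OF Kr0 this] row_of_cyc_block[OF Kr0 this(1) distinct_block[OF Kr0 this]]
      then show "distinct (x @ K @ r)" "x @ K @ r \<simeq> nx x r @ K @ nr x r"
        using pl_bmp_row[OF dd(1)] K by (simp_all add: nx_def nr_def)
    qed
    have "\<not> ?c w" if "length w < m'" for w
    proof
      assume "?c w"
      then obtain Y b s where "w \<simeq> Y @ b @ s" "length b = m'" by (auto simp: catable.simps(2))
      then show False using pl_length[of w "Y @ b @ s"] that by simp
    qed
    moreover have "length (r @ W @ x) < m'" using cz d0 unfolding Z_def by (metis distinct_card)
    moreover have "length (nr x r @ W @ nx x r) = length (r @ W @ x)" using pl_length[OF d(1)] by simp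
    ultimately show ?thesis by metis
  qed
  then show "?c (r @ W @ x) = ?c (drop m (row_of (x @ K @ r)) @ W @ bmp (x @ K @ r))"
    by (simp add: nr_def nx_def)
qed

theorem rot_closed_catable:
  assumes "sorted_wrt (\<ge>) mu" "\<forall>k\<in>set mu. k \<le> m"
  shows "rot_closed m (catable mu :: int list \<Rightarrow> bool)"
  using assms
proof (induction mu arbitrary: m)
  case Nil
  have "set (drop m (row_of (x @ K @ r)) @ W @ bmp (x @ K @ r)) = set (r @ W @ x)"
    if "length K = m" "inc (K @ r)" "\<forall>k\<in>set K. \<forall>a\<in>set (x @ W). k < a" "distinct (r @ W @ x)"
    for K x r W :: "int list"
  proof -
    have *: "\<forall>k\<in>set K. \<forall>a\<in>set x. k < a" "distinct (r @ x)" using that by auto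
    note d = distinct_block[OF that(2) *]
    have "set (bmp (x @ K @ r)) \<union> set (K @ drop m (row_of (x @ K @ r))) = set (x @ K @ r)"
      using set_bmp_row[of "x @ K @ r"] row_of_cyc_block[OF that(2) *(1) d] that(1) by simp
    moreover have "distinct (bmp (x @ K @ r) @ K @ drop m (row_of (x @ K @ r)))"
      using distinct_bmp_row[OF d] row_of_cyc_block[OF that(2) *(1) d] that(1) by simp
    ultimately show ?thesis using d by auto
  qed
  then show ?case unfolding rot_closed_def catable.simps(1) by (metis set_empty)
next
  case (Cons m' mu)
  then show ?case by (intro rot_closed_Cons) auto
qed

section \<open>Tableaux as normal forms of words\<close>

definition rword :: "'a list list \<Rightarrow> 'a list" where
  "rword T = concat (rev T)"

lemma rword_simps [simp]: "rword [] = []" "rword (x # T) = rword T @ x"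
  by (simp_all add: rword_def)

fun ctab :: "'a::linorder list list \<Rightarrow> bool" where
  "ctab [] = True"
| "ctab [x] = inc x"
| "ctab (x # v # T) = (inc x \<and> nrm v x \<and> ctab (v # T))"

lemma ctab_Cons: "ctab (x # T) \<Longrightarrow> inc x \<and> ctab T"
  by (cases T) auto

lemma ctab_row_bmp:
  "ctab T \<Longrightarrow> distinct (rword T) \<Longrightarrow>
    row_of (rword T) = (case T of [] \<Rightarrow> [] | x # V \<Rightarrow> x) \<and> bmp (rword T) = (case T of [] \<Rightarrow> [] | x # V \<Rightarrow> rword V)"
proof (induction T rule: ctab.induct)
  case 1
  then show ?case by (simp add: row_of_def bmp_def)
next
  case (3 x v T)
  have IH: "row_of (rword (v # T)) = v" "bmp (rword (v # T)) = rword T" using 3 by auto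
  then have "nrm (row_of (rword (v # T))) x" "inc x" "distinct (rword (v # T))" using 3 by auto
  from row_bmp_append_row[OF this] IH show ?case by simp
qed auto

text \<open>First rows are peeled off one by one. Empty rows at the bottom are allowed here, which
  is why the number of rows is prescribed; this form serves tableaux with a fixed number N of
  rows.\<close>

lemma ctab_unique:
  "ctab T \<Longrightarrow> ctab T' \<Longrightarrow> distinct (rword T) \<Longrightarrow> rword T \<simeq> rword T' \<Longrightarrow>
    length T = length T' \<Longrightarrow> T = T'"
proof (induction T arbitrary: T')
  case (Cons x T)
  then obtain x' V where T': "T' = x' # V" by (cases T') auto
  have d: "distinct (rword T')" using Cons.prems pl_distinct by blast
  have "row_of (rword (x # T)) = x" "bmp (rword (x # T)) = rword T"
    "row_of (rword T') = x'" "bmp (rword T') = rword V"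
    using ctab_row_bmp[of "x # T"] ctab_row_bmp[of T'] Cons.prems d T' by auto
  with pl_row_bmp[OF Cons.prems(4,3)] have x: "x = x'" and pl: "rword T \<simeq> rword V" by auto
  have "T = V"
    by (rule Cons.IH[OF _ _ _ pl]) (use Cons.prems T' ctab_Cons in auto)
  with x T' show ?case by simp
qed simp

lemma ctab_unique_nonempty:
  "ctab T \<Longrightarrow> ctab T' \<Longrightarrow> distinct (rword T) \<Longrightarrow> rword T \<simeq> rword T' \<Longrightarrow>
    [] \<notin> set T \<Longrightarrow> [] \<notin> set T' \<Longrightarrow> T = T'"
proof (induction T arbitrary: T')
  case Nil
  then show ?case by (cases T') auto
next
  case (Cons x T)
  then have "rword T' \<noteq> []" using pl_Nil by fastforce
  then obtain x' V where T': "T' = x' # V" by (cases T') auto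
  have d: "distinct (rword T')" using Cons.prems pl_distinct by blast
  have "row_of (rword (x # T)) = x" "bmp (rword (x # T)) = rword T"
    "row_of (rword T') = x'" "bmp (rword T') = rword V"
    using ctab_row_bmp[of "x # T"] ctab_row_bmp[of T'] Cons.prems d T' by auto
  with pl_row_bmp[OF Cons.prems(4,3)] have x: "x = x'" and pl: "rword T \<simeq> rword V" by auto
  have "T = V"
    by (rule Cons.IH[OF _ _ _ pl]) (use Cons.prems T' ctab_Cons in auto)
  with x T' show ?case by simp
qed

lemma ctab_ConsI: "inc x \<Longrightarrow> ctab T \<Longrightarrow> (T \<noteq> [] \<Longrightarrow> nrm (hd T) x) \<Longrightarrow> ctab (x # T)"
  by (cases T) auto

lemma row_of_Nil_iff: "row_of w = [] \<longleftrightarrow> w = []"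
proof (cases w rule: rev_cases)
  case (snoc v a)
  then show ?thesis using mem_ins[of a "row_of v"] by (auto simp: row_of_snoc)
qed (simp add: row_of_def)

lemma ctab_exists:
  "distinct w \<Longrightarrow> \<exists>T. ctab T \<and> [] \<notin> set T \<and> rword T \<simeq> w"
proof (induction "length w" arbitrary: w rule: less_induct)
  case less
  show ?case
  proof (cases "w = []")
    case True
    then show ?thesis by (intro exI[of _ "[]"]) simp
  next
    case False
    have "row_of w \<noteq> []" using False by (simp add: row_of_Nil_iff)
    then have "length (bmp w) < length w" using length_bmp_row[of w] by (cases "row_of w") auto
    moreover have d: "distinct (bmp w)" using distinct_bmp_row[OF less.prems] by simp
    ultimately obtain T where T: "ctab T" "[] \<notin> set T" "rword T \<simeq> bmp w" using less.hyps by blast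
    have dT: "distinct (rword T)" using pl_distinct[OF T(3)] d by simp
    have "nrm (hd T) (row_of w)" if "T \<noteq> []"
    proof -
      have "row_of (rword T) = hd T" using ctab_row_bmp[OF T(1) dT] that by (cases T) auto
      then have "hd T = row_of (bmp w)" using pl_row[OF T(3) dT] by simp
      then show ?thesis using nrm_row_bmp[OF less.prems] by simp
    qed
    then have "ctab (row_of w # T)" using inc_row_of[OF less.prems] T by (intro ctab_ConsI) auto
    moreover have "rword (row_of w # T) \<simeq> w"
      using pl_append_right[OF T(3)] pl_sym[OF pl_bmp_row[OF less.prems]] pl_trans by fastforce
    ultimately show ?thesis using T \<open>row_of w \<noteq> []\<close> by (intro exI[of _ "row_of w # T"]) auto
  qed
qed

lemma ctab_nth:
  "ctab T \<longleftrightarrow> (\<forall>r\<in>set T. inc r) \<and> (\<forall>i. Suc i < length T \<longrightarrow> nrm (T ! Suc i) (T ! i))"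
proof (induction T rule: ctab.induct)
  case (3 x v T)
  have "(\<forall>i. Suc i < length (x # v # T) \<longrightarrow> nrm ((x # v # T) ! Suc i) ((x # v # T) ! i)) \<longleftrightarrow>
     nrm v x \<and> (\<forall>i. Suc i < length (v # T) \<longrightarrow> nrm ((v # T) ! Suc i) ((v # T) ! i))"
    by (auto simp: less_Suc_eq_0_disj nth_Cons split: nat.splits)
  with 3 show ?case by auto
qed auto

lemma column_strict_ctab:
  assumes "distinct (rword T)"
  shows "column_strict T \<longleftrightarrow> ctab T \<and> [] \<notin> set T"
proof -
  have "inc r = sorted r" if "r \<in> set T" for r
    using that assms by (auto simp: rword_def strict_sorted_iff distinct_concat_iff)
  moreover have "is_partition (shape T) \<longleftrightarrow>
      (\<forall>i. Suc i < length T \<longrightarrow> length (T ! Suc i) \<le> length (T ! i)) \<and> [] \<notin> set T"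
  proof -
    have "sorted_wrt (\<ge>) (map length T) \<longleftrightarrow> (\<forall>i. Suc i < length T \<longrightarrow> length (T ! Suc i) \<le> length (T ! i))"
      using sorted_wrt_iff_nth_Suc_transp[of "(\<ge>) :: nat \<Rightarrow> _" "map length T"]
      by (auto simp: transp_on_def)
    then show ?thesis unfolding is_partition_def shape_def by force
  qed
  ultimately show ?thesis unfolding column_strict_def ctab_nth nrm_iff by blast
qed

text \<open>Moves permute the letters, so distinctness persists along a chain and every weak
  inequality in \<open>knuth_move\<close> is strict.\<close>

lemma knuth_equiv_pl:
  assumes "distinct u"
  shows "knuth_equiv u v \<longleftrightarrow> u \<simeq> v"
proof
  have mv: "pl_step u v" if "knuth_move u v" "distinct u" for u v
    using that(1)
  proof cases
    case (1 x y z a b)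
    with that(2) have "y < z" by auto
    with 1 show ?thesis using pl_step.pl_yxz[of x y z a b] by simp
  next
    case (2 x y z a b)
    with that(2) have "x < y" by auto
    with 2 show ?thesis using pl_step.pl_xzy[of x y z a b] by simp
  qed
  have ms: "mset u = mset v" if "knuth_move u v" for u v
    using that by cases auto
  have dd: "distinct u = distinct v" if "knuth_move u v" for u v
    using ms[OF that] mset_eq_imp_distinct_iff by blast
  show "knuth_equiv u v \<Longrightarrow> u \<simeq> v"
    unfolding knuth_equiv_def
  proof (induction rule: equivclp_induct)
    case (step y z)
    then have "distinct y" using pl_distinct assms by blast
    with step(2) dd have "pl_step y z \<or> pl_step z y" using mv by blast
    then show ?case using step pl_stepI pl_sym pl_trans by metis
  qed simp
  have "knuth_move u v" if "pl_step u v" for u v :: "nat list"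
    using that
  proof cases
    case (pl_yxz x y z a b)
    then show ?thesis using knuth_move.intros(1)[of x y z a b] by simp
  next
    case (pl_xzy x y z a b)
    then show ?thesis using knuth_move.intros(2)[of x y z a b] by simp
  qed
  note mv' = this
  assume "u \<simeq> v"
  then show "knuth_equiv u v"
    unfolding knuth_equiv_def
    by (induction rule: pl_induct) (auto intro: mv' equivclp_sym equivclp_trans)
qed

lemma reading_word_eq: "reading_word T = rword T"
  by (simp add: reading_word_def rword_def)

lemma P_tableau_eqI:
  assumes "distinct u" "ctab T" "[] \<notin> set T" "rword T \<simeq> u"
  shows "P_tableau u = T"
  unfolding P_tableau_def
proof (rule the_equality)
  have d: "distinct (rword T)" using assms pl_distinct by blast
  then show "column_strict T \<and> knuth_equiv (reading_word T) u"
    using assms by (simp add: column_strict_ctab knuth_equiv_pl reading_word_eq)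
  fix V assume V: "column_strict V \<and> knuth_equiv (reading_word V) u"
  have "knuth_equiv u (rword V)"
    using V unfolding knuth_equiv_def reading_word_eq by (blast intro: equivclp_sym)
  then have pl: "u \<simeq> rword V" using knuth_equiv_pl[OF assms(1)] by simp
  then have "distinct (rword V)" using assms(1) pl_distinct by blast
  with V show "V = T" using ctab_unique_nonempty[of V T] pl assms pl_sym pl_trans
    by (metis column_strict_ctab)
qed

lemma P_tableau:
  assumes "distinct u"
  shows "ctab (P_tableau u)" "[] \<notin> set (P_tableau u)" "rword (P_tableau u) \<simeq> u"
    "first_row (P_tableau u) = row_of u" "rword (tl (P_tableau u)) \<simeq> bmp u"
proof -
  obtain T where T: "ctab T" "[] \<notin> set T" "rword T \<simeq> u" using ctab_exists[OF assms] by blast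
  have P: "P_tableau u = T" by (rule P_tableau_eqI[OF assms T])
  with T show "ctab (P_tableau u)" "[] \<notin> set (P_tableau u)" "rword (P_tableau u) \<simeq> u" by auto
  have d: "distinct (rword T)" using assms pl_distinct[OF T(3)] by blast
  show "first_row (P_tableau u) = row_of u" "rword (tl (P_tableau u)) \<simeq> bmp u"
    using ctab_row_bmp[OF T(1) d] pl_row_bmp[OF T(3) d] by (cases T; simp add: P)+
qed

lemma P_tableau_pl:
  assumes "distinct u" "u \<simeq> v"
  shows "P_tableau u = P_tableau v"
proof -
  have "distinct v" using assms pl_distinct by blast
  from P_tableau(1-3)[OF this] show ?thesis
    using assms by (intro P_tableau_eqI) (auto intro: pl_trans pl_sym)
qed

lemma ins_map:
  assumes "strict_mono f"
  shows "ins (f a) (map f x) = (map f (fst (ins a x)), map f (snd (ins a x)))"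
  by (induction x) (auto simp: strict_mono_less[OF assms])

lemma rb_map:
  assumes "strict_mono f"
  shows "rb (map f x) (map f w) = (map f (fst (rb x w)), map f (snd (rb x w)))"
  by (induction w arbitrary: x) (auto simp: ins_map[OF assms])

lemma row_bmp_map:
  assumes "strict_mono f"
  shows "row_of (map f w) = map f (row_of w)" "bmp (map f w) = map f (bmp w)"
  using rb_map[OF assms, of "[]" w] by (auto simp: row_of_def bmp_def)

lemma strict_mono_int: "strict_mono int"
  by (simp add: strict_mono_def)

section \<open>Catabolism type\<close>

text \<open>Since all decompositions agree by \<open>rot_closed_catable\<close>, the one given by
  the tableau decides, and a step of \<open>catable\<close> becomes a deterministic test on the
  first row.\<close>

lemma catable_row_bmp:
  assumes mu: "sorted_wrt (\<ge>) (length b # mu)" and w: "distinct (w :: int list)"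
    and b: "inc b" "set b \<subseteq> set w" "\<forall>a\<in>set w. a \<in> set b \<or> (\<forall>k\<in>set b. k < a)"
  shows "catable (length b # mu) w \<longleftrightarrow>
    set b \<subseteq> set (row_of w) \<and> catable mu (drop (length b) (row_of w) @ bmp w)"
proof -
  have *: "catable (length b # mu) w \<longleftrightarrow> catable mu (drop (length b) (row_of w) @ bmp w)"
    if row: "row_of w = b @ drop (length b) (row_of w)"
  proof -
    let ?s = "drop (length b) (row_of w)"
    have pl: "w \<simeq> bmp w @ b @ ?s" using pl_bmp_row[OF w] row by simp
    have dd: "distinct (bmp w @ b @ ?s)" using pl_distinct[OF pl] w by simp
    have "catable (length b # mu) w = catable (length b # mu) (bmp w @ b @ ?s)"
      by (rule catable_pl[OF pl])
    also have "\<dots> = catable mu (?s @ bmp w)"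
    proof (rule catable_block)
      show "rot_closed (length b) (catable mu :: int list \<Rightarrow> bool)"
        using mu by (intro rot_closed_catable) auto
      show "inc (b @ ?s)" using inc_row_of[OF w] row by simp
      show "\<forall>k\<in>set b. \<forall>a\<in>set (bmp w). k < a"
        using b(3) dd set_bmp_row[of w] by auto
      show "distinct (?s @ bmp w)" using dd by auto
    qed simp
    finally show ?thesis .
  qed
  show ?thesis
  proof
    assume c: "catable (length b # mu) w"
    then have "filter (below b) w = b" by (rule catable_filter_below[OF _ b])
    then have r: "row_of w = b @ drop (length b) (row_of w)" by (rule row_of_block(1)[OF w _ b(1)])
    then have "set b \<subseteq> set (row_of w)" by (metis Un_upper1 set_append)
    with * c r show "set b \<subseteq> set (row_of w) \<and> catable mu (drop (length b) (row_of w) @ bmp w)" by simp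
  next
    assume c: "set b \<subseteq> set (row_of w) \<and> catable mu (drop (length b) (row_of w) @ bmp w)"
    have i: "inc (row_of w)" by (rule inc_row_of[OF w])
    have "set (filter (below b) (row_of w)) = set b"
      using c b(3) set_bmp_row[of w] by (force simp: below_def)
    then have "filter (below b) (row_of w) = b"
      using inc_set_eq i b(1) by (metis sorted_wrt_filter)
    then have "row_of w = b @ drop (length b) (row_of w)"
      using inc_split_down[OF i down_below, of b] by (metis append_eq_conv_conj)
    with * c show "catable (length b # mu) w" by simp
  qed
qed

text \<open>\<open>Cat\<close> keeps all letters, while \<open>catable\<close> deletes the blocks it
  has used. The deleted letters 1, ..., p are restored as a prefix; they stay at the start of the
  first row and do not interfere with the rest.\<close>

lemma P_tableau_prefix:
  assumes "distinct w" "set w \<subseteq> {p<..}"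
  shows "first_row (P_tableau ([1..<Suc p] @ w)) = [1..<Suc p] @ row_of w"
    "Cat (P_tableau ([1..<Suc p] @ w)) = P_tableau ([1..<Suc p] @ row_of w @ bmp w)"
proof -
  let ?u = "[1..<Suc p] @ w"
  have d: "distinct ?u" using assms by auto
  have ip: "inc [1..<Suc p]" by (simp add: strict_sorted_iff del: upt_Suc)
  have rb: "rb [] ?u = ([1..<Suc p] @ row_of w, bmp w)"
    using rb_prefix[of w "[1..<Suc p]" "[]"] rb_Nil_inc[OF ip] assms(2)
    by (simp add: rb_append row_of_def bmp_def del: upt_Suc) fastforce
  then have r: "row_of ?u = [1..<Suc p] @ row_of w" "bmp ?u = bmp w"
    unfolding row_of_def[of ?u] bmp_def[of ?u] by simp_all
  then show f: "first_row (P_tableau ?u) = [1..<Suc p] @ row_of w"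
    using P_tableau(4)[OF d] by simp
  have pl: "first_row (P_tableau ?u) @ reading_word (tl (P_tableau ?u)) \<simeq> row_of ?u @ bmp ?u"
    unfolding reading_word_eq P_tableau(4)[OF d] using pl_append_left[OF P_tableau(5)[OF d]] .
  have "distinct (row_of ?u @ bmp ?u)" using distinct_bmp_row[OF d] by auto
  with pl_distinct[OF pl] have "distinct (first_row (P_tableau ?u) @ reading_word (tl (P_tableau ?u)))" by simp
  from P_tableau_pl[OF this pl] show "Cat (P_tableau ?u) = P_tableau ([1..<Suc p] @ row_of w @ bmp w)"
    unfolding Cat_def r by simp
qed

text \<open>Induction along \<open>mu\<close>, with p counting the letters already removed. The
  condition for k = 0 says that the next block lies in the first row; the other conditions are those
  for the tableau after one catabolism.\<close>

lemma catable_iff_Cat: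
  assumes "sorted_wrt (\<ge>) mu" "distinct w" "set w = {p<..p + sum_list mu}"
  shows "catable mu (map int w) \<longleftrightarrow> (\<forall>k<length mu. {1..p + sum_list (take (Suc k) mu)} \<subseteq>
    set (first_row ((Cat ^^ k) (P_tableau ([1..<Suc p] @ w)))))"
  using assms
proof (induction mu arbitrary: p w)
  case Nil
  then show ?case by simp
next
  case (Cons m mu)
  let ?S = "P_tableau ([1..<Suc p] @ w)"
  define b where "b = map int [Suc p..<Suc (p + m)]"
  have lb: "length b = m" by (simp add: b_def)
  have setb: "set b = int ` {p<..p + m}" unfolding b_def set_map set_upt by auto
  have sw: "set w \<subseteq> {p<..}" using Cons.prems by auto
  note P = P_tableau_prefix[OF Cons.prems(2) sw]
  have rw: "set (row_of w) \<subseteq> set w" using set_bmp_row[of w] by auto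
  have iff: "catable (length b # mu) (map int w) \<longleftrightarrow> set b \<subseteq> set (row_of (map int w)) \<and>
      catable mu (drop (length b) (row_of (map int w)) @ bmp (map int w))"
  proof (rule catable_row_bmp)
    show "inc b" unfolding b_def by (simp add: sorted_wrt_map del: upt_Suc)
    show "set b \<subseteq> set (map int w)" using Cons.prems(3) by (auto simp: setb)
    show "\<forall>a\<in>set (map int w). a \<in> set b \<or> (\<forall>k\<in>set b. k < a)" using Cons.prems(3) by (auto simp: setb)
  qed (use Cons.prems lb in \<open>auto simp: distinct_map\<close>)
  have sub: "set b \<subseteq> set (row_of (map int w)) \<longleftrightarrow> {p<..p + m} \<subseteq> set (row_of w)"
    unfolding row_bmp_map[OF strict_mono_int] setb set_map by (simp add: inj_image_subset_iff)
  have zero: "{1..p + m} \<subseteq> set (first_row ?S) \<longleftrightarrow> {p<..p + m} \<subseteq> set (row_of w)"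
  proof -
    have "set (first_row ?S) = {1..p} \<union> set (row_of w)" unfolding P(1) by auto
    moreover have "{1..p + m} = {1..p} \<union> {p<..p + m}" "{1..p} \<inter> {p<..p + m} = {}" by auto
    ultimately show ?thesis by blast
  qed
  show ?case
  proof (cases "{p<..p + m} \<subseteq> set (row_of w)")
    case False
    then have "\<not> {1..p + sum_list (take (Suc 0) (m # mu))} \<subseteq> set (first_row ((Cat ^^ 0) ?S))"
      using zero by simp
    then have "\<not> (\<forall>k<length (m # mu). {1..p + sum_list (take (Suc k) (m # mu))} \<subseteq>
        set (first_row ((Cat ^^ k) ?S)))" by (metis length_greater_0_conv list.distinct(1))
    moreover have "\<not> catable (m # mu) (map int w)" using iff lb sub False by simp
    ultimately show ?thesis by blast
  next
    case True
    define w' where "w' = drop m (row_of w) @ bmp w"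
    have i: "inc (row_of w)" by (rule inc_row_of[OF Cons.prems(2)])
    have row: "row_of w = [Suc p..<Suc (p + m)] @ drop m (row_of w)"
    proof -
      have "set (filter (\<lambda>a. a \<le> p + m) (row_of w)) = set [Suc p..<Suc (p + m)]"
        using True rw sw by (auto simp del: upt_Suc)
      then have f: "filter (\<lambda>a. a \<le> p + m) (row_of w) = [Suc p..<Suc (p + m)]"
        using i by (intro inc_set_eq) (auto intro: sorted_wrt_filter simp del: upt_Suc)
      have "down (\<lambda>a. a \<le> p + m)" by (auto simp: down_def)
      from inc_split_down[OF i this] f
      have "row_of w = [Suc p..<Suc (p + m)] @ filter (\<lambda>a. \<not> a \<le> p + m) (row_of w)" by simp
      moreover have "length [Suc p..<Suc (p + m)] = m" by simp
      ultimately show ?thesis by (metis append_eq_conv_conj)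
    qed
    have ms: "mset (row_of w @ bmp w) = mset w" using mset_bmp_row[of w] by (simp add: ac_simps)
    have dw: "distinct (row_of w @ bmp w)" using distinct_bmp_row[OF Cons.prems(2)] by auto
    have eqw: "row_of w @ bmp w = [Suc p..<Suc (p + m)] @ w'" unfolding w'_def using row by (metis append.assoc)
    have sw': "set w' = {p + m<..p + m + sum_list mu}" and dw': "distinct w'"
    proof -
      show "distinct w'" using dw unfolding eqw by simp
      have "set ([Suc p..<Suc (p + m)] @ w') = set w" using ms unfolding eqw by (metis set_mset_mset)
      moreover have "set [Suc p..<Suc (p + m)] \<inter> set w' = {}" using dw unfolding eqw by auto
      moreover have "set [Suc p..<Suc (p + m)] = {p<..p+m}" by auto
      ultimately have "set w' = set w - {p<..p+m}" by auto
      then show "set w' = {p + m<..p + m + sum_list mu}" using Cons.prems(3) by auto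
    qed
    have up: "[1..<Suc p] @ [Suc p..<Suc (p + m)] = [1..<Suc (p + m)]"
      using upt_add_eq_append[of 1 "Suc p" m] by (simp del: upt_Suc)
    have Cat: "Cat ?S = P_tableau ([1..<Suc (p + m)] @ w')"
      unfolding P(2) eqw using up by (metis append.assoc)
    have IH: "catable mu (map int w') \<longleftrightarrow> (\<forall>k<length mu. {1..(p + m) + sum_list (take (Suc k) mu)} \<subseteq>
        set (first_row ((Cat ^^ k) (Cat ?S))))"
      unfolding Cat using Cons.prems(1) dw' sw' by (intro Cons.IH) auto
    have "catable (m # mu) (map int w) \<longleftrightarrow> catable mu (map int w')"
      using iff sub True by (simp add: row_bmp_map[OF strict_mono_int] w'_def drop_map lb)
    also have "\<dots> \<longleftrightarrow> (\<forall>k<length mu. {1..p + sum_list (take (Suc (Suc k)) (m # mu))} \<subseteq>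
        set (first_row ((Cat ^^ Suc k) ?S)))"
      unfolding IH by (simp add: funpow_swap1 add.assoc)
    also have "\<dots> \<longleftrightarrow> (\<forall>k<length (m # mu). {1..p + sum_list (take (Suc k) (m # mu))} \<subseteq>
        set (first_row ((Cat ^^ k) ?S)))"
    proof -
      have *: "(\<forall>k<length mu. Q (Suc k)) \<longleftrightarrow> (\<forall>k<length (m # mu). Q k)" if "Q 0" for Q
        using that by (auto simp: less_Suc_eq_0_disj)
      show ?thesis
        by (rule *[of "\<lambda>k. {1..p + sum_list (take (Suc k) (m # mu))} \<subseteq> set (first_row ((Cat ^^ k) ?S))"])
          (use zero True in simp)
    qed
    finally show ?thesis .
  qed
qed

lemma Cat_standard_word:
  assumes "ctab S" "[] \<notin> set S" "distinct (rword S)"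
  shows "S = P_tableau (rword S)" "ctab (Cat S)" "[] \<notin> set (Cat S)" "distinct (rword (Cat S))"
    "set (rword (Cat S)) = set (rword S)"
    "{1..i} \<subseteq> set (first_row S) \<Longrightarrow> set (rword S) \<subseteq> {1..} \<Longrightarrow> {1..i} \<subseteq> set (first_row (Cat S))"
proof -
  show S: "S = P_tableau (rword S)" using P_tableau_eqI[OF assms(3,1,2)] by simp
  let ?v = "first_row S @ reading_word (tl S)"
  have eq: "?v = first_row S @ rword (tl S)" "rword S = rword (tl S) @ first_row S"
    by (cases S; simp add: reading_word_eq)+
  then have d: "distinct ?v" and s: "set ?v = set (rword S)" using assms(3) by auto
  note P = P_tableau[OF d]
  show "ctab (Cat S)" "[] \<notin> set (Cat S)" "distinct (rword (Cat S))" "set (rword (Cat S)) = set (rword S)"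
    unfolding Cat_def using P pl_distinct[OF P(3)] pl_set[OF P(3)] d s by auto
  assume i: "{1..i} \<subseteq> set (first_row S)" and p: "set (rword S) \<subseteq> {1..}"
  have incS: "inc (first_row S)" using assms(1) ctab_Cons by (cases S) auto
  have dn: "down (\<lambda>a. a \<le> i)" by (auto simp: down_def)
  have notin: "a \<notin> set (rword (tl S))" if "a \<le> i" "1 \<le> a" for a
    using that i assms(3) eq(2) by (auto simp: subset_iff)
  have "filter (\<lambda>a. a \<le> i) (rword (tl S)) = []"
    using notin p eq(2) by (fastforce simp: filter_empty_conv)
  then have "inc (filter (\<lambda>a. a \<le> i) ?v)" unfolding eq(1) using incS by (simp add: sorted_wrt_filter)
  from filter_row_inc(2)[OF dn d this]
  have "filter (\<lambda>a. a \<le> i) (row_of ?v) = filter (\<lambda>a. a \<le> i) ?v" .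
  moreover have "{1..i} \<subseteq> set (filter (\<lambda>a. a \<le> i) ?v)" using i by auto
  ultimately have "{1..i} \<subseteq> set (row_of ?v)" by (metis filter_is_subset subset_trans)
  then show "{1..i} \<subseteq> set (first_row (Cat S))" unfolding Cat_def using P(4) by simp
qed

lemma d1_iff:
  assumes "distinct (rword S)"
  shows "i \<le> d1 S \<longleftrightarrow> {1..i} \<subseteq> set (first_row S)"
proof -
  let ?P = "\<lambda>i. {1..i} \<subseteq> set (first_row S)"
  have bd: "j \<le> length (first_row S)" if "?P j" for j
    using card_mono[OF _ that] card_length[of "first_row S"] by simp
  have "?P (d1 S)" unfolding d1_def by (rule GreatestI_nat[of ?P 0 "length (first_row S)"]) (use bd in auto)
  moreover have "i \<le> d1 S" if "?P i" unfolding d1_def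
    by (rule Greatest_le_nat[of ?P i "length (first_row S)"]) (use bd that in auto)
  moreover have "?P i" if "?P j" "i \<le> j" for i j using that by auto
  ultimately show ?thesis by blast
qed

text \<open>The partial sums of the catabolism type telescope to \<open>d1\<close> of the iterates,
  so dominance is a list of lower bounds on \<open>d1\<close>. The bounds beyond the last part of
  \<open>mu\<close> follow from the one at the last part, because \<open>d1\<close> does not
  decrease.\<close>

theorem dominates_cattype_iff:
  assumes S: "standard S" and mu: "mu \<in> partitions (length (reading_word S))"
  shows "dominates (cattype S) (nth_default 0 mu) \<longleftrightarrow> catable mu (map int (reading_word S))"
proof -
  define n where "n = length (reading_word S)"
  have d: "distinct (rword S)" and st: "set (rword S) = {1..n}" and sum: "sum_list mu = n"
    and srt: "sorted_wrt (\<ge>) mu"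
    using S mu by (auto simp: standard_def partitions_def is_partition_def reading_word_eq n_def)
  have cs: "ctab S" "[] \<notin> set S" using S column_strict_ctab[OF d] by (auto simp: standard_def)
  have inv: "ctab ((Cat ^^ k) S) \<and> [] \<notin> set ((Cat ^^ k) S) \<and> distinct (rword ((Cat ^^ k) S)) \<and>
      set (rword ((Cat ^^ k) S)) = {1..n}" for k
  proof (induction k)
    case (Suc k)
    then show ?case using Cat_standard_word(2-5)[of "(Cat ^^ k) S"] by simp
  qed (use cs d st in simp)
  have iff: "i \<le> d1 ((Cat ^^ k) S) \<longleftrightarrow> {1..i} \<subseteq> set (first_row ((Cat ^^ k) S))" for i k
    using d1_iff inv by blast
  have mono: "d1 ((Cat ^^ k) S) \<le> d1 ((Cat ^^ Suc k) S)" for k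
    unfolding iff using Cat_standard_word(6)[of "(Cat ^^ k) S"] inv[of k] iff[of "d1 ((Cat ^^ k) S)" k] by auto
  have sumcat: "(\<Sum>i<Suc k. cattype S i) = d1 ((Cat ^^ k) S)" for k
  proof (induction k)
    case (Suc k)
    then have "(\<Sum>i<Suc (Suc k). cattype S i) = d1 ((Cat ^^ k) S) + cattype S (Suc k)" by simp
    then show ?case using mono[of k] by (simp add: cattype_def)
  qed (simp add: cattype_def)
  have summu: "(\<Sum>i<k. nth_default 0 mu i) = sum_list (take k mu)" for k
  proof (induction k)
    case (Suc k)
    then show ?case by (cases "k < length mu") (simp_all add: nth_default_def take_Suc_conv_app_nth)
  qed simp
  have "dominates (cattype S) (nth_default 0 mu) \<longleftrightarrow>
      (\<forall>k. sum_list (take (Suc k) mu) \<le> d1 ((Cat ^^ k) S))"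
    unfolding dominates_def sumcat[symmetric] summu[symmetric]
  proof (intro iffI allI)
    fix k assume *: "\<forall>k. (\<Sum>i<Suc k. nth_default 0 mu i) \<le> (\<Sum>i<Suc k. cattype S i)"
    show "(\<Sum>i<k. nth_default 0 mu i) \<le> (\<Sum>i<k. cattype S i)"
      using *[rule_format, of "k - 1"] by (cases k) auto
  qed blast
  also have "\<dots> \<longleftrightarrow> (\<forall>k<length mu. sum_list (take (Suc k) mu) \<le> d1 ((Cat ^^ k) S))"
  proof (intro iffI allI impI)
    fix k assume h: "\<forall>k<length mu. sum_list (take (Suc k) mu) \<le> d1 ((Cat ^^ k) S)"
    show "sum_list (take (Suc k) mu) \<le> d1 ((Cat ^^ k) S)"
    proof (cases "k < length mu")
      case False
      show ?thesis
      proof (cases mu rule: rev_cases)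
        case (snoc nu x)
        have "sum_list (take (Suc (length nu)) mu) \<le> d1 ((Cat ^^ length nu) S)"
          using h[rule_format, of "length nu"] snoc by simp
        also have "\<dots> \<le> d1 ((Cat ^^ k) S)"
          using lift_Suc_mono_le[of "\<lambda>k. d1 ((Cat ^^ k) S)"] mono False snoc by simp
        finally show ?thesis using False snoc by simp
      qed simp
    qed (use h in simp)
  qed auto
  also have "\<dots> \<longleftrightarrow> catable mu (map int (rword S))"
  proof -
    have "set (rword S) = {0<..0 + sum_list mu}"
      unfolding st sum by (simp add: atLeastSucAtMost_greaterThanAtMost)
    from catable_iff_Cat[OF srt d this]
    have "catable mu (map int (rword S)) \<longleftrightarrow> (\<forall>k<length mu. {1..sum_list (take (Suc k) mu)} \<subseteq>
        set (first_row ((Cat ^^ k) (P_tableau (rword S)))))" by simp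
    then show ?thesis unfolding iff Cat_standard_word(1)[OF cs d, symmetric] by simp
  qed
  finally show ?thesis by (simp add: reading_word_eq)
qed

section \<open>Exchanging the lengths of two rows\<close>

lemma first_violation:
  "\<not> nrm x y \<Longrightarrow> \<exists>p v x1 y0 y1. x = p @ v # x1 \<and> y = y0 @ y1 \<and> length p = length y0 \<and> nrm p y0 \<and>
    (y1 = [] \<or> v \<le> hd y1)"
proof (induction x y rule: nrm.induct)
  case (2 v vs)
  then show ?case by (intro exI[of _ "[]"]) auto
next
  case (3 v vs a y)
  show ?case
  proof (cases "a < v")
    case True
    then have "\<not> nrm vs y" using 3 by simp
    from "3.IH"[OF this] obtain p w x1 y0 y1 where "vs = p @ w # x1 \<and> y = y0 @ y1 \<and>
      length p = length y0 \<and> nrm p y0 \<and> (y1 = [] \<or> w \<le> hd y1)" by blast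
    with True have "v # vs = (v # p) @ w # x1 \<and> a # y = (a # y0) @ y1 \<and> length (v # p) = length (a # y0) \<and>
      nrm (v # p) (a # y0) \<and> (y1 = [] \<or> w \<le> hd y1)" by simp
    then show ?thesis by blast
  next
    case False
    then have "v # vs = [] @ v # vs \<and> a # y = [] @ (a # y) \<and> length [] = length [] \<and> nrm [] [] \<and>
      (a # y = [] \<or> v \<le> hd (a # y))" by auto
    then show ?thesis by blast
  qed
qed auto

text \<open>As \<open>p\<close> and \<open>y0\<close> are equally long, inserting \<open>y0\<close>
  into the row \<open>p @ W\<close> bumps exactly \<open>p\<close>: the rectangle slides past the
  tail of its lower row.\<close>

lemma rect_comm:
  assumes "nrm p y0" "length p = length y0" "inc (p @ W)" "inc y0" "distinct (p @ W @ y0)"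
  shows "p @ W @ y0 \<simeq> p @ y0 @ W"
proof -
  have "rb (p @ W) y0 = (y0 @ W, p)"
    using assms by (intro rb_nrm_gen) (auto simp: sorted_wrt_append)
  with pl_rb[OF assms(3), of y0] assms(5) show ?thesis by simp
qed

lemma nrm_less:
  "nrm p y \<Longrightarrow> length p = length y \<Longrightarrow> inc p \<Longrightarrow> \<forall>a\<in>set p. a < v \<Longrightarrow> \<forall>b\<in>set y. b < v"
  by (induction p y rule: nrm.induct) (auto dest: less_trans)

text \<open>With the rectangle moved aside the word becomes \<open>p @ y0 @ [v] @ x1 @ y1\<close>.
  There the two tails are adjacent and may be replaced by an equivalent pair.\<close>

lemma suffix_exchange:
  assumes x: "inc (p @ v # x1)" and y: "inc (y0 @ y1)" and n: "nrm p y0" "length p = length y0"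
    and v: "\<forall>b\<in>set y1. v < b" and d: "distinct ((p @ v # x1) @ y0 @ y1)"
    and pl: "x1 @ y1 \<simeq> x1' @ y1'" and i: "inc x1'" "inc y1'"
  shows "(p @ v # x1) @ y0 @ y1 \<simeq> (p @ v # x1') @ y0 @ y1'"
    "inc (p @ v # x1')" "inc (y0 @ y1')"
proof -
  have s: "set (x1' @ y1') = set (x1 @ y1)" "distinct (x1' @ y1') = distinct (x1 @ y1)"
    using pl_set[OF pl] pl_distinct[OF pl] by auto
  have gt: "\<forall>b\<in>set (x1' @ y1'). v < b" unfolding s using x v by (auto simp: sorted_wrt_append)
  have pv: "\<forall>a\<in>set p. a < v" "inc p" using x by (auto simp: sorted_wrt_append)
  then have yv: "\<forall>b\<in>set y0. b < v" using nrm_less[OF n pv(2)] by simp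
  show ix: "inc (p @ v # x1')" using pv gt i by (auto simp: sorted_wrt_append dest: less_trans)
  show "inc (y0 @ y1')" using yv gt i y by (auto simp: sorted_wrt_append dest: less_trans)
  have iy: "inc y0" using y by (simp add: sorted_wrt_append)
  have d': "distinct ((p @ v # x1') @ y0)"
  proof -
    have "set x1' \<inter> set y0 = {}" using gt yv by (fastforce dest: less_trans)
    then show ?thesis using pv yv d inc_distinct[OF ix] by auto
  qed
  have "((p @ (v # x1)) @ y0) @ y1 \<simeq> ((p @ y0) @ (v # x1)) @ y1"
    using rect_comm[OF n x iy] d pl_append_right by fastforce
  also have "((p @ y0) @ (v # x1)) @ y1 = (p @ y0 @ [v]) @ (x1 @ y1)" by simp
  also have "\<dots> \<simeq> (p @ y0 @ [v]) @ (x1' @ y1')" by (rule pl_append_left[OF pl])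
  also have "\<dots> = ((p @ y0) @ (v # x1')) @ y1'" by simp
  also have "\<dots> \<simeq> ((p @ (v # x1')) @ y0) @ y1'"
    using rect_comm[OF n ix iy] d' pl_append_right pl_sym by fastforce
  finally show "(p @ v # x1) @ y0 @ y1 \<simeq> (p @ v # x1') @ y0 @ y1'" by simp
qed

text \<open>At the first violated column the entry v of the lower row is smaller than all that
  remains of the upper row. If the tails beyond v violate the column condition too, recursion
  changes them; otherwise v itself moves to the upper row.\<close>

lemma up_move:
  assumes "inc x" "inc y" "distinct (x @ y)" "\<not> nrm x y"
  shows "\<exists>x' y'. inc x' \<and> inc y' \<and> x @ y \<simeq> x' @ y' \<and> length y' = Suc (length y)"
  using assms
proof (induction "length x" arbitrary: x y rule: less_induct)
  case less
  from first_violation[OF less.prems(4)] obtain p v x1 y0 y1 where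
    xy: "x = p @ v # x1" "y = y0 @ y1" and n: "nrm p y0" "length p = length y0" and v: "y1 = [] \<or> v \<le> hd y1"
    by blast
  have vy: "\<forall>b\<in>set y1. v < b"
    using v less.prems xy by (cases y1) (auto simp: sorted_wrt_append)
  have i: "inc (p @ v # x1)" "inc (y0 @ y1)" "distinct ((p @ v # x1) @ y0 @ y1)"
    using less.prems xy by auto
  show ?case
  proof (cases "nrm x1 y1")
    case False
    have "\<exists>x' y'. inc x' \<and> inc y' \<and> x1 @ y1 \<simeq> x' @ y' \<and> length y' = Suc (length y1)"
      by (rule less.hyps) (use xy i False in \<open>auto simp: sorted_wrt_append\<close>)
    then obtain x1' y1' where e: "inc x1'" "inc y1'" "x1 @ y1 \<simeq> x1' @ y1'" "length y1' = Suc (length y1)"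
      by blast
    from suffix_exchange[OF i(1,2) n vy i(3) e(3,1,2)] e(4) xy show ?thesis
      by (intro exI[of _ "p @ v # x1'"] exI[of _ "y0 @ y1'"]) simp
  next
    case True
    have x1: "inc x1" "inc y1" "\<forall>a\<in>set x1. v < a" "inc p" "inc y0" "\<forall>a\<in>set p. a < v" "inc (p @ x1)"
      using i by (auto simp: sorted_wrt_append)
    have yv: "\<forall>b\<in>set y0. b < v" by (rule nrm_less[OF n x1(4,6)])
    have "row_of (v # x1 @ y1) = v # y1" "bmp (v # x1 @ y1) = x1"
      using row_bmp_Cons_min[of "x1 @ y1" v] row_bmp_two[OF True x1(2,1)] x1(3) vy by auto
    then have pv: "v # x1 @ y1 \<simeq> x1 @ v # y1"
      using pl_bmp_row[of "v # x1 @ y1"] i(3) by auto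
    have "((p @ (v # x1)) @ y0) @ y1 \<simeq> ((p @ y0) @ (v # x1)) @ y1"
      using rect_comm[OF n i(1) x1(5)] i(3) pl_append_right by fastforce
    also have "((p @ y0) @ (v # x1)) @ y1 = (p @ y0) @ (v # x1 @ y1)" by simp
    also have "\<dots> \<simeq> (p @ y0) @ (x1 @ v # y1)" by (rule pl_append_left[OF pv])
    also have "\<dots> = (p @ y0 @ x1) @ v # y1" by simp
    also have "\<dots> \<simeq> (p @ x1 @ y0) @ v # y1"
    proof -
      have "p @ x1 @ y0 \<simeq> p @ y0 @ x1" using rect_comm[OF n x1(7) x1(5)] i(3) by auto
      from pl_append_right[OF pl_sym[OF this]] show ?thesis by simp
    qed
    finally have "x @ y \<simeq> (p @ x1) @ (y0 @ v # y1)" using xy by simp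
    moreover have "inc (y0 @ v # y1)"
      using yv vy x1 i by (auto simp: sorted_wrt_append dest: less_trans)
    ultimately show ?thesis using x1 xy by (intro exI[of _ "p @ x1"] exI[of _ "y0 @ v # y1"]) simp
  qed
qed

lemma length_ins: "length (fst (ins a x)) + length (snd (ins a x)) = Suc (length x)"
  using mset_ins[of a x] by (metis add.commute length_append size_mset length_Cons)

lemma length_rb_ge: "length x \<le> length (fst (rb x w))"
proof (induction w arbitrary: x)
  case (Cons a w)
  have "length x \<le> length (fst (ins a x))" using length_ins[of a x] length_snd_ins[of a x] by linarith
  also have "\<dots> \<le> length (fst (rb (fst (ins a x)) w))" by (rule Cons)
  finally show ?case by simp
qed simp

lemma length_rb_max:
  assumes "z \<in> set (fst (rb x w))" "\<forall>a\<in>set w. a < z"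
  shows "length (fst (rb x w)) = length x \<and> z \<in> set x"
  using assms
proof (induction w arbitrary: x)
  case (Cons a w)
  then have IH: "length (fst (rb (fst (ins a x)) w)) = length (fst (ins a x))" "z \<in> set (fst (ins a x))"
    by auto
  then have z: "z \<in> set x" using set_ins_sub Cons.prems by fastforce
  have "snd (ins a x) \<noteq> []" if "z \<in> set x" for x :: "'a list"
    using that Cons.prems by (induction x) auto
  then have "length (snd (ins a x)) = 1" using z length_snd_ins[of a x]
    by (metis One_nat_def Suc_leI le_antisym length_greater_0_conv)
  then show ?case using IH z length_ins[of a x] by simp
qed auto

text \<open>Induction by deleting the largest letter z, which must lie in the same row on both
  sides. At the end of the upper row it makes the first row of the tableau longer than the lower
  row; in the lower row it can stay in the first row of the tableau only if the insertions never
  lengthen that row.\<close>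

lemma two_row_unique:
  assumes "inc x" "inc y" "inc x'" "inc y'" "distinct (x @ y)" "x @ y \<simeq> x' @ y'" "length x = length x'"
  shows "x = x' \<and> y = y'"
  using assms
proof (induction "length (x @ y)" arbitrary: x y x' y' rule: less_induct)
  case less
  have s: "set (x @ y) = set (x' @ y')" by (rule pl_set[OF less.prems(6)])
  have d': "distinct (x' @ y')" using pl_distinct[OF less.prems(6)] less.prems(5) by simp
  show ?case
  proof (cases "x @ y = []")
    case True
    then show ?thesis using s by auto
  next
    case False
    define z where "z = Max (set (x @ y))"
    have z: "z \<in> set (x @ y)" unfolding z_def by (rule Max_in) (use False in auto)
    have zm: "a \<le> z" if "a \<in> set (x @ y)" for a unfolding z_def using that by (intro Max_ge) auto
    let ?f = "filter (\<lambda>a. a < z)"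
    have f: "(z \<in> set l \<longrightarrow> l = ?f l @ [z]) \<and> (z \<notin> set l \<longrightarrow> ?f l = l)" if "inc l" "set l \<subseteq> set (x @ y)" for l
    proof -
      have e: "\<not> a < z \<longleftrightarrow> a = z" if "a \<in> set l" for a
        using zm[of a] that \<open>set l \<subseteq> set (x @ y)\<close> by auto
      have "filter (\<lambda>a. \<not> a < z) l = (if z \<in> set l then [z] else [])"
      proof (rule inc_set_eq)
        show "inc (filter (\<lambda>a. \<not> a < z) l)" by (rule sorted_wrt_filter[OF that(1)])
        show "set (filter (\<lambda>a. \<not> a < z) l) = set (if z \<in> set l then [z] else [])"
          using e by auto
      qed simp
      moreover have "?f l @ filter (\<lambda>a. \<not> a < z) l = l"
        by (rule inc_split_down[OF that(1)]) (auto simp: down_def dest: less_trans)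
      ultimately show ?thesis by (metis append_Nil2)
    qed
    note fx = f[OF less.prems(1)] and fy = f[OF less.prems(2)] and fx' = f[OF less.prems(3)] and fy' = f[OF less.prems(4)]
    have subs: "set x \<subseteq> set (x @ y)" "set y \<subseteq> set (x @ y)" "set x' \<subseteq> set (x @ y)" "set y' \<subseteq> set (x @ y)"
      unfolding s by auto (use s in auto)
    have pf: "?f x @ ?f y \<simeq> ?f x' @ ?f y'"
      using pl_filter_down[OF _ less.prems(6), of "\<lambda>a. a < z"] by (auto simp: down_def dest: less_trans)
    have len: "length (?f x @ ?f y) < length (x @ y)"
      using z by (metis filter_append length_filter_less order_less_irrefl)
    have IH: "length (?f x) = length (?f x') \<Longrightarrow> ?f x = ?f x' \<and> ?f y = ?f y'"
      using less.hyps[OF len _ _ _ _ _ pf] less.prems by (auto intro: sorted_wrt_filter)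
    have contra: False
      if "x = x0 @ [z]" "y' = y0 @ [z]" "inc x" "inc x'" "distinct (x @ y)" "distinct (x' @ y')"
        "x @ y \<simeq> x' @ y'" "length x = length x'" "\<forall>a\<in>set (x @ y). a \<le> z" for x y x' y' x0 y0
    proof -
      have "\<forall>a\<in>set (x' @ y0). a < z"
        using that(2,6,9) pl_set[OF that(7)] by (auto simp: order_le_less)
      moreover have "set (row_of (x' @ y0)) \<subseteq> set (x' @ y0)" using set_bmp_row[of "x' @ y0"] by auto
      ultimately have "\<forall>b\<in>set (row_of (x' @ y0)). b < z" by blast
      from ins_append_end[OF this] have "row_of (x' @ y') = row_of (x' @ y0) @ [z]"
        unfolding that(2) using row_of_snoc[of "x' @ y0" z] by simp
      then have 1: "z \<in> set (row_of (x' @ y'))" "length (row_of (x' @ y')) > length x'"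
        using length_rb_ge[of "row_of x'" y0] that(4) by (auto simp: row_bmp_append)
      have eq: "row_of (x @ y) = row_of (x' @ y')" by (rule pl_row[OF that(7,5)])
      have "\<forall>a\<in>set y. a < z" using that(1,5,9) by (auto simp: order_le_less)
      then have "length (row_of (x @ y)) = length x"
        using length_rb_max[of z x y] 1(1) eq that(3) by (simp add: row_bmp_append)
      with 1(2) eq that(8) show False by simp
    qed
    have ix: "z \<in> set x \<longleftrightarrow> z \<in> set x'"
    proof (rule ccontr)
      assume "(z \<in> set x) \<noteq> (z \<in> set x')"
      then consider "z \<in> set x" "z \<in> set y'" | "z \<in> set x'" "z \<in> set y"
        using z s by auto
      then show False
      proof cases
        case 1
        show False by (rule contra[of x "?f x" y' "?f y'" x' y]) (use 1 fx fy' subs less.prems d' zm in auto)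
      next
        case 2
        show False by (rule contra[of x' "?f x'" y "?f y" x y'])
          (use 2 fx' fy subs less.prems d' zm s in \<open>auto intro: pl_sym\<close>)
      qed
    qed
    show ?thesis
    proof (cases "z \<in> set x")
      case True
      then have "z \<notin> set y" "z \<notin> set y'" using ix less.prems(5) d' by auto
      with True ix fx fy fx' fy' subs have e: "x = ?f x @ [z]" "x' = ?f x' @ [z]" "?f y = y" "?f y' = y'" by auto
      then have "length (?f x) = length (?f x')" using less.prems(7) by (metis length_append_singleton nat.inject)
      with IH e show ?thesis by metis
    next
      case False
      then have "z \<in> set y" "z \<in> set y'" "z \<notin> set x'" using ix z s by auto
      with False fx fy fx' fy' subs have e: "y = ?f y @ [z]" "y' = ?f y' @ [z]" "?f x = x" "?f x' = x'" by auto
      then have "length (?f x) = length (?f x')" using less.prems(7) by simp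
      with IH e show ?thesis by metis
    qed
  qed
qed

section \<open>Exchange of cardinalities as an involution on pairs of disjoint sets\<close>

abbreviation sl :: "'a::linorder set \<Rightarrow> 'a list" where
  "sl \<equiv> sorted_list_of_set"

lemma inc_sl [simp]: "inc (sl A)"
  by simp

lemma inc_eq_sl: "inc x \<Longrightarrow> x = sl (set x)"
  by (intro inc_set_eq) auto

lemma up_moves:
  assumes "inc x" "inc y" "distinct (x @ y)" "length y + k \<le> length x"
  shows "\<exists>x' y'. inc x' \<and> inc y' \<and> x @ y \<simeq> x' @ y' \<and> length y' = length y + k"
  using assms(4)
proof (induction k)
  case 0
  then show ?case using assms by auto
next
  case (Suc k)
  then obtain x' y' where e: "inc x'" "inc y'" "x @ y \<simeq> x' @ y'" "length y' = length y + k" by auto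
  have d: "distinct (x' @ y')" using pl_distinct[OF e(3)] assms(3) by simp
  \<comment> \<open>A normal pair would have \<open>y'\<close> as first row of its tableau, but that
    row is at least as long as \<open>x\<close>, and \<open>y'\<close> is still shorter.\<close>
  have "\<not> nrm x' y'"
  proof
    assume "nrm x' y'"
    then have "row_of (x @ y) = y'" using row_bmp_two(1) e pl_row[OF e(3) assms(3)] by metis
    moreover have "length x \<le> length (row_of (x @ y))"
      using length_rb_ge[of x y] assms(1) by (simp add: row_bmp_append)
    ultimately show False using e(4) Suc.prems by simp
  qed
  from up_move[OF e(1,2) d this] e show ?case by (auto intro: pl_trans)
qed

definition is_exchange :: "'a::linorder set \<Rightarrow> 'a set \<Rightarrow> 'a set \<Rightarrow> bool" where
  "is_exchange X Y X' \<longleftrightarrow> X' \<subseteq> X \<union> Y \<and> card X' = card Y \<and> sl X @ sl Y \<simeq> sl X' @ sl (X \<union> Y - X')"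

lemma two_row_unique_sets:
  assumes "finite X" "finite Y" "X \<inter> Y = {}" "finite X'" "finite Y'" "sl X @ sl Y \<simeq> sl X' @ sl Y'" "card X = card X'"
  shows "X = X'" "Y = Y'"
proof -
  have "distinct (sl X @ sl Y)" using assms by simp
  from two_row_unique[OF _ _ _ _ this assms(6)] assms(7)
  have "sl X = sl X'" "sl Y = sl Y'" by simp_all
  then show "X = X'" "Y = Y'" using assms by (metis sorted_list_of_set.set_sorted_key_list_of_set)+
qed

lemma exchange_exists_ge:
  assumes "finite X" "finite Y" "X \<inter> Y = {}" "card Y \<le> card X"
  shows "\<exists>X'. is_exchange X Y X'"
proof -
  have d: "distinct (sl X @ sl Y)" using assms by simp
  have "length (sl Y) + (card X - card Y) \<le> length (sl X)" using assms by simp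
  from up_moves[OF _ _ d this] obtain x' y' where
    e: "inc x'" "inc y'" "sl X @ sl Y \<simeq> x' @ y'" "length y' = card X" using assms by auto
  have s: "set x' \<union> set y' = X \<union> Y" using pl_set[OF e(3)] assms by simp
  have d': "distinct (x' @ y')" using pl_distinct[OF e(3)] d by simp
  have "length x' + length y' = card X + card Y" using pl_length[OF e(3)] by simp
  then have c: "card (set x') = card Y" using e(4) d' by (simp add: distinct_card)
  have "set y' = X \<union> Y - set x'" using s d' by auto
  with e inc_eq_sl[of x'] inc_eq_sl[of y'] c s show ?thesis
    unfolding is_exchange_def by (intro exI[of _ "set x'"]) auto
qed

text \<open>When the lower row is the shorter one, no downward move is constructed. By uniqueness
  the exchange from long to short lower rows is injective, and it maps between families of subsets
  of equal size because binomial coefficients are symmetric; hence it is onto.\<close>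

lemma exchange_exists:
  assumes "finite X" "finite Y" "X \<inter> Y = {}"
  shows "\<exists>X'. is_exchange X Y X'"
proof (cases "card Y \<le> card X")
  case True
  then show ?thesis using exchange_exists_ge assms by blast
next
  case False
  define Z where "Z = X \<union> Y"
  define D where "D = (\<lambda>k. {U. U \<subseteq> Z \<and> card U = k})"
  have finZ: "finite Z" using assms by (simp add: Z_def)
  have cz: "card Z = card X + card Y" unfolding Z_def using assms by (simp add: card_Un_disjoint)
  define f where "f = (\<lambda>U. SOME U'. is_exchange U (Z - U) U')"
  have ff: "is_exchange U (Z - U) (f U)" if "U \<in> D (card Y)" for U
  proof -
    have "finite U" "card (Z - U) = card X"
      using that finZ cz by (auto simp: D_def card_Diff_subset finite_subset)
    then have "\<exists>U'. is_exchange U (Z - U) U'"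
      using that False finZ by (intro exchange_exists_ge) (auto simp: D_def)
    then show ?thesis unfolding f_def by (rule someI_ex)
  qed
  have fD: "f ` D (card Y) \<subseteq> D (card X)"
  proof
    fix V assume "V \<in> f ` D (card Y)"
    then obtain U where U: "U \<in> D (card Y)" "V = f U" by blast
    have "card (Z - U) = card X" using U finZ cz by (auto simp: D_def card_Diff_subset finite_subset)
    then show "V \<in> D (card X)" using ff[OF U(1)] U by (auto simp: is_exchange_def D_def)
  qed
  have "inj_on f (D (card Y))"
  proof (rule inj_onI)
    fix U V assume UV: "U \<in> D (card Y)" "V \<in> D (card Y)" "f U = f V"
    have e: "U \<union> (Z - U) = Z" "V \<union> (Z - V) = Z" using UV by (auto simp: D_def)
    have "sl U @ sl (Z - U) \<simeq> sl V @ sl (Z - V)"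
      using ff[OF UV(1)] ff[OF UV(2)] UV(3) e pl_sym pl_trans unfolding is_exchange_def by metis
    then show "U = V"
      using UV finZ by (intro two_row_unique_sets(1)[of U "Z - U" V "Z - V"]) (auto simp: D_def finite_subset)
  qed
  moreover have "card (D (card Y)) = card (D (card X))"
    unfolding D_def using finZ cz by (simp add: n_subsets binomial_symmetric[of "card Y"])
  moreover have fin: "finite (D (card X))" unfolding D_def using finZ by simp
  ultimately have "f ` D (card Y) = D (card X)"
    using fD by (metis card_image card_subset_eq)
  moreover have "X \<in> D (card X)" by (simp add: D_def Z_def)
  ultimately have "X \<in> f ` D (card Y)" by simp
  then obtain U where U: "U \<in> D (card Y)" "f U = X" by (metis imageE)
  have e: "U \<union> (Z - U) = Z" "Z - X = Y" "X \<union> Y = Z" using U(1) assms(3) by (auto simp: D_def Z_def)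
  have "sl X @ sl Y \<simeq> sl U @ sl (Z - U)"
    using ff[OF U(1)] U(2) e pl_sym unfolding is_exchange_def by metis
  then show ?thesis using U(1) e unfolding is_exchange_def by (intro exI[of _ U]) (auto simp: D_def)
qed

definition exchange :: "'a::linorder set \<Rightarrow> 'a set \<Rightarrow> 'a set" where
  "exchange X Y = (SOME X'. is_exchange X Y X')"

lemma exchange:
  assumes "finite X" "finite Y" "X \<inter> Y = {}"
  shows "exchange X Y \<subseteq> X \<union> Y" "card (exchange X Y) = card Y" "card (X \<union> Y - exchange X Y) = card X"
    "sl X @ sl Y \<simeq> sl (exchange X Y) @ sl (X \<union> Y - exchange X Y)"
    "exchange (exchange X Y) (X \<union> Y - exchange X Y) = X"
proof -
  have ex: "is_exchange X Y (exchange X Y)"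
    unfolding exchange_def using exchange_exists[OF assms] by (rule someI_ex)
  then show 1: "exchange X Y \<subseteq> X \<union> Y" "card (exchange X Y) = card Y"
    "sl X @ sl Y \<simeq> sl (exchange X Y) @ sl (X \<union> Y - exchange X Y)" by (auto simp: is_exchange_def)
  let ?X = "exchange X Y" and ?Y = "X \<union> Y - exchange X Y"
  have f: "finite ?X" "finite ?Y" "?X \<inter> ?Y = {}" using 1(1) assms by (auto intro: finite_subset)
  show 2: "card ?Y = card X" using 1 assms f by (simp add: card_Diff_subset card_Un_disjoint)
  have u: "?X \<union> ?Y = X \<union> Y" using 1(1) by auto
  have "is_exchange ?X ?Y (exchange ?X ?Y)"
    unfolding exchange_def[of ?X ?Y] using exchange_exists[OF f] by (rule someI_ex)
  then have e: "exchange ?X ?Y \<subseteq> X \<union> Y" "card (exchange ?X ?Y) = card X"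
     "sl ?X @ sl ?Y \<simeq> sl (exchange ?X ?Y) @ sl (X \<union> Y - exchange ?X ?Y)"
    unfolding is_exchange_def u 2 by auto
  have fe: "finite (exchange ?X ?Y)" using e(1) assms finite_subset by blast
  have "sl X @ sl Y \<simeq> sl (exchange ?X ?Y) @ sl (X \<union> Y - exchange ?X ?Y)"
    using 1(3) e(3) pl_trans by blast
  from two_row_unique_sets(1)[OF assms fe _ this] e(2) assms
  show "exchange ?X ?Y = X" by simp
qed

section \<open>Colourings of the letters by rows\<close>

abbreviation cols :: "nat \<Rightarrow> 'a set \<Rightarrow> ('a \<Rightarrow> nat) set" where
  "cols N Z \<equiv> Z \<rightarrow>\<^sub>E {..<N}"

definition crow :: "'a::linorder set \<Rightarrow> ('a \<Rightarrow> nat) \<Rightarrow> nat \<Rightarrow> 'a list" where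
  "crow Z c i = sl {a\<in>Z. c a = i}"

definition cword :: "nat \<Rightarrow> 'a::linorder set \<Rightarrow> ('a \<Rightarrow> nat) \<Rightarrow> 'a list" where
  "cword N Z c = rword (map (crow Z c) [0..<N])"

definition csize :: "'a set \<Rightarrow> ('a \<Rightarrow> nat) \<Rightarrow> nat \<Rightarrow> nat" where
  "csize Z c i = card {a\<in>Z. c a = i}"

text \<open>Row lengths plus staircase: the exponents in the bialternant formula, with colour 0 for
  the top row.\<close>

definition cexp :: "nat \<Rightarrow> 'a set \<Rightarrow> ('a \<Rightarrow> nat) \<Rightarrow> nat list" where
  "cexp N Z c = map (\<lambda>i. csize Z c i + (N - 1 - i)) [0..<N]"

text \<open>The rows form a tableau, empty rows allowed. Equivalently, the colours read in the order
  of the letters form a lattice word, whence the name.\<close>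

definition lattice :: "nat \<Rightarrow> 'a::linorder set \<Rightarrow> ('a \<Rightarrow> nat) \<Rightarrow> bool" where
  "lattice N Z c \<longleftrightarrow> ctab (map (crow Z c) [0..<N])"

definition alt :: "('b list \<Rightarrow> 'c::ab_group_add) \<Rightarrow> bool" where
  "alt g \<longleftrightarrow> (\<forall>xs a b ys. g (xs @ a # b # ys) = - g (xs @ b # a # ys))"

lemma altD: "alt g \<Longrightarrow> g (xs @ a # b # ys) = - g (xs @ b # a # ys)"
  unfolding alt_def by blast

lemma rword_append [simp]: "rword (A @ B) = rword B @ rword A"
  by (simp add: rword_def)

lemma inc_crow [simp]: "inc (crow Z c i)"
  by (simp add: crow_def)

lemma set_crow: "finite Z \<Longrightarrow> set (crow Z c i) = {a\<in>Z. c a = i}"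
  by (simp add: crow_def)

lemma length_crow: "finite Z \<Longrightarrow> length (crow Z c i) = csize Z c i"
  by (simp add: crow_def csize_def)

lemma filter_crow: "finite Z \<Longrightarrow> filter P (crow Z c i) = sl {a\<in>Z. c a = i \<and> P a}"
  by (rule inc_set_eq) (auto simp: crow_def intro: sorted_wrt_filter)

lemma upt_split: "Suc i < N \<Longrightarrow> [0..<N] = [0..<i] @ i # Suc i # [Suc (Suc i)..<N]"
  using upt_add_eq_append[of 0 i "N - i"] upt_conv_Cons[of i N] upt_conv_Cons[of "Suc i" N] by simp

lemma cword_split:
  "Suc i < N \<Longrightarrow> cword N Z c = rword (map (crow Z c) [Suc (Suc i)..<N]) @ (crow Z c (Suc i) @ crow Z c i) @
     rword (map (crow Z c) [0..<i])"
  unfolding cword_def by (subst upt_split) simp_all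

lemma cexp_split:
  "Suc i < N \<Longrightarrow> cexp N Z c = map (\<lambda>i. csize Z c i + (N - 1 - i)) [0..<i] @
     (csize Z c i + (N - 1 - i)) # (csize Z c (Suc i) + (N - 1 - Suc i)) #
     map (\<lambda>i. csize Z c i + (N - 1 - i)) [Suc (Suc i)..<N]"
  unfolding cexp_def by (subst upt_split) (assumption, simp only: list.map map_append)

lemma set_cword: "finite Z \<Longrightarrow> c \<in> cols N Z \<Longrightarrow> set (cword N Z c) = Z"
  by (auto simp: cword_def rword_def set_crow PiE_def Pi_def)

lemma distinct_cword: "finite Z \<Longrightarrow> distinct (cword N Z c)"
proof (induction N)
  case (Suc N)
  have "cword (Suc N) Z c = crow Z c N @ cword N Z c" by (simp add: cword_def)
  moreover have "set (cword N Z c) \<inter> set (crow Z c N) = {}"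
    using Suc by (auto simp: cword_def rword_def set_crow)
  ultimately show ?case using Suc inc_distinct[OF inc_crow] by auto
qed (simp add: cword_def)

definition recol :: "nat \<Rightarrow> 'a set \<Rightarrow> 'a set \<Rightarrow> ('a \<Rightarrow> nat) \<Rightarrow> 'a \<Rightarrow> nat" where
  "recol i S X c a = (if a \<in> S then if a \<in> X then Suc i else i else c a)"

lemma recol_crow:
  assumes "S \<subseteq> {a\<in>Z. c a = i \<or> c a = Suc i}" "X \<subseteq> S"
  shows "{a\<in>Z. recol i S X c a = Suc i} = ({a\<in>Z. c a = Suc i} - S) \<union> X"
    "{a\<in>Z. recol i S X c a = i} = ({a\<in>Z. c a = i} - S) \<union> (S - X)"
    "j \<noteq> i \<Longrightarrow> j \<noteq> Suc i \<Longrightarrow> {a\<in>Z. recol i S X c a = j} = {a\<in>Z. c a = j}"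
  using assms by (auto simp: recol_def)

lemma recol_cols:
  assumes "c \<in> cols N Z" "S \<subseteq> Z" "Suc i < N"
  shows "recol i S X c \<in> cols N Z"
  using assms by (auto simp: recol_def PiE_def extensional_def)

lemma recol_pl:
  assumes S: "S \<subseteq> {a\<in>Z. c a = i \<or> c a = Suc i}" "X \<subseteq> S" and i: "Suc i < N"
    and pl: "crow Z c (Suc i) @ crow Z c i \<simeq> crow Z (recol i S X c) (Suc i) @ crow Z (recol i S X c) i"
  shows "cword N Z c \<simeq> cword N Z (recol i S X c)"
proof -
  have "crow Z (recol i S X c) j = crow Z c j" if "j \<noteq> i" "j \<noteq> Suc i" for j
    using recol_crow(3)[OF S that] by (simp add: crow_def)
  then have m: "map (crow Z (recol i S X c)) [Suc (Suc i)..<N] = map (crow Z c) [Suc (Suc i)..<N]"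
    "map (crow Z (recol i S X c)) [0..<i] = map (crow Z c) [0..<i]" by auto
  show ?thesis unfolding cword_split[OF i] m by (rule pl_append[OF pl])
qed

subsection \<open>The first violation of the lattice condition\<close>

text \<open>The lattice word condition fails at v for its row and the row above. Only letters up to
  v are consulted, so recolouring larger letters does not affect badness of v.\<close>

definition bad :: "'a::linorder set \<Rightarrow> ('a \<Rightarrow> nat) \<Rightarrow> 'a \<Rightarrow> bool" where
  "bad Z c v \<longleftrightarrow> v \<in> Z \<and> 0 < c v \<and>
     length (filter (\<lambda>a. a < v) (crow Z c (c v - 1))) < length (filter (\<lambda>a. a \<le> v) (crow Z c (c v)))"

lemma nrm_filter_iff:
  "inc x \<Longrightarrow> inc y \<Longrightarrow>
    nrm x y \<longleftrightarrow> (\<forall>v\<in>set x. length (filter (\<lambda>a. a \<le> v) x) \<le> length (filter (\<lambda>a. a < v) y))"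
proof (induction x y rule: nrm.induct)
  case (3 v vs a y)
  have v: "filter (\<lambda>b. b \<le> v) (v # vs) = [v]"
    using 3 by (auto simp: filter_empty_conv not_le)
  show ?case
  proof (cases "a < v")
    case True
    have "length (filter (\<lambda>b. b \<le> u) (v # vs)) = Suc (length (filter (\<lambda>b. b \<le> u) vs))"
      "length (filter (\<lambda>b. b < u) (a # y)) = Suc (length (filter (\<lambda>b. b < u) y))" if "u \<in> set vs" for u
      using that 3 True by auto
    with 3 True v show ?thesis by auto
  next
    case False
    then have "filter (\<lambda>b. b < v) (a # y) = []" using 3 by (auto simp: filter_empty_conv)
    with False v show ?thesis by auto
  qed
qed auto

lemma lattice_iff:
  assumes "finite Z" "c \<in> cols N Z"
  shows "lattice N Z c \<longleftrightarrow> (\<forall>v. \<not> bad Z c v)"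
proof -
  have "lattice N Z c \<longleftrightarrow> (\<forall>i. Suc i < N \<longrightarrow> nrm (crow Z c (Suc i)) (crow Z c i))"
    unfolding lattice_def ctab_nth by auto
  also have "\<dots> \<longleftrightarrow> (\<forall>i. Suc i < N \<longrightarrow> (\<forall>v\<in>Z. c v = Suc i \<longrightarrow> \<not> bad Z c v))"
    using assms(1) by (auto simp: nrm_filter_iff set_crow bad_def not_less)
  also have "\<dots> \<longleftrightarrow> (\<forall>v. \<not> bad Z c v)"
  proof (intro iffI allI impI)
    fix v assume h: "\<forall>i. Suc i < N \<longrightarrow> (\<forall>v\<in>Z. c v = Suc i \<longrightarrow> \<not> bad Z c v)"
    show "\<not> bad Z c v"
    proof
      assume b: "bad Z c v"
      then have "v \<in> Z" "c v = Suc (c v - 1)" by (auto simp: bad_def)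
      moreover have "c v < N" using assms(2) \<open>v \<in> Z\<close> by auto
      ultimately show False using h b by metis
    qed
  qed auto
  finally show ?thesis .
qed

lemma bad_agree:
  assumes "finite Z" "v \<in> Z" "\<forall>a\<in>Z. a \<le> v \<longrightarrow> c' a = c a"
  shows "bad Z c' v = bad Z c v"
proof -
  have "{a\<in>Z. c' a = i \<and> a < v} = {a\<in>Z. c a = i \<and> a < v}" "{a\<in>Z. c' a = i \<and> a \<le> v} = {a\<in>Z. c a = i \<and> a \<le> v}" for i
    using assms by auto
  moreover have "c' v = c v" using assms by auto
  ultimately show ?thesis using assms(1) by (simp add: bad_def filter_crow)
qed

definition viol :: "'a::linorder set \<Rightarrow> ('a \<Rightarrow> nat) \<Rightarrow> 'a" where
  "viol Z c = Min {v\<in>Z. bad Z c v}"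

text \<open>Beyond the first bad letter the tails of the two rows trade their cardinalities. Simply
  swapping the tails would in general leave the Knuth class; \<open>exchange\<close> stays inside
  it.\<close>

definition flip :: "'a::linorder set \<Rightarrow> ('a \<Rightarrow> nat) \<Rightarrow> 'a \<Rightarrow> nat" where
  "flip Z c = (let v = viol Z c; i = c v - 1; X = {a\<in>Z. v < a \<and> c a = Suc i}; Y = {a\<in>Z. v < a \<and> c a = i}
     in recol i (X \<union> Y) (exchange X Y) c)"

lemma viol:
  assumes "finite Z" "c \<in> cols N Z" "\<not> lattice N Z c"
  shows "viol Z c \<in> Z" "bad Z c (viol Z c)" "\<And>u. u < viol Z c \<Longrightarrow> \<not> bad Z c u"
proof -
  let ?B = "{v\<in>Z. bad Z c v}"
  have "?B \<noteq> {}" "finite ?B" using assms lattice_iff[OF assms(1,2)] by (auto simp: bad_def)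
  then have "viol Z c \<in> ?B" unfolding viol_def by (intro Min_in)
  then show "viol Z c \<in> Z" "bad Z c (viol Z c)" by auto
  show "\<not> bad Z c u" if "u < viol Z c" for u
  proof
    assume "bad Z c u"
    then have "u \<in> ?B" by (simp add: bad_def)
    then show False using Min_le[OF \<open>finite ?B\<close>] that unfolding viol_def by (simp add: leD)
  qed
qed

lemma viol_split:
  assumes fin: "finite Z" and c: "c \<in> cols N Z" "\<not> lattice N Z c"
  defines "v \<equiv> viol Z c"
  defines "i \<equiv> c v - 1"
  shows "c v = Suc i" "Suc i < N"
    "\<exists>p y0. crow Z c (Suc i) = p @ v # sl {a\<in>Z. v < a \<and> c a = Suc i} \<and>
      crow Z c i = y0 @ sl {a\<in>Z. v < a \<and> c a = i} \<and> nrm p y0 \<and> length p = length y0 \<and>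
      (\<forall>a\<in>set p. a < v) \<and> (\<forall>a\<in>set y0. a < v)"
proof -
  note V = viol[OF fin c, folded v_def]
  show cv: "c v = Suc i" using V(2) by (auto simp: bad_def i_def)
  have "c v < N" using c(1) V(1) by auto
  then show "Suc i < N" using cv by simp
  let ?x = "crow Z c (Suc i)" and ?y = "crow Z c i"
  have nn: "\<not> nrm ?x ?y"
    using V(1,2) cv fin by (auto simp: nrm_filter_iff bad_def set_crow not_le)
  \<comment> \<open>The entry in the first violated column turns out to be bad, and the entries
    before it are not; this identifies it with v.\<close>
  from first_violation[OF nn] obtain p w x1 y0 y1 where
    e: "?x = p @ w # x1" "?y = y0 @ y1" "length p = length y0" "nrm p y0" "y1 = [] \<or> w \<le> hd y1" by blast
  have ix: "inc (p @ w # x1)" "inc (y0 @ y1)" using e inc_crow by metis+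
  have w: "w \<in> Z" "c w = Suc i" using e(1) set_crow[OF fin, of c "Suc i"] by auto
  have "w \<notin> set ?y" using w(2) set_crow[OF fin, of c i] by auto
  then have y1: "\<forall>b\<in>set y1. w < b" using e(2,5) ix(2) by (cases y1) (auto simp: sorted_wrt_append)
  have pw: "\<forall>a\<in>set p. a < w" "inc p" "\<forall>a\<in>set x1. w < a" using ix by (auto simp: sorted_wrt_append)
  have yw: "\<forall>a\<in>set y0. a < w" by (rule nrm_less[OF e(4,3) pw(2,1)])
  have "filter (\<lambda>a. a \<le> w) ?x = p @ [w]" "filter (\<lambda>a. a < w) ?y = y0"
    unfolding e(1,2) using pw yw y1 by (auto simp: filter_empty_conv filter_id_conv not_le not_less less_imp_le)
  then have "bad Z c w" using w e(3) by (simp add: bad_def)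
  then have vw: "v \<le> w" using V(3) not_less by blast
  have "\<not> bad Z c u" if u: "u \<in> set p" for u
  proof -
    have "c u = Suc i" using u e(1) set_crow[OF fin, of c "Suc i"] by auto
    moreover have "filter (\<lambda>a. a \<le> u) ?x = filter (\<lambda>a. a \<le> u) p"
      unfolding e(1) using u pw by (auto simp: filter_empty_conv not_le dest: less_trans)
    moreover have "length (filter (\<lambda>a. a < u) y0) \<le> length (filter (\<lambda>a. a < u) ?y)" unfolding e(2) by simp
    moreover have "length (filter (\<lambda>a. a \<le> u) p) \<le> length (filter (\<lambda>a. a < u) y0)"
      using e(4) u pw(2) ix(2) nrm_filter_iff[of p y0] by (auto simp: sorted_wrt_append)
    ultimately show ?thesis by (auto simp: bad_def)
  qed
  moreover have "v \<in> set ?x" using V(1) cv set_crow[OF fin] by auto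
  ultimately have "v = w" using e(1) V(2) vw pw by auto
  moreover have "x1 = sl {a\<in>Z. w < a \<and> c a = Suc i}"
  proof (rule inc_set_eq)
    show "set x1 = set (sl {a\<in>Z. w < a \<and> c a = Suc i})"
      using e(1) pw set_crow[OF fin, of c "Suc i"] fin by (auto dest: less_trans)
  qed (use ix in \<open>auto simp: sorted_wrt_append\<close>)
  moreover have "y1 = sl {a\<in>Z. w < a \<and> c a = i}"
  proof (rule inc_set_eq)
    have "set y0 \<union> set y1 = {a\<in>Z. c a = i}" using e(2) set_crow[OF fin, of c i] by auto
    then show "set y1 = set (sl {a\<in>Z. w < a \<and> c a = i})"
      using yw y1 fin by (auto dest: less_asym)
  qed (use ix in \<open>auto simp: sorted_wrt_append\<close>)
  ultimately show "\<exists>p y0. crow Z c (Suc i) = p @ v # sl {a\<in>Z. v < a \<and> c a = Suc i} \<and>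
      crow Z c i = y0 @ sl {a\<in>Z. v < a \<and> c a = i} \<and> nrm p y0 \<and> length p = length y0 \<and>
      (\<forall>a\<in>set p. a < v) \<and> (\<forall>a\<in>set y0. a < v)"
    using e pw yw by blast
qed

text \<open>Up to v the lower row has one letter more than the upper row. After the tails have
  traded cardinalities the lower length is the old upper one plus 1, and the upper length is the old
  lower one minus 1; with the staircase added, the two exponents are interchanged. Letters up to v
  keep their colours, so v is again the first bad letter and the map undoes itself.\<close>

lemma flip:
  fixes Z :: "'a::linorder set"
  assumes fin: "finite Z" and c: "c \<in> cols N Z" "\<not> lattice N Z c"
  shows "flip Z c \<in> cols N Z" "\<not> lattice N Z (flip Z c)" "flip Z (flip Z c) = c"
    "cword N Z c \<simeq> cword N Z (flip Z c)" "viol Z c \<in> Z" "0 < c (viol Z c)"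
    "\<forall>a\<in>Z. a \<le> viol Z c \<longrightarrow> flip Z c a = c a"
    "alt g \<Longrightarrow> g (cexp N Z (flip Z c)) = - g (cexp N Z c)"
proof -
  define v where "v = viol Z c"
  define i where "i = c v - 1"
  define X where "X = {a\<in>Z. v < a \<and> c a = Suc i}"
  define Y where "Y = {a\<in>Z. v < a \<and> c a = i}"
  define E where "E = exchange X Y"
  define c' where "c' = flip Z c"
  have c': "c' = recol i (X \<union> Y) E c"
    unfolding c'_def flip_def Let_def v_def i_def X_def Y_def E_def by simp
  note V = viol[OF fin c, folded v_def]
  note S = viol_split[OF fin c, folded v_def, folded i_def, folded X_def Y_def]
  have XY: "finite X" "finite Y" "X \<inter> Y = {}" using fin by (auto simp: X_def Y_def)
  note E = exchange[OF XY, folded E_def]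
  have sub: "X \<union> Y \<subseteq> {a\<in>Z. c a = i \<or> c a = Suc i}" by (auto simp: X_def Y_def)
  show cols: "flip Z c \<in> cols N Z"
    unfolding c'_def[symmetric] c' using c(1) sub S(2) by (intro recol_cols) auto
  show "viol Z c \<in> Z" "0 < c (viol Z c)" using V S(1) by (auto simp: v_def)
  have agree: "\<forall>a\<in>Z. a \<le> v \<longrightarrow> c' a = c a"
    unfolding c' recol_def X_def Y_def by auto
  then show "\<forall>a\<in>Z. a \<le> viol Z c \<longrightarrow> flip Z c a = c a" by (simp add: v_def c'_def)
  have badc': "bad Z c' u = bad Z c u" if "u \<le> v" for u
  proof (cases "u \<in> Z")
    case True
    then show ?thesis using agree that by (intro bad_agree[OF fin]) auto
  qed (simp add: bad_def)
  have nl: "\<not> lattice N Z c'"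
    using lattice_iff[OF fin cols[folded c'_def]] badc'[of v] V(2) by auto
  then show "\<not> lattice N Z (flip Z c)" by (simp add: c'_def)
  have viol': "viol Z c' = v"
  proof -
    note V' = viol[OF fin cols[folded c'_def] nl]
    have "\<not> viol Z c' < v" using V'(2) V(3) badc'[of "viol Z c'"] less_imp_le by blast
    moreover have "\<not> v < viol Z c'" using V'(3)[of v] V(2) badc'[of v] by auto
    ultimately show ?thesis by auto
  qed
  have cv': "c' v - 1 = i" using agree V(1) by (simp add: i_def)
  have X': "{a\<in>Z. v < a \<and> c' a = Suc i} = E"
    unfolding c' recol_def using E(1) by (auto simp: X_def Y_def)
  have Y': "{a\<in>Z. v < a \<and> c' a = i} = X \<union> Y - E"
    unfolding c' recol_def using E(1) by (auto simp: X_def Y_def)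
  have "flip Z c' = recol i (E \<union> (X \<union> Y - E)) (exchange E (X \<union> Y - E)) c'"
    unfolding flip_def[of Z c'] Let_def viol' cv' X' Y' ..
  also have "\<dots> = recol i (X \<union> Y) X c'" using E(1,5) by (simp add: Un_absorb1)
  also have "\<dots> = c" unfolding c' by (auto simp: recol_def X_def Y_def)
  finally show "flip Z (flip Z c) = c" by (simp add: c'_def)
  obtain p y0 where py: "crow Z c (Suc i) = p @ v # sl X" "crow Z c i = y0 @ sl Y" "nrm p y0"
    "length p = length y0" "\<forall>a\<in>set p. a < v" "\<forall>a\<in>set y0. a < v"
    using S(3) by blast
  have ixy: "inc (p @ v # sl X)" "inc (y0 @ sl Y)" using py inc_crow by metis+
  have gtY: "\<forall>b\<in>set (sl Y). v < b" using XY by (auto simp: Y_def)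
  have dxy: "distinct ((p @ v # sl X) @ y0 @ sl Y)"
  proof -
    have "set (crow Z c (Suc i)) \<inter> set (crow Z c i) = {}" using fin by (auto simp: set_crow)
    then show ?thesis using inc_distinct[OF ixy(1)] inc_distinct[OF ixy(2)] unfolding py by auto
  qed
  note SE = suffix_exchange[OF ixy py(3,4) gtY dxy E(4) inc_sl inc_sl]
  have fE: "finite E" "finite (X \<union> Y - E)" using E(1) XY by (auto intro: finite_subset)
  have p': "{a\<in>Z. c a = Suc i} - (X \<union> Y) = insert v (set p)" "{a\<in>Z. c a = i} - (X \<union> Y) = set y0"
  proof -
    have "set p \<union> {v} \<union> X = {a\<in>Z. c a = Suc i}" "set y0 \<union> Y = {a\<in>Z. c a = i}"
      using py(1,2) set_crow[OF fin, of c] XY by (metis Un_insert_right list.set(2) set_append set_sorted_list_of_set sup_bot_right Un_assoc insert_is_Un, metis set_append set_sorted_list_of_set)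
    moreover have "v \<notin> X \<union> Y" "set p \<inter> (X \<union> Y) = {}" "set y0 \<inter> (X \<union> Y) = {}"
      using py(5,6) by (auto simp: X_def Y_def)
    moreover have "X \<inter> {a\<in>Z. c a = i} = {}" "Y \<inter> {a\<in>Z. c a = Suc i} = {}" by (auto simp: X_def Y_def)
    ultimately show "{a\<in>Z. c a = Suc i} - (X \<union> Y) = insert v (set p)" "{a\<in>Z. c a = i} - (X \<union> Y) = set y0"
      by auto
  qed
  have rows': "crow Z c' (Suc i) = p @ v # sl E" "crow Z c' i = y0 @ sl (X \<union> Y - E)"
  proof -
    have "set (p @ v # sl E) = insert v (set p) \<union> E" "set (y0 @ sl (X \<union> Y - E)) = set y0 \<union> (X \<union> Y - E)"
      using fE by auto
    then show "crow Z c' (Suc i) = p @ v # sl E" "crow Z c' i = y0 @ sl (X \<union> Y - E)"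
      unfolding crow_def c' recol_crow(1,2)[OF sub E(1)] p' using inc_eq_sl[OF SE(2)] inc_eq_sl[OF SE(3)] by metis+
  qed
  show "cword N Z c \<simeq> cword N Z (flip Z c)"
    unfolding c'_def[symmetric] c'
    by (rule recol_pl[OF sub E(1) S(2)]) (use SE(1) rows' py c' in simp)
  have sz: "csize Z c' (Suc i) = Suc (csize Z c i)" "Suc (csize Z c' i) = csize Z c (Suc i)"
    unfolding length_crow[OF fin, symmetric] rows' py(1,2) using py(4) E(2,3) by simp_all
  have sz': "csize Z c' j = csize Z c j" if "j \<noteq> i" "j \<noteq> Suc i" for j
    unfolding csize_def c' using recol_crow(3)[OF sub E(1) that] by simp
  let ?e = "\<lambda>c j. csize Z c j + (N - 1 - j)"
  have "?e c' i = ?e c (Suc i)" "?e c' (Suc i) = ?e c i" using sz S(2) by auto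
  moreover have "map (?e c') [0..<i] = map (?e c) [0..<i]"
    "map (?e c') [Suc (Suc i)..<N] = map (?e c) [Suc (Suc i)..<N]" using sz' by auto
  ultimately have eq: "cexp N Z c' = map (?e c) [0..<i] @ ?e c (Suc i) # ?e c i # map (?e c) [Suc (Suc i)..<N]"
    unfolding cexp_split[OF S(2)] by simp
  show "g (cexp N Z (flip Z c)) = - g (cexp N Z c)" if "alt g"
    unfolding c'_def[symmetric] eq cexp_split[OF S(2), of Z c] by (rule altD[OF that])
qed

text \<open>Closure of \<open>Om\<close> is asked only for changes beyond a letter v outside the top
  row. This leaves room for sets \<open>Om\<close> that prescribe the top row for the smallest
  letters, as the recursion will require.\<close>

theorem lattice_sum:
  fixes g :: "nat list \<Rightarrow> 'b::{idom, ring_char_0}" and Om :: "('a::linorder \<Rightarrow> nat) set"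
  assumes fin: "finite Z" and Om: "Om \<subseteq> cols N Z" and "alt g"
    and closed: "\<And>c c' v. c \<in> Om \<Longrightarrow> c' \<in> cols N Z \<Longrightarrow> v \<in> Z \<Longrightarrow> 0 < c v \<Longrightarrow>
      \<forall>a\<in>Z. a \<le> v \<longrightarrow> c' a = c a \<Longrightarrow> cword N Z c \<simeq> cword N Z c' \<Longrightarrow> c' \<in> Om"
  shows "(\<Sum>c\<in>Om. g (cexp N Z c)) = (\<Sum>c\<in>{c\<in>Om. lattice N Z c}. g (cexp N Z c))"
proof -
  have "finite (cols N Z)" using fin by (intro finite_PiE) auto
  then have finO: "finite Om" using Om finite_subset by blast
  let ?B = "{c\<in>Om. \<not> lattice N Z c}"
  have fl: "flip Z c \<in> ?B \<and> flip Z (flip Z c) = c \<and> g (cexp N Z (flip Z c)) = - g (cexp N Z c)" if "c \<in> ?B" for c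
  proof -
    have c: "c \<in> cols N Z" "\<not> lattice N Z c" using that Om by auto
    note F = flip[OF fin c]
    have "flip Z c \<in> Om" using closed[of c "flip Z c" "viol Z c"] F that by auto
    then show ?thesis using F \<open>alt g\<close> by auto
  qed
  define s where "s = (\<Sum>c\<in>?B. g (cexp N Z c))"
  have "s = (\<Sum>c\<in>?B. g (cexp N Z (flip Z c)))"
    unfolding s_def by (rule sum.reindex_bij_witness[of _ "flip Z" "flip Z"]) (use fl in auto)
  also have "\<dots> = (\<Sum>c\<in>?B. - g (cexp N Z c))"
    by (rule sum.cong) (use fl in auto)
  finally have "s = - s" by (simp add: sum_negf s_def)
  then have "2 * s = 0" by (simp only: eq_neg_iff_add_eq_0 mult_2)
  then have "s = 0" by simp
  moreover have "Om = {c\<in>Om. lattice N Z c} \<union> ?B" by auto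
  then have "(\<Sum>c\<in>Om. g (cexp N Z c)) = (\<Sum>c\<in>{c\<in>Om. lattice N Z c} \<union> ?B. g (cexp N Z c))" by simp
  then have "(\<Sum>c\<in>Om. g (cexp N Z c)) = (\<Sum>c\<in>{c\<in>Om. lattice N Z c}. g (cexp N Z c)) + s"
    unfolding s_def using finO by (subst (asm) sum.union_disjoint) auto
  ultimately show ?thesis by simp
qed

subsection \<open>Symmetry in the row lengths\<close>

text \<open>Here two complete adjacent rows trade their cardinalities within the class: the action
  of the symmetric group found by Lascoux and Schuetzenberger.\<close>

lemma csize_transpose:
  fixes Om :: "('a::linorder \<Rightarrow> nat) set"
  assumes fin: "finite Z" and Om: "Om \<subseteq> cols N Z"
    and closed: "\<And>c c'. c \<in> Om \<Longrightarrow> c' \<in> cols N Z \<Longrightarrow> cword N Z c \<simeq> cword N Z c' \<Longrightarrow> c' \<in> Om"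
    and i: "Suc i < N"
  shows "(\<Sum>c\<in>Om. F (csize Z c)) = (\<Sum>c\<in>Om. F (csize Z c \<circ> transpose i (Suc i)))"
proof -
  define S where "S c = {a\<in>Z. c a = i \<or> c a = Suc i}" for c
  define X where "X c = {a\<in>Z. c a = Suc i}" for c
  define Y where "Y c = {a\<in>Z. c a = i}" for c
  define f where "f c = recol i (S c) (exchange (X c) (Y c)) c" for c
  have f: "f c \<in> Om \<and> f (f c) = c \<and> csize Z (f c) = csize Z c \<circ> transpose i (Suc i)" if "c \<in> Om" for c
  proof -
    have fXY: "finite (X c)" "finite (Y c)" "X c \<inter> Y c = {}" and SXY: "S c = X c \<union> Y c"
      using fin by (auto simp: X_def Y_def S_def)
    note E = exchange[OF fXY]
    let ?E = "exchange (X c) (Y c)"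
    have sub: "S c \<subseteq> {a\<in>Z. c a = i \<or> c a = Suc i}" "?E \<subseteq> S c" using E(1) SXY by (auto simp: S_def)
    note R = recol_crow[OF sub]
    have X': "X (f c) = ?E" using R(1) sub(2) unfolding X_def f_def by (auto simp: S_def)
    have Y': "Y (f c) = S c - ?E" using R(2) sub(2) unfolding Y_def f_def by (auto simp: S_def)
    have S': "S (f c) = S c" using X' Y' sub(2) unfolding S_def X_def Y_def by blast
    have cols: "f c \<in> cols N Z" unfolding f_def
      using that Om i by (intro recol_cols) (auto simp: S_def)
    have "crow Z c (Suc i) @ crow Z c i \<simeq> crow Z (f c) (Suc i) @ crow Z (f c) i"
      using E(4) X' Y' SXY by (simp add: crow_def X_def Y_def)
    then have "cword N Z c \<simeq> cword N Z (f c)" unfolding f_def by (rule recol_pl[OF sub i])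
    then have "f c \<in> Om" using closed that cols by blast
    moreover have "f (f c) = recol i (S c) (X c) (f c)"
      unfolding f_def[of "f c"] S' X' Y' using E(5) SXY by simp
    then have "f (f c) = c" by (auto simp: f_def recol_def S_def X_def)
    moreover have "csize Z (f c) j = (csize Z c \<circ> transpose i (Suc i)) j" for j
    proof (cases "j = i \<or> j = Suc i")
      case True
      have "csize Z d (Suc i) = card (X d)" "csize Z d i = card (Y d)" for d
        by (simp_all add: csize_def X_def Y_def)
      with True show ?thesis using X' Y' E(2,3) SXY by (auto simp: transpose_def)
    next
      case False
      then show ?thesis using R(3)[of j] by (auto simp: csize_def f_def transpose_def)
    qed
    ultimately show ?thesis by auto
  qed
  show ?thesis
    by (rule sum.reindex_bij_witness[of _ f f])
      (use f in \<open>auto simp: comp_assoc transpose_comp_involutory\<close>)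
qed

lemma csize_permutes:
  fixes Om :: "('a::linorder \<Rightarrow> nat) set"
  assumes fin: "finite Z" and Om: "Om \<subseteq> cols N Z"
    and closed: "\<And>c c'. c \<in> Om \<Longrightarrow> c' \<in> cols N Z \<Longrightarrow> cword N Z c \<simeq> cword N Z c' \<Longrightarrow> c' \<in> Om"
    and p: "p permutes {..<N}"
  shows "(\<Sum>c\<in>Om. F (csize Z c) :: 'b::comm_monoid_add) = (\<Sum>c\<in>Om. F (csize Z c \<circ> p))"
proof -
  define Q where "Q = (\<lambda>p. \<forall>F :: (nat \<Rightarrow> nat) \<Rightarrow> 'b. (\<Sum>c\<in>Om. F (csize Z c)) = (\<Sum>c\<in>Om. F (csize Z c \<circ> p)))"
  have comp: "Q (p \<circ> q)" if "Q p" "Q q" for p q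
    unfolding Q_def
  proof
    fix F :: "(nat \<Rightarrow> nat) \<Rightarrow> 'b"
    have "(\<Sum>c\<in>Om. F (csize Z c)) = (\<Sum>c\<in>Om. F (csize Z c \<circ> q))" using that unfolding Q_def by blast
    also have "\<dots> = (\<Sum>c\<in>Om. F ((csize Z c \<circ> p) \<circ> q))"
      using that(1)[unfolded Q_def, rule_format, of "\<lambda>s. F (s \<circ> q)"] by simp
    finally show "(\<Sum>c\<in>Om. F (csize Z c)) = (\<Sum>c\<in>Om. F (csize Z c \<circ> (p \<circ> q)))" by (simp add: o_assoc)
  qed
  have adj: "Q (transpose i (Suc i))" if "Suc i < N" for i
    unfolding Q_def
  proof
    fix F :: "(nat \<Rightarrow> nat) \<Rightarrow> 'b"
    show "(\<Sum>c\<in>Om. F (csize Z c)) = (\<Sum>c\<in>Om. F (csize Z c \<circ> transpose i (Suc i)))"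
      by (rule csize_transpose[OF fin Om _ that]) (erule (2) closed)
  qed
  have tr: "Q (transpose a (a + Suc k))" if "a + Suc k < N" for a k
    using that
  proof (induction k)
    case 0
    then show ?case using adj by simp
  next
    case (Suc k)
    let ?b = "a + Suc k"
    have e: "transpose a (a + Suc (Suc k)) = transpose ?b (Suc ?b) \<circ> transpose a ?b \<circ> transpose ?b (Suc ?b)"
      by (auto simp: transpose_def fun_eq_iff)
    show ?case unfolding e by (intro comp adj Suc.IH) (use Suc.prems in auto)
  qed
  have tr': "Q (transpose a b)" if "a < N" "b < N" for a b
  proof (cases a b rule: linorder_cases)
    case less
    then obtain k where "b = a + Suc k" by (metis less_imp_Suc_add add_Suc_right)
    then show ?thesis using tr that by simp
  next
    case equal
    then show ?thesis by (simp add: Q_def)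
  next
    case greater
    then obtain k where "a = b + Suc k" by (metis less_imp_Suc_add add_Suc_right)
    then show ?thesis using tr that by (simp add: transpose_commute)
  qed
  have "Q p"
    using p finite_lessThan[of N]
  proof (induction rule: permutes_induct)
    case id
    then show ?case by (simp add: Q_def comp_def)
  next
    case (swap a b p)
    show ?case by (rule comp[OF tr' swap.IH]) (use swap in auto)
  qed
  then show ?thesis unfolding Q_def by blast
qed

section \<open>Alternants\<close>

definition alternant :: "nat list \<Rightarrow> (nat \<Rightarrow> 'a::comm_ring_1) \<Rightarrow> 'a" where
  "alternant al y = (\<Sum>w | w permutes {..<length al}. of_int (sign w) * (\<Prod>i<length al. y (w i) ^ (al ! i)))"

lemma alternant_det:
  "alternant al y = det (mat (length al) (length al) (\<lambda>(i, j). y j ^ (al ! i)))"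
proof -
  let ?n = "length al"
  let ?A = "mat ?n ?n (\<lambda>(i, j). y j ^ (al ! i))"
  have "det ?A = (\<Sum>p\<in>{p. p permutes {0..<?n}}. signof p * (\<Prod>i = 0..<?n. ?A $$ (i, p i)))"
    by (rule det_def') simp
  also have "\<dots> = alternant al y"
    unfolding alternant_def lessThan_atLeast0
  proof (rule sum.cong)
    fix p assume "p \<in> {p. p permutes {0..<?n}}"
    then have "p i < ?n" if "i < ?n" for i
      using that permutes_in_image[of p "{0..<?n}" i] by simp
    then show "signof p * (\<Prod>i = 0..<?n. ?A $$ (i, p i)) = of_int (sign p) * (\<Prod>i = 0..<?n. y (p i) ^ al ! i)"
      by simp
  qed simp
  finally show ?thesis by simp
qed

lemma alt_alternant: "alt (\<lambda>al. alternant al y)"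
  unfolding alt_def
proof (intro allI)
  fix xs ys :: "nat list" and a b :: nat
  let ?al = "xs @ a # b # ys" and ?be = "xs @ b # a # ys" and ?k = "length xs"
  let ?n = "length ?be"
  have "mat ?n ?n (\<lambda>(i, j). y j ^ (?al ! i)) = swaprows ?k (Suc ?k) (mat ?n ?n (\<lambda>(i, j). y j ^ (?be ! i)))"
    by (rule eq_matI) (auto simp: mat_swaprows_def nth_append nth_Cons split: nat.splits)
  moreover have "det (swaprows ?k (Suc ?k) (mat ?n ?n (\<lambda>(i, j). y j ^ (?be ! i)))) =
      - det (mat ?n ?n (\<lambda>(i, j). y j ^ (?be ! i)))"
    by (rule det_swaprows[of _ ?n]) auto
  moreover have "length ?al = ?n" by simp
  ultimately show "alternant ?al y = - alternant ?be y" unfolding alternant_det by metis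
qed

lemma alternant_Nil [simp]: "alternant [] y = 1"
  by (simp add: alternant_def)

lemma alternant_permute:
  assumes "p permutes {..<length al}"
  shows "alternant al (y \<circ> p) = of_int (sign p) * alternant al y"
proof -
  let ?n = "length al"
  let ?S = "{w. w permutes {..<?n}}"
  have sg: "of_int (sign (p \<circ> w)) = (of_int (sign p) * of_int (sign w) :: 'a)" if w: "w \<in> ?S" for w
  proof -
    have "permutation p" "permutation w" using w assms permutation_permutes finite_lessThan by blast+
    then show ?thesis by (simp add: sign_compose)
  qed
  have "of_int (sign p) * alternant al y = (\<Sum>w\<in>?S. of_int (sign p) * of_int (sign w) * (\<Prod>i<?n. y (w i) ^ (al ! i)))"
    unfolding alternant_def by (simp add: sum_distrib_left mult.assoc)
  also have "\<dots> = (\<Sum>w\<in>?S. of_int (sign p) * of_int (sign (p \<circ> w)) * (\<Prod>i<?n. y ((p \<circ> w) i) ^ (al ! i)))"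
    by (rule sum.reindex_bij_betw[symmetric, of "\<lambda>w. p \<circ> w"])
      (use bij_betw_def assms in \<open>auto intro!: bij_betwI[of _ _ _ "\<lambda>w. inv_into UNIV p \<circ> w"] simp: permutes_compose permutes_inv o_assoc permutes_inv_o\<close>)
  also have "\<dots> = (\<Sum>w\<in>?S. of_int (sign w) * (\<Prod>i<?n. (y \<circ> p) (w i) ^ (al ! i)))"
  proof (rule sum.cong)
    fix w assume w: "w \<in> ?S"
    have "of_int (sign p) * of_int (sign p) = (1 :: 'a)" by (simp add: sign_def)
    then show "of_int (sign p) * of_int (sign (p \<circ> w)) * (\<Prod>i<?n. y ((p \<circ> w) i) ^ (al ! i)) =
      of_int (sign w) * (\<Prod>i<?n. (y \<circ> p) (w i) ^ (al ! i))"
      using sg[OF w] by (simp add: mult.assoc[symmetric])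
  qed simp
  finally show ?thesis by (simp add: alternant_def)
qed

subsection \<open>Branching\<close>

text \<open>Interlacing of strictly decreasing exponent lists, that is of partitions shifted by the staircase.\<close>

fun interl :: "nat list \<Rightarrow> nat list set" where
  "interl [] = {}"
| "interl [b] = {[]}"
| "interl (b # b' # be) = (\<lambda>(k, ka). k # ka) ` ({b'..<b} \<times> interl (b' # be))"

lemma finite_interl: "finite (interl be)"
  by (induction be rule: interl.induct) auto

lemma interl_iff:
  "ka \<in> interl be \<longleftrightarrow> be \<noteq> [] \<and> Suc (length ka) = length be \<and> (\<forall>i<length ka. be ! Suc i \<le> ka ! i \<and> ka ! i < be ! i)"
proof (induction be arbitrary: ka rule: interl.induct)
  case (3 b b' be)
  show ?case
  proof (cases ka)
    case (Cons k ks)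
    have "(\<forall>i<length ka. (b # b' # be) ! Suc i \<le> ka ! i \<and> ka ! i < (b # b' # be) ! i) \<longleftrightarrow>
      (b' \<le> k \<and> k < b) \<and> (\<forall>i<length ks. (b' # be) ! Suc i \<le> ks ! i \<and> ks ! i < (b' # be) ! i)"
      unfolding Cons by (auto simp: less_Suc_eq_0_disj)
    then show ?thesis using 3[of ks] unfolding Cons by auto
  qed auto
qed auto

lemma sum_interl_prod:
  "be \<noteq> [] \<Longrightarrow> (\<Sum>ka\<in>interl be. \<Prod>i<length be - 1. f i (ka ! i)) =
    (\<Prod>i<length be - 1. \<Sum>k=be ! Suc i..<be ! i. f i k :: 'a::comm_semiring_1)"
proof (induction be arbitrary: f rule: interl.induct)
  case (3 b b' be)
  have inj: "inj_on (\<lambda>(k, ka). k # ka) ({b'..<b} \<times> interl (b' # be))" by (auto simp: inj_on_def)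
  have "(\<Sum>ka\<in>interl (b # b' # be). \<Prod>i<length (b # b' # be) - 1. f i (ka ! i)) =
    (\<Sum>(k, ka)\<in>{b'..<b} \<times> interl (b' # be). f 0 k * (\<Prod>i<length (b' # be) - 1. f (Suc i) (ka ! i)))"
    unfolding interl.simps sum.reindex[OF inj]
    by (rule sum.cong) (auto simp: prod.lessThan_Suc_shift simp del: prod.lessThan_Suc)
  also have "\<dots> = (\<Sum>k=b'..<b. f 0 k) * (\<Sum>ka\<in>interl (b' # be). \<Prod>i<length (b' # be) - 1. f (Suc i) (ka ! i))"
    by (simp add: sum_product sum.cartesian_product)
  also have "\<dots> = (\<Sum>k=b'..<b. f 0 k) * (\<Prod>i<length (b' # be) - 1. \<Sum>k=(b' # be) ! Suc i..<(b' # be) ! i. f (Suc i) k)"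
    using "3.IH"[of "\<lambda>i. f (Suc i)"] by simp
  also have "\<dots> = (\<Prod>i<length (b # b' # be) - 1. \<Sum>k=(b # b' # be) ! Suc i..<(b # b' # be) ! i. f i k)"
    by (simp add: prod.lessThan_Suc_shift del: prod.lessThan_Suc)
  finally show ?case .
qed auto

lemma geometric_telescope:
  fixes u z :: "'a::comm_ring_1"
  shows "b \<le> a \<Longrightarrow> (\<Sum>k=b..<a. z ^ (a - 1 - k) * u ^ k * (u - z)) = u ^ a - z ^ (a - b) * u ^ b"
proof (induction a)
  case (Suc a)
  show ?case
  proof (cases "b = Suc a")
    case False
    then have b: "b \<le> a" using Suc by simp
    have "(\<Sum>k=b..<Suc a. z ^ (Suc a - 1 - k) * u ^ k * (u - z)) =
      (\<Sum>k=b..<a. z * (z ^ (a - 1 - k) * u ^ k * (u - z))) + u ^ a * (u - z)"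
      using b by (simp add: power_Suc[symmetric] Suc_diff_Suc algebra_simps del: power_Suc)
        (rule sum.cong, auto simp: Suc_diff_Suc[symmetric] algebra_simps)
    also have "\<dots> = z * (u ^ a - z ^ (a - b) * u ^ b) + u ^ a * (u - z)"
      using Suc.IH[OF b] by (simp add: sum_distrib_left[symmetric])
    also have "\<dots> = u ^ Suc a - z ^ (Suc a - b) * u ^ b"
      using b by (simp add: Suc_diff_le algebra_simps)
    finally show ?thesis .
  qed simp
qed simp

text \<open>Subtracting from each row of the determinant a power of \<open>y M\<close> times the
  next row clears the last column except for its bottom entry. The multiplier \<open>L\<close> is
  unitriangular.\<close>

lemma alternant_branch_aux:
  fixes y :: "nat \<Rightarrow> 'a::comm_ring_1"
  assumes len: "length be = Suc M" and dec: "\<forall>i<M. be ! Suc i \<le> be ! i"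
  shows "alternant be y = y M ^ (be ! M) *
    det (mat M M (\<lambda>(i, j). y j ^ (be ! i) - y M ^ (be ! i - be ! Suc i) * y j ^ (be ! Suc i)))"
proof -
  let ?z = "y M"
  let ?n = "Suc M"
  define A where "A = mat ?n ?n (\<lambda>(i, j). y j ^ (be ! i))"
  define L where "L = mat ?n ?n (\<lambda>(i, j). if i = j then 1 else if j = Suc i then - (?z ^ (be ! i - be ! j)) else 0)"
  define B where "B = mat M M (\<lambda>(i, j). y j ^ (be ! i) - ?z ^ (be ! i - be ! Suc i) * y j ^ (be ! Suc i))"
  have cA: "A \<in> carrier_mat ?n ?n" and cL: "L \<in> carrier_mat ?n ?n" by (auto simp: A_def L_def)
  have "upper_triangular L" by (auto simp: L_def)
  from det_upper_triangular[OF this cL] have "det L = prod_list (diag_mat L)" .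
  also have "diag_mat L = map (\<lambda>i. 1) [0..<?n]" unfolding diag_mat_def L_def by (auto simp del: upt_Suc)
  also have "prod_list \<dots> = 1" unfolding map_replicate_const prod_list_replicate by simp
  finally have dL: "det L = 1" .
  have LA: "(L * A) $$ (i, j) = (if i < M then y j ^ (be ! i) - ?z ^ (be ! i - be ! Suc i) * y j ^ (be ! Suc i)
      else y j ^ (be ! i))" if ij: "i < ?n" "j < ?n" for i j
  proof -
    have "(L * A) $$ (i, j) = (\<Sum>k = 0..<?n. L $$ (i, k) * A $$ (k, j))"
      using ij cA cL by (simp add: scalar_prod_def)
    also have "\<dots> = (\<Sum>k\<in>{0..<?n}. (if k = i then y j ^ (be ! i) else 0) +
        (if k = Suc i then - (?z ^ (be ! i - be ! Suc i)) * y j ^ (be ! Suc i) else 0))"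
      by (rule sum.cong) (use ij in \<open>auto simp: L_def A_def\<close>)
    also have "\<dots> = (if i < M then y j ^ (be ! i) - ?z ^ (be ! i - be ! Suc i) * y j ^ (be ! Suc i)
      else y j ^ (be ! i))"
      using ij by (simp add: sum.distrib)
    finally show ?thesis .
  qed
  have cLA: "L * A \<in> carrier_mat ?n ?n" using cA cL by simp
  have "alternant be y = det (L * A)"
    using det_mult[OF cL cA] dL by (simp add: alternant_det len A_def)
  also have "\<dots> = (\<Sum>i<?n. (L * A) $$ (i, M) * cofactor (L * A) i M)"
    using laplace_expansion_column[OF cLA, of M] by simp
  also have "\<dots> = (\<Sum>i<?n. if i = M then ?z ^ (be ! M) * cofactor (L * A) M M else 0)"
  proof (rule sum.cong)
    fix i assume i: "i \<in> {..<?n}"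
    show "(L * A) $$ (i, M) * cofactor (L * A) i M = (if i = M then ?z ^ (be ! M) * cofactor (L * A) M M else 0)"
    proof (cases "i = M")
      case False
      then have "i < M" using i by simp
      then have "?z ^ (be ! i) = ?z ^ (be ! i - be ! Suc i) * ?z ^ (be ! Suc i)"
        using dec by (simp add: power_add[symmetric])
      then show ?thesis using LA[of i M] \<open>i < M\<close> by simp
    qed (use LA[of M M] in simp)
  qed simp
  also have "\<dots> = ?z ^ (be ! M) * cofactor (L * A) M M" by simp
  also have "cofactor (L * A) M M = det (mat_delete (L * A) M M)" by (simp add: cofactor_def)
  also have "mat_delete (L * A) M M = B"
  proof (rule eq_matI)
    fix i j assume "i < dim_row B" "j < dim_col B"
    then have ij: "i < M" "j < M" by (auto simp: B_def)
    then show "mat_delete (L * A) M M $$ (i, j) = B $$ (i, j)"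
      using LA[of i j] cA cL by (simp add: mat_delete_def B_def del: index_mult_mat(1))
  qed (use cLA in \<open>auto simp: mat_delete_def B_def\<close>)
  finally show ?thesis by (simp add: B_def)
qed

text \<open>Each entry of the reduced determinant is \<open>y j - y M\<close> times a geometric sum
  over the exponents in one interval. Expanding these sums in all rows produces the interlacing
  lists.\<close>

lemma alternant_branch:
  fixes y :: "nat \<Rightarrow> 'a::comm_ring_1"
  assumes len: "length be = Suc M" and dec: "\<forall>i<M. be ! Suc i \<le> be ! i"
  shows "alternant be y = (\<Prod>i<M. y i - y M) *
    (\<Sum>ka\<in>interl be. y M ^ ((\<Sum>i<M. be ! i - 1 - ka ! i) + be ! M) * alternant ka y)"
proof -
  let ?z = "y M"
  let ?S = "{w. w permutes {..<M}}"
  let ?B = "mat M M (\<lambda>(i, j). y j ^ (be ! i) - ?z ^ (be ! i - be ! Suc i) * y j ^ (be ! Suc i))"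
  have be: "be \<noteq> []" using len by auto
  have lk: "length ka = M" if "ka \<in> interl be" for ka using that len by (simp add: interl_iff)
  have "(\<Prod>i<M. y i - y M) * (\<Sum>ka\<in>interl be. ?z ^ ((\<Sum>i<M. be ! i - 1 - ka ! i) + be ! M) * alternant ka y) =
    (\<Sum>ka\<in>interl be. \<Sum>w\<in>?S. of_int (sign w) * (?z ^ (be ! M) * (\<Prod>i<M. ?z ^ (be ! i - 1 - ka ! i) * y (w i) ^ (ka ! i) * (y (w i) - ?z))))"
    unfolding sum_distrib_left
  proof (rule sum.cong)
    fix ka assume ka: "ka \<in> interl be"
    show "(\<Prod>i<M. y i - y M) * (?z ^ ((\<Sum>i<M. be ! i - 1 - ka ! i) + be ! M) * alternant ka y) =
      (\<Sum>w\<in>?S. of_int (sign w) * (?z ^ (be ! M) * (\<Prod>i<M. ?z ^ (be ! i - 1 - ka ! i) * y (w i) ^ (ka ! i) * (y (w i) - ?z))))"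
      unfolding alternant_def lk[OF ka] sum_distrib_left
    proof (rule sum.cong)
      fix w assume "w \<in> ?S"
      then have "(\<Prod>i<M. y i - y M) = (\<Prod>i<M. y (w i) - y M)"
        using prod.permute[of w "{..<M}" "\<lambda>i. y i - y M"] by (simp add: comp_def)
      then show "(\<Prod>i<M. y i - y M) * (?z ^ ((\<Sum>i<M. be ! i - 1 - ka ! i) + be ! M) *
          (of_int (sign w) * (\<Prod>i<M. y (w i) ^ ka ! i))) =
        of_int (sign w) * (?z ^ (be ! M) * (\<Prod>i<M. ?z ^ (be ! i - 1 - ka ! i) * y (w i) ^ (ka ! i) * (y (w i) - ?z)))"
        by (simp add: power_add power_sum prod.distrib mult_ac)
    qed simp
  qed simp
  also have "\<dots> = (\<Sum>w\<in>?S. of_int (sign w) * (?z ^ (be ! M) *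
      (\<Sum>ka\<in>interl be. \<Prod>i<M. ?z ^ (be ! i - 1 - ka ! i) * y (w i) ^ (ka ! i) * (y (w i) - ?z))))"
    by (subst sum.swap) (simp add: sum_distrib_left)
  also have "\<dots> = (\<Sum>w\<in>?S. of_int (sign w) * (?z ^ (be ! M) *
      (\<Prod>i<M. y (w i) ^ (be ! i) - ?z ^ (be ! i - be ! Suc i) * y (w i) ^ (be ! Suc i))))"
  proof (rule sum.cong)
    fix w assume "w \<in> ?S"
    have "(\<Sum>ka\<in>interl be. \<Prod>i<M. ?z ^ (be ! i - 1 - ka ! i) * y (w i) ^ (ka ! i) * (y (w i) - ?z)) =
      (\<Prod>i<M. \<Sum>k=be ! Suc i..<be ! i. ?z ^ (be ! i - 1 - k) * y (w i) ^ k * (y (w i) - ?z))"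
      using sum_interl_prod[OF be, of "\<lambda>i k. ?z ^ (be ! i - 1 - k) * y (w i) ^ k * (y (w i) - ?z)"] len by simp
    also have "\<dots> = (\<Prod>i<M. y (w i) ^ (be ! i) - ?z ^ (be ! i - be ! Suc i) * y (w i) ^ (be ! Suc i))"
      by (rule prod.cong, simp, rule geometric_telescope) (use dec in auto)
    finally show "of_int (sign w) * (?z ^ (be ! M) * (\<Sum>ka\<in>interl be. \<Prod>i<M. ?z ^ (be ! i - 1 - ka ! i) * y (w i) ^ (ka ! i) * (y (w i) - ?z))) =
      of_int (sign w) * (?z ^ (be ! M) * (\<Prod>i<M. y (w i) ^ (be ! i) - ?z ^ (be ! i - be ! Suc i) * y (w i) ^ (be ! Suc i)))"
      by simp
  qed simp
  also have "\<dots> = ?z ^ (be ! M) * det ?B"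
  proof -
    have "det ?B = (\<Sum>p\<in>{p. p permutes {0..<M}}. signof p * (\<Prod>i = 0..<M. ?B $$ (i, p i)))"
      by (rule det_def') simp
    also have "\<dots> = (\<Sum>w\<in>?S. of_int (sign w) * (\<Prod>i<M. y (w i) ^ (be ! i) - ?z ^ (be ! i - be ! Suc i) * y (w i) ^ (be ! Suc i)))"
      unfolding lessThan_atLeast0
    proof (rule sum.cong)
      fix p assume "p \<in> {p. p permutes {0..<M}}"
      then have "p i < M" if "i < M" for i
        using that permutes_in_image[of p "{0..<M}" i] by simp
      then show "signof p * (\<Prod>i = 0..<M. ?B $$ (i, p i)) = of_int (sign p) *
        (\<Prod>i = 0..<M. y (p i) ^ (be ! i) - ?z ^ (be ! i - be ! Suc i) * y (p i) ^ (be ! Suc i))" by simp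
    qed simp
    finally show ?thesis by (simp add: sum_distrib_left mult_ac)
  qed
  also have "\<dots> = alternant be y" by (rule alternant_branch_aux[OF len dec, symmetric])
  finally show ?thesis by simp
qed

definition stair :: "nat \<Rightarrow> nat list" where
  "stair N = map (\<lambda>i. N - 1 - i) [0..<N]"

lemma length_stair [simp]: "length (stair N) = N"
  by (simp add: stair_def)

lemma nth_stair [simp]: "i < N \<Longrightarrow> stair N ! i = N - 1 - i"
  by (simp add: stair_def)

lemma interl_stair: "interl (stair (Suc M)) = {stair M}"
proof -
  have "ka \<in> interl (stair (Suc M)) \<longleftrightarrow> ka = stair M" for ka
  proof
    assume "ka \<in> interl (stair (Suc M))"
    then have *: "length ka = M" "\<And>i. i < M \<Longrightarrow> stair (Suc M) ! Suc i \<le> ka ! i \<and> ka ! i < stair (Suc M) ! i"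
      unfolding interl_iff by auto
    show "ka = stair M"
    proof (rule nth_equalityI)
      fix i assume "i < length ka"
      then have i: "i < M" using *(1) by simp
      then show "ka ! i = stair M ! i" using *(2)[OF i] by auto
    qed (simp add: *(1))
  qed (auto simp: interl_iff simp flip: length_0_conv)
  then show ?thesis by auto
qed

lemma alternant_stair_Suc:
  "alternant (stair (Suc M)) y = (\<Prod>i<M. y i - y M) * alternant (stair M) y"
proof -
  have "(\<Sum>i<M. stair (Suc M) ! i - 1 - stair M ! i) + stair (Suc M) ! M = 0" by simp
  then show ?thesis
    by (subst alternant_branch[of _ M]) (auto simp: interl_stair)
qed

lemma alternant_stair:
  "alternant (stair N) y = (\<Prod>(i, j)\<in>{(i, j). i < j \<and> j < N}. y i - y j)"
proof (induction N)
  case (Suc N)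
  have eq: "{(i, j). i < j \<and> j < Suc N} = {(i, j). i < j \<and> j < N} \<union> (\<lambda>i. (i, N)) ` {..<N}"
    by (auto simp: less_Suc_eq)
  have fin: "finite {(i, j). i < j \<and> j < N}"
    by (rule finite_subset[of _ "{..<N} \<times> {..<N}"]) auto
  have "(\<Prod>(i, j)\<in>{(i, j). i < j \<and> j < Suc N}. y i - y j) =
    (\<Prod>(i, j)\<in>{(i, j). i < j \<and> j < N}. y i - y j) * (\<Prod>(i, j)\<in>(\<lambda>i. (i, N)) ` {..<N}. y i - y j)"
    unfolding eq by (rule prod.union_disjoint) (use fin in auto)
  also have "(\<Prod>(i, j)\<in>(\<lambda>i. (i, N)) ` {..<N}. y i - y j) = (\<Prod>i<N. y i - y N)"
    by (subst prod.reindex) (auto simp: inj_on_def)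
  finally show ?case using Suc by (simp add: alternant_stair_Suc mult.commute)
qed (simp add: stair_def)

subsection \<open>Knuth classes of colourings\<close>

lemma length_cexp [simp]: "length (cexp N Z c) = N"
  by (simp add: cexp_def)

lemma nth_cexp [simp]: "i < N \<Longrightarrow> cexp N Z c ! i = csize Z c i + (N - 1 - i)"
  by (simp add: cexp_def)

text \<open>The generating function is symmetric by \<open>csize_permutes\<close>, so in each term
  of the Vandermonde determinant its variables may be permuted along.\<close>

lemma sum_alternant_cexp:
  fixes Om :: "('a::linorder \<Rightarrow> nat) set" and y :: "nat \<Rightarrow> 'b::comm_ring_1"
  assumes fin: "finite Z" and Om: "Om \<subseteq> cols N Z"
    and closed: "\<And>c c'. c \<in> Om \<Longrightarrow> c' \<in> cols N Z \<Longrightarrow> cword N Z c \<simeq> cword N Z c' \<Longrightarrow> c' \<in> Om"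
  shows "(\<Sum>c\<in>Om. (\<Prod>j<N. y j ^ csize Z c j)) * alternant (stair N) y = (\<Sum>c\<in>Om. alternant (cexp N Z c) y)"
proof -
  let ?S = "{w. w permutes {..<N}}"
  have split: "(\<Prod>i<N. u i ^ (cexp N Z c ! i)) = (\<Prod>i<N. u i ^ csize Z c i) * (\<Prod>i<N. u i ^ (N - 1 - i))"
    for u :: "nat \<Rightarrow> 'b" and c
    unfolding prod.distrib[symmetric] by (rule prod.cong[OF refl]) (simp only: lessThan_iff nth_cexp power_add)
  have "(\<Sum>c\<in>Om. alternant (cexp N Z c) y) =
    (\<Sum>w\<in>?S. of_int (sign w) * (\<Sum>c\<in>Om. (\<Prod>i<N. y (w i) ^ csize Z c i) * (\<Prod>i<N. y (w i) ^ (N - 1 - i))))"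
    unfolding alternant_def length_cexp split sum_distrib_left by (rule sum.swap)
  also have "\<dots> = (\<Sum>w\<in>?S. of_int (sign w) * ((\<Sum>c\<in>Om. (\<Prod>j<N. y j ^ csize Z c j)) * (\<Prod>i<N. y (w i) ^ (N - 1 - i))))"
  proof (rule sum.cong)
    fix w assume w: "w \<in> ?S"
    have "(\<Sum>c\<in>Om. (\<Prod>j<N. y j ^ csize Z c j)) = (\<Sum>c\<in>Om. (\<Prod>i<N. y (w i) ^ csize Z c (w i)))"
    proof (rule sum.cong)
      fix c
      show "(\<Prod>j<N. y j ^ csize Z c j) = (\<Prod>i<N. y (w i) ^ csize Z c (w i))"
        using prod.permute[of w "{..<N}" "\<lambda>j. y j ^ csize Z c j"] w by (simp add: comp_def)
    qed simp
    also have "\<dots> = (\<Sum>c\<in>Om. (\<Prod>i<N. y (w i) ^ csize Z c i))"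
      using csize_permutes[OF fin Om closed, where p = w and F = "\<lambda>s. \<Prod>i<N. y (w i) ^ s i"] w by simp
    finally show "of_int (sign w) * (\<Sum>c\<in>Om. (\<Prod>i<N. y (w i) ^ csize Z c i) * (\<Prod>i<N. y (w i) ^ (N - 1 - i))) =
      of_int (sign w) * ((\<Sum>c\<in>Om. (\<Prod>j<N. y j ^ csize Z c j)) * (\<Prod>i<N. y (w i) ^ (N - 1 - i)))"
      by (simp add: sum_distrib_right)
  qed simp
  also have "\<dots> = (\<Sum>c\<in>Om. (\<Prod>j<N. y j ^ csize Z c j)) * alternant (stair N) y"
    unfolding alternant_def length_stair sum_distrib_left
    by (rule sum.cong) (auto simp: mult_ac)
  finally show ?thesis by simp
qed

lemma lattice_unique:
  assumes "finite Z" "c \<in> cols N Z" "c' \<in> cols N Z" "lattice N Z c" "lattice N Z c'" "cword N Z c \<simeq> cword N Z c'"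
  shows "c = c'"
proof -
  have "map (crow Z c) [0..<N] = map (crow Z c') [0..<N]"
    by (rule ctab_unique) (use assms distinct_cword[OF assms(1), of N c] in \<open>simp_all add: lattice_def cword_def\<close>)
  then have *: "crow Z c i = crow Z c' i" if "i < N" for i using that by auto
  have "c a = c' a" if "a \<in> Z" for a
  proof -
    have "c a < N" using assms(2) that by auto
    then have "a \<in> set (crow Z c' (c a))" using *[of "c a"] that assms(1) by (metis (mono_tags, lifting) mem_Collect_eq set_crow)
    then show ?thesis using assms(1) by (simp add: set_crow)
  qed
  then show ?thesis using assms(2,3) by (metis PiE_ext)
qed

text \<open>All members of the class cancel except its only tableau. Thus the row lengths over a
  Knuth class are distributed as a Schur polynomial.\<close>

lemma lattice_class_alternant:
  fixes U :: "'a::linorder \<Rightarrow> nat" and y :: "nat \<Rightarrow> 'b::{idom, ring_char_0}"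
  assumes fin: "finite Z" and U: "U \<in> cols N Z" "lattice N Z U"
  shows "(\<Sum>c\<in>{c\<in>cols N Z. cword N Z c \<simeq> cword N Z U}. (\<Prod>j<N. y j ^ csize Z c j)) * alternant (stair N) y =
    alternant (cexp N Z U) y"
proof -
  let ?Om = "{c\<in>cols N Z. cword N Z c \<simeq> cword N Z U}"
  have "(\<Sum>c\<in>?Om. (\<Prod>j<N. y j ^ csize Z c j)) * alternant (stair N) y = (\<Sum>c\<in>?Om. alternant (cexp N Z c) y)"
    by (rule sum_alternant_cexp[OF fin]) (auto intro: pl_trans pl_sym)
  also have "\<dots> = (\<Sum>c\<in>{c\<in>?Om. lattice N Z c}. alternant (cexp N Z c) y)"
    by (rule lattice_sum[OF fin _ alt_alternant]) (auto intro: pl_trans pl_sym)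
  also have "{c\<in>?Om. lattice N Z c} = {U}"
    using U lattice_unique[OF fin] by auto
  finally show ?thesis by simp
qed

section \<open>Bernstein operators on functions of exponent lists\<close>

fun ee :: "'a::comm_ring_1 \<Rightarrow> int \<Rightarrow> (nat list \<Rightarrow> 'a) \<Rightarrow> nat list \<Rightarrow> 'a" where
  "ee t k f [] = (if k = 0 then f [] else 0)"
| "ee t k f (b # be) = ee t k (\<lambda>x. f (b # x)) be - (if b = 0 then 0 else t * ee t (k - 1) (\<lambda>x. f ((b - 1) # x)) be)"

fun boxsum :: "'a::comm_ring_1 \<Rightarrow> (nat \<Rightarrow> nat list \<Rightarrow> 'a) \<Rightarrow> nat list \<Rightarrow> 'a" where
  "boxsum t F [] = F 0 []"
| "boxsum t F (b # be) = (\<Sum>j\<le>b. t ^ j * boxsum t (\<lambda>k x. F (k + j) ((b - j) # x)) be)"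

definition del :: "nat \<Rightarrow> 'b list \<Rightarrow> 'b list" where
  "del i xs = take i xs @ drop (Suc i) xs"

text \<open>The operator D_m on coefficients. One entry of \<open>al\<close> is taken as the new
  first exponent: with L the length of \<open>al\<close>, it equals m + L - 1 minus the number of
  lowered entries. The sign is the cost of moving that entry to the front.\<close>

definition crea :: "'a::comm_ring_1 \<Rightarrow> nat \<Rightarrow> (nat list \<Rightarrow> 'a) \<Rightarrow> nat list \<Rightarrow> 'a" where
  "crea t m f al = (\<Sum>i<length al. (- 1) ^ i * ee t (int m + int (length al) - 1 - int (al ! i)) f (del i al))"

text \<open>The operator B_n. The new first row has length n plus the k boxes that the others lose;
  \<open>length be\<close> is the staircase part of its exponent.\<close>

definition annih :: "'a::comm_ring_1 \<Rightarrow> nat \<Rightarrow> (nat list \<Rightarrow> 'a) \<Rightarrow> nat list \<Rightarrow> 'a" where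
  "annih t n g be = boxsum t (\<lambda>k ka. g ((n + length be + k) # ka)) be"

lemma length_del [simp]: "i < length xs \<Longrightarrow> length (del i xs) = length xs - 1"
  by (simp add: del_def)

lemma del_0 [simp]: "del 0 (x # xs) = xs"
  by (simp add: del_def)

lemma del_Suc [simp]: "del (Suc i) (x # xs) = x # del i xs"
  by (simp add: del_def)

lemma ee_add: "ee t k (\<lambda>x. f x + g x) be = ee t k f be + ee t k g be"
  by (induction be arbitrary: k f g) (auto simp: algebra_simps)

lemma ee_mult: "ee t k (\<lambda>x. c * f x) be = c * ee t k f be"
  by (induction be arbitrary: k f) (auto simp: algebra_simps)

lemma ee_zero: "ee t k (\<lambda>x. 0) be = 0"
  by (induction be arbitrary: k) auto

lemma ee_sum: "ee t k (\<lambda>x. \<Sum>i\<in>A. f i x) be = (\<Sum>i\<in>A. ee t k (f i) be)"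
  by (induction A rule: infinite_finite_induct) (auto simp: ee_zero ee_add)

lemma ee_cong: "(\<And>x. length x = length be \<Longrightarrow> f x = g x) \<Longrightarrow> ee t k f be = ee t k g be"
proof (induction be arbitrary: k f g)
  case (Cons b be)
  have "ee t k' (\<lambda>x. f (c # x)) be = ee t k' (\<lambda>x. g (c # x)) be" for k' c
    by (rule Cons.IH) (use Cons.prems in auto)
  then show ?case by (simp del: One_nat_def)
qed auto

lemma ee_big: "k < 0 \<or> int (length be) < k \<Longrightarrow> ee t k f be = 0"
  by (induction be arbitrary: k f) auto

lemma boxsum_add: "boxsum t (\<lambda>k x. F k x + G k x) be = boxsum t F be + boxsum t G be"
  by (induction be arbitrary: F G) (auto simp: algebra_simps sum.distrib)

lemma boxsum_mult: "boxsum t (\<lambda>k x. c * F k x) be = c * boxsum t F be"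
  by (induction be arbitrary: F) (auto simp: sum_distrib_left mult_ac)

lemma boxsum_zero: "boxsum t (\<lambda>k x. 0) be = 0"
  by (induction be) auto

lemma boxsum_diff: "boxsum t (\<lambda>k x. F k x - G k x) be = boxsum t F be - boxsum t G be"
  using boxsum_add[of t F "\<lambda>k x. (- 1) * G k x" be] boxsum_mult[of t "- 1" G be] by simp

lemma boxsum_sum: "boxsum t (\<lambda>k x. \<Sum>i\<in>A. F i k x) be = (\<Sum>i\<in>A. boxsum t (F i) be)"
  by (induction A rule: infinite_finite_induct) (auto simp: boxsum_zero boxsum_add)

lemma boxsum_cong:
  "(\<And>k x. length x = length be \<Longrightarrow> k + sum_list x = sum_list be \<Longrightarrow> F k x = G k x) \<Longrightarrow> boxsum t F be = boxsum t G be"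
proof (induction be arbitrary: F G)
  case (Cons b be)
  have "boxsum t (\<lambda>k x. F (k + j) ((b - j) # x)) be = boxsum t (\<lambda>k x. G (k + j) ((b - j) # x)) be" if "j \<le> b" for j
    by (rule Cons.IH) (use Cons.prems that in auto)
  then show ?case by (auto intro!: sum.cong)
qed auto

lemma ee_boxsum: "ee t l (boxsum t F) be = boxsum t (\<lambda>k. ee t l (F k)) be"
proof (induction be arbitrary: l F)
  case (Cons b be)
  have E: "ee t l' (\<lambda>x. boxsum t F (c # x)) be = (\<Sum>j\<le>c. t ^ j * boxsum t (\<lambda>k. ee t l' (\<lambda>x. F (k + j) ((c - j) # x))) be)" for l' c
    by (simp add: ee_sum ee_mult Cons.IH)
  have R: "boxsum t (\<lambda>k. ee t l (F k)) (b # be) =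
      (\<Sum>j\<le>b. t ^ j * boxsum t (\<lambda>k. ee t l (\<lambda>x. F (k + j) ((b - j) # x))) be) -
      (\<Sum>j\<le>b. if b - j = 0 then 0 else t ^ j * (t * boxsum t (\<lambda>k. ee t (l - 1) (\<lambda>x. F (k + j) ((b - j - 1) # x))) be))"
    unfolding sum_subtractf[symmetric] boxsum.simps
    by (rule sum.cong) (auto simp: boxsum_diff boxsum_mult boxsum_zero algebra_simps)
  show ?case
  proof (cases b)
    case (Suc b')
    have eq: "(\<Sum>j\<le>b. if b - j = 0 then 0 else t ^ j * (t * boxsum t (\<lambda>k. ee t (l - 1) (\<lambda>x. F (k + j) ((b - j - 1) # x))) be)) =
      t * (\<Sum>j\<le>b'. t ^ j * boxsum t (\<lambda>k. ee t (l - 1) (\<lambda>x. F (k + j) ((b' - j) # x))) be)"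
      unfolding Suc sum_distrib_left by (simp add: mult_ac Suc_diff_le)
    have "ee t l (boxsum t F) (b # be) = ee t l (\<lambda>x. boxsum t F (b # x)) be - t * ee t (l - 1) (\<lambda>x. boxsum t F (b' # x)) be"
      by (simp only: ee.simps Suc nat.distinct if_False diff_Suc_1)
    then show ?thesis by (simp only: E R eq)
  qed (simp add: R E Cons.IH)
qed simp

text \<open>The two generating products are inverse to each other. Over the first entry of the list
  this is a telescoping sum.\<close>

lemma boxsum_ee_inverse:
  "boxsum t (\<lambda>k. ee t (K - int k) f) be = (if K = 0 then f be else 0)"
proof (induction be arbitrary: K f)
  case (Cons b be)
  define h where "h j = (if K = int j then f ((b - j) # be) else 0)" for j
  have A: "boxsum t (\<lambda>k. ee t (K - int (k + j)) (\<lambda>x. f ((b - j) # x))) be = h j" for j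
    using Cons.IH[of "K - int j" "\<lambda>x. f ((b - j) # x)"] by (auto simp: h_def algebra_simps)
  have B: "boxsum t (\<lambda>k. ee t (K - int (k + j) - 1) (\<lambda>x. f ((b - j - 1) # x))) be = h (Suc j)" for j
    using Cons.IH[of "K - int (Suc j)" "\<lambda>x. f ((b - Suc j) # x)"] by (auto simp: h_def algebra_simps)
  have "boxsum t (\<lambda>k. ee t (K - int k) f) (b # be) =
      (\<Sum>j\<le>b. t ^ j * h j) - (\<Sum>j\<le>b. if b - j = 0 then 0 else t ^ Suc j * h (Suc j))"
    unfolding sum_subtractf[symmetric] boxsum.simps
  proof (rule sum.cong)
    fix j assume "j \<in> {..b}"
    show "t ^ j * boxsum t (\<lambda>k x. ee t (K - int (k + j)) f ((b - j) # x)) be =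
      t ^ j * h j - (if b - j = 0 then 0 else t ^ Suc j * h (Suc j))"
      unfolding ee.simps boxsum_diff A
      by (cases "b - j = 0") (simp_all only: if_True if_False boxsum_zero boxsum_mult B, simp_all add: boxsum_zero algebra_simps)
  qed simp
  also have "\<dots> = h 0"
  proof (cases b)
    case (Suc b')
    have "(\<Sum>j\<le>b. if b - j = 0 then 0 else t ^ Suc j * h (Suc j)) = (\<Sum>j\<le>b'. t ^ Suc j * h (Suc j))"
      unfolding Suc by (simp add: sum.atMost_Suc)
    moreover have "(\<Sum>j\<le>b. t ^ j * h j) = h 0 + (\<Sum>j\<le>b'. t ^ Suc j * h (Suc j))"
      unfolding Suc by (subst sum.atMost_Suc_shift) simp
    ultimately show ?thesis by simp
  qed simp
  finally show ?case by (simp add: h_def)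
qed auto

lemma boxsum_split:
  "i < length be \<Longrightarrow> boxsum t (\<lambda>k x. G k (x ! i) (del i x)) be =
    (\<Sum>j\<le>be ! i. t ^ j * boxsum t (\<lambda>k. G (k + j) (be ! i - j)) (del i be))"
proof (induction be arbitrary: i G)
  case (Cons b be)
  show ?case
  proof (cases i)
    case (Suc i')
    then have i': "i' < length be" using Cons.prems by simp
    have "boxsum t (\<lambda>k x. G (k + l) (x ! i') ((b - l) # del i' x)) be =
      (\<Sum>j\<le>be ! i'. t ^ j * boxsum t (\<lambda>k x. G (k + j + l) (be ! i' - j) ((b - l) # x)) (del i' be))" for l
      using Cons.IH[OF i', of "\<lambda>k c z. G (k + l) c ((b - l) # z)"] by simp
    then have "boxsum t (\<lambda>k x. G k (x ! i) (del i x)) (b # be) =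
      (\<Sum>l\<le>b. \<Sum>j\<le>be ! i'. t ^ j * (t ^ l * boxsum t (\<lambda>k x. G (k + j + l) (be ! i' - j) ((b - l) # x)) (del i' be)))"
      by (simp add: Suc sum_distrib_left mult_ac)
    also have "\<dots> = (\<Sum>j\<le>(b # be) ! i. t ^ j * boxsum t (\<lambda>k. G (k + j) ((b # be) ! i - j)) (del i (b # be)))"
      by (subst sum.swap) (simp add: Suc sum_distrib_left add_ac)
    finally show ?thesis .
  qed simp
qed simp

text \<open>In \<open>crea\<close> the term that takes out the freshly added first entry leaves the
  product of two inverse series, hence the Kronecker delta. In the other terms the entry taken out
  contributes a geometric series, the sum over j, and the first entry is either kept or lowered,
  which gives the two summands.\<close>

lemma annih_crea:
  assumes S: "\<forall>b\<in>set be. b \<le> S"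
  shows "annih t n (crea t m f) be = (if m = n then f be else 0) -
    (\<Sum>j\<le>S. t ^ j * (crea t (m + j + 1) (annih t (n + j + 1) f) be - t * crea t (m + j) (annih t (n + j) f) be))"
proof -
  define M where "M = length be"
  define E where "E p q i = ee t (p + int M - 1 - int (be ! i)) (\<lambda>z. boxsum t (\<lambda>k ka. f ((q + k) # ka)) z) (del i be)" for p q i
  define G where "G k c z = ee t (int m + int M - int c) (\<lambda>x. f ((n + M + k) # x)) z -
      t * ee t (int m + int M - int c - 1) (\<lambda>x. f ((n + M + k - 1) # x)) z" for k c z
  have cr: "crea t p (annih t q f) be = (\<Sum>i<M. (- 1) ^ i * E (int p) (q + M - 1) i)" for p q
    unfolding crea_def E_def M_def[symmetric]
  proof (intro sum.cong refl arg_cong2[where f = "(*)"] ee_cong)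
    fix i and x :: "nat list" assume "i \<in> {..<M}" "length x = length (del i be)"
    then have "length x = M - 1" "0 < M" by (auto simp: M_def)
    then show "annih t q f x = boxsum t (\<lambda>k ka. f ((q + M - 1 + k) # ka)) x" by (simp add: annih_def)
  qed
  \<comment> \<open>The first summand takes out the new first entry; \<open>G\<close> collects both
    ways in which that entry can stay.\<close>
  have "crea t m f ((n + M + k) # ka) = ee t (int m - int n - int k) f ka - (\<Sum>i<M. (- 1) ^ i * G k (ka ! i) (del i ka))"
    if "length ka = M" for k ka
    unfolding crea_def that length_Cons
    by (subst sum.lessThan_Suc_shift) (simp add: that G_def sum_negf, simp add: algebra_simps)
  then have "annih t n (crea t m f) be = boxsum t (\<lambda>k ka. ee t (int m - int n - int k) f ka -
      (\<Sum>i<M. (- 1) ^ i * G k (ka ! i) (del i ka))) be"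
    unfolding annih_def M_def[symmetric] by (intro boxsum_cong) (simp add: M_def)
  also have "\<dots> = boxsum t (\<lambda>k. ee t (int m - int n - int k) f) be -
      (\<Sum>i<M. (- 1) ^ i * boxsum t (\<lambda>k ka. G k (ka ! i) (del i ka)) be)"
    by (simp add: boxsum_diff boxsum_sum boxsum_mult)
  also have "boxsum t (\<lambda>k. ee t (int m - int n - int k) f) be = (if m = n then f be else 0)"
    using boxsum_ee_inverse[of t "int m - int n" f be] by simp
  also have "(\<Sum>i<M. (- 1) ^ i * boxsum t (\<lambda>k ka. G k (ka ! i) (del i ka)) be) =
      (\<Sum>i<M. (- 1) ^ i * (\<Sum>j\<le>S. t ^ j * (E (int (m + j + 1)) (n + j + 1 + M - 1) i - t * E (int (m + j)) (n + j + M - 1) i)))"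
  proof (intro sum.cong refl arg_cong2[where f = "(*)"])
    fix i assume "i \<in> {..<M}"
    then have i: "i < length be" by (simp add: M_def)
    have "boxsum t (\<lambda>k ka. G k (ka ! i) (del i ka)) be =
        (\<Sum>j\<le>be ! i. t ^ j * boxsum t (\<lambda>k. G (k + j) (be ! i - j)) (del i be))"
      by (rule boxsum_split[OF i])
    also have "\<dots> = (\<Sum>j\<le>be ! i. t ^ j * (E (int (m + j + 1)) (n + j + 1 + M - 1) i - t * E (int (m + j)) (n + j + M - 1) i))"
    proof (intro sum.cong refl arg_cong2[where f = "(*)"])
      fix j assume j: "j \<in> {..be ! i}"
      have 1: "int m + int M - int (be ! i - j) = int (m + j + 1) + int M - 1 - int (be ! i)"
        and 2: "int (m + j + 1) + int M - 1 - int (be ! i) - 1 = int (m + j) + int M - 1 - int (be ! i)"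
        using j by auto
      have 3: "n + j + 1 + M - 1 + k = n + M + (k + j)" "n + j + M - 1 + k = n + M + (k + j) - 1" for k
        using i by (auto simp: M_def)
      show "boxsum t (\<lambda>k. G (k + j) (be ! i - j)) (del i be) =
        E (int (m + j + 1)) (n + j + 1 + M - 1) i - t * E (int (m + j)) (n + j + M - 1) i"
        unfolding E_def G_def 1 2 3 ee_boxsum boxsum_diff boxsum_mult ..
    qed
    also have "\<dots> = (\<Sum>j\<le>S. t ^ j * (E (int (m + j + 1)) (n + j + 1 + M - 1) i - t * E (int (m + j)) (n + j + M - 1) i))"
    \<comment> \<open>For j beyond \<open>be ! i\<close> the degree asked of \<open>ee\<close>
      exceeds the number of entries it acts on.\<close>
    proof (rule sum.mono_neutral_left)
      show "{..be ! i} \<subseteq> {..S}" using S i by (auto dest: nth_mem)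
      show "\<forall>j\<in>{..S} - {..be ! i}. t ^ j * (E (int (m + j + 1)) (n + j + 1 + M - 1) i - t * E (int (m + j)) (n + j + M - 1) i) = 0"
        unfolding E_def using i by (auto simp: M_def ee_big)
    qed simp
    finally show "boxsum t (\<lambda>k ka. G k (ka ! i) (del i ka)) be = \<dots>" .
  qed
  also have "\<dots> = (\<Sum>j\<le>S. t ^ j * (crea t (m + j + 1) (annih t (n + j + 1) f) be - t * crea t (m + j) (annih t (n + j) f) be))"
    unfolding cr sum_distrib_left right_diff_distrib sum_subtractf
    by (intro arg_cong2[where f = "(-)"]; subst sum.swap; intro sum.cong refl; simp add: mult_ac)
  finally show ?thesis .
qed

section \<open>Iterated operators and their orthogonality\<close>

primrec annihs :: "'a::comm_ring_1 \<Rightarrow> nat list \<Rightarrow> (nat list \<Rightarrow> 'a) \<Rightarrow> 'a" where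
  "annihs t [] g = g []"
| "annihs t (n # nu) g = annihs t nu (annih t n g)"

primrec creas :: "'a::comm_ring_1 \<Rightarrow> nat list \<Rightarrow> nat list \<Rightarrow> 'a" where
  "creas t [] = (\<lambda>al. if al = [] then 1 else 0)"
| "creas t (m # mu) = crea t m (creas t mu)"

text \<open>Supplies a bound S for the commutation relation: \<open>annihs\<close> consults only
  lists of bounded sum, so one finite range of j serves for all of them.\<close>

lemma annihs_local:
  "\<exists>b. \<forall>g g'. (\<forall>al. length al = length nu \<longrightarrow> sum_list al \<le> b \<longrightarrow> g al = g' al) \<longrightarrow> annihs t nu g = annihs t nu g'"
proof (induction nu)
  case (Cons n nu)
  then obtain b where b: "\<And>g g'. (\<forall>al. length al = length nu \<longrightarrow> sum_list al \<le> b \<longrightarrow> g al = g' al) \<Longrightarrow> annihs t nu g = annihs t nu g'"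
    by blast
  show ?case
  proof (intro exI allI impI)
    fix g g' :: "nat list \<Rightarrow> 'a"
    assume *: "\<forall>al. length al = length (n # nu) \<longrightarrow> sum_list al \<le> n + length nu + b \<longrightarrow> g al = g' al"
    have "annih t n g be = annih t n g' be" if "length be = length nu" "sum_list be \<le> b" for be
      unfolding annih_def by (rule boxsum_cong) (use * that in auto)
    then show "annihs t (n # nu) g = annihs t (n # nu) g'" using b by simp
  qed
qed auto

lemma annihs_cong: "(\<And>al. length al = length nu \<Longrightarrow> g al = g' al) \<Longrightarrow> annihs t nu g = annihs t nu g'"
  using annihs_local[of nu t] by blast

lemma annih_add: "annih t n (\<lambda>x. f x + g x) = (\<lambda>x. annih t n f x + annih t n g x)"
  by (rule ext) (simp add: annih_def boxsum_add)

lemma annih_mult: "annih t n (\<lambda>x. c * f x) = (\<lambda>x. c * annih t n f x)"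
  by (rule ext) (simp add: annih_def boxsum_mult)

lemma annihs_add: "annihs t nu (\<lambda>x. f x + g x) = annihs t nu f + annihs t nu g"
  by (induction nu arbitrary: f g) (auto simp: annih_add)

lemma annihs_mult: "annihs t nu (\<lambda>x. c * f x) = c * annihs t nu f"
  by (induction nu arbitrary: f) (auto simp: annih_mult)

lemma annihs_zero: "annihs t nu (\<lambda>x. 0) = 0"
  using annihs_mult[of t nu 0 "\<lambda>x. 0"] by simp

lemma annihs_diff: "annihs t nu (\<lambda>x. f x - g x) = annihs t nu f - annihs t nu g"
  using annihs_add[of t nu f "\<lambda>x. (- 1) * g x"] annihs_mult[of t nu "- 1" g] by simp

lemma annihs_sum: "annihs t nu (\<lambda>x. \<Sum>i\<in>A. f i x) = (\<Sum>i\<in>A. annihs t nu (f i))"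
  by (induction A rule: infinite_finite_induct) (auto simp: annihs_zero annihs_add)

definition qnum :: "'a::comm_ring_1 \<Rightarrow> nat \<Rightarrow> 'a" where
  "qnum t k = (\<Sum>i<k. t ^ i)"

text \<open>Creation of a part larger than everything in \<open>nu\<close> is killed by
  \<open>annihs t nu\<close>, so in the commutation relation only a term with j = 0 survives. Each
  part equal to m then contributes a delta and a factor t, which add up to 1 + t + ... over the
  multiplicity of m.\<close>

lemma annihs_crea:
  "sorted_wrt (\<ge>) nu \<Longrightarrow> \<forall>k\<in>set nu. k \<le> m \<Longrightarrow>
    annihs t nu (crea t m f) = qnum t (count_list nu m) * annihs t (tl nu) f"
proof (induction nu arbitrary: m f)
  case Nil
  then show ?case by (simp add: crea_def qnum_def)
next
  case (Cons n nu)
  note IH = Cons.IH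
  have nu: "sorted_wrt (\<ge>) nu" "\<forall>k\<in>set nu. k \<le> n" "n \<le> m" using Cons.prems by auto
  from annihs_local[of nu t] obtain S where S:
    "\<And>g g'. (\<forall>al. length al = length nu \<longrightarrow> sum_list al \<le> S \<longrightarrow> g al = g' al) \<Longrightarrow> annihs t nu g = annihs t nu g'" by blast
  have big: "annihs t nu (crea t p h) = 0" if "n < p" for p h
  proof -
    have le: "\<forall>k\<in>set nu. k < p" using nu(2) that le_less_trans by blast
    then have "count_list nu p = 0" by (auto simp: count_list_0_iff)
    then show ?thesis using IH[OF nu(1), of p h] le by (auto simp: qnum_def less_imp_le)
  qed
  have "annihs t (n # nu) (crea t m f) = annihs t nu (\<lambda>be. (if m = n then f be else 0) -
    (\<Sum>j\<le>S. t ^ j * (crea t (m + j + 1) (annih t (n + j + 1) f) be - t * crea t (m + j) (annih t (n + j) f) be)))"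
    unfolding annihs.simps
  proof (rule S, intro allI impI)
    fix be assume "sum_list be \<le> S"
    then have "\<forall>b\<in>set be. b \<le> S" using member_le_sum_list by force
    then show "annih t n (crea t m f) be = (if m = n then f be else 0) -
    (\<Sum>j\<le>S. t ^ j * (crea t (m + j + 1) (annih t (n + j + 1) f) be - t * crea t (m + j) (annih t (n + j) f) be))"
      by (rule annih_crea)
  qed
  also have "\<dots> = (if m = n then annihs t nu f else 0) -
      (\<Sum>j\<le>S. t ^ j * (0 - t * annihs t nu (crea t (m + j) (annih t (n + j) f))))"
    using nu by (simp add: annihs_diff annihs_sum annihs_mult annihs_zero big del: add_Suc_right)
  also have "(\<Sum>j\<le>S. t ^ j * (0 - t * annihs t nu (crea t (m + j) (annih t (n + j) f)))) =
      (\<Sum>j\<in>{0}. t ^ j * (0 - t * annihs t nu (crea t (m + j) (annih t (n + j) f))))"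
    by (rule sum.mono_neutral_right) (use nu in \<open>auto simp: big\<close>)
  finally have eq: "annihs t (n # nu) (crea t m f) = (if m = n then annihs t nu f else 0) +
      t * annihs t nu (crea t m (annih t n f))" by simp
  show ?case
  proof (cases "m = n")
    case True
    have "annihs t nu (crea t m (annih t n f)) = qnum t (count_list nu m) * annihs t nu f"
    proof (cases "count_list nu m")
      case (Suc c)
      then have "m \<in> set nu" using count_list_0_iff[of nu m] by auto
      then have "nu \<noteq> []" "hd nu = n" using nu True by (cases nu; fastforce)+
      then have "annihs t (tl nu) (annih t n f) = annihs t nu f" by (cases nu) auto
      then show ?thesis using IH[OF nu(1), of m "annih t n f"] nu True by auto
    qed (use IH[OF nu(1), of m "annih t n f"] nu True in \<open>auto simp: qnum_def\<close>)
    moreover have "qnum t (Suc c) = 1 + t * qnum t c" for c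
      unfolding qnum_def by (subst sum.lessThan_Suc_shift) (simp add: sum_distrib_left)
    ultimately show ?thesis using eq True by (simp add: algebra_simps)
  next
    case False
    then have "n < m" using nu by simp
    then have "count_list nu m = 0" using nu(2) by (force simp: count_list_0_iff)
    then show ?thesis using eq False nu big[OF \<open>n < m\<close>, of "annih t n f"] by (simp add: qnum_def)
  qed
qed

lemma ee_bounded:
  "(\<And>al. length al = length be \<Longrightarrow> \<exists>a\<in>set al. B < a \<Longrightarrow> f al = 0) \<Longrightarrow> \<exists>a\<in>set be. Suc B < a \<Longrightarrow> ee t k f be = 0"
proof (induction be arbitrary: k f)
  case (Cons b be)
  show ?case
  proof (cases "Suc B < b")
    case True
    then have "ee t k' (\<lambda>x. f (c # x)) be = 0" if "b - 1 \<le> c" for k' c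
    proof -
      have "B < c" using True that by simp
      then have "ee t k' (\<lambda>x. f (c # x)) be = ee t k' (\<lambda>x. 0) be"
        by (intro ee_cong Cons.prems(1)) auto
      then show ?thesis by (simp add: ee_zero)
    qed
    then show ?thesis by simp
  next
    case False
    have "ee t k' (\<lambda>x. f (c # x)) be = 0" for k' c
      by (rule Cons.IH) (use Cons.prems False in auto)
    then show ?thesis by simp
  qed
qed auto

lemma creas_bounded:
  "length al = length mu \<Longrightarrow> \<forall>k\<in>set mu. k \<le> m \<Longrightarrow> \<exists>a\<in>set al. m + length mu \<le> a \<Longrightarrow> creas t mu al = 0"
proof (induction mu arbitrary: al)
  case (Cons k mu)
  then obtain p where p: "p < length al" "m + length (k # mu) \<le> al ! p" by (auto simp: in_set_conv_nth)
  have "ee t (int k + int (length al) - 1 - int (al ! i)) (creas t mu) (del i al) = 0" if i: "i < length al" for i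
  proof (cases "i = p")
    case True
    then show ?thesis using p Cons.prems by (intro ee_big) auto
  next
    case False
    have "al ! p \<in> set (del i al)"
    proof -
      have "al = take i al @ al ! i # drop (Suc i) al" using i by (rule id_take_nth_drop)
      then have "al ! p \<in> set (del i al) \<or> al ! p = al ! i" 
        using p(1) nth_mem[of p al] unfolding del_def by (metis Un_iff insert_iff list.simps(15) set_append)
      moreover have "p < i \<Longrightarrow> al ! p \<in> set (take i al)" using p(1) by (auto simp: in_set_conv_nth)
      moreover have "i < p \<Longrightarrow> al ! p \<in> set (drop (Suc i) al)"
        using p(1) by (auto simp: in_set_conv_nth intro!: exI[of _ "p - Suc i"])
      ultimately show ?thesis using False unfolding del_def by (metis Un_iff nat_neq_iff set_append)
    qed
    then obtain a where a: "a \<in> set (del i al)" "m + length (k # mu) \<le> a" using p by auto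
    have "length mu > 0" using False i p Cons.prems by (cases mu) auto
    then have "\<exists>a\<in>set (del i al). Suc (m + length mu - 1) < a" using a by (intro bexI[of _ a]) auto
    then show ?thesis
    proof (rule ee_bounded[rotated])
      fix be assume "length be = length (del i al)" "\<exists>a\<in>set be. m + length mu - 1 < a"
      then obtain a where "a \<in> set be" "m + length mu - 1 < a" "length be = length mu" using i Cons.prems by auto
      then show "creas t mu be = 0" using Cons.prems by (intro Cons.IH) (auto intro!: bexI[of _ a])
    qed
  qed
  then show ?case by (simp add: crea_def)
qed simp

primrec vnorm :: "'a::comm_ring_1 \<Rightarrow> nat list \<Rightarrow> 'a" where
  "vnorm t [] = 1"
| "vnorm t (m # mu) = qnum t (count_list (m # mu) m) * vnorm t mu"

text \<open>The first parts are compared. If that of \<open>nu\<close> is larger,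
  \<open>annih\<close> asks for an entry beyond the support of \<open>creas t mu\<close>; if it is
  smaller, creation of m is killed; if they are equal, one part is split off on both sides.\<close>

theorem annihs_creas:
  "length nu = length mu \<Longrightarrow> sorted_wrt (\<ge>) nu \<Longrightarrow> sorted_wrt (\<ge>) mu \<Longrightarrow>
    annihs t nu (creas t mu) = (if nu = mu then vnorm t mu else 0)"
proof (induction mu arbitrary: nu)
  case (Cons m mu)
  then obtain n nu' where nu: "nu = n # nu'" by (cases nu) auto
  have len: "length nu' = length mu" using Cons.prems nu by simp
  consider "m < n" | "n < m" | "n = m" by linarith
  then show ?case
  proof cases
    case 1
    have "annih t n (creas t (m # mu)) be = 0" if "length be = length nu'" for be
    proof -
      have "annih t n (creas t (m # mu)) be = boxsum t (\<lambda>k x. 0) be"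
        unfolding annih_def
      proof (rule boxsum_cong)
        fix k and x :: "nat list" assume "length x = length be"
        then show "creas t (m # mu) ((n + length be + k) # x) = 0"
          using Cons.prems(3) 1 that len by (intro creas_bounded[where m = m]) auto
      qed
      then show ?thesis by (simp add: boxsum_zero)
    qed
    then show ?thesis using annihs_cong[of nu' "annih t n (creas t (m # mu))" "\<lambda>x. 0" t] 1 nu by (simp add: annihs_zero)
  next
    case 2
    have le: "\<forall>k\<in>set nu. k < m" using 2 Cons.prems(2) nu by auto
    then have "count_list nu m = 0" by (auto simp: count_list_0_iff)
    then show ?thesis using annihs_crea[OF Cons.prems(2), of m t "creas t mu"] le 2 nu by (auto simp: qnum_def less_imp_le)
  next
    case 3
    then show ?thesis using annihs_crea[of nu m t "creas t mu"] Cons.prems Cons.IH[of nu'] nu len by auto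
  qed
qed simp

subsection \<open>Alternating functions\<close>

lemma alt_Cons: "alt g \<Longrightarrow> alt (\<lambda>x. g (b # x))"
  unfolding alt_def by (metis append_Cons)

lemma alt_pair: "alt g \<Longrightarrow> g (a # b # x) = - g (b # a # x)"
  by (metis altD append_Nil)

lemma alt_eq_0:
  fixes g :: "'b list \<Rightarrow> 'a::{idom, ring_char_0}"
  assumes "alt g"
  shows "g (xs @ a # a # ys) = 0"
proof -
  have "g (xs @ a # a # ys) = - g (xs @ a # a # ys)" by (rule altD[OF assms])
  then have "g (xs @ a # a # ys) + g (xs @ a # a # ys) = 0" unfolding eq_neg_iff_add_eq_0 .
  then show ?thesis by (simp flip: mult_2)
qed

lemma alt_move:
  fixes g :: "'b list \<Rightarrow> 'a::comm_ring_1"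
  shows "alt g \<Longrightarrow> g (xs @ a # ys) = (- 1) ^ length xs * g (a # xs @ ys)"
proof (induction xs arbitrary: g)
  case (Cons x xs)
  have "g ((x # xs) @ a # ys) = (- 1) ^ length xs * g (x # a # xs @ ys)"
    using Cons.IH[OF alt_Cons[OF Cons.prems], of x] by simp
  then show ?case using alt_pair[OF Cons.prems, of x a "xs @ ys"] by simp
qed simp

lemma alt_repeat:
  fixes g :: "'b list \<Rightarrow> 'a::{idom, ring_char_0}"
  assumes "alt g" "a \<in> set ys"
  shows "g (a # ys) = 0"
proof -
  obtain xs zs where ys: "ys = xs @ a # zs" using assms(2) by (meson split_list)
  have "g ((a # xs) @ a # zs) = (- 1) ^ length (a # xs) * g (a # (a # xs) @ zs)"
    by (rule alt_move[OF assms(1)])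
  moreover have "g (a # a # xs @ zs) = 0" using alt_eq_0[OF assms(1), of "[]"] by simp
  ultimately show ?thesis by (simp add: ys)
qed

lemma ee_neg: "ee t k (\<lambda>x. - f x) be = - ee t k f be"
  using ee_mult[of t k "- 1" f be] by simp

lemma boxsum_neg: "boxsum t (\<lambda>k x. - F k x) be = - boxsum t F be"
  using boxsum_mult[of t "- 1" F be] by simp

lemma ee_alt: "alt f \<Longrightarrow> ee t k f (xs @ a # b # ys) = - ee t k f (xs @ b # a # ys)"
proof (induction xs arbitrary: k f)
  case Nil
  have sw: "ee t k (\<lambda>x. f (c # d # x)) ys = - ee t k (\<lambda>x. f (d # c # x)) ys" for k c d
    unfolding ee_neg[symmetric] by (rule ee_cong) (rule alt_pair[OF Nil])
  have *: "ee t k f ([] @ c # d # ys) = ee t k (\<lambda>x. f (c # d # x)) ys -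
      (if d = 0 then 0 else t * ee t (k - 1) (\<lambda>x. f (c # (d - 1) # x)) ys) -
      (if c = 0 then 0 else t * ee t (k - 1) (\<lambda>x. f ((c - 1) # d # x)) ys) +
      (if c = 0 \<or> d = 0 then 0 else t * (t * ee t (k - 1 - 1) (\<lambda>x. f ((c - 1) # (d - 1) # x)) ys))" for c d
    by (simp add: algebra_simps)
  show ?case unfolding * using sw[of k a b] sw[of "k - 1" a "b - 1"] sw[of "k - 1" "a - 1" b] sw[of "k - 1 - 1" "a - 1" "b - 1"]
    by (simp only:) (auto simp: algebra_simps)
next
  case (Cons x xs)
  have "ee t k' (\<lambda>z. f (c # z)) (xs @ a # b # ys) = - ee t k' (\<lambda>z. f (c # z)) (xs @ b # a # ys)" for k' c
    by (rule Cons.IH[OF alt_Cons[OF Cons.prems]])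
  then show ?case by (simp add: algebra_simps)
qed

lemma boxsum_alt: "(\<And>k. alt (F k)) \<Longrightarrow> boxsum t F (xs @ a # b # ys) = - boxsum t F (xs @ b # a # ys)"
proof (induction xs arbitrary: F)
  case Nil
  have sw: "boxsum t (\<lambda>k x. F (k + l + j) (c # d # x)) ys = - boxsum t (\<lambda>k x. F (k + j + l) (d # c # x)) ys" for c d j l
    unfolding boxsum_neg[symmetric] by (rule boxsum_cong) (simp add: add_ac, rule alt_pair[OF Nil])
  have "boxsum t F ([] @ a # b # ys) = (\<Sum>j\<le>a. \<Sum>l\<le>b. t ^ j * (t ^ l * boxsum t (\<lambda>k x. F (k + l + j) ((a - j) # (b - l) # x)) ys))"
    by (simp add: sum_distrib_left)
  also have "\<dots> = (\<Sum>l\<le>b. \<Sum>j\<le>a. t ^ j * (t ^ l * boxsum t (\<lambda>k x. F (k + l + j) ((a - j) # (b - l) # x)) ys))"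
    by (rule sum.swap)
  also have "\<dots> = (\<Sum>l\<le>b. \<Sum>j\<le>a. - (t ^ l * (t ^ j * boxsum t (\<lambda>k x. F (k + j + l) ((b - l) # (a - j) # x)) ys)))"
    by (intro sum.cong refl, subst sw) (simp add: mult.left_commute)
  also have "\<dots> = - (\<Sum>l\<le>b. \<Sum>j\<le>a. t ^ l * (t ^ j * boxsum t (\<lambda>k x. F (k + j + l) ((b - l) # (a - j) # x)) ys))"
    unfolding sum_negf ..
  finally show ?case by (simp add: sum_distrib_left)
next
  case (Cons x xs)
  have "boxsum t (\<lambda>k z. F (k + j) (c # z)) (xs @ a # b # ys) = - boxsum t (\<lambda>k z. F (k + j) (c # z)) (xs @ b # a # ys)" for j c
    by (rule Cons.IH[OF alt_Cons[OF Cons.prems]])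
  then show ?case by (simp add: sum_negf)
qed

lemma alt_annih:
  assumes "alt g"
  shows "alt (annih t n g)"
  unfolding alt_def
proof (intro allI)
  fix xs a b ys
  have "boxsum t (\<lambda>k ka. g ((n + L + k) # ka)) (xs @ a # b # ys) = - boxsum t (\<lambda>k ka. g ((n + L + k) # ka)) (xs @ b # a # ys)" for L
    by (rule boxsum_alt) (rule alt_Cons[OF assms])
  from this[of "length (xs @ a # b # ys)"]
  show "annih t n g (xs @ a # b # ys) = - annih t n g (xs @ b # a # ys)"
    unfolding annih_def by simp
qed

lemma del_append: "del i (xs @ ys) = (if i < length xs then del i xs @ ys else xs @ del (i - length xs) ys)"
  by (simp add: del_def Suc_diff_le)

text \<open>A swap of neighbours permutes the terms of the sum by the same transposition. The two
  terms at the swapped places change sign through the power of -1, all others through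
  \<open>f\<close>.\<close>

lemma alt_crea:
  assumes "alt f"
  shows "alt (crea t m f)"
  unfolding alt_def
proof (intro allI)
  fix xs ys :: "nat list" and a b :: nat
  let ?p = "length xs" and ?al = "xs @ a # b # ys" and ?be = "xs @ b # a # ys"
  define T where "T al i = (- 1) ^ i * ee t (int m + int (length al) - 1 - int (al ! i)) f (del i al)" for al i
  let ?s = "transpose ?p (Suc ?p)"
  have T: "T ?be (?s i) = - T ?al i" if "i < length ?al" for i
  proof -
    consider "i < ?p" | "i = ?p" | "i = Suc ?p" | j where "i = ?p + Suc (Suc j)"
      by (metis Suc_lessI less_iff_Suc_add add_Suc_right linorder_neqE_nat)
    then show ?thesis
    proof cases
      case 1
      then show ?thesis
        using ee_alt[OF assms, of t _ "del i xs" b a ys] by (simp add: T_def del_append nth_append transpose_apply_other)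
    next
      case 2
      then show ?thesis by (simp add: T_def del_append nth_append)
    next
      case 3
      then show ?thesis by (simp add: T_def del_append nth_append)
    next
      case (4 j)
      then show ?thesis
        using ee_alt[OF assms, of t _ xs b a "del j ys"] by (simp add: T_def del_append nth_append transpose_apply_other)
    qed
  qed
  have "bij_betw ?s {..<length ?al} {..<length ?al}"
    by (rule permutes_imp_bij) (simp add: permutes_swap_id)
  then have "(\<Sum>i<length ?al. T ?be i) = (\<Sum>i<length ?al. T ?be (?s i))" 
    by (rule sum.reindex_bij_betw[symmetric])
  also have "\<dots> = - (\<Sum>i<length ?al. T ?al i)" by (simp add: T sum_negf[symmetric])
  finally show "crea t m f ?al = - crea t m f ?be" by (simp add: crea_def T_def)
qed

lemma alt_creas: "alt (creas t mu)"
  by (induction mu) (auto simp: alt_crea, auto simp: alt_def)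

lemma boxsum_Cons:
  "boxsum t F (b # be) = (\<Sum>c\<le>b. t ^ (b - c) * boxsum t (\<lambda>k x. F (k + (b - c)) (c # x)) be)"
  by (simp, rule sum.reindex_bij_witness[of _ "\<lambda>c. b - c" "\<lambda>j. b - j"]) auto

text \<open>The terms with \<open>\<kappa>\<^sub>i \<le> \<beta>\<^sub>i\<^sub>+\<^sub>1\<close> cancel, since \<open>\<kappa>\<^sub>i\<close> and \<open>\<kappa>\<^sub>i\<^sub>+\<^sub>1\<close> then range over the same interval.\<close>

lemma boxsum_interl:
  fixes t :: "'a::{idom, ring_char_0}"
  shows "sorted_wrt (>) be \<Longrightarrow> (\<And>k. alt (F k)) \<Longrightarrow>
    boxsum t F be = (\<Sum>ka\<in>interl (map Suc be @ [0]). t ^ (sum_list be - sum_list ka) * F (sum_list be - sum_list ka) ka)"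
proof (induction be arbitrary: F)
  case (Cons b be)
  define lo where "lo = (case be of [] \<Rightarrow> 0 | b' # _ \<Rightarrow> Suc b')"
  have lo: "lo \<le> b" using Cons.prems(1) by (auto simp: lo_def split: list.splits)
  define X where "X c = t ^ (b - c) * boxsum t (\<lambda>k x. F (k + (b - c)) (c # x)) be" for c
  have il: "interl (map Suc (b # be) @ [0]) = (\<lambda>(k, ka). k # ka) ` ({lo..<Suc b} \<times> interl (map Suc be @ [0]))"
    by (cases be) (auto simp: lo_def)
  have small: "(\<Sum>c<lo. X c) = 0"
  proof (cases be)
    case (Cons b1 bs)
    obtain e where e: "b = b1 + e" using lo Cons by (auto simp: lo_def dest: le_Suc_ex)
    define Y where "Y c d = t ^ e * (t ^ (b1 - c) * t ^ (b1 - d)) * boxsum t (\<lambda>k x. F (k + ((b1 - c) + (b1 - d)) + e) (c # d # x)) bs" for c d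
    have XY: "X c = (\<Sum>d\<le>b1. Y c d)" if "c \<le> b1" for c
    proof -
      have bc: "b - c = (b1 - c) + e" using that e by simp
      show ?thesis unfolding X_def Cons boxsum_Cons sum_distrib_left bc Y_def
        by (simp add: power_add mult_ac add_ac)
    qed
    have sw: "Y c d = - Y d c" for c d
    proof -
      have "boxsum t (\<lambda>k x. F (k + ((b1 - c) + (b1 - d)) + e) (c # d # x)) bs =
        - boxsum t (\<lambda>k x. F (k + ((b1 - d) + (b1 - c)) + e) (d # c # x)) bs"
        unfolding boxsum_neg[symmetric] by (rule boxsum_cong) (simp add: add_ac, rule alt_pair[OF Cons.prems(2)])
      then show ?thesis by (simp add: Y_def mult_ac)
    qed
    have S: "(\<Sum>c<lo. X c) = (\<Sum>c\<le>b1. \<Sum>d\<le>b1. Y c d)"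
      using XY by (simp add: lo_def Cons lessThan_Suc_atMost)
    also have "\<dots> = (\<Sum>d\<le>b1. \<Sum>c\<le>b1. Y c d)" by (rule sum.swap)
    also have "\<dots> = (\<Sum>d\<le>b1. \<Sum>c\<le>b1. - Y d c)" by (intro sum.cong refl sw)
    also have "\<dots> = - (\<Sum>c<lo. X c)" unfolding sum_negf S ..
    finally have "(\<Sum>c<lo. X c) = - (\<Sum>c<lo. X c)" .
    then have "(\<Sum>c<lo. X c) + (\<Sum>c<lo. X c) = 0" unfolding eq_neg_iff_add_eq_0 .
    then show ?thesis by (simp flip: mult_2)
  qed (simp add: lo_def)
  have "{..b} = {..<lo} \<union> {lo..<Suc b}" using lo by auto
  then have "boxsum t F (b # be) = (\<Sum>c<lo. X c) + (\<Sum>c=lo..<Suc b. X c)"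
    unfolding boxsum_Cons X_def[symmetric] by (simp only:) (rule sum.union_disjoint, auto)
  also have "\<dots> = (\<Sum>c=lo..<Suc b. \<Sum>ka\<in>interl (map Suc be @ [0]).
      t ^ (sum_list (b # be) - sum_list (c # ka)) * F (sum_list (b # be) - sum_list (c # ka)) (c # ka))"
    unfolding small add_0
  proof (rule sum.cong)
    fix c assume c: "c \<in> {lo..<Suc b}"
    have "X c = t ^ (b - c) * (\<Sum>ka\<in>interl (map Suc be @ [0]).
        t ^ (sum_list be - sum_list ka) * F (sum_list be - sum_list ka + (b - c)) (c # ka))"
      unfolding X_def using Cons.prems by (subst Cons.IH) (auto intro: alt_Cons)
    also have "\<dots> = (\<Sum>ka\<in>interl (map Suc be @ [0]).
      t ^ (sum_list (b # be) - sum_list (c # ka)) * F (sum_list (b # be) - sum_list (c # ka)) (c # ka))"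
      unfolding sum_distrib_left
    proof (rule sum.cong)
      fix ka assume "ka \<in> interl (map Suc be @ [0])"
      then have l: "length ka = length be" and i: "\<And>i. i < length ka \<Longrightarrow> ka ! i < (map Suc be @ [0]) ! i"
        by (auto simp: interl_iff)
      have "sum_list ka \<le> sum_list be"
        unfolding sum_list_sum_nth l
        by (rule sum_mono) (use i in \<open>force simp: nth_append l\<close>)
      then have e: "sum_list (b # be) - sum_list (c # ka) = sum_list be - sum_list ka + (b - c)" using c by auto
      show "t ^ (b - c) * (t ^ (sum_list be - sum_list ka) * F (sum_list be - sum_list ka + (b - c)) (c # ka)) =
        t ^ (sum_list (b # be) - sum_list (c # ka)) * F (sum_list (b # be) - sum_list (c # ka)) (c # ka)"
        unfolding e power_add by (simp add: mult_ac)
    qed simp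
    finally show "X c = \<dots>" .
  qed simp
  also have "\<dots> = (\<Sum>ka\<in>interl (map Suc (b # be) @ [0]). t ^ (sum_list (b # be) - sum_list ka) * F (sum_list (b # be) - sum_list ka) ka)"
    unfolding il by (subst sum.reindex) (auto simp: inj_on_def sum.cartesian_product intro!: sum.cong)
  finally show ?case .
qed simp

subsection \<open>Duality\<close>

text \<open>The transpose of \<open>ee\<close>: entries are raised instead of lowered, and the
  number of raised entries is handed to \<open>F\<close>.\<close>

fun upsum :: "'a::comm_ring_1 \<Rightarrow> (nat \<Rightarrow> nat list \<Rightarrow> 'a) \<Rightarrow> nat list \<Rightarrow> 'a" where
  "upsum t F [] = F 0 []"
| "upsum t F (b # be) = upsum t (\<lambda>k x. F k (b # x)) be - t * upsum t (\<lambda>k x. F (Suc k) (Suc b # x)) be"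

definition cocrea :: "'a::comm_ring_1 \<Rightarrow> nat \<Rightarrow> (nat list \<Rightarrow> 'a) \<Rightarrow> nat list \<Rightarrow> 'a" where
  "cocrea t m g be = upsum t (\<lambda>k x. g ((m + length be - k) # x)) be"

primrec cocreas :: "'a::comm_ring_1 \<Rightarrow> nat list \<Rightarrow> (nat list \<Rightarrow> 'a) \<Rightarrow> 'a" where
  "cocreas t [] g = g []"
| "cocreas t (m # mu) g = cocreas t mu (cocrea t m g)"

abbreviation vstrip :: "nat list \<Rightarrow> nat list \<Rightarrow> bool" where
  "vstrip \<equiv> list_all2 (\<lambda>b b'. b \<le> b' \<and> b' \<le> Suc b)"

definition slists :: "nat \<Rightarrow> nat \<Rightarrow> nat list set" where
  "slists N d = {ka. length ka = N \<and> sorted_wrt (>) ka \<and> sum_list ka = d}"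

lemma finite_slists: "finite (slists N d)"
  by (rule finite_subset[OF _ finite_lists_length_eq[of "{..d}" N]])
    (use member_le_sum_list in \<open>fastforce simp: slists_def\<close>)+

lemma vstrip_sum: "vstrip be be' \<Longrightarrow> sum_list be \<le> sum_list be' \<and> sum_list be' \<le> sum_list be + length be"
  by (induction rule: list_all2_induct) auto

lemma finite_vstrip: "finite {be'. vstrip be be'}" "finite {be. vstrip be be'}"
proof -
  have fin: "finite {xs. set xs \<subseteq> {..B} \<and> length xs = L}" for B :: nat and L
    by (rule finite_lists_length_eq) simp
  have el: "set x \<subseteq> {..B}" if "sum_list x \<le> B" for x :: "nat list" and B
    using member_le_sum_list[of _ x] that order_trans by blast
  have "{be'. vstrip be be'} \<subseteq> {xs. set xs \<subseteq> {..sum_list be + length be} \<and> length xs = length be}"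
    using vstrip_sum el list_all2_lengthD by (metis (mono_tags, lifting) Collect_mono)
  then show "finite {be'. vstrip be be'}" using fin finite_subset by blast
  have "{be. vstrip be be'} \<subseteq> {xs. set xs \<subseteq> {..sum_list be'} \<and> length xs = length be'}"
    using vstrip_sum el list_all2_lengthD by (metis (mono_tags, lifting) Collect_mono)
  then show "finite {be. vstrip be be'}" using fin finite_subset by blast
qed

lemma upsum_vstrip:
  "upsum t F be = (\<Sum>be'\<in>{be'. vstrip be be'}. (- t) ^ (sum_list be' - sum_list be) * F (sum_list be' - sum_list be) be')"
proof (induction be arbitrary: F)
  case (Cons b be)
  have eq: "{be'. vstrip (b # be) be'} = (#) b ` {be'. vstrip be be'} \<union> (#) (Suc b) ` {be'. vstrip be be'}"
    by (auto simp: list_all2_Cons1 le_Suc_eq image_iff)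
  have "(\<Sum>be'\<in>{be'. vstrip (b # be) be'}. (- t) ^ (sum_list be' - sum_list (b # be)) * F (sum_list be' - sum_list (b # be)) be') =
    (\<Sum>be'\<in>{be'. vstrip be be'}. (- t) ^ (sum_list be' - sum_list be) * F (sum_list be' - sum_list be) (b # be')) +
    (\<Sum>be'\<in>{be'. vstrip be be'}. (- t) ^ (Suc b + sum_list be' - (b + sum_list be)) * F (Suc b + sum_list be' - (b + sum_list be)) (Suc b # be'))"
    unfolding eq by (subst sum.union_disjoint) (auto simp: finite_vstrip sum.reindex)
  also have "(\<Sum>be'\<in>{be'. vstrip be be'}. (- t) ^ (Suc b + sum_list be' - (b + sum_list be)) * F (Suc b + sum_list be' - (b + sum_list be)) (Suc b # be')) =
    - t * (\<Sum>be'\<in>{be'. vstrip be be'}. (- t) ^ (sum_list be' - sum_list be) * F (Suc (sum_list be' - sum_list be)) (Suc b # be'))"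
    unfolding sum_distrib_left
  proof (rule sum.cong)
    fix be' assume "be' \<in> {be'. vstrip be be'}"
    then have "Suc b + sum_list be' - (b + sum_list be) = Suc (sum_list be' - sum_list be)" using vstrip_sum[of be be'] by auto
    then show "(- t) ^ (Suc b + sum_list be' - (b + sum_list be)) * F (Suc b + sum_list be' - (b + sum_list be)) (Suc b # be') =
      - t * ((- t) ^ (sum_list be' - sum_list be) * F (Suc (sum_list be' - sum_list be)) (Suc b # be'))"
      by (simp only: power_Suc mult.assoc)
  qed simp
  finally show ?case using Cons.IH by simp
next
  case Nil
  have "{be'. vstrip [] be'} = {[]}" by auto
  then show ?case by simp
qed

lemma ee_vstrip:
  "ee t k f be' = (\<Sum>be\<in>{be. vstrip be be' \<and> int (sum_list be') - int (sum_list be) = k}. (- t) ^ (sum_list be' - sum_list be) * f be)"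
proof (induction be' arbitrary: k f)
  case (Cons b be')
  let ?A = "\<lambda>k. {be. vstrip be be' \<and> int (sum_list be') - int (sum_list be) = k}"
  let ?B = "{be. vstrip be (b # be') \<and> int (sum_list (b # be')) - int (sum_list be) = k}"
  have eq: "?B = (#) b ` ?A k \<union> (if b = 0 then {} else (#) (b - 1) ` ?A (k - 1))"
    by (cases b) (auto simp: list_all2_Cons2 le_Suc_eq image_iff)
  have fin: "finite (?A k)" for k by (rule finite_subset[OF _ finite_vstrip(2)[of be']]) auto
  have "(\<Sum>be\<in>?B. (- t) ^ (sum_list (b # be') - sum_list be) * f be) =
    (\<Sum>be\<in>?A k. (- t) ^ (sum_list be' - sum_list be) * f (b # be)) +
    (if b = 0 then 0 else \<Sum>be\<in>?A (k - 1). (- t) ^ (b + sum_list be' - (b - 1 + sum_list be)) * f ((b - 1) # be))"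
    unfolding eq by (subst sum.union_disjoint) (auto simp: fin sum.reindex)
  also have "(if b = 0 then 0 else \<Sum>be\<in>?A (k - 1). (- t) ^ (b + sum_list be' - (b - 1 + sum_list be)) * f ((b - 1) # be)) =
    (if b = 0 then 0 else - t * (\<Sum>be\<in>?A (k - 1). (- t) ^ (sum_list be' - sum_list be) * f ((b - 1) # be)))"
  proof (cases "b = 0")
    case False
    have "(\<Sum>be\<in>?A (k - 1). (- t) ^ (b + sum_list be' - (b - 1 + sum_list be)) * f ((b - 1) # be)) =
      (\<Sum>be\<in>?A (k - 1). - t * ((- t) ^ (sum_list be' - sum_list be) * f ((b - 1) # be)))"
    proof (rule sum.cong)
      fix be assume "be \<in> ?A (k - 1)"
      then have "b + sum_list be' - (b - 1 + sum_list be) = Suc (sum_list be' - sum_list be)"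
        using vstrip_sum[of be be'] False by auto
      then show "(- t) ^ (b + sum_list be' - (b - 1 + sum_list be)) * f ((b - 1) # be) =
        - t * ((- t) ^ (sum_list be' - sum_list be) * f ((b - 1) # be))" by (simp only: power_Suc mult.assoc)
    qed simp
    then show ?thesis using False by (simp add: sum_distrib_left)
  qed simp
  finally show ?case using Cons.IH by simp
next
  case Nil
  have "{be. vstrip be [] \<and> int (sum_list []) - int (sum_list be) = k} = (if k = 0 then {[]} else {})" by auto
  then show ?case by simp
qed

lemma upsum_neg: "upsum t (\<lambda>k x. - F k x) be = - upsum t F be"
  by (induction be arbitrary: F) (auto simp: algebra_simps)

lemma upsum_mult: "upsum t (\<lambda>k x. c * F k x) be = c * upsum t F be"
  by (induction be arbitrary: F) (auto simp: algebra_simps)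

lemma upsum_cong: "(\<And>k x. length x = length be \<Longrightarrow> k \<le> length be \<Longrightarrow> F k x = G k x) \<Longrightarrow> upsum t F be = upsum t G be"
proof (induction be arbitrary: F G)
  case (Cons b be)
  have "upsum t (\<lambda>k x. F k (b # x)) be = upsum t (\<lambda>k x. G k (b # x)) be"
    "upsum t (\<lambda>k x. F (Suc k) (Suc b # x)) be = upsum t (\<lambda>k x. G (Suc k) (Suc b # x)) be"
    by (rule Cons.IH; use Cons.prems in auto)+
  then show ?case by simp
qed simp

lemma upsum_alt: "(\<And>k. alt (F k)) \<Longrightarrow> upsum t F (xs @ a # b # ys) = - upsum t F (xs @ b # a # ys)"
proof (induction xs arbitrary: F)
  case Nil
  have sw: "upsum t (\<lambda>k x. F (h k) (c # d # x)) ys = - upsum t (\<lambda>k x. F (h k) (d # c # x)) ys" for c d h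
    unfolding upsum_neg[symmetric] by (rule upsum_cong) (rule alt_pair[OF Nil])
  show ?case
    using sw[of "\<lambda>k. k" a b] sw[of "\<lambda>k. Suc k" a "Suc b"] sw[of "\<lambda>k. Suc k" "Suc a" b] sw[of "\<lambda>k. Suc (Suc k)" "Suc a" "Suc b"]
    by (simp add: algebra_simps)
next
  case (Cons x xs)
  have "upsum t (\<lambda>k z. F (h k) (c # z)) (xs @ a # b # ys) = - upsum t (\<lambda>k z. F (h k) (c # z)) (xs @ b # a # ys)" for h c
    by (rule Cons.IH[OF alt_Cons[OF Cons.prems]])
  from this[of "\<lambda>k. k" x] this[of Suc "Suc x"] show ?case by (simp add: algebra_simps)
qed

lemma alt_cocrea:
  assumes "alt g"
  shows "alt (cocrea t m g)"
  unfolding alt_def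
proof (intro allI)
  fix xs a b ys
  have "upsum t (\<lambda>k ka. g ((m + L - k) # ka)) (xs @ a # b # ys) = - upsum t (\<lambda>k ka. g ((m + L - k) # ka)) (xs @ b # a # ys)" for L
    by (rule upsum_alt) (rule alt_Cons[OF assms])
  from this[of "length (xs @ a # b # ys)"]
  show "cocrea t m g (xs @ a # b # ys) = - cocrea t m g (xs @ b # a # ys)"
    unfolding cocrea_def by simp
qed

lemma not_strict_adjacent:
  assumes "sorted_wrt (\<ge>) be" "\<not> sorted_wrt (>) (be :: nat list)"
  shows "\<exists>xs a ys. be = xs @ a # a # ys"
  using assms
proof (induction be)
  case (Cons b be)
  show ?case
  proof (cases "sorted_wrt (>) be")
    case True
    then obtain b' be' where be: "be = b' # be'" using Cons.prems by (cases be) auto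
    have "b = b'"
    proof (rule ccontr)
      assume "b \<noteq> b'"
      then have "\<forall>x\<in>set be. x < b" using Cons.prems(1) True be by auto
      then show False using Cons.prems(2) True by auto
    qed
    then show ?thesis using be by (intro exI[of _ "[]"]) auto
  next
    case False
    then obtain xs a ys where "be = xs @ a # a # ys" using Cons by auto
    then show ?thesis by (intro exI[of _ "b # xs"]) auto
  qed
qed simp

text \<open>A vertical strip spoils strict decrease at most to weak decrease. Failure of strictness
  then shows as two equal neighbours, where alternating functions vanish.\<close>

lemma vstrip_weak:
  "vstrip be be' \<Longrightarrow> sorted_wrt (>) be' \<Longrightarrow> sorted_wrt (\<ge>) be"
  "vstrip be be' \<Longrightarrow> sorted_wrt (>) be \<Longrightarrow> sorted_wrt (\<ge>) be'"
  unfolding sorted_wrt_iff_nth_less list_all2_conv_all_nth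
  by (metis (no_types, lifting) Suc_leI dual_order.strict_trans le_less_trans less_Suc_eq_le less_trans_Suc not_less order_trans)+

lemma strict_set_unique:
  "sorted_wrt (>) (xs :: nat list) \<Longrightarrow> sorted_wrt (>) ys \<Longrightarrow> set xs = set ys \<Longrightarrow> xs = ys"
  using inc_set_eq[of "rev xs" "rev ys"] by (simp add: sorted_wrt_rev)

text \<open>A new entry fits into a strictly decreasing list at exactly one place, so a list with a
  marked position amounts to an entry together with a list that avoids it.\<close>

lemma strict_remove:
  fixes h :: "nat \<Rightarrow> nat list \<Rightarrow> 'a::comm_monoid_add"
  shows "(\<Sum>ka\<in>slists (Suc M) s. \<Sum>i<Suc M. h (ka ! i) (del i ka)) =
    (\<Sum>(a, be)\<in>{(a, be). a \<notin> set be \<and> length be = M \<and> sorted_wrt (>) be \<and> a + sum_list be = s}. h a be)"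
proof -
  let ?A = "{(a, be). a \<notin> set be \<and> length be = M \<and> sorted_wrt (>) be \<and> a + sum_list be = s}"
  let ?f = "\<lambda>(ka, i). (ka ! i, del i ka)"
  have sp: "\<exists>xs ys. ka = xs @ ka ! i # ys \<and> length xs = i \<and> del i ka = xs @ ys" if "i < length ka" for ka :: "nat list" and i
    using id_take_nth_drop[OF that] that unfolding del_def by (intro exI[of _ "take i ka"] exI[of _ "drop (Suc i) ka"]) auto
  have "bij_betw ?f (slists (Suc M) s \<times> {..<Suc M}) ?A"
    unfolding bij_betw_def
  proof
    show "inj_on ?f (slists (Suc M) s \<times> {..<Suc M})"
    proof (rule inj_onI, clarify)
      fix ka i la j
      assume ka: "ka \<in> slists (Suc M) s" "i < Suc M" and la: "la \<in> slists (Suc M) s" "j < Suc M"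
        and eq: "ka ! i = la ! j" "del i ka = del j la"
      have s: "set ka' = insert (ka' ! i') (set (del i' ka'))" if k: "ka' \<in> slists (Suc M) s" "i' < Suc M" for ka' i'
      proof -
        obtain xs ys where x: "ka' = xs @ ka' ! i' # ys" "del i' ka' = xs @ ys"
          using sp[of i' ka'] k by (auto simp: slists_def)
        have "set ka' = set (xs @ ka' ! i' # ys)" using x(1) by (rule arg_cong)
        then show ?thesis unfolding x(2) by auto
      qed
      have k: "ka = la" using s[OF ka] s[OF la] eq ka la by (intro strict_set_unique) (auto simp: slists_def)
      have "distinct ka" using ka(1) by (auto simp: slists_def sorted_wrt_iff_nth_less distinct_conv_nth) (metis less_irrefl linorder_neqE_nat)
      then show "ka = la \<and> i = j" using k eq(1) ka la by (auto simp: slists_def nth_eq_iff_index_eq)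
    qed
    show "?f ` (slists (Suc M) s \<times> {..<Suc M}) = ?A"
    proof (intro equalityI subsetI)
      fix p assume "p \<in> ?f ` (slists (Suc M) s \<times> {..<Suc M})"
      then obtain ka i where p: "p = (ka ! i, del i ka)" "ka \<in> slists (Suc M) s" "i < Suc M" by auto
      obtain xs ys where x: "ka = xs @ ka ! i # ys" "length xs = i" "del i ka = xs @ ys"
        using sp[of i ka] p by (auto simp: slists_def)
      obtain a where a: "a = ka ! i" by simp
      have ka: "ka = xs @ a # ys" using x a by simp
      have "sorted_wrt (>) (xs @ a # ys)" "length (xs @ a # ys) = Suc M" "sum_list (xs @ a # ys) = s"
        using p(2) ka by (auto simp: slists_def)
      then show "p \<in> ?A" unfolding p x(3) a[symmetric] by (auto simp: sorted_wrt_append)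
    next
      fix p assume "p \<in> ?A"
      then obtain a be where p: "p = (a, be)" "a \<notin> set be" "length be = M" "sorted_wrt (>) be" "a + sum_list be = s" by auto
      let ?xs = "filter (\<lambda>b. a < b) be" and ?ys = "filter (\<lambda>b. b < a) be"
      have be0: "be = ?xs @ ?ys" using p(2,4)
      proof (induction be)
        case (Cons b be)
        show ?case
        proof (cases "a < b")
          case False
          then have "b < a" "\<forall>x\<in>set be. x < a" using Cons.prems by auto
          then show ?thesis by (auto simp: filter_empty_conv filter_id_conv)
        qed (use Cons in auto)
      qed simp
      obtain xs ys where be: "be = xs @ ys" and xs: "\<forall>b\<in>set xs. a < b" and ys: "\<forall>b\<in>set ys. b < a"
        using be0 by (rule that) auto
      have "sorted_wrt (>) (xs @ a # ys)" using p(4) xs ys unfolding be by (auto simp: sorted_wrt_append)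
      then have "xs @ a # ys \<in> slists (Suc M) s" using p(3,5) unfolding be by (auto simp: slists_def)
      moreover have "length xs < Suc M" using p(3) unfolding be by simp
      moreover have "?f (xs @ a # ys, length xs) = p" unfolding p be by (simp add: del_def)
      ultimately show "p \<in> ?f ` (slists (Suc M) s \<times> {..<Suc M})" by (intro image_eqI[of _ _ "(xs @ a # ys, length xs)"]) auto
    qed
  qed
  from sum.reindex_bij_betw[OF this, of "\<lambda>(a, be). h a be"] show ?thesis
    by (simp add: sum.cartesian_product case_prod_unfold del: sum.lessThan_Suc)
qed

text \<open>Both sides become a single sum over pairs of strictly decreasing lists that differ by a
  vertical strip. Every term added or dropped on the way contains a repeated entry and vanishes
  because \<open>f\<close> and \<open>g\<close> alternate.\<close>

lemma crea_adjoint: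
  fixes t :: "'a::{idom, ring_char_0}"
  assumes f: "alt f" and g: "alt g"
  shows "(\<Sum>ka\<in>slists (Suc M) (d + m + M). crea t m f ka * g ka) = (\<Sum>be\<in>slists M d. f be * cocrea t m g be)"
proof -
  let ?s = "d + m + M"
  let ?A = "{(a, be). length be = M \<and> sorted_wrt (>) be \<and> a + sum_list be = ?s}"
  let ?A' = "{(a, be). a \<notin> set be \<and> length be = M \<and> sorted_wrt (>) be \<and> a + sum_list be = ?s}"
  define h where "h a be = ee t (int m + int M - int a) f be * g (a # be)" for a be
  have finA: "finite ?A"
  proof (rule finite_subset)
    show "?A \<subseteq> {..?s} \<times> (\<Union>s\<le>?s. slists M s)" by (auto simp: slists_def)
  qed (auto simp: finite_slists)
  have "(\<Sum>ka\<in>slists (Suc M) ?s. crea t m f ka * g ka) = (\<Sum>ka\<in>slists (Suc M) ?s. \<Sum>i<Suc M. h (ka ! i) (del i ka))"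
  proof (rule sum.cong)
    fix ka assume "ka \<in> slists (Suc M) ?s"
    then have l: "length ka = Suc M" by (simp add: slists_def)
    have "(- 1) ^ i * ee t (int m + int (length ka) - 1 - int (ka ! i)) f (del i ka) * g ka = h (ka ! i) (del i ka)" if "i < Suc M" for i
    proof -
      have "g ka = g (take i ka @ ka ! i # drop (Suc i) ka)"
        using id_take_nth_drop[of i ka] that l by (intro arg_cong[where f = g]) simp
      also have "\<dots> = (- 1) ^ i * g (ka ! i # del i ka)"
        using alt_move[OF g, of "take i ka" "ka ! i" "drop (Suc i) ka"] that l by (simp add: del_def min_def)
      finally have gka: "g ka = (- 1) ^ i * g (ka ! i # del i ka)" .
      have one: "(- 1) ^ i * (- 1) ^ i = (1 :: 'a)" by (simp flip: power_mult_distrib)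
      have "(- 1) ^ i * e * ((- 1) ^ i * x) = e * x" for e x :: 'a
        using arg_cong[OF one, of "\<lambda>z. z * (e * x)"] by (simp add: mult_ac)
      then show ?thesis unfolding gka h_def l by (simp add: algebra_simps)
    qed
    then show "crea t m f ka * g ka = (\<Sum>i<Suc M. h (ka ! i) (del i ka))"
      unfolding crea_def sum_distrib_right l by (intro sum.cong) auto
  qed simp
  also have "\<dots> = (\<Sum>(a, be)\<in>?A'. h a be)" by (rule strict_remove)
  also have "\<dots> = (\<Sum>(a, be)\<in>?A. h a be)"
    by (rule sum.mono_neutral_left[OF finA]) (auto simp: h_def alt_repeat[OF g])
  also have "\<dots> = (\<Sum>(a, be')\<in>?A. \<Sum>be\<in>{be. vstrip be be' \<and> sum_list be = d}. (- t) ^ (sum_list be' - d) * f be * g (a # be'))"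
  proof (rule sum.cong)
    fix p assume "p \<in> ?A"
    then obtain a be' where p: "p = (a, be')" "a + sum_list be' = ?s" by auto
    then have e: "{be. vstrip be be' \<and> int (sum_list be') - int (sum_list be) = int m + int M - int a} =
      {be. vstrip be be' \<and> sum_list be = d}" by auto
    show "(case p of (a, be) \<Rightarrow> h a be) = (case p of (a, be') \<Rightarrow> \<Sum>be\<in>{be. vstrip be be' \<and> sum_list be = d}. (- t) ^ (sum_list be' - d) * f be * g (a # be'))"
      unfolding p prod.case h_def ee_vstrip e sum_distrib_right by (intro sum.cong) auto
  qed simp
  also have "\<dots> = (\<Sum>(be, be')\<in>{(be, be'). be \<in> slists M d \<and> sorted_wrt (>) be' \<and> vstrip be be'}.
      (- t) ^ (sum_list be' - d) * f be * g ((m + M - (sum_list be' - d)) # be'))"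
    (is "?L = sum ?F ?P")
  proof -
    let ?S = "Sigma ?A (\<lambda>(a, be'). {be. vstrip be be' \<and> sum_list be = d})"
    let ?G = "\<lambda>((a, be'), be). (- t) ^ (sum_list be' - d) * f be * g (a # be')"
    have fin: "finite (case p of (a, be') \<Rightarrow> {be. vstrip be be' \<and> sum_list be = d})" for p :: "nat \<times> nat list"
      by (cases p, simp, rule finite_subset[OF _ finite_vstrip(2)[of "snd p"]]) auto
    have "?L = (\<Sum>p\<in>?A. \<Sum>be\<in>(case p of (a, be') \<Rightarrow> {be. vstrip be be' \<and> sum_list be = d}). ?G (p, be))"
      by (rule sum.cong) auto
    also have "\<dots> = sum ?G ?S"
      by (subst sum.Sigma[OF finA]) (use fin in \<open>auto simp: split_def\<close>)
    also have "\<dots> = sum ?G {p\<in>?S. sorted_wrt (>) (snd p)}"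
    proof (rule sum.mono_neutral_right)
      show "finite ?S" using finA fin by (rule finite_SigmaI)
      show "\<forall>p\<in>?S - {p\<in>?S. sorted_wrt (>) (snd p)}. ?G p = 0"
      proof
        fix p assume "p \<in> ?S - {p\<in>?S. sorted_wrt (>) (snd p)}"
        then obtain a be' be where p: "p = ((a, be'), be)" "sorted_wrt (>) be'" "vstrip be be'" "\<not> sorted_wrt (>) be" by auto
        then obtain xs b ys where "be = xs @ b # b # ys" using not_strict_adjacent vstrip_weak(1) by blast
        then show "?G p = 0" using alt_eq_0[OF f] p by simp
      qed
    qed auto
    also have "\<dots> = sum ?F ?P"
    proof -
      let ?S' = "{p\<in>?S. sorted_wrt (>) (snd p)}"
      have S: "\<exists>a be' be. p = ((a, be'), be) \<and> m + M - (sum_list be' - d) = a \<and> (be, be') \<in> ?P" if p: "p \<in> ?S'" for p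
      proof -
        obtain a be' be where pp: "p = ((a, be'), be)" by (metis prod.exhaust)
        have q: "length be' = M" "a + sum_list be' = ?s" "sum_list be = d" "vstrip be be'"
          "sorted_wrt (>) be'" "sorted_wrt (>) be" using p unfolding pp by simp_all
        have l: "length be = M" using list_all2_lengthD[OF q(4)] q(1) by simp
        have "m + M - (sum_list be' - d) = a" using vstrip_sum[OF q(4)] q(2,3) l by arith
        then show ?thesis using pp q l by (intro exI conjI) (auto simp: slists_def)
      qed
      have T: "((m + M - (sum_list be' - d), be'), be) \<in> ?S'" if p: "(be, be') \<in> ?P" for be be'
      proof -
        have q: "be \<in> slists M d" "sorted_wrt (>) be'" "vstrip be be'" using p by auto
        then have "d \<le> sum_list be'" "sum_list be' \<le> d + M" "length be' = M"
          using vstrip_sum[OF q(3)] list_all2_lengthD[OF q(3)] by (auto simp: slists_def)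
        then show ?thesis using q by (simp add: slists_def)
      qed
      have "sum ?F ?P = sum ?G ?S'"
      proof (rule sum.reindex_bij_betw[where h = "\<lambda>(be, be'). ((m + M - (sum_list be' - d), be'), be)" and g = ?G, THEN trans[rotated]])
        show "bij_betw (\<lambda>(be, be'). ((m + M - (sum_list be' - d), be'), be)) ?P ?S'"
          unfolding bij_betw_def
        proof
          show "inj_on (\<lambda>(be, be'). ((m + M - (sum_list be' - d), be'), be)) ?P" by (auto simp: inj_on_def)
          show "(\<lambda>(be, be'). ((m + M - (sum_list be' - d), be'), be)) ` ?P = ?S'"
          proof (intro equalityI subsetI, erule imageE)
            fix p x assume x: "x \<in> ?P" and px: "p = (\<lambda>(be, be'). ((m + M - (sum_list be' - d), be'), be)) x"
            obtain be be' where xx: "x = (be, be')" by (cases x)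
            show "p \<in> ?S'" using T[of be be'] x unfolding px xx by (simp only: prod.case)
          next
            fix p assume "p \<in> ?S'"
            then obtain a be' be where q: "p = ((a, be'), be)" "m + M - (sum_list be' - d) = a" "(be, be') \<in> ?P" using S by blast
            show "p \<in> (\<lambda>(be, be'). ((m + M - (sum_list be' - d), be'), be)) ` ?P"
              by (rule image_eqI[OF _ q(3)]) (simp add: q(1,2))
          qed
        qed
      qed (simp add: split_def)
      then show ?thesis ..
    qed
    finally show ?thesis .
  qed
  also have "\<dots> = (\<Sum>be\<in>slists M d. f be * cocrea t m g be)"
  proof -
    have "f be * cocrea t m g be = (\<Sum>be'\<in>{be'. sorted_wrt (>) be' \<and> vstrip be be'}.
      (- t) ^ (sum_list be' - d) * f be * g ((m + M - (sum_list be' - d)) # be'))" if be: "be \<in> slists M d" for be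
    proof -
      have "f be * cocrea t m g be = (\<Sum>be'\<in>{be'. vstrip be be'}.
        (- t) ^ (sum_list be' - d) * f be * g ((m + M - (sum_list be' - d)) # be'))"
        unfolding cocrea_def upsum_vstrip sum_distrib_left
        by (intro sum.cong refl) (use be in \<open>simp add: slists_def mult_ac\<close>)
      also have "\<dots> = (\<Sum>be'\<in>{be'. sorted_wrt (>) be' \<and> vstrip be be'}.
        (- t) ^ (sum_list be' - d) * f be * g ((m + M - (sum_list be' - d)) # be'))"
      proof (rule sum.mono_neutral_right[OF finite_vstrip(1)])
        show "\<forall>be'\<in>{be'. vstrip be be'} - {be'. sorted_wrt (>) be' \<and> vstrip be be'}.
          (- t) ^ (sum_list be' - d) * f be * g ((m + M - (sum_list be' - d)) # be') = 0"
        proof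
          fix be' assume "be' \<in> {be'. vstrip be be'} - {be'. sorted_wrt (>) be' \<and> vstrip be be'}"
          then have "vstrip be be'" "\<not> sorted_wrt (>) be'" by auto
          then obtain xs b ys where "be' = xs @ b # b # ys"
            using not_strict_adjacent vstrip_weak(2) be unfolding slists_def by blast
          then have "g ((m + M - (sum_list be' - d)) # be') = 0" using alt_eq_0[OF alt_Cons[OF g]] by auto
          then show "(- t) ^ (sum_list be' - d) * f be * g ((m + M - (sum_list be' - d)) # be') = 0" by simp
        qed
      qed auto
      finally show ?thesis .
    qed
    note eq = this
    have fin: "finite {be'. sorted_wrt (>) be' \<and> vstrip be be'}" for be
      by (rule finite_subset[OF _ finite_vstrip(1)[of be]]) auto
    have P: "?P = Sigma (slists M d) (\<lambda>be. {be'. sorted_wrt (>) be' \<and> vstrip be be'})" by auto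
    have "(\<Sum>be\<in>slists M d. f be * cocrea t m g be) =
      (\<Sum>be\<in>slists M d. \<Sum>be'\<in>{be'. sorted_wrt (>) be' \<and> vstrip be be'}.
        (- t) ^ (sum_list be' - d) * f be * g ((m + M - (sum_list be' - d)) # be'))"
      by (rule sum.cong[OF refl]) (rule eq)
    also have "\<dots> = sum ?F (Sigma (slists M d) (\<lambda>be. {be'. sorted_wrt (>) be' \<and> vstrip be be'}))"
      by (rule sum.Sigma[OF finite_slists]) (use fin in blast)
    finally show ?thesis unfolding P ..
  qed
  finally show ?thesis .
qed

text \<open>For \<open>g\<close> an alternant this exhibits \<open>creas t mu\<close> as the
  coefficients in the alternants of the polynomial built by \<open>cocreas\<close>. The binomial
  coefficient is the sum of the staircase.\<close>

theorem cocreas_dual: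
  fixes t :: "'a::{idom, ring_char_0}"
  shows "alt g \<Longrightarrow> cocreas t mu g = (\<Sum>ka\<in>slists (length mu) (sum_list mu + (length mu choose 2)). creas t mu ka * g ka)"
proof (induction mu arbitrary: g)
  case Nil
  have "slists 0 0 = {[]}" by (auto simp: slists_def)
  then show ?case by (simp add: binomial_eq_0)
next
  case (Cons m mu)
  have e: "sum_list (m # mu) + (length (m # mu) choose 2) = sum_list mu + (length mu choose 2) + m + length mu"
    by (simp add: numeral_2_eq_2)
  show ?case
    unfolding e using Cons.IH[OF alt_cocrea[OF Cons.prems], of t m] crea_adjoint[OF alt_creas[of t mu] Cons.prems, where M = "length mu" and d = "sum_list mu + (length mu choose 2)" and m = m and t = t]
    by simp
qed

section \<open>Hall--Littlewood functions in terms of alternants\<close>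

definition mono :: "(nat \<Rightarrow> 'a::comm_ring_1) \<Rightarrow> nat list \<Rightarrow> 'a" where
  "mono y al = (\<Prod>i<length al. y i ^ (al ! i))"

lemma mono_Cons: "mono y (b # be) = y 0 ^ b * mono (\<lambda>i. y (Suc i)) be"
  unfolding mono_def by (simp add: prod.lessThan_Suc_shift del: prod.lessThan_Suc)

lemma alternant_mono: "alternant al y = (\<Sum>w | w permutes {..<length al}. of_int (sign w) * mono (\<lambda>i. y (w i)) al)"
  by (simp add: alternant_def mono_def)

text \<open>Every entry is either left alone, which leaves a factor z in the first power, or raised,
  which gives - t y_j. The product is the numerator that pairs one variable with all later ones in
  the symmetrisation formula.\<close>

lemma upsum_mono:
  "upsum t (\<lambda>k x. z ^ (c + length be - k) * mono y x) be = z ^ c * mono y be * (\<Prod>j<length be. z - t * y j)"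
proof (induction be arbitrary: c y)
  case (Cons b be)
  let ?y = "\<lambda>i. y (Suc i)"
  have 1: "upsum t (\<lambda>k x. z ^ (c + length (b # be) - k) * mono y (b # x)) be =
      y 0 ^ b * upsum t (\<lambda>k x. z ^ (Suc c + length be - k) * mono ?y x) be"
    unfolding upsum_mult[symmetric] by (rule upsum_cong) (simp add: mono_Cons mult_ac)
  have 2: "upsum t (\<lambda>k x. z ^ (c + length (b # be) - Suc k) * mono y (Suc b # x)) be =
      y 0 ^ Suc b * upsum t (\<lambda>k x. z ^ (c + length be - k) * mono ?y x) be"
    unfolding upsum_mult[symmetric] by (rule upsum_cong) (simp add: mono_Cons mult_ac)
  have p: "(\<Prod>j<length (b # be). z - t * y j) = (z - t * y 0) * (\<Prod>j<length be. z - t * y (Suc j))"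
    by (simp add: prod.lessThan_Suc_shift del: prod.lessThan_Suc)
  show ?case unfolding upsum.simps 1 2 Cons.IH p by (simp add: mono_Cons algebra_simps)
qed (simp add: mono_def)

lemma cocreas_mult: "cocreas t mu (\<lambda>x. c * g x) = c * cocreas t mu g"
proof (induction mu arbitrary: g)
  case (Cons m mu)
  have "cocrea t m (\<lambda>x. c * g x) = (\<lambda>x. c * cocrea t m g x)"
    by (rule ext) (simp add: cocrea_def upsum_mult)
  then show ?case using Cons by simp
qed simp

lemma cocreas_cong: "(\<And>al. length al = length mu \<Longrightarrow> g al = h al) \<Longrightarrow> cocreas t mu g = cocreas t mu h"
proof (induction mu arbitrary: g h)
  case (Cons m mu)
  have "cocrea t m g al = cocrea t m h al" if "length al = length mu" for al
    unfolding cocrea_def by (rule upsum_cong) (use Cons.prems that in auto)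
  then show ?case using Cons.IH[of "cocrea t m g" "cocrea t m h"] by simp
qed simp

lemma upsum_add: "upsum t (\<lambda>k x. F k x + G k x) be = upsum t F be + upsum t G be"
  by (induction be arbitrary: F G) (auto simp: algebra_simps)

lemma cocreas_add: "cocreas t mu (\<lambda>x. f x + g x) = cocreas t mu f + cocreas t mu g"
proof (induction mu arbitrary: f g)
  case (Cons m mu)
  have "cocrea t m (\<lambda>x. f x + g x) = (\<lambda>x. cocrea t m f x + cocrea t m g x)"
    by (rule ext) (simp add: cocrea_def upsum_add)
  then show ?case using Cons by simp
qed simp

lemma cocreas_sum: "cocreas t mu (\<lambda>x. \<Sum>i\<in>A. f i x) = (\<Sum>i\<in>A. cocreas t mu (f i))"
proof (induction A rule: infinite_finite_induct)
  case (insert i A)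
  then show ?case by (simp add: cocreas_add)
qed (use cocreas_mult[of t mu 0 "\<lambda>x. 0"] in simp_all)

lemma pair_prod_Suc:
  "(\<Prod>(i, j)\<in>{(i, j). i < j \<and> j < Suc L}. h i j :: 'a::comm_monoid_mult) =
    (\<Prod>j<L. h 0 (Suc j)) * (\<Prod>(i, j)\<in>{(i, j). i < j \<and> j < L}. h (Suc i) (Suc j))"
proof -
  have eq: "{(i, j). i < j \<and> j < Suc L} = (\<lambda>j. (0, Suc j)) ` {..<L} \<union> (\<lambda>(i, j). (Suc i, Suc j)) ` {(i, j). i < j \<and> j < L}"
  proof -
    have "(i, j) \<in> (\<lambda>j. (0, Suc j)) ` {..<L} \<union> (\<lambda>(i, j). (Suc i, Suc j)) ` {(i, j). i < j \<and> j < L}"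
      if "i < j" "j < Suc L" for i j
      using that by (cases i; cases j) (auto simp: image_iff)
    then show ?thesis by auto
  qed
  have fin: "finite {(i, j). i < j \<and> j < L}"
    by (rule finite_subset[of _ "{..<L} \<times> {..<L}"]) auto
  show ?thesis unfolding eq
    by (subst prod.union_disjoint) (auto simp: fin fin[unfolded split_def] prod.reindex inj_on_def split_def)
qed

lemma cocreas_mono:
  "cocreas t mu (mono y) = mono y mu * (\<Prod>(i, j)\<in>{(i, j). i < j \<and> j < length mu}. y i - t * y j)"
proof (induction mu arbitrary: y)
  case (Cons m mu)
  let ?y = "\<lambda>i. y (Suc i)"
  have "cocrea t m (mono y) be = y 0 ^ m * (\<Prod>j<length mu. y 0 - t * ?y j) * mono ?y be" if "length be = length mu" for be
    using upsum_mono[of t "y 0" m be ?y] that by (simp add: cocrea_def mono_Cons mult_ac)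
  then have "cocreas t (m # mu) (mono y) = cocreas t mu (\<lambda>be. y 0 ^ m * (\<Prod>j<length mu. y 0 - t * ?y j) * mono ?y be)"
    unfolding cocreas.simps by (rule cocreas_cong)
  then show ?case
    unfolding cocreas_mult Cons.IH mono_Cons length_Cons pair_prod_Suc by (simp add: mult_ac)
qed (simp add: mono_def)

lemma cocreas_alternant:
  "cocreas t mu (\<lambda>al. alternant al x) = (\<Sum>w | w permutes {..<length mu}. of_int (sign w) *
    (mono (\<lambda>i. x (w i)) mu * (\<Prod>(i, j)\<in>{(i, j). i < j \<and> j < length mu}. x (w i) - t * x (w j))))"
proof -
  have "cocreas t mu (\<lambda>al. alternant al x) =
    cocreas t mu (\<lambda>al. \<Sum>w | w permutes {..<length mu}. of_int (sign w) * mono (\<lambda>i. x (w i)) al)"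
    by (rule cocreas_cong) (simp add: alternant_mono)
  then show ?thesis by (simp add: cocreas_sum cocreas_mult cocreas_mono)
qed

definition pad :: "nat \<Rightarrow> nat list \<Rightarrow> nat list" where
  "pad N mu = mu @ replicate (N - length mu) 0"

lemma length_pad: "length mu \<le> N \<Longrightarrow> length (pad N mu) = N"
  by (simp add: pad_def)

lemma nth_pad: "i < N \<Longrightarrow> pad N mu ! i = nth_default 0 mu i"
  by (auto simp: pad_def nth_append nth_default_def)

text \<open>The denominators for the permutation w form a Vandermonde product that differs from the
  one of x by the sign of w. Multiplication by the latter clears them and turns the symmetrisation
  into an antisymmetrisation.\<close>

lemma hall_littlewood_alternant:
  fixes x :: "nat \<Rightarrow> 'a::field"
  assumes len: "length mu \<le> N" and x: "inj_on x {..<N}" and norm: "hl_norm N mu t \<noteq> 0"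
  shows "hall_littlewood_P N mu x t * hl_norm N mu t * alternant (stair N) x =
    cocreas t (pad N mu) (\<lambda>al. alternant al x)"
proof -
  let ?S = "{(i, j). i < j \<and> j < N}"
  let ?A = "alternant (stair N) x"
  have fin: "finite ?S"
    by (rule finite_subset[of _ "{..<N} \<times> {..<N}"]) auto
  have "?A \<noteq> 0"
    unfolding alternant_stair using x fin by (auto simp: inj_on_def)
  have "hall_littlewood_P N mu x t * hl_norm N mu t * ?A =
    (\<Sum>w | w permutes {..<N}. (\<Prod>i<N. x (w i) ^ nth_default 0 mu i) *
        (\<Prod>(i, j)\<in>?S. (x (w i) - t * x (w j)) / (x (w i) - x (w j))) * ?A)"
    unfolding hall_littlewood_P_def sum_distrib_right[symmetric] using norm by simp
  also have "\<dots> = cocreas t (pad N mu) (\<lambda>al. alternant al x)"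
    unfolding cocreas_alternant length_pad[OF len]
  proof (rule sum.cong)
    fix w assume "w \<in> {w. w permutes {..<N}}"
    then have w: "w permutes {..<length (stair N)}" by simp
    have "(\<Prod>(i, j)\<in>?S. (x (w i) - t * x (w j)) / (x (w i) - x (w j))) =
      (\<Prod>(i, j)\<in>?S. x (w i) - t * x (w j)) / (\<Prod>(i, j)\<in>?S. x (w i) - x (w j))"
      unfolding split_def by (rule prod_dividef)
    also have "(\<Prod>(i, j)\<in>?S. x (w i) - x (w j)) = of_int (sign w) * ?A"
      using alternant_permute[OF w, of x] alternant_stair[of N "x \<circ> w"] by simp
    also have "(\<Prod>(i, j)\<in>?S. x (w i) - t * x (w j)) / (of_int (sign w) * ?A) * ?A =
        of_int (sign w) * (\<Prod>(i, j)\<in>?S. x (w i) - t * x (w j))"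
      using \<open>?A \<noteq> 0\<close> by (simp add: sign_def)
    finally have e: "(\<Prod>(i, j)\<in>?S. (x (w i) - t * x (w j)) / (x (w i) - x (w j))) * ?A =
      of_int (sign w) * (\<Prod>(i, j)\<in>?S. x (w i) - t * x (w j))" .
    have "mono (\<lambda>i. x (w i)) (pad N mu) = (\<Prod>i<N. x (w i) ^ nth_default 0 mu i)"
      unfolding mono_def length_pad[OF len] by (rule prod.cong) (simp_all add: nth_pad)
    then show "(\<Prod>i<N. x (w i) ^ nth_default 0 mu i) * (\<Prod>(i, j)\<in>?S. (x (w i) - t * x (w j)) / (x (w i) - x (w j))) * ?A =
      of_int (sign w) * (mono (\<lambda>i. x (w i)) (pad N mu) * (\<Prod>(i, j)\<in>?S. x (w i) - t * x (w j)))"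
      unfolding mult.assoc e by (simp add: mult_ac)
  qed simp
  finally show ?thesis .
qed

lemma vnorm_prod:
  "finite A \<Longrightarrow> set mu \<subseteq> A \<Longrightarrow> vnorm t mu = (\<Prod>i\<in>A. \<Prod>k=1..count_list mu i. qnum t k)"
proof (induction mu)
  case (Cons m mu)
  have m: "m \<in> A" using Cons.prems by simp
  have "(\<Prod>i\<in>A. \<Prod>k=1..count_list (m # mu) i. qnum t k) =
    (\<Prod>k=1..Suc (count_list mu m). qnum t k) * (\<Prod>i\<in>A - {m}. \<Prod>k=1..count_list mu i. qnum t k)"
    using prod.remove[OF Cons.prems(1) m, of "\<lambda>i. \<Prod>k=1..count_list (m # mu) i. qnum t k"]
    by (simp add: prod.cong[of "A - {m}" "A - {m}" "\<lambda>i. \<Prod>k=1..count_list (m # mu) i. qnum t k" "\<lambda>i. \<Prod>k=1..count_list mu i. qnum t k"])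
  also have "\<dots> = qnum t (Suc (count_list mu m)) * (\<Prod>i\<in>A. \<Prod>k=1..count_list mu i. qnum t k)"
    using prod.remove[OF Cons.prems(1) m, of "\<lambda>i. \<Prod>k=1..count_list mu i. qnum t k"] by (simp add: mult_ac)
  finally show ?case using Cons by simp
qed simp

lemma count_list_replicate [simp]: "count_list (replicate n a) b = (if a = b then n else 0)"
  by (induction n) auto

text \<open>\<open>vnorm\<close> builds the t-factorials of the multiplicities one factor at a time;
  the zeros appended by \<open>pad\<close> account for the multiplicity of 0.\<close>

lemma hl_norm_vnorm:
  fixes t :: "'a::field"
  assumes "t \<noteq> 1" "0 \<notin> set mu"
  shows "hl_norm N mu t = vnorm t (pad N mu)"
proof -
  have q: "(1 - t ^ i) / (1 - t) = qnum t i" for i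
    using assms(1) by (simp add: qnum_def sum_gp_strict)
  have hl: "hl_v m t = (\<Prod>k=1..m. qnum t k)" for m by (simp add: hl_v_def q)
  have c0: "count_list mu 0 = 0" using assms(2) by (simp add: count_list_0_iff)
  have "vnorm t (pad N mu) = (\<Prod>i\<in>insert 0 (set mu). \<Prod>k=1..count_list (pad N mu) i. qnum t k)"
    by (rule vnorm_prod) (auto simp: pad_def)
  also have "\<dots> = (\<Prod>k=1..N - length mu. qnum t k) * (\<Prod>i\<in>set mu. \<Prod>k=1..count_list (pad N mu) i. qnum t k)"
    using assms(2) c0 by (simp add: pad_def)
  also have "(\<Prod>i\<in>set mu. \<Prod>k=1..count_list (pad N mu) i. qnum t k) = (\<Prod>i\<in>set mu. \<Prod>k=1..count_list mu i. qnum t k)"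
    using assms(2) by (intro prod.cong) (auto simp: pad_def)
  finally show ?thesis by (simp add: hl_norm_def hl)
qed

section \<open>Schur functions\<close>

text \<open>Semistandard fillings in which rows may be empty, so that the number of rows can be kept
  equal to the number of variables.\<close>

definition ssyt :: "nat \<Rightarrow> nat list \<Rightarrow> nat list list set" where
  "ssyt M la = {T. length T = length la \<and>
     (\<forall>i<length la. length (T ! i) = la ! i \<and> sorted (T ! i) \<and> set (T ! i) \<subseteq> {..<M}) \<and>
     (\<forall>i j. Suc i < length la \<longrightarrow> j < la ! Suc i \<longrightarrow> T ! i ! j < T ! Suc i ! j)}"

definition weight :: "(nat \<Rightarrow> 'a::comm_monoid_mult) \<Rightarrow> nat list list \<Rightarrow> 'a" where
  "weight x T = (\<Prod>i<length T. prod_list (map x (T ! i)))"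

definition horiz :: "nat list \<Rightarrow> nat list set" where
  "horiz la = {ka. Suc (length ka) = length la \<and> (\<forall>i<length ka. la ! Suc i \<le> ka ! i \<and> ka ! i \<le> la ! i)}"

text \<open>Fills up the rows to the shape \<open>la\<close> with the largest letter M. The row with
  index M is new and consists of M only.\<close>

definition ext :: "nat \<Rightarrow> nat list \<Rightarrow> nat list list \<Rightarrow> nat list list" where
  "ext M la T = map (\<lambda>i. (if i < M then T ! i else []) @ replicate (la ! i - (if i < M then length (T ! i) else 0)) M) [0..<Suc M]"

lemma filter_sorted_split:
  "sorted r \<Longrightarrow> set r \<subseteq> {..<Suc M} \<Longrightarrow>
    r = filter (\<lambda>a. a < M) r @ replicate (length r - length (filter (\<lambda>a. a < M) r)) (M :: nat)"
proof (induction r)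
  case (Cons a r)
  show ?case
  proof (cases "a < M")
    case False
    then have a: "a = M" using Cons.prems by simp
    have "b = M" if "b \<in> set r" for b
    proof -
      have "a \<le> b" "b < Suc M" using Cons.prems that by auto
      then show ?thesis using a by simp
    qed
    with a have "a = M" "\<forall>b\<in>set r. b = M" by auto
    then have "filter (\<lambda>a. a < M) (a # r) = []" "a # r = replicate (length (a # r)) M"
      by (auto simp: filter_empty_conv intro: replicate_eqI)
    then show ?thesis by (metis append_Nil diff_zero list.size(3))
  qed (use Cons in auto)
qed simp

context
  fixes M :: nat and la :: "nat list"
  assumes len: "length la = Suc M" and dec: "\<forall>i<M. la ! Suc i \<le> la ! i"
begin

lemma nth_ext: "i < Suc M \<Longrightarrow> ext M la T ! i = (if i < M then T ! i else []) @ replicate (la ! i - (if i < M then length (T ! i) else 0)) M"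
  unfolding ext_def by (subst nth_map) (auto simp del: upt_Suc)

lemma ext_ssyt:
  assumes ka: "ka \<in> horiz la" and T: "T \<in> ssyt M ka"
  shows "ext M la T \<in> ssyt (Suc M) la"
proof -
  have lk: "length ka = M" and hk: "\<And>i. i < M \<Longrightarrow> la ! Suc i \<le> ka ! i \<and> ka ! i \<le> la ! i"
    using ka len by (auto simp: horiz_def)
  have T': "length T = M" "\<And>i. i < M \<Longrightarrow> length (T ! i) = ka ! i \<and> sorted (T ! i) \<and> set (T ! i) \<subseteq> {..<M}"
    "\<And>i j. Suc i < M \<Longrightarrow> j < ka ! Suc i \<Longrightarrow> T ! i ! j < T ! Suc i ! j"
    using T lk by (auto simp: ssyt_def)
  have "length (ext M la T ! i) = la ! i \<and> sorted (ext M la T ! i) \<and> set (ext M la T ! i) \<subseteq> {..<Suc M}" if "i < Suc M" for i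
    using T'(2)[of i] hk[of i] that unfolding nth_ext[OF that] by (cases "i < M") (fastforce simp: sorted_append)+
  moreover have "ext M la T ! i ! j < ext M la T ! Suc i ! j" if "Suc i < Suc M" "j < la ! Suc i" for i j
  proof -
    have i: "i < M" "i < Suc M" using that by auto
    have j: "j < ka ! i" using hk[OF i(1)] that by simp
    then have l: "ext M la T ! i ! j = T ! i ! j" using T'(2)[OF i(1)] i by (simp add: nth_ext nth_append)
    have "T ! i ! j \<in> set (T ! i)" using T'(2)[OF i(1)] j by simp
    then have "T ! i ! j < M" using T'(2)[OF i(1)] by auto
    then show ?thesis unfolding l nth_ext[OF that(1)]
      using that T'(2)[of "Suc i"] T'(3)[of i j] by (auto simp: nth_append)
  qed
  moreover have "length (ext M la T) = Suc M" by (simp add: ext_def)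
  ultimately show ?thesis by (simp add: ssyt_def len)
qed

lemma weight_ext:
  fixes x :: "nat \<Rightarrow> 'a::comm_semiring_1"
  assumes ka: "ka \<in> horiz la" and T: "T \<in> ssyt M ka"
  shows "weight x (ext M la T) = x M ^ ((\<Sum>i<M. la ! i - ka ! i) + la ! M) * weight x T"
proof -
  have lk: "length ka = M" using ka len by (auto simp: horiz_def)
  have T': "length T = M" "\<And>i. i < M \<Longrightarrow> length (T ! i) = ka ! i" using T lk by (auto simp: ssyt_def)
  have "weight x (ext M la T) = (\<Prod>i<M. prod_list (map x (ext M la T ! i))) * prod_list (map x (ext M la T ! M))"
    by (simp add: weight_def ext_def del: upt_Suc)
  also have "(\<Prod>i<M. prod_list (map x (ext M la T ! i))) = (\<Prod>i<M. prod_list (map x (T ! i)) * x M ^ (la ! i - ka ! i))"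
    by (rule prod.cong) (auto simp: nth_ext T' prod_list_replicate)
  finally show ?thesis
    by (simp add: weight_def T'(1) nth_ext prod_list_replicate prod.distrib power_add power_sum mult_ac)
qed

lemma res_ext:
  assumes ka: "ka \<in> horiz la" and T: "T \<in> ssyt M ka"
  shows "map (filter (\<lambda>a. a < M)) (butlast (ext M la T)) = T"
proof (rule nth_equalityI)
  have lk: "length ka = M" using ka len by (auto simp: horiz_def)
  have T': "length T = M" "\<And>i. i < M \<Longrightarrow> set (T ! i) \<subseteq> {..<M}" using T lk by (auto simp: ssyt_def)
  have le: "length (butlast (ext M la T)) = M" by (simp add: ext_def)
  then show "length (map (filter (\<lambda>a. a < M)) (butlast (ext M la T))) = length T" using T' by simp
  fix i assume "i < length (map (filter (\<lambda>a. a < M)) (butlast (ext M la T)))"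
  then have i: "i < M" using le by simp
  have "filter (\<lambda>a. a < M) (T ! i) = T ! i" using T'(2)[OF i] by (auto simp: filter_id_conv)
  then show "map (filter (\<lambda>a. a < M)) (butlast (ext M la T)) ! i = T ! i"
    using i le by (simp add: nth_butlast nth_ext)
qed

lemma ssyt_res:
  assumes T: "T \<in> ssyt (Suc M) la"
  defines "T' \<equiv> map (filter (\<lambda>a. a < M)) (butlast T)"
  shows "map length T' \<in> horiz la" "T' \<in> ssyt M (map length T')" "ext M la T' = T"
proof -
  have T1: "length T = Suc M" "\<And>i. i < Suc M \<Longrightarrow> length (T ! i) = la ! i \<and> sorted (T ! i) \<and> set (T ! i) \<subseteq> {..<Suc M}"
    "\<And>i j. Suc i < Suc M \<Longrightarrow> j < la ! Suc i \<Longrightarrow> T ! i ! j < T ! Suc i ! j"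
    using T len by (auto simp: ssyt_def)
  have lT': "length T' = M" by (simp add: T'_def T1(1))
  have nth: "T' ! i = filter (\<lambda>a. a < M) (T ! i)" if "i < M" for i
    using that by (simp add: T'_def T1(1) nth_butlast)
  have spl: "T ! i = filter (\<lambda>a. a < M) (T ! i) @ replicate (la ! i - length (filter (\<lambda>a. a < M) (T ! i))) M" if "i < Suc M" for i
    using filter_sorted_split[of "T ! i" M] T1(2)[OF that] by simp
  \<comment> \<open>Columns increase strictly, so row i has entries at least i; in the last row this
    leaves only the letter M.\<close>
  have low: "i \<le> T ! i ! j" if "i < Suc M" "j < la ! i" for i j
    using that
  proof (induction i)
    case (Suc i)
    then have "j < la ! i" using dec by (metis Suc_less_eq less_le_trans)
    then show ?case using Suc T1(3)[of i j] by fastforce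
  qed simp
  have last: "filter (\<lambda>a. a < M) (T ! M) = []"
    unfolding filter_empty_conv using low[of M] T1(2)[of M] by (auto simp: in_set_conv_nth not_less)
  have pre: "T' ! i ! j = T ! i ! j \<and> j < length (T' ! i)" if "i < M" "j < la ! i" "T ! i ! j < M" for i j
  proof -
    let ?f = "filter (\<lambda>a. a < M) (T ! i)"
    have "j < length ?f"
    proof (rule ccontr)
      assume "\<not> j < length ?f"
      then have "(?f @ replicate (la ! i - length ?f) M) ! j = M" using that by (simp add: nth_append)
      then show False using spl[of i] that by auto
    qed
    moreover from this have "(?f @ replicate (la ! i - length ?f) M) ! j = ?f ! j" by (simp add: nth_append)
    ultimately show ?thesis using spl[of i] nth that by auto
  qed
  have up: "T ! i ! j < M" if "Suc i < Suc M" "j < la ! Suc i" for i j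
  proof -
    have "T ! Suc i ! j \<in> set (T ! Suc i)" using T1(2)[OF that(1)] that by simp
    then show ?thesis using T1(2)[OF that(1)] T1(3)[OF that] by fastforce
  qed
  have inter: "la ! Suc i \<le> length (T' ! i) \<and> length (T' ! i) \<le> la ! i" if "i < M" for i
  proof
    show "length (T' ! i) \<le> la ! i" using nth[OF that] T1(2)[of i] that length_filter_le[of _ "T ! i"] by simp
    show "la ! Suc i \<le> length (T' ! i)"
    proof (rule ccontr)
      assume "\<not> la ! Suc i \<le> length (T' ! i)"
      then have j: "length (T' ! i) < la ! Suc i" by simp
      moreover from j have "length (T' ! i) < la ! i" using dec that less_le_trans by blast
      ultimately show False using pre[of i "length (T' ! i)"] up[of i "length (T' ! i)"] that by simp
    qed
  qed
  then show "map length T' \<in> horiz la" by (simp add: horiz_def lT' len)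
  have "T' ! i ! j < T' ! Suc i ! j" if "Suc i < M" "j < length (T' ! Suc i)" for i j
  proof -
    have j: "j < la ! Suc i" using inter[OF that(1)] that(2) by simp
    moreover from j have "j < la ! i" using dec that(1) by (metis Suc_lessD less_le_trans)
    ultimately have "T' ! i ! j = T ! i ! j" using pre[of i j] up[of i j] that by simp
    moreover have "T' ! Suc i ! j = T ! Suc i ! j"
    proof -
      have "T ! Suc i ! j = (filter (\<lambda>a. a < M) (T ! Suc i) @ replicate (la ! Suc i - length (filter (\<lambda>a. a < M) (T ! Suc i))) M) ! j"
        using spl[of "Suc i"] that by simp
      then show ?thesis using nth[OF that(1)] that(2) by (simp add: nth_append)
    qed
    ultimately show ?thesis using T1(3)[of i j] j that by simp
  qed
  moreover have "sorted (T' ! i) \<and> set (T' ! i) \<subseteq> {..<M}" if "i < M" for i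
    using nth[OF that] T1(2)[of i] that sorted_wrt_filter by auto
  ultimately show "T' \<in> ssyt M (map length T')" by (simp add: ssyt_def lT')
  show "ext M la T' = T"
  proof (rule nth_equalityI)
    show "length (ext M la T') = length T" by (simp add: ext_def T1(1))
    fix i assume "i < length (ext M la T')"
    then have i: "i < Suc M" by (simp add: ext_def)
    show "ext M la T' ! i = T ! i"
    proof (cases "i < M")
      case True
      then show ?thesis using spl[OF i] nth[OF True] i by (simp add: nth_ext)
    next
      case False
      then have "i = M" using i by simp
      then show ?thesis using spl[OF i] last by (simp add: nth_ext)
    qed
  qed
qed

lemma ssyt_branch:
  fixes x :: "nat \<Rightarrow> 'a::comm_semiring_1"
  assumes fin: "\<And>ka. finite (ssyt M ka)"
  shows "(\<Sum>T\<in>ssyt (Suc M) la. weight x T) =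
    (\<Sum>ka\<in>horiz la. x M ^ ((\<Sum>i<M. la ! i - ka ! i) + la ! M) * (\<Sum>T\<in>ssyt M ka. weight x T))"
proof -
  have finh: "finite (horiz la)"
  proof (rule finite_subset)
    show "horiz la \<subseteq> {ka. set ka \<subseteq> {..sum_list la} \<and> length ka = M}"
    proof
      fix ka assume "ka \<in> horiz la"
      then have *: "length ka = M" "\<And>i. i < M \<Longrightarrow> ka ! i \<le> la ! i" using len by (auto simp: horiz_def)
      have "ka ! i \<le> sum_list la" if "i < M" for i
        using *(2)[OF that] elem_le_sum_list[of i la] len that by simp
      then show "ka \<in> {ka. set ka \<subseteq> {..sum_list la} \<and> length ka = M}" using *(1) by (auto simp: in_set_conv_nth)
    qed
  qed (simp add: finite_lists_length_eq)
  have "(\<Sum>ka\<in>horiz la. x M ^ ((\<Sum>i<M. la ! i - ka ! i) + la ! M) * (\<Sum>T\<in>ssyt M ka. weight x T)) =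
    (\<Sum>(ka, T)\<in>Sigma (horiz la) (ssyt M). weight x (ext M la T))"
    by (subst sum.Sigma[symmetric]) (auto simp: finh fin sum_distrib_left weight_ext intro!: sum.cong)
  also have "\<dots> = (\<Sum>T\<in>ssyt (Suc M) la. weight x T)"
  proof (rule sum.reindex_bij_witness[of _ "\<lambda>T. (map length (map (filter (\<lambda>a. a < M)) (butlast T)), map (filter (\<lambda>a. a < M)) (butlast T))" "\<lambda>(ka, T). ext M la T"])
    fix p assume "p \<in> Sigma (horiz la) (ssyt M)"
    then obtain ka T where p: "p = (ka, T)" "ka \<in> horiz la" "T \<in> ssyt M ka" by auto
    have "map length T = ka" using p by (intro nth_equalityI) (auto simp: ssyt_def)
    then show "(map length (map (filter (\<lambda>a. a < M)) (butlast (case p of (ka, T) \<Rightarrow> ext M la T))),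
        map (filter (\<lambda>a. a < M)) (butlast (case p of (ka, T) \<Rightarrow> ext M la T))) = p"
      unfolding p prod.case using res_ext[OF p(2,3)] by simp
    show "(case p of (ka, T) \<Rightarrow> ext M la T) \<in> ssyt (Suc M) la" unfolding p using ext_ssyt[OF p(2,3)] by simp
  next
    fix T assume "T \<in> ssyt (Suc M) la"
    from ssyt_res[OF this]
    show "(case (map length (map (filter (\<lambda>a. a < M)) (butlast T)), map (filter (\<lambda>a. a < M)) (butlast T)) of (ka, T) \<Rightarrow> ext M la T) = T"
      "(map length (map (filter (\<lambda>a. a < M)) (butlast T)), map (filter (\<lambda>a. a < M)) (butlast T)) \<in> Sigma (horiz la) (ssyt M)"
      by auto
  qed auto
  finally show ?thesis ..
qed

end

lemma finite_ssyt: "finite (ssyt M la)"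
proof (rule finite_subset)
  let ?R = "{r. set r \<subseteq> {..<M} \<and> length r \<le> sum_list la}"
  show "ssyt M la \<subseteq> {T. set T \<subseteq> ?R \<and> length T = length la}"
    using elem_le_sum_list[of _ la] by (fastforce simp: ssyt_def in_set_conv_nth)
  show "finite {T. set T \<subseteq> ?R \<and> length T = length la}"
    by (intro finite_lists_length_eq finite_lists_length_le) simp
qed

section \<open>Schur functions as quotients of alternants\<close>

definition shift :: "nat list \<Rightarrow> nat list" where
  "shift la = map2 (+) la (stair (length la))"

lemma length_shift [simp]: "length (shift la) = length la"
  by (simp add: shift_def)

lemma nth_shift: "i < length la \<Longrightarrow> shift la ! i = la ! i + (length la - 1 - i)"
  by (simp add: shift_def)

lemma interl_shift:
  assumes "length la = Suc M"
  shows "interl (shift la) = shift ` horiz la"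
proof (intro equalityI subsetI)
  fix ka assume "ka \<in> interl (shift la)"
  then have ka: "length ka = M" "\<And>i. i < M \<Longrightarrow> shift la ! Suc i \<le> ka ! i \<and> ka ! i < shift la ! i"
    using assms by (auto simp: interl_iff)
  define kp where "kp = map (\<lambda>i. ka ! i - (M - 1 - i)) [0..<M]"
  have b: "la ! Suc i \<le> kp ! i \<and> kp ! i \<le> la ! i \<and> ka ! i = kp ! i + (M - 1 - i)" if "i < M" for i
    using ka(2)[OF that] that assms by (auto simp: nth_shift kp_def)
  have lk: "length kp = M" by (simp add: kp_def)
  have "ka = shift kp" by (rule nth_equalityI) (use b ka(1) lk in \<open>auto simp: nth_shift\<close>)
  moreover have "kp \<in> horiz la" using b lk assms by (auto simp: horiz_def)
  ultimately show "ka \<in> shift ` horiz la" by blast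
next
  fix ka assume "ka \<in> shift ` horiz la"
  then obtain kp where kp: "ka = shift kp" "kp \<in> horiz la" by blast
  then have lk: "length kp = M" "\<And>i. i < M \<Longrightarrow> la ! Suc i \<le> kp ! i \<and> kp ! i \<le> la ! i" using assms by (auto simp: horiz_def)
  have "shift la ! Suc i \<le> ka ! i \<and> ka ! i < shift la ! i" if "i < M" for i
    using lk(2)[OF that] that assms lk(1) by (auto simp: kp(1) nth_shift)
  then show "ka \<in> interl (shift la)" using assms lk(1) kp(1) by (auto simp: interl_iff simp flip: length_0_conv)
qed

lemma inj_shift: "inj shift"
proof (rule injI)
  fix la ka :: "nat list" assume eq: "shift la = shift ka"
  then have l: "length la = length ka" by (metis length_shift)
  show "la = ka"
  proof (rule nth_equalityI)
    fix i assume i: "i < length la"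
    then show "la ! i = ka ! i" using arg_cong[OF eq, of "\<lambda>z. z ! i"] l by (simp add: nth_shift)
  qed (rule l)
qed

text \<open>Removing the largest letter from the fillings and the last variable from the alternant
  gives the same recursion, since interlacing of the shifted lists means that the shapes differ by a
  horizontal strip.\<close>

lemma ssyt_alternant:
  fixes x :: "nat \<Rightarrow> 'a::comm_ring_1"
  shows "length la = M \<Longrightarrow> \<forall>i. Suc i < M \<longrightarrow> la ! Suc i \<le> la ! i \<Longrightarrow>
    (\<Sum>T\<in>ssyt M la. weight x T) * alternant (stair M) x = alternant (shift la) x"
proof (induction M arbitrary: la)
  case 0
  then have "ssyt 0 la = {[]}" "shift la = []" by (auto simp: ssyt_def shift_def)
  then show ?case by (simp add: weight_def stair_def)
next
  case (Suc M)
  have dec: "\<forall>i<M. la ! Suc i \<le> la ! i" using Suc.prems by auto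
  have decs: "\<forall>i<M. shift la ! Suc i \<le> shift la ! i" using dec Suc.prems by (auto simp: nth_shift)
  have "alternant (shift la) x = (\<Prod>i<M. x i - x M) *
    (\<Sum>ka\<in>interl (shift la). x M ^ ((\<Sum>i<M. shift la ! i - 1 - ka ! i) + shift la ! M) * alternant ka x)"
    using Suc.prems decs by (intro alternant_branch) auto
  also have "\<dots> = (\<Prod>i<M. x i - x M) * (\<Sum>ka\<in>horiz la. x M ^ ((\<Sum>i<M. la ! i - ka ! i) + la ! M) * alternant (shift ka) x)"
    unfolding interl_shift[OF Suc.prems(1)] sum.reindex[OF inj_on_subset[OF inj_shift subset_UNIV]]
  proof (intro arg_cong2[where f = "(*)"] refl sum.cong, unfold comp_def)
    fix ka assume "ka \<in> horiz la"
    then have "length ka = M" using Suc.prems(1) by (simp add: horiz_def)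
    then have "(\<Sum>i<M. shift la ! i - 1 - shift ka ! i) = (\<Sum>i<M. la ! i - ka ! i)"
      using Suc.prems(1) by (intro sum.cong) (auto simp: nth_shift)
    then show "x M ^ ((\<Sum>i<M. shift la ! i - 1 - shift ka ! i) + shift la ! M) * alternant (shift ka) x =
      x M ^ ((\<Sum>i<M. la ! i - ka ! i) + la ! M) * alternant (shift ka) x"
      using Suc.prems(1) by (simp add: nth_shift)
  qed
  also have "\<dots> = (\<Prod>i<M. x i - x M) * (\<Sum>ka\<in>horiz la. x M ^ ((\<Sum>i<M. la ! i - ka ! i) + la ! M) *
      ((\<Sum>T\<in>ssyt M ka. weight x T) * alternant (stair M) x))"
  proof (intro arg_cong2[where f = "(*)"] refl sum.cong)
    fix ka assume ka: "ka \<in> horiz la"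
    then have "\<forall>i. Suc i < M \<longrightarrow> ka ! Suc i \<le> ka ! i" "length ka = M"
      using Suc.prems by (auto simp: horiz_def intro: order_trans)
    then show "alternant (shift ka) x = (\<Sum>T\<in>ssyt M ka. weight x T) * alternant (stair M) x"
      using Suc.IH by simp
  qed
  also have "\<dots> = (\<Sum>T\<in>ssyt (Suc M) la. weight x T) * alternant (stair (Suc M)) x"
    unfolding ssyt_branch[OF Suc.prems(1) dec finite_ssyt] alternant_stair_Suc
    by (simp add: sum_distrib_left sum_distrib_right mult_ac)
  finally show ?case ..
qed

lemma partition_nth_mono:
  assumes "is_partition la" "Suc i < N"
  shows "pad N la ! Suc i \<le> pad N la ! i"
  using assms unfolding is_partition_def
  by (auto simp: nth_pad nth_default_def sorted_wrt_iff_nth_less)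

theorem schur_alternant:
  assumes la: "is_partition la" "length la \<le> N"
  shows "schur N la x * alternant (stair N) x = alternant (shift (pad N la)) x"
proof -
  let ?A = "{T. column_strict T \<and> shape T = la \<and> set (reading_word T) \<subseteq> {..<N}}"
  let ?p = "\<lambda>T. T @ replicate (N - length la) []"
  have w: "prod_list (map x (reading_word T)) = weight x T" for T
    unfolding weight_def reading_word_def
    by (induction T rule: rev_induct) (auto simp: nth_append mult.commute intro!: prod.cong arg_cong2[where f = "(*)"])
  have wp: "weight x (?p T) = weight x T" for T
    unfolding w[symmetric] by (simp add: reading_word_def)
  have nd: "pad N la ! i = (if i < length la then la ! i else 0)" if "i < N" for i
    using that by (simp add: nth_pad nth_default_def)
  have cs: "T \<in> ?A \<longleftrightarrow> ?p T \<in> ssyt N (pad N la) \<and> length T = length la" for T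
  proof -
    have n: "?p T ! i = (if i < length T then T ! i else [])" if "i < N" "length T = length la" for i
      using that by (simp add: nth_append)
    show ?thesis
    proof
      assume T: "T \<in> ?A"
      then have l: "length T = length la" "\<And>i. i < length la \<Longrightarrow> length (T ! i) = la ! i" by (auto simp: shape_def)
      have "sorted (T ! i) \<and> set (T ! i) \<subseteq> {..<N}" if "i < length la" for i
      proof -
        have m: "T ! i \<in> set T" using that l(1) by simp
        then have "set (T ! i) \<subseteq> set (reading_word T)" by (auto simp: reading_word_def)
        then show ?thesis using m T unfolding column_strict_def by blast
      qed
      moreover have "T ! i ! j < T ! Suc i ! j" if "Suc i < length la" "j < la ! Suc i" for i j
        using T that l by (auto simp: column_strict_def)
      ultimately show "?p T \<in> ssyt N (pad N la) \<and> length T = length la"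
        using l la(2) by (auto simp: ssyt_def length_pad nd n split: if_splits)
    next
      assume T: "?p T \<in> ssyt N (pad N la) \<and> length T = length la"
      then have l: "length T = length la" by simp
      have a: "length (T ! i) = la ! i \<and> sorted (T ! i) \<and> set (T ! i) \<subseteq> {..<N}" if "i < length la" for i
      proof -
        have iN: "i < N" using that la(2) by simp
        then have "length (?p T ! i) = pad N la ! i \<and> sorted (?p T ! i) \<and> set (?p T ! i) \<subseteq> {..<N}"
          using T la(2) unfolding ssyt_def by (simp add: length_pad)
        then show ?thesis unfolding n[OF iN l] nd[OF iN] using that l by simp
      qed
      have b: "T ! i ! j < T ! Suc i ! j" if "Suc i < length la" "j < la ! Suc i" for i j
      proof -
        have "?p T ! i ! j < ?p T ! Suc i ! j"
          using T that la(2) nd[of "Suc i"] unfolding ssyt_def by (simp add: length_pad)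
        then show ?thesis using n[of i] n[of "Suc i"] that la(2) l by simp
      qed
      have "shape T = la" unfolding shape_def by (rule nth_equalityI) (use a l in auto)
      then show "T \<in> ?A" using a b l la(1)
        by (auto simp: column_strict_def reading_word_def in_set_conv_nth) (metis lessThan_iff nth_mem subsetD)
    qed
  qed
  have img: "?p ` ?A = ssyt N (pad N la)"
  proof (intro equalityI subsetI)
    fix T' assume T': "T' \<in> ssyt N (pad N la)"
    let ?T = "take (length la) T'"
    have l: "length T' = N" using T' la(2) by (simp add: ssyt_def length_pad)
    have "T' = ?p ?T"
    proof (rule nth_equalityI)
      fix i assume i: "i < length T'"
      have "length (T' ! i) = (if i < length la then la ! i else 0)"
        using T' i l la(2) nd[of i] by (simp add: ssyt_def length_pad)
      then show "T' ! i = ?p ?T ! i" using i l la(2) by (auto simp: nth_append)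
    qed (use l la(2) in simp)
    then have e: "?p ?T = T'" by (rule sym)
    have "length ?T = length la" using l la(2) by simp
    then have "?T \<in> ?A" unfolding cs e using T' by blast
    then show "T' \<in> ?p ` ?A" by (rule image_eqI[where f = "\<lambda>T. T @ replicate (N - length la) []", OF e[symmetric]])
  next
    fix T' assume "T' \<in> ?p ` ?A"
    then show "T' \<in> ssyt N (pad N la)" using cs by blast
  qed
  have "schur N la x = (\<Sum>T\<in>?A. weight x (?p T))" unfolding schur_def w wp ..
  also have "\<dots> = (\<Sum>T\<in>?p ` ?A. weight x T)"
    by (subst sum.reindex) (auto simp: inj_on_def)
  finally show ?thesis
    unfolding img using ssyt_alternant[of "pad N la" N x] la partition_nth_mono length_pad by auto
qed

section \<open>Independence of alternants\<close>

definition var :: "nat \<Rightarrow> (nat \<Rightarrow>\<^sub>0 nat) \<Rightarrow>\<^sub>0 int poly" where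
  "var i = Poly_Mapping.single (Poly_Mapping.single i 1) 1"

definition expo :: "(nat \<Rightarrow> nat) \<Rightarrow> nat list \<Rightarrow> nat \<Rightarrow>\<^sub>0 nat" where
  "expo w al = (\<Sum>i<length al. Poly_Mapping.single (w i) (al ! i))"

lemma var_power: "var i ^ k = Poly_Mapping.single (Poly_Mapping.single i k) 1"
  by (induction k) (simp_all add: var_def mult_single single_add[symmetric])

lemma prod_single: "finite A \<Longrightarrow> (\<Prod>i\<in>A. Poly_Mapping.single (m i) (1 :: int poly)) = Poly_Mapping.single (\<Sum>i\<in>A. m i :: nat \<Rightarrow>\<^sub>0 nat) 1"
  by (induction A rule: finite_induct) (simp_all add: mult_single)

lemma mono_var: "mono (\<lambda>i. var (w i)) al = Poly_Mapping.single (expo w al) 1"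
  by (simp add: mono_def var_power prod_single expo_def)

lemma lookup_expo: "inj w \<Longrightarrow> j < length al \<Longrightarrow> Poly_Mapping.lookup (expo w al) (w j) = al ! j"
  unfolding expo_def Poly_Mapping.lookup_sum
  by (simp add: Poly_Mapping.lookup_single when_def inj_eq)

lemma strict_distinct: "sorted_wrt (>) (xs :: nat list) \<Longrightarrow> distinct xs"
  by (induction xs) auto

lemma expo_eq:
  assumes w: "w permutes {..<M}" and ka: "length ka = M" "sorted_wrt (>) ka" and la: "length la = M" "sorted_wrt (>) la"
  shows "expo w ka = expo id la \<longleftrightarrow> w = id \<and> ka = la"
proof
  assume eq: "expo w ka = expo id la"
  have wi: "w i < M" if "i < M" for i using w that permutes_in_image by fastforce
  have e: "ka ! i = la ! w i" if "i < M" for i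
    using lookup_expo[of w i ka] lookup_expo[of id "w i" la] eq that ka la wi[OF that] permutes_inj[OF w] by simp
  have "set ka = (\<lambda>i. ka ! i) ` {..<M}" using ka(1) by (auto simp: set_conv_nth)
  also have "\<dots> = (\<lambda>i. la ! w i) ` {..<M}" using e by (intro image_cong) auto
  also have "\<dots> = (\<lambda>i. la ! i) ` (w ` {..<M})" by auto
  also have "\<dots> = set la" using permutes_image[OF w] la(1) by (auto simp: set_conv_nth image_iff)
  finally have s: "ka = la" using strict_set_unique ka(2) la(2) by blast
  have "w i = i" for i
  proof (cases "i < M")
    case True
    then show ?thesis using e[OF True] wi[OF True] s strict_distinct[OF la(2)] la(1) by (simp add: nth_eq_iff_index_eq)
  next
    case False
    then show ?thesis using w by (auto simp: permutes_def)
  qed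
  then show "w = id \<and> ka = la" using s by auto
qed auto

text \<open>Among the monomials of an alternant with strictly decreasing exponents, only the one for
  the identity permutation has its exponents in decreasing order.\<close>

lemma alternant_coeff:
  assumes "length ka = M" "sorted_wrt (>) ka" "length la = M" "sorted_wrt (>) la"
  shows "Poly_Mapping.lookup (Poly_Mapping.single 0 a * alternant ka var) (expo id la) = (if ka = la then a else 0)"
proof -
  let ?S = "{w. w permutes {..<M}}"
  have "Poly_Mapping.single 0 a * alternant ka var = (\<Sum>w\<in>?S. Poly_Mapping.single (expo w ka) (a * of_int (sign w)))"
    unfolding alternant_mono mono_var assms(1) sum_distrib_left single_of_int[symmetric] mult_single by simp
  then have "Poly_Mapping.lookup (Poly_Mapping.single 0 a * alternant ka var) (expo id la) =
    (\<Sum>w\<in>?S. if w = id then (if ka = la then a else 0) else 0)"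
    using expo_eq[OF _ assms] by (auto simp: Poly_Mapping.lookup_sum Poly_Mapping.lookup_single when_def intro!: sum.cong)
  also have "\<dots> = (if ka = la then a else 0)"
    by (subst sum.delta) (auto simp: finite_permutations permutes_id[unfolded id_def] permutes_id)
  finally show ?thesis .
qed

lemma alternants_independent:
  assumes fin: "finite S" and S: "\<And>ka. ka \<in> S \<Longrightarrow> length ka = M \<and> sorted_wrt (>) ka"
    and z: "(\<Sum>ka\<in>S. Poly_Mapping.single 0 (a ka) * alternant ka var) = 0" and la: "la \<in> S"
  shows "a la = 0"
proof -
  have "0 = (\<Sum>ka\<in>S. Poly_Mapping.lookup (Poly_Mapping.single 0 (a ka) * alternant ka var) (expo id la))"
    using arg_cong[OF z, of "\<lambda>p. Poly_Mapping.lookup p (expo id la)"] by (simp add: Poly_Mapping.lookup_sum)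
  also have "\<dots> = (\<Sum>ka\<in>S. if ka = la then a ka else 0)"
    by (rule sum.cong) (use S la alternant_coeff in auto)
  finally show ?thesis using fin la by simp
qed

text \<open>Independence makes the two families of exponent lists agree as multisets. An identity
  between symmetric polynomials is thereby carried over to any function of the exponent
  lists.\<close>

lemma alternant_sum_transfer:
  fixes G :: "nat list \<Rightarrow> 'b::comm_ring_1"
  assumes fin: "finite Q" "finite I" and Q: "\<And>q. q \<in> Q \<Longrightarrow> length (e q) = M \<and> sorted_wrt (>) (e q)"
    and I: "\<And>ka. ka \<in> I \<Longrightarrow> length ka = M \<and> sorted_wrt (>) ka"
    and eq: "(\<Sum>q\<in>Q. alternant (e q) var) = (\<Sum>ka\<in>I. alternant ka var)"
  shows "(\<Sum>q\<in>Q. G (e q)) = (\<Sum>ka\<in>I. G ka)"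
proof -
  have count: "card {q \<in> Q. e q = la} = (if la \<in> I then 1 else 0)" if la: "length la = M" "sorted_wrt (>) la" for la
  proof -
    have one: "alternant ka var = Poly_Mapping.single 0 1 * alternant ka var" for ka by simp
    have "(\<Sum>q\<in>Q. Poly_Mapping.lookup (alternant (e q) var) (expo id la)) = (\<Sum>ka\<in>I. Poly_Mapping.lookup (alternant ka var) (expo id la))"
      using arg_cong[OF eq, of "\<lambda>p. Poly_Mapping.lookup p (expo id la)"] by (simp add: Poly_Mapping.lookup_sum)
    also have "(\<Sum>q\<in>Q. Poly_Mapping.lookup (alternant (e q) var) (expo id la)) = (\<Sum>q\<in>Q. if e q = la then 1 else 0)"
      by (rule sum.cong[OF refl], subst one, rule alternant_coeff) (use Q la in auto)
    also have "(\<Sum>ka\<in>I. Poly_Mapping.lookup (alternant ka var) (expo id la)) = (\<Sum>ka\<in>I. if ka = la then 1 else 0)"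
      by (rule sum.cong[OF refl], subst one, rule alternant_coeff) (use I la in auto)
    finally have "of_nat (card {q \<in> Q. e q = la}) = (of_nat (if la \<in> I then 1 else 0) :: int poly)"
      using fin by (simp add: sum.If_cases Int_def)
    then show ?thesis unfolding of_nat_eq_iff .
  qed
  have "(\<Sum>q\<in>Q. G (e q)) = (\<Sum>la\<in>e ` Q. \<Sum>q\<in>{q \<in> Q. e q = la}. G (e q))"
    by (rule sum.image_gen[OF fin(1)])
  also have "\<dots> = (\<Sum>la\<in>e ` Q. of_nat (card {q \<in> Q. e q = la}) * G la)"
    by (intro sum.cong) simp_all
  also have "\<dots> = (\<Sum>la\<in>e ` Q. if la \<in> I then G la else 0)"
    by (rule sum.cong) (use Q count in auto)
  also have "\<dots> = (\<Sum>la\<in>e ` Q \<inter> I. G la)" using fin(1) by (simp add: sum.inter_restrict)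
  also have "e ` Q \<inter> I = I"
  proof -
    have "la \<in> e ` Q" if "la \<in> I" for la
    proof (rule ccontr)
      assume "la \<notin> e ` Q"
      then have "{q \<in> Q. e q = la} = {}" by auto
      then have c0: "card {q \<in> Q. e q = la} = 0" by (simp only: card.empty)
      have "card {q \<in> Q. e q = la} = 1" using count[of la] I[OF that] that by presburger
      then show False unfolding c0 by simp
    qed
    then show ?thesis by auto
  qed
  finally show ?thesis .
qed

lemma alternant_cong:
  assumes "\<And>i. i < length al \<Longrightarrow> y i = y' i"
  shows "alternant al y = alternant al y'"
  unfolding alternant_def
proof (intro sum.cong arg_cong2[where f = "(*)"] prod.cong refl)
  fix w i assume "w \<in> {w. w permutes {..<length al}}" "i \<in> {..<length al}"
  then have "w i < length al" using permutes_in_image by fastforce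
  then show "y (w i) ^ al ! i = y' (w i) ^ al ! i" using assms by simp
qed

section \<open>Separating the bottom row of a class\<close>

lemma lattice_strict:
  assumes fin: "finite Z" and l: "lattice N Z c"
  shows "sorted_wrt (>) (cexp N Z c)"
proof -
  have le: "csize Z c (Suc i) \<le> csize Z c i" if "Suc i < N" for i
  proof -
    have "nrm (crow Z c (Suc i)) (crow Z c i)"
      using l that unfolding lattice_def ctab_nth by auto
    then have "length (crow Z c (Suc i)) \<le> length (crow Z c i)"
      unfolding nrm_iff by auto
    then show ?thesis by (simp add: length_crow fin)
  qed
  have step: "cexp N Z c ! Suc i < cexp N Z c ! i" if "Suc i < N" for i
    using le[OF that] that by simp
  have "cexp N Z c ! j < cexp N Z c ! i" if "i < j" "j < N" for i j
    using that
  proof (induction j)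
    case (Suc j)
    then show ?case using step[of j] by (cases "i = j") auto
  qed simp
  then show ?thesis by (simp add: sorted_wrt_iff_nth_less)
qed

lemma interl_strict:
  assumes "ka \<in> interl be"
  shows "sorted_wrt (>) ka"
proof -
  have *: "Suc (length ka) = length be" "\<And>i. i < length ka \<Longrightarrow> be ! Suc i \<le> ka ! i \<and> ka ! i < be ! i"
    using assms by (auto simp: interl_iff)
  have "ka ! j < ka ! i" if "i < j" "j < length ka" for i j
    using that
  proof (induction j)
    case (Suc j)
    then have "ka ! Suc j < ka ! j" using *(2)[of j] *(2)[of "Suc j"] by simp
    then show ?case using Suc by (cases "i = j") auto
  qed simp
  then show ?thesis by (simp add: sorted_wrt_iff_nth_less)
qed

context
  fixes Z :: "'a::linorder set" and U :: "'a \<Rightarrow> nat" and M :: nat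
  assumes fin: "finite Z"
begin

text \<open>The full class of \<open>U\<close> in M + 1 rows. The sums below look at the lengths of
  the upper M rows; \<open>rest R\<close> is the fibre over a given bottom row R.\<close>

definition cls :: "('a \<Rightarrow> nat) set" where
  "cls = {c\<in>cols (Suc M) Z. cword (Suc M) Z c \<simeq> cword (Suc M) Z U}"

definition rest :: "'a set \<Rightarrow> ('a \<Rightarrow> nat) set" where
  "rest R = {d\<in>cols M (Z - R). sl R @ cword M (Z - R) d \<simeq> cword (Suc M) Z U}"

lemma sum_cls:
  fixes H :: "nat list \<Rightarrow> 'b::comm_monoid_add"
  shows "(\<Sum>c\<in>cls. H (cexp M Z c)) = (\<Sum>R\<in>Pow Z. \<Sum>d\<in>rest R. H (cexp M (Z - R) d))"
proof -
  have finc: "finite cls"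
    by (rule finite_subset[of _ "cols (Suc M) Z"]) (auto simp: cls_def fin intro!: finite_PiE)
  have "(\<Sum>c\<in>cls. H (cexp M Z c)) = (\<Sum>R\<in>Pow Z. \<Sum>c\<in>{c\<in>cls. {a\<in>Z. c a = M} = R}. H (cexp M Z c))"
    by (rule sum.group[symmetric]) (auto simp: finc fin)
  also have "\<dots> = (\<Sum>R\<in>Pow Z. \<Sum>d\<in>rest R. H (cexp M (Z - R) d))"
  proof (rule sum.cong[OF refl])
    fix R assume "R \<in> Pow Z"
    then have R: "R \<subseteq> Z" by simp
    have ex: "{a\<in>Z - R. d a = i} = {a\<in>Z. c a = i}" if "i < M" "\<And>a. a \<in> R \<Longrightarrow> c a = M" "\<And>a. a \<in> Z - R \<Longrightarrow> d a = c a"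
      for c d :: "'a \<Rightarrow> nat" and i using that by force
    have cw: "cword (Suc M) Z c = sl R @ cword M (Z - R) d \<and> cexp M Z c = cexp M (Z - R) d"
      if "{a\<in>Z. c a = M} = R" "\<And>a. a \<in> Z - R \<Longrightarrow> d a = c a" for c d :: "'a \<Rightarrow> nat"
    proof -
      have RM: "\<And>a. a \<in> R \<Longrightarrow> c a = M" using that(1) by auto
      have "cexp M Z c = cexp M (Z - R) d"
        unfolding cexp_def csize_def by (rule map_cong[OF refl]) (use ex[OF _ RM that(2)] in auto)
      moreover have "map (crow Z c) [0..<M] = map (crow (Z - R) d) [0..<M]"
        unfolding crow_def by (rule map_cong[OF refl]) (use ex[OF _ RM that(2)] in auto)
      moreover have "crow Z c M = sl R" using that(1) by (simp add: crow_def)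
      ultimately show ?thesis unfolding cword_def by (simp del: map_eq_conv)
    qed
    show "(\<Sum>c\<in>{c\<in>cls. {a\<in>Z. c a = M} = R}. H (cexp M Z c)) = (\<Sum>d\<in>rest R. H (cexp M (Z - R) d))"
    proof (rule sum.reindex_bij_witness[of _ "\<lambda>d. \<lambda>a\<in>Z. if a \<in> R then M else d a" "\<lambda>c. restrict c (Z - R)"])
      fix c assume c: "c \<in> {c\<in>cls. {a\<in>Z. c a = M} = R}"
      then have cc: "c \<in> cols (Suc M) Z" "{a\<in>Z. c a = M} = R" by (auto simp: cls_def)
      have w: "cword (Suc M) Z c = sl R @ cword M (Z - R) (restrict c (Z - R)) \<and> cexp M Z c = cexp M (Z - R) (restrict c (Z - R))"
        by (rule cw[OF cc(2)]) simp
      show "(\<lambda>a\<in>Z. if a \<in> R then M else restrict c (Z - R) a) = c"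
        by (rule ext) (use cc in \<open>auto simp: restrict_def PiE_def extensional_def\<close>)
      show "H (cexp M (Z - R) (restrict c (Z - R))) = H (cexp M Z c)" using w by simp
      have "restrict c (Z - R) \<in> cols M (Z - R)"
      proof (rule PiE_I)
        fix a assume a: "a \<in> Z - R"
        then have "c a < Suc M" "c a \<noteq> M" using cc by auto
        then show "restrict c (Z - R) a \<in> {..<M}" using a by simp
      qed auto
      then show "restrict c (Z - R) \<in> rest R" using c w unfolding rest_def cls_def by auto
    next
      fix d assume d: "d \<in> rest R"
      then have dd: "d \<in> cols M (Z - R)" by (simp add: rest_def)
      let ?c = "\<lambda>a\<in>Z. if a \<in> R then M else d a"
      have dM: "d a < M" if "a \<in> Z - R" for a using dd that by auto
      have c2: "{a\<in>Z. ?c a = M} = R" using R dM by (force split: if_splits)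
      show "restrict ?c (Z - R) = d"
        by (rule ext) (use dd in \<open>auto simp: restrict_def PiE_def extensional_def\<close>)
      have w: "cword (Suc M) Z ?c = sl R @ cword M (Z - R) d \<and> cexp M Z ?c = cexp M (Z - R) d"
        by (rule cw[OF c2]) simp
      have "?c \<in> cols (Suc M) Z" using dM by (auto simp: less_Suc_eq)
      then show "?c \<in> {c\<in>cls. {a\<in>Z. c a = M} = R}" using d w c2 unfolding rest_def cls_def by simp
    qed
  qed
  finally show ?thesis .
qed

lemma sum_rest:
  fixes G :: "nat list \<Rightarrow> 'b::{idom, ring_char_0}"
  assumes "alt G"
  shows "(\<Sum>d\<in>rest R. G (cexp M (Z - R) d)) = (\<Sum>d\<in>{d\<in>rest R. lattice M (Z - R) d}. G (cexp M (Z - R) d))"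
proof (rule lattice_sum[OF _ _ assms])
  fix c c' v assume "c \<in> rest R" "c' \<in> cols M (Z - R)" "cword M (Z - R) c \<simeq> cword M (Z - R) c'"
  then show "c' \<in> rest R" unfolding rest_def using pl_trans pl_sym pl_append_left by blast
qed (auto simp: fin rest_def)

lemma rest_alternant:
  fixes y :: "nat \<Rightarrow> 'b::comm_ring_1"
  shows "(\<Sum>d\<in>rest R. (\<Prod>j<M. y j ^ csize (Z - R) d j)) * alternant (stair M) y = (\<Sum>d\<in>rest R. alternant (cexp M (Z - R) d) y)"
proof (rule sum_alternant_cexp)
  fix c c' assume "c \<in> rest R" "c' \<in> cols M (Z - R)" "cword M (Z - R) c \<simeq> cword M (Z - R) c'"
  then show "c' \<in> rest R" unfolding rest_def using pl_trans pl_sym pl_append_left by blast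
qed (auto simp: fin rest_def)

text \<open>The variable of the bottom row is set to 1, which forgets the length of that row.
  Branching of the alternant of \<open>U\<close> then yields the interlacing lists, and the common
  factor, the product of all \<open>var i - 1\<close>, is cancelled.\<close>

lemma cls_alternant:
  assumes U: "U \<in> cols (Suc M) Z" "lattice (Suc M) Z U" "csize Z U M = 0"
  shows "(\<Sum>c\<in>cls. alternant (cexp M Z c) var) = (\<Sum>ka\<in>interl (cexp (Suc M) Z U). alternant ka var)"
proof -
  let ?be = "cexp (Suc M) Z U"
  define y where "y = var(M := 1)"
  define p where "p = (\<Prod>i<M. var i - 1)"
  have y: "y i = var i" if "i < M" for i using that by (simp add: y_def)
  have yM: "y M = 1" by (simp add: y_def)
  have ne: "var i \<noteq> 1" for i
  proof
    assume "var i = 1"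
    then have "Poly_Mapping.single (Poly_Mapping.single i (1 :: nat)) (1 :: int poly) = Poly_Mapping.single 0 1" by (simp add: var_def)
    from arg_cong[OF this, of "\<lambda>p. Poly_Mapping.lookup p 0"]
    have "Poly_Mapping.single i (1 :: nat) = 0" by (simp add: Poly_Mapping.lookup_single when_def split: if_splits)
    from arg_cong[OF this, of "\<lambda>p. Poly_Mapping.lookup p i"] show False by (simp add: Poly_Mapping.lookup_single)
  qed
  have p0: "p \<noteq> 0" unfolding p_def using ne by simp
  have py: "(\<Prod>i<M. y i - y M) = p" unfolding p_def yM by (rule prod.cong) (simp_all add: y)
  have st: "alternant (stair M) y = alternant (stair M) var" by (rule alternant_cong) (simp add: y)
  have pr: "(\<Prod>j<Suc M. y j ^ csize Z c j) = (\<Prod>j<M. var j ^ csize Z c j)" for c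
    by (simp add: yM y cong: prod.cong_simp)
  have E: "(\<Prod>j<M. var j ^ csize X d j) = (\<Prod>j<M. var j ^ (cexp M X d ! j - (M - 1 - j)))" for X and d :: "'a \<Rightarrow> nat"
    by (rule prod.cong) simp_all
  have strict: "sorted_wrt (>) ?be" by (rule lattice_strict[OF fin U(2)])
  have dec: "\<forall>i<M. ?be ! Suc i \<le> ?be ! i"
    using strict by (auto simp: sorted_wrt_iff_nth_less intro!: less_imp_le)
  have "p * ((\<Sum>c\<in>cls. (\<Prod>j<M. var j ^ csize Z c j)) * alternant (stair M) var) =
      (\<Sum>c\<in>cls. (\<Prod>j<Suc M. y j ^ csize Z c j)) * alternant (stair (Suc M)) y"
    unfolding alternant_stair_Suc py st pr by (simp add: mult_ac)
  also have "\<dots> = alternant ?be y"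
    unfolding cls_def by (rule lattice_class_alternant[OF fin U(1,2)])
  also have "\<dots> = (\<Prod>i<M. y i - y M) * (\<Sum>ka\<in>interl ?be. y M ^ ((\<Sum>i<M. ?be ! i - 1 - ka ! i) + ?be ! M) * alternant ka y)"
    by (rule alternant_branch[OF _ dec]) simp
  also have "\<dots> = p * (\<Sum>ka\<in>interl ?be. alternant ka var)"
    unfolding py unfolding yM power_one mult_1
  proof (intro arg_cong2[where f = "(*)"] refl sum.cong)
    fix ka assume "ka \<in> interl ?be"
    then have "length ka = M" by (simp add: interl_iff)
    then show "alternant ka y = alternant ka var" by (intro alternant_cong) (simp add: y)
  qed
  finally have eq: "(\<Sum>c\<in>cls. (\<Prod>j<M. var j ^ csize Z c j)) * alternant (stair M) var = (\<Sum>ka\<in>interl ?be. alternant ka var)"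
    using p0 by simp
  have "(\<Sum>c\<in>cls. (\<Prod>j<M. var j ^ csize Z c j)) * alternant (stair M) var =
    (\<Sum>R\<in>Pow Z. (\<Sum>d\<in>rest R. (\<Prod>j<M. var j ^ csize (Z - R) d j)) * alternant (stair M) var)"
    unfolding E sum_cls[of "\<lambda>al. \<Prod>j<M. var j ^ (al ! j - (M - 1 - j))"] by (rule sum_distrib_right)
  also have "\<dots> = (\<Sum>R\<in>Pow Z. \<Sum>d\<in>rest R. alternant (cexp M (Z - R) d) var)"
    by (rule sum.cong[OF refl]) (rule rest_alternant)
  also have "\<dots> = (\<Sum>c\<in>cls. alternant (cexp M Z c) var)"
    by (rule sum_cls[of "\<lambda>al. alternant al var", symmetric])
  finally show ?thesis using eq by simp
qed

text \<open>Cancellation inside each fibre leaves strictly decreasing exponent lists, as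
  \<open>alternant_sum_transfer\<close> requires; the identity for alternants then carries over to
  \<open>G\<close>.\<close>

lemma cls_interl:
  fixes G :: "nat list \<Rightarrow> 'b::{idom, ring_char_0}"
  assumes U: "U \<in> cols (Suc M) Z" "lattice (Suc M) Z U" "csize Z U M = 0" and G: "alt G"
  shows "(\<Sum>c\<in>cls. G (cexp M Z c)) = (\<Sum>ka\<in>interl (cexp (Suc M) Z U). G ka)"
proof -
  let ?L = "\<lambda>R. {d\<in>rest R. lattice M (Z - R) d}"
  let ?Q = "Sigma (Pow Z) ?L"
  let ?e = "\<lambda>(R, d). cexp M (Z - R) d"
  have finL: "finite (?L R)" for R
    by (rule finite_subset[of _ "cols M (Z - R)"]) (auto simp: rest_def fin intro!: finite_PiE)
  have key: "(\<Sum>c\<in>cls. F (cexp M Z c)) = (\<Sum>q\<in>?Q. F (?e q))" if "alt F" for F :: "nat list \<Rightarrow> 'c::{idom, ring_char_0}"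
  proof -
    have "(\<Sum>c\<in>cls. F (cexp M Z c)) = (\<Sum>R\<in>Pow Z. \<Sum>d\<in>?L R. F (cexp M (Z - R) d))"
      unfolding sum_cls by (rule sum.cong[OF refl]) (rule sum_rest[OF that])
    also have "\<dots> = (\<Sum>q\<in>?Q. F (?e q))"
      by (subst sum.Sigma) (auto simp: fin finL split_def)
    finally show ?thesis .
  qed
  have "(\<Sum>q\<in>?Q. G (?e q)) = (\<Sum>ka\<in>interl (cexp (Suc M) Z U). G ka)"
  proof (rule alternant_sum_transfer[where M = M])
    show "finite ?Q" using fin finL by auto
    show "length (?e q) = M \<and> sorted_wrt (>) (?e q)" if "q \<in> ?Q" for q
      using that lattice_strict[OF finite_Diff[OF fin], of M "fst q" "snd q"] by (auto simp: split_def)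
    show "length ka = M \<and> sorted_wrt (>) ka" if "ka \<in> interl (cexp (Suc M) Z U)" for ka
      using that interl_strict[OF that] by (simp add: interl_iff)
    show "(\<Sum>q\<in>?Q. alternant (?e q) var) = (\<Sum>ka\<in>interl (cexp (Suc M) Z U). alternant ka var)"
      using key[OF alt_alternant, of var] cls_alternant[OF U] by simp
  qed (rule finite_interl)
  then show ?thesis using key[OF G] by simp
qed

end

section \<open>Cocharge of words of integers\<close>

definition desc :: "int list \<Rightarrow> int \<Rightarrow> bool" where
  "desc w a \<longleftrightarrow> filter (\<lambda>x. x = a \<or> x = a + 1) w = [a + 1, a]"

text \<open>Cocharge of a word in the letters p + 1, ..., T: a descent at a raises the cocharge
  labels of all larger letters by one, and there are T - a of these.\<close>

definition coch :: "int \<Rightarrow> int \<Rightarrow> int list \<Rightarrow> int" where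
  "coch p T w = (\<Sum>a\<in>{p + 1..<T}. if desc w a then T - a else 0)"

lemma pl_short:
  assumes "u \<simeq> v" "length u \<le> 2"
  shows "u = v"
proof -
  have "length u = length v \<and> (length u \<le> 2 \<longrightarrow> u = v)"
    using assms(1)
  proof (induction rule: pl_induct)
    case (step u v)
    then show ?case by (cases rule: pl_step.cases) auto
  next
    case (sym u v)
    then show ?case by metis
  next
    case (trans u v w)
    then show ?case by metis
  qed simp
  then show ?thesis using assms(2) by blast
qed

lemma length_filter_pair: "distinct w \<Longrightarrow> length (filter (\<lambda>x. x = a \<or> x = b) w) \<le> 2"
proof -
  assume "distinct w"
  then have "length (filter (\<lambda>x. x = a \<or> x = b) w) = card (set (filter (\<lambda>x. x = a \<or> x = b) w))"
    by (metis distinct_card distinct_filter)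
  also have "\<dots> \<le> card {a, b}" by (rule card_mono) auto
  also have "\<dots> \<le> 2" by (simp add: card_insert_if)
  finally show ?thesis .
qed

lemma coch_pl:
  assumes "w \<simeq> w'" "distinct w"
  shows "coch p T w = coch p T w'"
proof -
  have "filter (\<lambda>x. x = a \<or> x = a + 1) w = filter (\<lambda>x. x = a \<or> x = a + 1) w'" for a
  proof (rule pl_short[OF pl_filter[OF _ assms(1)] length_filter_pair[OF assms(2)]])
    fix x y z assume "x = a \<or> x = a + 1" "z = a \<or> z = a + 1" "x < y" "y < z"
    then show "y = a \<or> y = a + 1" by auto
  qed
  then show ?thesis by (simp add: coch_def desc_def)
qed

lemma abel_sum:
  fixes h :: "int \<Rightarrow> int"
  assumes "a \<le> T"
  shows "(\<Sum>i\<in>{a..<T}. (T - i) * (h (i + 1) - h i)) = (\<Sum>i\<in>{a<..T}. h i) - (T - a) * h a"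
  using assms
proof (induction T rule: int_ge_induct)
  case (step T)
  have 1: "{a..<T + 1} = insert T {a..<T}" and 2: "{a<..T + 1} = insert (T + 1) {a<..T}"
    using step.hyps by auto
  have tel: "(\<Sum>i\<in>{a..<T}. h (i + 1) - h i) = h T - h a"
    using step.hyps
  proof (induction T rule: int_ge_induct)
    case (step T)
    have "{a..<T + 1} = insert T {a..<T}" using step.hyps by auto
    then show ?case using step by simp
  qed simp
  have "(\<Sum>i\<in>{a..<T + 1}. (T + 1 - i) * (h (i + 1) - h i)) =
    (\<Sum>i\<in>{a..<T}. (T - i) * (h (i + 1) - h i)) + (\<Sum>i\<in>{a..<T}. h (i + 1) - h i) + (h (T + 1) - h T)"
    unfolding 1 by (simp add: sum.distrib[symmetric] algebra_simps)
  also have "\<dots> = (\<Sum>i\<in>{a<..T + 1}. h i) - (T + 1 - a) * h a"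
    unfolding tel step.IH 2 by (simp add: algebra_simps)
  finally show ?case .
qed simp

lemma filter_pair_one:
  assumes "distinct xs" "a \<in> set xs" "b \<notin> set xs"
  shows "filter (\<lambda>x. x = a \<or> x = b) xs = [a]" "filter (\<lambda>x. x = b \<or> x = a) xs = [a]"
proof -
  have "filter (\<lambda>x. x = a) ys = (if a \<in> set ys then [a] else [])" if "distinct ys" for ys
    using that by (induction ys) auto
  moreover have "filter (\<lambda>x. x = a \<or> x = b) xs = filter (\<lambda>x. x = a) xs" "filter (\<lambda>x. x = b \<or> x = a) xs = filter (\<lambda>x. x = a) xs"
    by (rule filter_cong; use assms(3) in auto)+
  ultimately show "filter (\<lambda>x. x = a \<or> x = b) xs = [a]" "filter (\<lambda>x. x = b \<or> x = a) xs = [a]"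
    using assms by simp_all
qed

lemma filter_pair_none: "a \<notin> set xs \<Longrightarrow> b \<notin> set xs \<Longrightarrow> filter (\<lambda>x. x = a \<or> x = b) xs = []"
  by (auto simp: filter_empty_conv)

lemma filter_pair_inc:
  assumes "inc xs" "a \<in> set xs" "a + 1 \<in> set xs"
  shows "filter (\<lambda>x. x = a \<or> x = a + 1) xs = [a, a + 1 :: int]"
proof (rule inc_set_eq[OF sorted_wrt_filter[OF assms(1)]])
  show "set (filter (\<lambda>x. x = a \<or> x = a + 1) xs) = set [a, a + 1]" using assms(2,3) by auto
qed simp

text \<open>Moving the block \<open>K r\<close> to the front and deleting \<open>K\<close> changes the descent indicator at \<open>a\<close> by the
  difference of the indicator function of \<open>X\<close>; summation by parts then gives \<open>|X|\<close>.\<close>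

lemma coch_rotate:
  assumes d: "distinct (X @ K @ r)" and s: "set (X @ K @ r) = {p + 1..T}" and K: "set K = {p + 1..p + int m}"
    and i: "inc (K @ r)" and m: "0 < m \<or> T = p"
  shows "coch p T (X @ K @ r) = coch (p + int m) T (r @ X) + int (length X)"
proof (cases "T = p")
  case True
  then have "X = []" using s by auto
  then show ?thesis using True by (simp add: coch_def)
next
  case False
  then have m0: "0 < m" using m by simp
  define h where "h a = (if a \<in> set X then 1 else 0 :: int)" for a
  define D where "D a = (if desc (X @ K @ r) a then 1 else 0 :: int)" for a
  define D' where "D' a = (if p + int m < a \<and> desc (r @ X) a then 1 else 0 :: int)" for a
  have "p + 1 \<in> set (X @ K @ r)"
  proof -
    have "set (X @ K @ r) \<noteq> {}" using K m0 by auto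
    then show ?thesis unfolding s by auto
  qed
  then have pT: "p + 1 \<le> T" unfolding s by simp
  have dX: "distinct X" and dr: "distinct r" and dK: "distinct K" and disj: "set X \<inter> set K = {}" "set X \<inter> set r = {}" "set K \<inter> set r = {}"
    using d by auto
  have ir: "inc r" using i by (simp add: sorted_wrt_append)
  have big: "p + int m < a" if "a \<in> set X \<or> a \<in> set r" for a
  proof -
    have "a \<in> {p + 1..T}" using that s by auto
    moreover have "a \<notin> set K" using that disj by auto
    ultimately show ?thesis unfolding K by auto
  qed
  have key: "D a - D' a = h (a + 1) - h a" if a: "a \<in> {p + 1..<T}" for a
  proof -
    have mem: "a \<in> set X \<or> a \<in> set (K @ r)" "a + 1 \<in> set X \<or> a + 1 \<in> set (K @ r)"
      using a s by (metis (no_types, lifting) Un_iff atLeastAtMost_iff atLeastLessThan_iff less_imp_le set_append, metis (no_types, lifting) Un_iff add1_zle_eq add_increasing2 atLeastAtMost_iff atLeastLessThan_iff set_append zero_le_one)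
    have dKr: "distinct (K @ r)" using d by simp
    have notK: "a \<in> set X \<Longrightarrow> a + 1 \<notin> set K" using big[of a] K by auto
    consider "a \<in> set X" "a + 1 \<in> set X" | "a \<in> set X" "a + 1 \<in> set (K @ r)" | "a \<in> set (K @ r)" "a + 1 \<in> set X"
      | "a \<in> set (K @ r)" "a + 1 \<in> set (K @ r)" using mem by blast
    then show ?thesis
    proof cases
      case 1
      then have n: "a \<notin> set K" "a + 1 \<notin> set K" "a \<notin> set r" "a + 1 \<notin> set r" using disj by auto
      then show ?thesis using 1 big[of a] by (simp add: D_def D'_def h_def desc_def filter_pair_none)
    next
      case 2
      then have n: "a + 1 \<in> set r" "a \<notin> set K" "a + 1 \<notin> set K" "a \<notin> set r" "a + 1 \<notin> set X" using disj notK by auto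
      have "filter (\<lambda>x. x = a \<or> x = a + 1) X = [a]" "filter (\<lambda>x. x = a \<or> x = a + 1) r = [a + 1]"
        using filter_pair_one[OF dX 2(1) n(5)] filter_pair_one[OF dr n(1,4)] by simp_all
      then show ?thesis using 2 n big[of a] by (simp add: D_def D'_def h_def desc_def filter_pair_none)
    next
      case 3
      then have n: "a \<notin> set X" "a + 1 \<notin> set K" "a + 1 \<notin> set r" using disj by auto
      have fX: "filter (\<lambda>x. x = a \<or> x = a + 1) X = [a + 1]" using filter_pair_one[OF dX 3(2) n(1)] by simp
      have fKr: "filter (\<lambda>x. x = a \<or> x = a + 1) (K @ r) = [a]" using filter_pair_one[OF dKr 3(1)] n by simp
      have "\<not> (p + int m < a \<and> desc (r @ X) a)"
      proof
        assume *: "p + int m < a \<and> desc (r @ X) a"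
        then have "a \<in> set r" using 3(1) K by auto
        then have "filter (\<lambda>x. x = a \<or> x = a + 1) r = [a]" using filter_pair_one[OF dr _ n(3)] by simp
        then show False using * fX by (simp add: desc_def)
      qed
      moreover have "desc (X @ K @ r) a" unfolding desc_def filter_append[of _ X] fX fKr by simp
      ultimately show ?thesis using 3 n by (simp add: D_def D'_def h_def)
    next
      case 4
      then have n: "a \<notin> set X" "a + 1 \<notin> set X" using disj by auto
      have "filter (\<lambda>x. x = a \<or> x = a + 1) (K @ r) = [a, a + 1]" by (rule filter_pair_inc[OF i 4])
      then have nd: "\<not> desc (X @ K @ r) a" unfolding desc_def filter_append[of _ X] by (simp add: filter_pair_none n)
      have "\<not> (p + int m < a \<and> desc (r @ X) a)"
      proof
        assume *: "p + int m < a \<and> desc (r @ X) a"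
        then have "a \<in> set r" "a + 1 \<in> set r" using 4 K by auto
        then have "filter (\<lambda>x. x = a \<or> x = a + 1) r = [a, a + 1]" by (rule filter_pair_inc[OF ir])
        then show False using * n by (simp add: desc_def filter_pair_none)
      qed
      then show ?thesis using nd n by (simp add: D_def D'_def h_def)
    qed
  qed
  have c1: "coch p T (X @ K @ r) = (\<Sum>a\<in>{p + 1..<T}. (T - a) * D a)"
    unfolding coch_def D_def by (rule sum.cong) auto
  have c2: "coch (p + int m) T (r @ X) = (\<Sum>a\<in>{p + 1..<T}. (T - a) * D' a)"
    unfolding coch_def D'_def
    by (rule sum.mono_neutral_cong_left) auto
  have "coch p T (X @ K @ r) - coch (p + int m) T (r @ X) = (\<Sum>a\<in>{p + 1..<T}. (T - a) * (h (a + 1) - h a))"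
    unfolding c1 c2 sum_subtractf[symmetric] by (rule sum.cong) (simp_all add: key right_diff_distrib[symmetric])
  also have "\<dots> = (\<Sum>i\<in>{p + 1<..T}. h i) - (T - (p + 1)) * h (p + 1)" by (rule abel_sum[OF pT])
  \<comment> \<open>The boundary term vanishes because the smallest letter lies in
    \<open>K\<close>.\<close>
  also have "h (p + 1) = 0" using K m0 disj by (auto simp: h_def)
  also have "(\<Sum>i\<in>{p + 1<..T}. h i) = (\<Sum>i\<in>set X. 1)"
  proof (rule sum.mono_neutral_cong_right)
    show "set X \<subseteq> {p + 1<..T}"
    proof
      fix a assume a: "a \<in> set X"
      then have "a \<in> {p + 1..T}" using s by auto
      moreover have "p + int m < a" using big a by simp
      ultimately show "a \<in> {p + 1<..T}" using m0 by auto
    qed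
  qed (auto simp: h_def)
  also have "\<dots> = int (length X)" using distinct_card[OF dX] by simp
  finally show ?thesis by simp
qed

lemma initial_segment:
  fixes p T :: int
  assumes "A \<union> B = {p + 1..T}" "\<forall>a\<in>A. \<forall>b\<in>B. a < b" "card A = m"
  shows "A = {p + 1..p + int m}"
proof (cases "A = {}")
  case False
  have finA: "finite A" using assms(1) by (metis finite_Un finite_atLeastAtMost_int)
  have x: "Max A \<in> A" "\<And>a. a \<in> A \<Longrightarrow> a \<le> Max A" using finA False by auto
  have "A = {p + 1..Max A}"
  proof (intro equalityI subsetI)
    fix a assume "a \<in> A"
    then show "a \<in> {p + 1..Max A}" using x(2) assms(1) by fastforce
  next
    fix a assume a: "a \<in> {p + 1..Max A}"
    have "Max A \<in> {p + 1..T}" using x(1) assms(1) by blast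
    then have "a \<in> A \<union> B" using a unfolding assms(1) by auto
    moreover have "a \<notin> B" using assms(2) x(1) a by fastforce
    ultimately show "a \<in> A" by simp
  qed
  moreover from this have "m = nat (Max A - p)" using assms(3) by (metis card_atLeastAtMost_int add_diff_cancel diff_diff_eq2 add.commute diff_add_eq)
  moreover have "p + 1 \<le> Max A" using x(1) assms(1) by fastforce
  ultimately show ?thesis by simp
qed (use assms in simp)

lemma n_stat_Cons: "n_stat (m # nu) = n_stat nu + sum_list nu"
proof -
  have "n_stat (m # nu) = (\<Sum>i<length nu. Suc i * nu ! i)"
    by (simp add: n_stat_def sum.lessThan_Suc_shift del: sum.lessThan_Suc)
  then show ?thesis by (simp add: n_stat_def sum.distrib sum_list_sum_nth lessThan_atLeast0 add.commute)
qed

lemma sorted_zero: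
  "sorted_wrt (\<ge>) (m # nu) \<Longrightarrow> 0 < m \<or> sum_list (m # nu) = (0 :: nat)"
  by (cases m) (auto simp: sum_list_eq_0_iff)

text \<open>A step of catabolism lowers the cocharge by the number of letters outside the removed
  row, at most the sum of the remaining parts, and these sums add up to n(\<mu>). Hence n(\<mu>)
  minus the cocharge can serve as an exponent.\<close>

lemma coch_le_n_stat:
  "sorted_wrt (\<ge>) mu \<Longrightarrow> catable mu w \<Longrightarrow> set w = {p + 1..p + int (sum_list mu)} \<Longrightarrow>
    coch p (p + int (sum_list mu)) w \<le> int (n_stat mu)"
proof (induction mu arbitrary: w p)
  case Nil
  then show ?case by (simp add: coch_def n_stat_def)
next
  case (Cons m nu)
  let ?T = "p + int (sum_list (m # nu))"
  from Cons.prems(2) obtain Y b s where *: "distinct w" "w \<simeq> Y @ b @ s" "inc (b @ s)" "length b = m"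
    "\<forall>a\<in>set Y. \<forall>c\<in>set b. c < a" "catable nu (s @ Y)" unfolding catable.simps by blast
  have d: "distinct (Y @ b @ s)" using pl_distinct[OF *(2)] *(1) by simp
  have sw: "set (Y @ b @ s) = {p + 1..?T}" using pl_set[OF *(2)] Cons.prems(3) by simp
  have sb: "set b = {p + 1..p + int m}"
  proof (rule initial_segment[where B = "set (s @ Y)"])
    show "set b \<union> set (s @ Y) = {p + 1..?T}" using sw by auto
    show "card (set b) = m" using d *(4) distinct_card by auto
    show "\<forall>a\<in>set b. \<forall>c\<in>set (s @ Y). a < c" using *(3,5) by (auto simp: sorted_wrt_append)
  qed
  have ss: "set (s @ Y) = {p + int m + 1..?T}"
  proof -
    have "set (s @ Y) = set (Y @ b @ s) - set b" using d by auto
    also have "\<dots> = {p + 1..?T} - {p + 1..p + int m}" unfolding sw sb ..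
    also have "\<dots> = {p + int m + 1..?T}" by auto
    finally show ?thesis .
  qed
  have "card (set (s @ Y)) = sum_list nu" unfolding ss by simp
  moreover have "distinct (s @ Y)" using d by auto
  ultimately have len: "length s + length Y = sum_list nu" using distinct_card by fastforce
  have m: "0 < m \<or> ?T = p" using sorted_zero[OF Cons.prems(1)] by linarith
  have "coch p ?T w = coch (p + int m) ?T (s @ Y) + int (length Y)"
    using coch_pl[OF *(2,1)] coch_rotate[OF d sw sb *(3) m] by simp
  also have "coch (p + int m) ?T (s @ Y) \<le> int (n_stat nu)"
    using Cons.IH[of "s @ Y" "p + int m"] Cons.prems(1) *(6) ss by (simp add: add.assoc)
  finally show ?case using len by (simp add: n_stat_Cons)
qed

section \<open>Recursion for the lattice sums\<close>

text \<open>A weight that depends on the Knuth class is constant along the cancellation, so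
  \<open>lattice_sum\<close> applies to each of its level sets.\<close>

lemma weighted_lattice_sum:
  fixes g :: "nat list \<Rightarrow> 'b::{idom, ring_char_0}" and Om :: "('a::linorder \<Rightarrow> nat) set"
  assumes fin: "finite Z" and Om: "Om \<subseteq> cols N Z" and g: "alt g"
    and wt: "\<And>c c'. c \<in> Om \<Longrightarrow> cword N Z c \<simeq> cword N Z c' \<Longrightarrow> wt (cword N Z c) = wt (cword N Z c')"
    and closed: "\<And>c c' v. c \<in> Om \<Longrightarrow> c' \<in> cols N Z \<Longrightarrow> v \<in> Z \<Longrightarrow> 0 < c v \<Longrightarrow>
      \<forall>a\<in>Z. a \<le> v \<longrightarrow> c' a = c a \<Longrightarrow> cword N Z c \<simeq> cword N Z c' \<Longrightarrow> c' \<in> Om"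
  shows "(\<Sum>c\<in>Om. wt (cword N Z c) * g (cexp N Z c)) = (\<Sum>c\<in>{c\<in>Om. lattice N Z c}. wt (cword N Z c) * g (cexp N Z c))"
proof -
  have "finite (cols N Z)" using fin by (intro finite_PiE) auto
  then have finO: "finite Om" using Om finite_subset by blast
  let ?W = "(\<lambda>c. wt (cword N Z c)) ` Om"
  have e: "(\<Sum>c\<in>{c\<in>Om. wt (cword N Z c) = y}. g (cexp N Z c)) =
    (\<Sum>c\<in>{c\<in>{c\<in>Om. wt (cword N Z c) = y}. lattice N Z c}. g (cexp N Z c))" for y
  proof (rule lattice_sum[OF fin _ g])
    fix c c' v assume c: "c \<in> {c\<in>Om. wt (cword N Z c) = y}" "c' \<in> cols N Z" "v \<in> Z" "0 < c v"
      "\<forall>a\<in>Z. a \<le> v \<longrightarrow> c' a = c a" "cword N Z c \<simeq> cword N Z c'"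
    then have "c' \<in> Om" using closed[of c c' v] by simp
    moreover have "wt (cword N Z c') = y" using wt[of c c'] c by simp
    ultimately show "c' \<in> {c\<in>Om. wt (cword N Z c) = y}" by simp
  qed (use Om in auto)
  have "(\<Sum>c\<in>Om. wt (cword N Z c) * g (cexp N Z c)) = (\<Sum>y\<in>?W. \<Sum>c\<in>{c\<in>Om. wt (cword N Z c) = y}. wt (cword N Z c) * g (cexp N Z c))"
    by (rule sum.image_gen[OF finO])
  also have "\<dots> = (\<Sum>y\<in>?W. y * (\<Sum>c\<in>{c\<in>Om. wt (cword N Z c) = y}. g (cexp N Z c)))"
    by (simp add: sum_distrib_left)
  also have "\<dots> = (\<Sum>y\<in>?W. \<Sum>c\<in>{c\<in>{c\<in>Om. lattice N Z c}. wt (cword N Z c) = y}. wt (cword N Z c) * g (cexp N Z c))"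
    unfolding e sum_distrib_left by (intro sum.cong) auto
  also have "\<dots> = (\<Sum>c\<in>{c\<in>Om. lattice N Z c}. wt (cword N Z c) * g (cexp N Z c))"
    by (rule sum.group) (use finO in auto)
  finally show ?thesis .
qed

lemma lattice_csize_mono:
  assumes fin: "finite Z" and l: "lattice N Z c"
  shows "i \<le> j \<Longrightarrow> j < N \<Longrightarrow> csize Z c j \<le> csize Z c i"
proof (induction j)
  case (Suc j)
  have "nrm (crow Z c (Suc j)) (crow Z c j)"
    using l Suc.prems unfolding lattice_def ctab_nth by auto
  then have "length (crow Z c (Suc j)) \<le> length (crow Z c j)" unfolding nrm_iff by auto
  then have "csize Z c (Suc j) \<le> csize Z c j" by (simp add: length_crow fin)
  then show ?case using Suc by (cases "i = Suc j") auto
qed simp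

lemma sum_csize:
  assumes "finite Z" "c \<in> cols N Z"
  shows "(\<Sum>i<N. csize Z c i) = card Z"
proof -
  have "(\<Sum>i<N. \<Sum>a\<in>{a\<in>Z. c a = i}. 1) = (\<Sum>a\<in>Z. 1 :: nat)"
    by (rule sum.group) (use assms in auto)
  then show ?thesis by (simp add: csize_def)
qed

lemma lattice_last_empty:
  assumes fin: "finite Z" and U: "U \<in> cols (Suc M) Z" "lattice (Suc M) Z U" and M: "card Z \<le> M"
  shows "csize Z U M = 0"
proof (rule ccontr)
  assume "csize Z U M \<noteq> 0"
  then have "1 \<le> csize Z U i" if "i < Suc M" for i
    using lattice_csize_mono[OF fin U(2), of i M] that by simp
  then have "(\<Sum>i<Suc M. 1) \<le> (\<Sum>i<Suc M. csize Z U i)" by (intro sum_mono) auto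
  then show False using sum_csize[OF fin U(1)] M by simp
qed

lemma lattice_exists:
  fixes Z :: "'a::linorder set"
  assumes fin: "finite Z" and N: "card Z \<le> N" and w: "set w = Z" "distinct w"
  shows "\<exists>U\<in>cols N Z. lattice N Z U \<and> cword N Z U \<simeq> w"
proof -
  obtain T where T: "ctab T" "[] \<notin> set T" "rword T \<simeq> w" using ctab_exists[OF w(2)] by blast
  have dT: "distinct (rword T)" "set (rword T) = Z" using pl_distinct[OF T(3)] pl_set[OF T(3)] w by auto
  have "length T \<le> length (rword T)" using T(2)
  proof (induction T)
    case (Cons x T)
    then have "1 \<le> length x" by (cases x) auto
    then show ?case using Cons by simp
  qed simp
  also have "\<dots> = card Z" using distinct_card[OF dT(1)] dT(2) by simp
  finally have lT: "length T \<le> N" using N by simp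
  define T' where "T' = T @ replicate (N - length T) []"
  have rT': "rword T' = rword T" by (simp add: T'_def) (simp add: rword_def)
  have lT': "length T' = N" using lT by (simp add: T'_def)
  have cT': "ctab T'"
  proof -
    have "nrm (T' ! Suc i) (T' ! i)" if "Suc i < N" for i
    proof (cases "Suc i < length T")
      case True
      then show ?thesis using T(1) unfolding ctab_nth by (simp add: T'_def nth_append)
    next
      case False
      then have "T' ! Suc i = []" using that by (simp add: T'_def nth_append)
      then show ?thesis by simp
    qed
    then show ?thesis using T(1) unfolding ctab_nth lT' by (auto simp: T'_def)
  qed
  have disj: "i = j" if "a \<in> set (T' ! i)" "a \<in> set (T' ! j)" "i < N" "j < N" for i j a
  proof (rule ccontr)
    assume "i \<noteq> j"
    have "set (T' ! i) \<inter> set (T' ! j) = {}" if "i < j" "j < length T'" "distinct (rword T')" for i j T'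
      using that
    proof (induction T' arbitrary: i j)
      case (Cons x T')
      show ?case
      proof (cases i)
        case 0
        have "set (T' ! (j - 1)) \<subseteq> set (rword T')" using Cons.prems 0
          by (auto simp: rword_def intro!: bexI[of _ "T' ! (j - 1)"])
        then show ?thesis using Cons.prems 0 by (auto simp: nth_Cons')
      next
        case (Suc i')
        then show ?thesis using Cons.IH[of i' "j - 1"] Cons.prems by (auto simp: nth_Cons')
      qed
    qed simp
    from this[of i j T'] this[of j i T'] show False
      using that \<open>i \<noteq> j\<close> dT(1) rT' lT' by (cases "i < j") auto
  qed
  define U where "U = (\<lambda>a\<in>Z. THE i. i < N \<and> a \<in> set (T' ! i))"
  have ex: "\<exists>i<N. a \<in> set (T' ! i)" if "a \<in> Z" for a
  proof -
    have "a \<in> set (rword T')" using that dT(2) rT' by simp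
    then obtain x where "x \<in> set T'" "a \<in> set x" by (auto simp: rword_def)
    then show ?thesis using lT' by (metis in_set_conv_nth)
  qed
  have U: "U a = i \<longleftrightarrow> a \<in> set (T' ! i)" if aZ: "a \<in> Z" and iN: "i < N" for a i
  proof -
    obtain k where k: "k < N" "a \<in> set (T' ! k)" using ex[OF aZ] by blast
    have "(THE i. i < N \<and> a \<in> set (T' ! i)) = k" by (rule the_equality) (use k disj in auto)
    then have "U a = k" using aZ unfolding U_def by simp
    then show ?thesis using k iN disj[of a k i] by auto
  qed
  have Uc: "U \<in> cols N Z"
  proof (rule PiE_I)
    fix a assume a: "a \<in> Z"
    then obtain k where k: "k < N" "a \<in> set (T' ! k)" using ex by blast
    then show "U a \<in> {..<N}" using U[OF a k(1)] by simp
  qed (simp add: U_def)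
  have row: "crow Z U i = T' ! i" if "i < N" for i
  proof -
    have "T' ! i \<in> set T'" using that lT' by simp
    then have "set (T' ! i) \<subseteq> set (rword T')" by (auto simp: rword_def)
    then have "set (T' ! i) \<subseteq> Z" using dT(2) rT' by simp
    then have "{a\<in>Z. U a = i} = set (T' ! i)" using U that by auto
    moreover have "inc (T' ! i)" using cT' that lT' unfolding ctab_nth by auto
    ultimately show ?thesis unfolding crow_def using inc_eq_sl by metis
  qed
  have "map (crow Z U) [0..<N] = T'" by (rule nth_equalityI) (use lT' row in auto)
  then show ?thesis using Uc cT' T(3) rT' unfolding lattice_def cword_def by auto
qed

text \<open>The sum L_\<mu> for the alphabet that starts after p; the offset spares a renaming of
  letters when the smallest block is removed. There are as many rows as entries of
  \<open>mu\<close>, zeros included.\<close>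

definition latsum :: "'b::comm_ring_1 \<Rightarrow> int \<Rightarrow> nat list \<Rightarrow> (nat list \<Rightarrow> 'b) \<Rightarrow> 'b" where
  "latsum t p mu g = (let T = p + int (sum_list mu); Z = {p + 1..T}; N = length mu in
     \<Sum>c\<in>{c\<in>cols N Z. lattice N Z c \<and> catable mu (cword N Z c)}.
       t ^ nat (int (n_stat mu) - coch p T (cword N Z c)) * g (cexp N Z c))"

context
  fixes t :: "'b::{idom, ring_char_0}" and p :: int and m :: nat and nu :: "nat list"
  assumes sorted: "sorted_wrt (\<ge>) (m # nu)" and small: "sum_list nu \<le> length nu"
begin

abbreviation (input) "MM \<equiv> length nu"
abbreviation (input) "TT \<equiv> p + int (sum_list (m # nu))"
abbreviation (input) "ZZ \<equiv> {p + 1..TT}"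
abbreviation (input) "KK \<equiv> {p + 1..p + int m}"
abbreviation (input) "ZR \<equiv> {p + int m + 1..TT}"

text \<open>The rotation: the top row without the block of the m smallest letters becomes the bottom
  row, with colour \<open>MM\<close>, and the other rows move up by one.\<close>

definition first :: "(int \<Rightarrow> nat) \<Rightarrow> int \<Rightarrow> nat" where
  "first c = (\<lambda>a\<in>ZR. if c a = 0 then MM else c a - 1)"

lemma first_props:
  assumes c: "c \<in> cols (Suc MM) ZZ" "\<forall>a\<in>KK. c a = 0"
  shows "first c \<in> cols (Suc MM) ZR"
    "cword (Suc MM) ZZ c = cword MM ZR (first c) @ sl KK @ crow ZR (first c) MM"
    "cword (Suc MM) ZR (first c) = crow ZR (first c) MM @ cword MM ZR (first c)"
    "cexp (Suc MM) ZZ c = (m + MM + csize ZR (first c) MM) # cexp MM ZR (first c)"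
    "catable (m # nu) (cword (Suc MM) ZZ c) = catable nu (cword (Suc MM) ZR (first c))"
    "coch p TT (cword (Suc MM) ZZ c) = coch (p + int m) TT (cword (Suc MM) ZR (first c)) + int (sum_list nu) - int (csize ZR (first c) MM)"
proof -
  let ?d = "first c"
  show dc: "?d \<in> cols (Suc MM) ZR"
  proof (rule PiE_I)
    fix a assume a: "a \<in> ZR"
    then have "c a < Suc MM" using c(1) by auto
    then have "c a - 1 < Suc MM" by (rule less_imp_diff_less)
    then show "?d a \<in> {..<Suc MM}" using a by (simp add: first_def)
  qed (simp only: first_def restrict_apply if_False)
  have Z: "ZZ = KK \<union> ZR" "KK \<inter> ZR = {}" by auto
  have rows: "{a\<in>ZR. ?d a = i} = {a\<in>ZZ. c a = Suc i}" if "i < MM" for i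
    using that c(2) unfolding first_def by (auto split: if_splits)
  have zero: "{a\<in>ZZ. c a = 0} = KK \<union> {a\<in>ZR. ?d a = MM}"
  proof -
    have "c a < Suc MM" if "a \<in> ZR" for a using c(1) that by auto
    then have "{a\<in>ZR. ?d a = MM} = {a\<in>ZR. c a = 0}" unfolding first_def by (force split: if_splits)
    then show ?thesis using c(2) by auto
  qed
  have crows: "crow ZR ?d i = crow ZZ c (Suc i)" if "i < MM" for i
    using rows[OF that] by (simp add: crow_def)
  have row0: "crow ZZ c 0 = sl KK @ crow ZR ?d MM"
  proof (rule inc_set_eq)
    have r: "set (crow ZR ?d MM) = {a\<in>ZR. ?d a = MM}" by (rule set_crow) simp
    have k: "set (sl KK) = KK" by simp
    have "set (crow ZZ c 0) = {a\<in>ZZ. c a = 0}" by (rule set_crow) simp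
    then show "set (crow ZZ c 0) = set (sl KK @ crow ZR ?d MM)" by (simp only: zero set_append r k)
    have "\<forall>x\<in>KK. \<forall>y\<in>{a\<in>ZR. ?d a = MM}. x < y" by auto
    then show "inc (sl KK @ crow ZR ?d MM)" unfolding sorted_wrt_append r k by simp
  qed simp
  have X: "rword (map (crow ZZ c) [1..<Suc MM]) = cword MM ZR ?d"
  proof -
    have "map (crow ZZ c) [1..<Suc MM] = map (crow ZR ?d) [0..<MM]"
    proof -
      have "map (crow ZZ c) [1..<Suc MM] = map (\<lambda>i. crow ZZ c (Suc i)) [0..<MM]"
        by (simp only: map_Suc_upt[symmetric] map_map comp_def One_nat_def)
      also have "\<dots> = map (crow ZR ?d) [0..<MM]"
      proof (rule map_cong[OF refl])
        fix i assume "i \<in> set [0..<MM]"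
        then show "crow ZZ c (Suc i) = crow ZR ?d i" by (intro crows[symmetric]) simp
      qed
      finally show ?thesis .
    qed
    then show ?thesis unfolding cword_def by (rule arg_cong)
  qed
  have "[0..<Suc MM] = 0 # [1..<Suc MM]" using upt_conv_Cons[of 0 "Suc MM"] by simp
  then show w: "cword (Suc MM) ZZ c = cword MM ZR ?d @ sl KK @ crow ZR ?d MM"
    unfolding cword_def[of "Suc MM" ZZ] using X row0 by simp
  show w': "cword (Suc MM) ZR ?d = crow ZR ?d MM @ cword MM ZR ?d" by (simp add: cword_def)
  have cs: "csize ZR ?d i = csize ZZ c (Suc i)" if "i < MM" for i
    unfolding csize_def rows[OF that] ..
  have cs0: "csize ZZ c 0 = m + csize ZR ?d MM"
    using arg_cong[OF row0, of length] by (simp add: length_crow)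
  show "cexp (Suc MM) ZZ c = (m + MM + csize ZR ?d MM) # cexp MM ZR ?d"
  proof (rule nth_equalityI)
    fix i assume "i < length (cexp (Suc MM) ZZ c)"
    then have i: "i < Suc MM" by simp
    show "cexp (Suc MM) ZZ c ! i = ((m + MM + csize ZR ?d MM) # cexp MM ZR ?d) ! i"
    proof (cases i)
      case 0
      show ?thesis unfolding nth_cexp[OF i] unfolding 0 cs0 nth_Cons_0 by simp
    next
      case (Suc k)
      then have k: "k < MM" using i by simp
      show ?thesis unfolding nth_cexp[OF i] unfolding Suc nth_Cons_Suc nth_cexp[OF k] cs[OF k] by simp
    qed
  qed simp
  have d: "distinct (cword MM ZR ?d @ sl KK @ crow ZR ?d MM)"
    unfolding w[symmetric] by (rule distinct_cword) simp
  have i: "inc (sl KK @ crow ZR ?d MM)" unfolding row0[symmetric] by simp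
  have lK: "length (sl KK) = m" by simp
  have sX: "set (cword MM ZR ?d) \<subseteq> ZR" by (auto simp: cword_def rword_def set_crow)
  have rc: "rot_closed m (catable nu :: int list \<Rightarrow> bool)"
    using sorted by (intro rot_closed_catable) auto
  show "catable (m # nu) (cword (Suc MM) ZZ c) = catable nu (cword (Suc MM) ZR ?d)"
    unfolding w w' by (rule catable_block[OF rc lK i]) (use sX d in auto)
  have m0: "0 < m \<or> TT = p" using sorted_zero[OF sorted] by linarith
  have "coch p TT (cword (Suc MM) ZZ c) = coch (p + int m) TT (cword (Suc MM) ZR ?d) + int (length (cword MM ZR ?d))"
    unfolding w w'
  proof (rule coch_rotate[OF d _ _ i m0])
    show "set (cword MM ZR ?d @ sl KK @ crow ZR ?d MM) = ZZ"
      unfolding w[symmetric] by (rule set_cword[OF _ c(1)]) simp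
  qed simp
  moreover have "length (cword MM ZR ?d) + csize ZR ?d MM = sum_list nu"
  proof -
    have "length (cword (Suc MM) ZR ?d) = card ZR"
      using distinct_card[OF distinct_cword, of ZR "Suc MM" ?d] set_cword[OF _ dc] by simp
    then show ?thesis unfolding w' by (simp add: length_crow)
  qed
  ultimately show "coch p TT (cword (Suc MM) ZZ c) = coch (p + int m) TT (cword (Suc MM) ZR ?d) + int (sum_list nu) - int (csize ZR ?d MM)"
    by simp
qed

lemma first_bij:
  "bij_betw first {c\<in>cols (Suc MM) ZZ. (\<forall>a\<in>KK. c a = 0) \<and> catable (m # nu) (cword (Suc MM) ZZ c)}
     {d\<in>cols (Suc MM) ZR. catable nu (cword (Suc MM) ZR d)}"
proof (rule bij_betwI[where g = "\<lambda>d. \<lambda>a\<in>ZZ. if a \<in> KK \<or> d a = MM then 0 else Suc (d a)"])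
  let ?g = "\<lambda>d. \<lambda>a\<in>ZZ. if a \<in> KK \<or> d a = MM then 0 else Suc (d a)"
  show "first \<in> {c\<in>cols (Suc MM) ZZ. (\<forall>a\<in>KK. c a = 0) \<and> catable (m # nu) (cword (Suc MM) ZZ c)} \<rightarrow>
      {d\<in>cols (Suc MM) ZR. catable nu (cword (Suc MM) ZR d)}"
    using first_props(1,5) by blast
  have fg: "first (?g d) = d" if "d \<in> cols (Suc MM) ZR" for d
  proof
    fix a
    show "first (?g d) a = d a"
    proof (cases "a \<in> ZR")
      case True
      then have "a \<in> ZZ" "a \<notin> KK" by auto
      then show ?thesis using True by (simp add: first_def)
    next
      case False
      then have "d a = undefined" using that by (rule PiE_arb[rotated])
      then show ?thesis unfolding first_def using False by (simp only: restrict_apply if_False)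
    qed
  qed
  then show "first (?g d) = d" if "d \<in> {d\<in>cols (Suc MM) ZR. catable nu (cword (Suc MM) ZR d)}" for d
    using that by simp
  show "?g \<in> {d\<in>cols (Suc MM) ZR. catable nu (cword (Suc MM) ZR d)} \<rightarrow>
      {c\<in>cols (Suc MM) ZZ. (\<forall>a\<in>KK. c a = 0) \<and> catable (m # nu) (cword (Suc MM) ZZ c)}"
  proof (rule Pi_I)
    fix d assume d: "d \<in> {d\<in>cols (Suc MM) ZR. catable nu (cword (Suc MM) ZR d)}"
    have lt: "d a < Suc MM" if "a \<in> ZR" for a using d that by auto
    have gc: "?g d \<in> cols (Suc MM) ZZ"
    proof (rule PiE_I)
      fix a assume a: "a \<in> ZZ"
      show "?g d a \<in> {..<Suc MM}"
      proof (cases "a \<in> KK \<or> d a = MM")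
        case False
        then have "a \<in> ZR" using a by auto
        then show ?thesis using lt[of a] a False by simp
      qed (use a in simp)
    qed (simp only: restrict_apply if_False)
    have gK: "\<forall>a\<in>KK. ?g d a = 0" by simp
    have e: "first (?g d) = d" using d by (intro fg) blast
    have "catable (m # nu) (cword (Suc MM) ZZ (?g d))"
      unfolding first_props(5)[OF gc gK] e using d by blast
    then show "?g d \<in> {c\<in>cols (Suc MM) ZZ. (\<forall>a\<in>KK. c a = 0) \<and> catable (m # nu) (cword (Suc MM) ZZ c)}"
      using gc gK by blast
  qed
  show "?g (first c) = c" if "c \<in> {c\<in>cols (Suc MM) ZZ. (\<forall>a\<in>KK. c a = 0) \<and> catable (m # nu) (cword (Suc MM) ZZ c)}" for c
  proof
    fix a
    have c: "c \<in> cols (Suc MM) ZZ" "\<forall>a\<in>KK. c a = 0" using that by auto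
    consider "a \<notin> ZZ" | "a \<in> KK" | "a \<in> ZR" by fastforce
    then show "?g (first c) a = c a"
    proof cases
      case 3
      then have "c a < Suc MM" "a \<notin> KK" "a \<in> ZZ" using c(1) by auto
      then show ?thesis using 3 by (auto simp: first_def)
    qed (use c in \<open>auto simp: PiE_def extensional_def\<close>)
  qed
qed

text \<open>A tableau that admits the catabolism has the block \<open>KK\<close> in its top row.
  With this condition imposed, \<open>weighted_lattice_sum\<close> allows the column conditions to
  be dropped, and arbitrary colourings can be rotated.\<close>

lemma latsum_first:
  assumes g: "alt g"
  shows "latsum t p (m # nu) g = (\<Sum>d\<in>{d\<in>cols (Suc MM) ZR. catable nu (cword (Suc MM) ZR d)}.
    t ^ nat (int (n_stat nu) - coch (p + int m) TT (cword (Suc MM) ZR d)) *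
    (t ^ csize ZR d MM * g ((m + MM + csize ZR d MM) # cexp MM ZR d)))"
proof -
  let ?Om = "{c\<in>cols (Suc MM) ZZ. (\<forall>a\<in>KK. c a = 0) \<and> catable (m # nu) (cword (Suc MM) ZZ c)}"
  let ?wt = "\<lambda>w. t ^ nat (int (n_stat (m # nu)) - coch p TT w)"
  have lat: "{c\<in>cols (Suc MM) ZZ. lattice (Suc MM) ZZ c \<and> catable (m # nu) (cword (Suc MM) ZZ c)} = {c\<in>?Om. lattice (Suc MM) ZZ c}"
  proof -
    have "\<forall>a\<in>KK. c a = 0" if c: "c \<in> cols (Suc MM) ZZ" "lattice (Suc MM) ZZ c" "catable (m # nu) (cword (Suc MM) ZZ c)" for c
    proof -
      have l: "length (sl KK) = m" by simp
      have sw: "set (cword (Suc MM) ZZ c) = ZZ" by (rule set_cword[OF _ c(1)]) simp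
      have dw: "distinct (cword (Suc MM) ZZ c)" by (rule distinct_cword) simp
      have "set (sl KK) \<subseteq> set (row_of (cword (Suc MM) ZZ c))"
      proof (rule catable_row_bmp[THEN iffD1, THEN conjunct1])
        show "sorted_wrt (\<ge>) (length (sl KK) # nu)" unfolding l by (rule sorted)
        show "catable (length (sl KK) # nu) (cword (Suc MM) ZZ c)" unfolding l by (rule c(3))
        show "set (sl KK) \<subseteq> set (cword (Suc MM) ZZ c)" unfolding sw by simp
        show "\<forall>a\<in>set (cword (Suc MM) ZZ c). a \<in> set (sl KK) \<or> (\<forall>k\<in>set (sl KK). k < a)"
          unfolding sw by auto
      qed (rule dw, simp)
      moreover have "row_of (cword (Suc MM) ZZ c) = crow ZZ c 0"
      proof -
        have e: "[0..<Suc MM] = 0 # [1..<Suc MM]" using upt_conv_Cons[of 0 "Suc MM"] by simp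
        show ?thesis using ctab_row_bmp[of "map (crow ZZ c) [0..<Suc MM]"] c(2) dw
          unfolding lattice_def cword_def unfolding e by simp
      qed
      ultimately show ?thesis by (auto simp: set_crow)
    qed
    then show ?thesis by auto
  qed
  have "latsum t p (m # nu) g = (\<Sum>c\<in>{c\<in>?Om. lattice (Suc MM) ZZ c}. ?wt (cword (Suc MM) ZZ c) * g (cexp (Suc MM) ZZ c))"
    unfolding latsum_def Let_def length_Cons lat ..
  also have "\<dots> = (\<Sum>c\<in>?Om. ?wt (cword (Suc MM) ZZ c) * g (cexp (Suc MM) ZZ c))"
  proof (rule weighted_lattice_sum[symmetric, where wt = ?wt, OF _ _ g])
    fix c c' assume "cword (Suc MM) ZZ c \<simeq> cword (Suc MM) ZZ c'"
    then have "coch p TT (cword (Suc MM) ZZ c) = coch p TT (cword (Suc MM) ZZ c')"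
      by (rule coch_pl[OF _ distinct_cword]) simp
    then show "?wt (cword (Suc MM) ZZ c) = ?wt (cword (Suc MM) ZZ c')" by (simp only:)
  next
    fix c c' v assume c: "c \<in> ?Om" "c' \<in> cols (Suc MM) ZZ" "v \<in> ZZ" "0 < c v"
      "\<forall>a\<in>ZZ. a \<le> v \<longrightarrow> c' a = c a" "cword (Suc MM) ZZ c \<simeq> cword (Suc MM) ZZ c'"
    \<comment> \<open>A letter outside the top row exceeds the whole block, so the colours of the
      block are among those that stay fixed.\<close>
    have "v \<notin> KK" using c(1,4) by auto
    then have "\<forall>a\<in>KK. a \<le> v \<and> a \<in> ZZ" using c(3) by auto
    then have "\<forall>a\<in>KK. c' a = 0" using c(1,5) by auto
    then show "c' \<in> ?Om" using c(1,2) catable_pl[OF c(6), of "m # nu"] by auto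
  qed auto
  also have "\<dots> = (\<Sum>c\<in>?Om. (\<lambda>d. t ^ nat (int (n_stat nu) - coch (p + int m) TT (cword (Suc MM) ZR d)) *
    (t ^ csize ZR d MM * g ((m + MM + csize ZR d MM) # cexp MM ZR d))) (first c))"
  proof (rule sum.cong[OF refl])
    fix c assume "c \<in> ?Om"
    then have c: "c \<in> cols (Suc MM) ZZ" "\<forall>a\<in>KK. c a = 0" "catable (m # nu) (cword (Suc MM) ZZ c)" by auto
    note fp = first_props[OF c(1,2)]
    have sd: "set (cword (Suc MM) ZR (first c)) = ZR" by (rule set_cword[OF _ fp(1)]) simp
    have "coch (p + int m) TT (cword (Suc MM) ZR (first c)) \<le> int (n_stat nu)"
      using coch_le_n_stat[of nu "cword (Suc MM) ZR (first c)" "p + int m"] sorted c(3) fp(5) sd by (simp add: add.assoc)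
    then have "nat (int (n_stat (m # nu)) - coch p TT (cword (Suc MM) ZZ c)) =
      nat (int (n_stat nu) - coch (p + int m) TT (cword (Suc MM) ZR (first c))) + csize ZR (first c) MM"
      unfolding fp(6) n_stat_Cons by (simp add: nat_eq_iff)
    then show "?wt (cword (Suc MM) ZZ c) * g (cexp (Suc MM) ZZ c) = (\<lambda>d. t ^ nat (int (n_stat nu) - coch (p + int m) TT (cword (Suc MM) ZR d)) *
      (t ^ csize ZR d MM * g ((m + MM + csize ZR d MM) # cexp MM ZR d))) (first c)"
      unfolding fp(4) by (simp only: power_add mult.assoc)
  qed
  also have "\<dots> = (\<Sum>d\<in>{d\<in>cols (Suc MM) ZR. catable nu (cword (Suc MM) ZR d)}.
    t ^ nat (int (n_stat nu) - coch (p + int m) TT (cword (Suc MM) ZR d)) *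
    (t ^ csize ZR d MM * g ((m + MM + csize ZR d MM) # cexp MM ZR d)))"
    by (rule sum.reindex_bij_betw[OF first_bij])
  finally show ?thesis .
qed

text \<open>The number of letters is fixed, so the bottom row holds what the upper rows lack in
  comparison with the tableau \<open>U\<close>. The summand thus depends on the upper row lengths
  only, and \<open>cls_interl\<close> applies.\<close>

lemma sum_cls_annih:
  assumes g: "alt g" and U: "U \<in> cols (Suc MM) ZR" "lattice (Suc MM) ZR U"
  shows "(\<Sum>d\<in>cls ZR U MM. t ^ csize ZR d MM * g ((m + MM + csize ZR d MM) # cexp MM ZR d)) = annih t m g (cexp MM ZR U)"
proof -
  let ?be = "cexp MM ZR U"
  have fin: "finite ZR" by simp
  have cZ: "card ZR \<le> MM" using small by simp
  have U0: "csize ZR U MM = 0" by (rule lattice_last_empty[OF fin U cZ])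
  define G where "G ka = t ^ (sum_list ?be - sum_list ka) * g ((m + MM + (sum_list ?be - sum_list ka)) # ka)" for ka
  have aG: "alt G"
    unfolding alt_def
  proof (intro allI)
    fix xs ys :: "nat list" and a b :: nat
    have s: "sum_list (xs @ a # b # ys) = sum_list (xs @ b # a # ys)" by simp
    show "G (xs @ a # b # ys) = - G (xs @ b # a # ys)"
      unfolding G_def s altD[OF alt_Cons[OF g], of _ xs a b ys] by simp
  qed
  have sl: "sum_list (cexp MM ZR d) = (\<Sum>i<MM. csize ZR d i) + (\<Sum>i<MM. MM - 1 - i)" for d
    unfolding sum.distrib[symmetric] by (simp add: sum_list_sum_nth lessThan_atLeast0)
  have sz: "csize ZR d MM = sum_list ?be - sum_list (cexp MM ZR d)" if d: "d \<in> cols (Suc MM) ZR" for d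
    using sum_csize[OF fin d] sum_csize[OF fin U(1)] U0 unfolding sl by simp
  have "(\<Sum>d\<in>cls ZR U MM. t ^ csize ZR d MM * g ((m + MM + csize ZR d MM) # cexp MM ZR d)) = (\<Sum>d\<in>cls ZR U MM. G (cexp MM ZR d))"
  proof (rule sum.cong[OF refl])
    fix d assume "d \<in> cls ZR U MM"
    then have "d \<in> cols (Suc MM) ZR" unfolding cls_def[OF fin] by blast
    then show "t ^ csize ZR d MM * g ((m + MM + csize ZR d MM) # cexp MM ZR d) = G (cexp MM ZR d)"
      unfolding G_def by (simp only: sz)
  qed
  also have "\<dots> = (\<Sum>ka\<in>interl (cexp (Suc MM) ZR U). G ka)"
    by (rule cls_interl[OF fin U U0 aG])
  \<comment> \<open>One more row raises the staircase by one, and the bottom row of \<open>U\<close>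
    is empty.\<close>
  also have "cexp (Suc MM) ZR U = map Suc ?be @ [0]"
  proof (rule nth_equalityI)
    fix i assume "i < length (cexp (Suc MM) ZR U)"
    then show "cexp (Suc MM) ZR U ! i = (map Suc ?be @ [0]) ! i"
      using U0 by (cases "i < MM") (auto simp: nth_append less_Suc_eq)
  qed simp
  also have "(\<Sum>ka\<in>interl (map Suc ?be @ [0]). G ka) = annih t m g ?be"
  proof -
    have "sorted_wrt (>) (cexp (Suc MM) ZR U)" by (rule lattice_strict[OF fin U(2)])
    then have "sorted_wrt (>) (map Suc ?be @ [0])" unfolding \<open>cexp (Suc MM) ZR U = map Suc ?be @ [0]\<close> .
    then have "sorted_wrt (>) ?be" by (simp add: sorted_wrt_append sorted_wrt_map)
    then show ?thesis unfolding annih_def G_def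
      by (subst boxsum_interl) (auto intro: alt_Cons[OF g])
  qed
  finally show ?thesis .
qed

lemma latsum_Cons:
  assumes g: "alt g"
  shows "latsum t p (m # nu) g = latsum t (p + int m) nu (annih t m g)"
proof -
  let ?Om = "{d\<in>cols (Suc MM) ZR. catable nu (cword (Suc MM) ZR d)}"
  let ?F = "\<lambda>d. t ^ csize ZR d MM * g ((m + MM + csize ZR d MM) # cexp MM ZR d)"
  let ?wt = "\<lambda>w. t ^ nat (int (n_stat nu) - coch (p + int m) TT w)"
  let ?P = "\<lambda>d U. U \<in> cols (Suc MM) ZR \<and> lattice (Suc MM) ZR U \<and> cword (Suc MM) ZR U \<simeq> cword (Suc MM) ZR d"
  let ?L = "{U\<in>?Om. lattice (Suc MM) ZR U}"
  have fin: "finite ZR" by simp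
  have cZ: "card ZR \<le> MM" using small by simp
  have finO: "finite ?Om"
    by (rule finite_subset[of _ "cols (Suc MM) ZR"]) (auto intro!: finite_PiE)
  define lat where "lat d = (SOME U. ?P d U)" for d
  have lat: "?P d (lat d)" if "d \<in> cols (Suc MM) ZR" for d
  proof -
    have "\<exists>U. ?P d U"
      using lattice_exists[OF fin _ set_cword[OF fin that] distinct_cword[OF fin], of "Suc MM"] cZ by auto
    then show ?thesis unfolding lat_def by (rule someI_ex)
  qed
  have lat_eq: "lat d = U" if "d \<in> cols (Suc MM) ZR" "?P d U" for d U
    using lattice_unique[OF fin, of "lat d" "Suc MM" U] lat[OF that(1)] that(2) pl_trans pl_sym by blast
  have cl: "{d\<in>?Om. lat d = U} = cls ZR U MM" if U: "U \<in> ?L" for U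
  proof -
    have "d \<in> cls ZR U MM" if "d \<in> ?Om" "lat d = U" for d
      using that lat[of d] pl_sym unfolding cls_def[OF fin] by blast
    moreover have "d \<in> ?Om \<and> lat d = U" if "d \<in> cls ZR U MM" for d
    proof -
      have d: "d \<in> cols (Suc MM) ZR" "cword (Suc MM) ZR d \<simeq> cword (Suc MM) ZR U"
        using that unfolding cls_def[OF fin] by auto
      have "catable nu (cword (Suc MM) ZR d)" using catable_pl[OF d(2), of nu] U by auto
      moreover have "lat d = U" using lat_eq[OF d(1), of U] U pl_sym[OF d(2)] by blast
      ultimately show ?thesis using d(1) by blast
    qed
    ultimately show ?thesis by blast
  qed
  have "latsum t p (m # nu) g = (\<Sum>d\<in>?Om. ?wt (cword (Suc MM) ZR d) * ?F d)" by (rule latsum_first[OF g])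
  also have "\<dots> = (\<Sum>U\<in>?L. \<Sum>d\<in>{d\<in>?Om. lat d = U}. ?wt (cword (Suc MM) ZR d) * ?F d)"
  proof (rule sum.group[symmetric])
    show "finite ?L" by (rule finite_subset[OF _ finO]) auto
    show "lat ` ?Om \<subseteq> ?L"
    proof (rule image_subsetI)
      fix d assume d: "d \<in> ?Om"
      then have "?P d (lat d)" using lat by blast
      moreover from this have "catable nu (cword (Suc MM) ZR (lat d)) = catable nu (cword (Suc MM) ZR d)"
        using catable_pl by blast
      ultimately show "lat d \<in> ?L" using d by blast
    qed
  qed (rule finO)
  also have "\<dots> = (\<Sum>U\<in>?L. ?wt (cword (Suc MM) ZR U) * annih t m g (cexp MM ZR U))"
  proof (rule sum.cong[OF refl])
    fix U assume U: "U \<in> ?L"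
    have "(\<Sum>d\<in>cls ZR U MM. ?wt (cword (Suc MM) ZR d) * ?F d) = (\<Sum>d\<in>cls ZR U MM. ?wt (cword (Suc MM) ZR U) * ?F d)"
    proof (rule sum.cong[OF refl])
      fix d assume "d \<in> cls ZR U MM"
      then have "cword (Suc MM) ZR d \<simeq> cword (Suc MM) ZR U" unfolding cls_def[OF fin] by blast
      then have "coch (p + int m) TT (cword (Suc MM) ZR d) = coch (p + int m) TT (cword (Suc MM) ZR U)"
        by (rule coch_pl[OF _ distinct_cword[OF fin]])
      then show "?wt (cword (Suc MM) ZR d) * ?F d = ?wt (cword (Suc MM) ZR U) * ?F d" by (simp only:)
    qed
    also have "\<dots> = ?wt (cword (Suc MM) ZR U) * annih t m g (cexp MM ZR U)"
      unfolding sum_distrib_left[symmetric] using sum_cls_annih[OF g, of U] U by auto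
    finally show "(\<Sum>d\<in>{d\<in>?Om. lat d = U}. ?wt (cword (Suc MM) ZR d) * ?F d) = ?wt (cword (Suc MM) ZR U) * annih t m g (cexp MM ZR U)"
      unfolding cl[OF U] .
  qed
  also have "\<dots> = (\<Sum>U\<in>{U\<in>cols MM ZR. lattice MM ZR U \<and> catable nu (cword MM ZR U)}. ?wt (cword MM ZR U) * annih t m g (cexp MM ZR U))"
  proof (rule sum.cong)
    have top: "crow ZR U MM = []" if "csize ZR U MM = 0" for U
      using that length_crow[OF fin, of U MM] by simp
    have cw: "cword (Suc MM) ZR U = cword MM ZR U" if "csize ZR U MM = 0" for U
      using top[OF that] by (simp add: cword_def)
    have la: "lattice (Suc MM) ZR U = lattice MM ZR U" if "csize ZR U MM = 0" for U
      unfolding lattice_def ctab_nth using top[OF that] by (auto simp: nth_append less_Suc_eq)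
    have s1: "U \<in> cols MM ZR" if "U \<in> cols (Suc MM) ZR" "csize ZR U MM = 0" for U
    proof -
      have "finite {a\<in>ZR. U a = MM}" by (rule finite_subset[of _ ZR]) auto
      then have "{a\<in>ZR. U a = MM} = {}" using that(2) unfolding csize_def card_eq_0_iff by blast
      then have "U a \<noteq> MM" if "a \<in> ZR" for a using that by blast
      then show ?thesis using that(1) by (auto simp: PiE_def Pi_def less_Suc_eq)
    qed
    have s2: "U \<in> cols (Suc MM) ZR" "csize ZR U MM = 0" if "U \<in> cols MM ZR" for U
    proof -
      have "U a < MM" if "a \<in> ZR" for a using \<open>U \<in> cols MM ZR\<close> that by auto
      then have "\<forall>a\<in>ZR. U a \<noteq> MM" by (metis less_irrefl)
      then have "{a\<in>ZR. U a = MM} = {}" by blast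
      then show "csize ZR U MM = 0" unfolding csize_def by (simp only: card.empty)
      show "U \<in> cols (Suc MM) ZR" using that by (auto simp: PiE_def Pi_def less_Suc_eq)
    qed
    show "?L = {U\<in>cols MM ZR. lattice MM ZR U \<and> catable nu (cword MM ZR U)}"
    proof (intro equalityI subsetI)
      fix U assume "U \<in> ?L"
      then have U: "U \<in> cols (Suc MM) ZR" "lattice (Suc MM) ZR U" "catable nu (cword (Suc MM) ZR U)" by auto
      have U0: "csize ZR U MM = 0" by (rule lattice_last_empty[OF fin U(1,2) cZ])
      show "U \<in> {U\<in>cols MM ZR. lattice MM ZR U \<and> catable nu (cword MM ZR U)}"
        using U s1[OF U(1) U0] la[OF U0] cw[OF U0] by simp
    next
      fix U assume "U \<in> {U\<in>cols MM ZR. lattice MM ZR U \<and> catable nu (cword MM ZR U)}"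
      then have U: "U \<in> cols MM ZR" "lattice MM ZR U" "catable nu (cword MM ZR U)" by auto
      note U0 = s2[OF U(1)]
      show "U \<in> ?L" using U U0 la[OF U0(2)] cw[OF U0(2)] by simp
    qed
    fix U assume "U \<in> {U\<in>cols MM ZR. lattice MM ZR U \<and> catable nu (cword MM ZR U)}"
    then have "csize ZR U MM = 0" using s2 by blast
    then show "?wt (cword (Suc MM) ZR U) * annih t m g (cexp MM ZR U) = ?wt (cword MM ZR U) * annih t m g (cexp MM ZR U)"
      by (simp only: cw)
  qed
  also have "\<dots> = latsum t (p + int m) nu (annih t m g)"
  proof -
    have "TT = p + int m + int (sum_list nu)" by simp
    then show ?thesis unfolding latsum_def Let_def by (simp only:)
  qed
  finally show ?thesis .
qed

end

theorem latsum_annihs: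
  fixes t :: "'b::{idom, ring_char_0}"
  shows "sorted_wrt (\<ge>) mu \<Longrightarrow> sum_list mu \<le> length mu \<Longrightarrow> alt g \<Longrightarrow> latsum t p mu g = annihs t mu g"
proof (induction mu arbitrary: p g)
  case Nil
  have "cols 0 {p + 1..p} = {\<lambda>x. undefined}" by simp
  moreover have "lattice 0 {} (\<lambda>x::int. undefined)" by (simp add: lattice_def)
  ultimately show ?case by (simp add: latsum_def n_stat_def coch_def cword_def cexp_def cong: conj_cong)
next
  case (Cons m nu)
  \<comment> \<open>A positive part lowers the sum at least as much as the length; if the part is 0,
    all later ones are 0 too.\<close>
  have "sum_list nu \<le> length nu"
    using Cons.prems(2) sorted_zero[OF Cons.prems(1)] by (simp only: sum_list.Cons list.size) linarith
  then show ?case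
    using latsum_Cons[OF Cons.prems(1) _ Cons.prems(3)] Cons.IH alt_annih[OF Cons.prems(3)] Cons.prems(1) by simp
qed

section \<open>Standard tableaux as lattice colourings\<close>

lemma catable_zeros: "catable (mu @ replicate k 0) w = catable mu w"
proof (induction mu arbitrary: w)
  case Nil
  show ?case
  proof (induction k arbitrary: w)
    case (Suc k)
    have "catable (0 # replicate k 0) w \<longleftrightarrow> w = []"
    proof
      assume "catable (0 # replicate k 0) w"
      then obtain Y b s where *: "w \<simeq> Y @ b @ s" "length b = 0" "catable (replicate k 0) (s @ Y)"
        unfolding catable.simps by blast
      then have "s @ Y = []" using Suc[of "s @ Y"] by simp
      then have "set w = {}" using pl_set[OF *(1)] *(2) by simp
      then show "w = []" by simp
    next
      assume "w = []"
      then show "catable (0 # replicate k 0) w"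
        unfolding catable.simps using Suc[of "[]"] by (intro conjI exI[of _ "[]"]) auto
    qed
    then show ?case by simp
  qed simp
next
  case (Cons m mu)
  then show ?case unfolding append_Cons catable.simps by simp
qed

lemma catable_pad: "catable (pad N mu) w = catable mu w"
  by (simp add: pad_def catable_zeros)

lemma n_stat_pad: "n_stat (pad N mu) = n_stat mu"
proof -
  have "n_stat (mu @ replicate k 0) = n_stat mu" for k
    by (induction mu) (auto simp: n_stat_Cons, simp add: n_stat_def)
  then show ?thesis by (simp add: pad_def)
qed

lemma left_of_split: "left_of u b a \<longleftrightarrow> (\<exists>xs ys zs. u = xs @ b # ys @ a # zs)"
proof
  assume "left_of u b a"
  then obtain k l where *: "k < l" "l < length u" "u ! k = b" "u ! l = a" by (auto simp: left_of_def)
  have u: "u = take k u @ b # drop (Suc k) u" using id_take_nth_drop[of k u] * by simp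
  have "drop (Suc k) u ! (l - Suc k) = a" "l - Suc k < length (drop (Suc k) u)" using * by auto
  then have "a \<in> set (drop (Suc k) u)" by (metis nth_mem)
  then obtain ys zs where "drop (Suc k) u = ys @ a # zs" by (meson split_list)
  with u show "\<exists>xs ys zs. u = xs @ b # ys @ a # zs" by metis
next
  assume "\<exists>xs ys zs. u = xs @ b # ys @ a # zs"
  then obtain xs ys zs where u: "u = xs @ b # ys @ a # zs" by blast
  show "left_of u b a" unfolding left_of_def u
    by (rule exI[of _ "length xs"], rule exI[of _ "Suc (length xs + length ys)"]) (auto simp: nth_append)
qed

lemma filter_pair_left_of:
  assumes "distinct u" "a \<noteq> b"
  shows "filter (\<lambda>x. x = a \<or> x = b) u = [b, a] \<longleftrightarrow> left_of u b a"
proof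
  assume "filter (\<lambda>x. x = a \<or> x = b) u = [b, a]"
  then obtain us vs where 1: "u = us @ b # vs" "[a] = filter (\<lambda>x. x = a \<or> x = b) vs"
    by (blast dest: filter_eq_ConsD)
  obtain us' vs' where "vs = us' @ a # vs'"
    using filter_eq_ConsD[OF 1(2)[symmetric]] by blast
  then show "left_of u b a" using 1(1) unfolding left_of_split by blast
next
  assume "left_of u b a"
  then obtain xs ys zs where u: "u = xs @ b # ys @ a # zs" unfolding left_of_split by blast
  have "filter (\<lambda>x. x = a \<or> x = b) xs = []" "filter (\<lambda>x. x = a \<or> x = b) ys = []" "filter (\<lambda>x. x = a \<or> x = b) zs = []"
    using assms(1) unfolding u by (auto simp: filter_empty_conv)
  then show "filter (\<lambda>x. x = a \<or> x = b) u = [b, a]" by (simp add: u)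
qed

lemma desc_left_of:
  assumes "distinct u"
  shows "desc (map int u) (int a) \<longleftrightarrow> left_of u (Suc a) a"
proof -
  have "filter (\<lambda>x. x = int a \<or> x = int a + 1) (map int u) = map int (filter (\<lambda>x. x = a \<or> x = Suc a) u)"
    unfolding filter_map by (rule arg_cong[where f = "map int"], rule filter_cong) auto
  moreover have "map int v = [int a + 1, int a] \<longleftrightarrow> v = [Suc a, a]" for v
    by (auto simp: map_eq_Cons_conv)
  ultimately show ?thesis using filter_pair_left_of[OF assms, of a "Suc a"] by (simp add: desc_def)
qed

lemma charge_label_sum:
  "int (charge_label u (Suc i)) = int i - (\<Sum>a\<in>{1..i}. if left_of u (Suc a) a then 1 else 0)"
proof (induction i)
  case (Suc i)
  have "{1..Suc i} = insert (Suc i) {1..i}" by auto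
  then show ?case using Suc by simp
qed simp

lemma triangle_swap:
  fixes f :: "nat \<Rightarrow> int"
  shows "(\<Sum>i<n. \<Sum>a\<in>{1..i}. f a) = (\<Sum>a\<in>{1..<n}. (int n - int a) * f a)"
proof (induction n)
  case (Suc n)
  have "(\<Sum>a\<in>{1..<Suc n}. (int (Suc n) - int a) * f a) = (\<Sum>a\<in>{1..<Suc n}. (int n - int a) * f a) + (\<Sum>a\<in>{1..<Suc n}. f a)"
    by (simp add: sum.distrib[symmetric] algebra_simps del: sum.op_ivl_Suc)
  also have "(\<Sum>a\<in>{1..<Suc n}. (int n - int a) * f a) = (\<Sum>a\<in>{1..<n}. (int n - int a) * f a)"
    by (cases n) (simp_all)
  finally show ?case using Suc by (simp add: atLeastLessThanSuc_atLeastAtMost del: sum.op_ivl_Suc)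
qed simp

lemma sum_int_choose: "(\<Sum>i<n. int i) = int (n choose 2)"
  by (induction n) (auto simp: numeral_2_eq_2)

text \<open>The label of i + 1 is i minus the number of descents up to i. Summed over all letters, a
  descent at a is counted once for each of the n - a larger letters.\<close>

lemma cocharge_coch:
  assumes "standard S" "length (reading_word S) = n"
  shows "int (cocharge S) = coch 0 (int n) (map int (reading_word S))"
proof -
  let ?u = "reading_word S"
  have d: "distinct ?u" using assms by (simp add: standard_def)
  let ?f = "\<lambda>a. if left_of ?u (Suc a) a then 1 else 0 :: int"
  have "int (charge S) = (\<Sum>i<n. int (charge_label ?u (Suc i)))"
    unfolding charge_def Let_def assms(2) by (simp add: sum.atLeast1_atMost_eq lessThan_atLeast0)
  also have "\<dots> = int (n choose 2) - (\<Sum>a\<in>{1..<n}. (int n - int a) * ?f a)"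
    unfolding charge_label_sum sum_subtractf triangle_swap sum_int_choose ..
  finally have ch: "int (charge S) = int (n choose 2) - (\<Sum>a\<in>{1..<n}. (int n - int a) * ?f a)" .
  have co: "coch 0 (int n) (map int ?u) = (\<Sum>a\<in>{1..<n}. (int n - int a) * ?f a)"
  proof -
    have "coch 0 (int n) (map int ?u) = (\<Sum>a\<in>int ` {1..<n}. if desc (map int ?u) a then int n - a else 0)"
      unfolding coch_def by (rule sum.cong) (auto simp: image_int_atLeastLessThan)
    also have "\<dots> = (\<Sum>a\<in>{1..<n}. (int n - int a) * ?f a)"
      by (subst sum.reindex) (auto simp: inj_on_def desc_left_of[OF d] intro!: sum.cong)
    finally show ?thesis .
  qed
  have "0 \<le> (\<Sum>a\<in>{1..<n}. (int n - int a) * ?f a)" by (rule sum_nonneg) auto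
  then have "charge S \<le> n choose 2" using ch by linarith
  then show ?thesis unfolding cocharge_def assms(2) using ch co by simp
qed

lemma ctab_split: "ctab T \<Longrightarrow> T = filter (\<lambda>r. r \<noteq> []) T @ replicate (length T - length (filter (\<lambda>r. r \<noteq> []) T)) []"
proof (induction T rule: ctab.induct)
  case (3 x v T)
  have IH: "v # T = filter (\<lambda>r. r \<noteq> []) (v # T) @ replicate (length (v # T) - length (filter (\<lambda>r. r \<noteq> []) (v # T))) []"
    using 3 by simp
  show ?case
  proof (cases "x = []")
    case True
    then have v: "v = []" using 3(2) by (simp add: nrm_iff)
    have "filter (\<lambda>r. r \<noteq> []) (v # T) = []"
    proof (rule ccontr)
      assume ne: "filter (\<lambda>r. r \<noteq> []) (v # T) \<noteq> []"
      have "hd (v # T) = hd (filter (\<lambda>r. r \<noteq> []) (v # T))"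
        by (subst IH) (rule hd_append2[OF ne])
      moreover have "hd (filter (\<lambda>r. r \<noteq> []) (v # T)) \<in> set (filter (\<lambda>r. r \<noteq> []) (v # T))" using ne by (rule hd_in_set)
      ultimately show False using v by simp
    qed
    then have "v # T = replicate (length (v # T)) []" "filter (\<lambda>r. r \<noteq> []) (x # v # T) = []" using IH True by simp_all
    then show ?thesis using True by (metis append_Nil diff_zero length_Cons list.size(3) replicate_Suc)
  next
    case False
    have "length (x # v # T) - length (filter (\<lambda>r. r \<noteq> []) (x # v # T)) = length (v # T) - length (filter (\<lambda>r. r \<noteq> []) (v # T))"
      using False by simp
    moreover have "filter (\<lambda>r. r \<noteq> []) (x # v # T) = x # filter (\<lambda>r. r \<noteq> []) (v # T)" using False by simp
    ultimately show ?thesis using arg_cong[OF IH, of "(#) x"] by (simp only: append_Cons)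
  qed
qed auto

lemma ctab_append: "ctab (T @ V) \<Longrightarrow> ctab T"
  unfolding ctab_nth by (auto simp: nth_append split: if_splits)

lemma ctab_map:
  assumes "strict_mono (f :: 'a::linorder \<Rightarrow> 'b::linorder)"
  shows "ctab (map (map f) T) \<longleftrightarrow> ctab T"
proof -
  have lt: "f a < f b \<longleftrightarrow> a < b" for a b using assms by (simp add: strict_mono_less)
  have "nrm (map f v) (map f x) = nrm v x" for v x by (auto simp: nrm_iff lt)
  moreover have "inc (map f r) = inc r" for r by (simp add: sorted_wrt_map lt)
  ultimately show ?thesis by (auto simp: ctab_nth)
qed

lemma rword_filter: "rword (filter (\<lambda>r. r \<noteq> []) T) = rword T"
  by (induction T) (auto simp: rword_def)

lemma rword_map: "rword (map (map f) T) = map f (rword T)"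
  by (simp add: rword_def rev_map map_concat)

definition standards :: "nat \<Rightarrow> tableau set" where
  "standards n = {S. standard S \<and> length (reading_word S) = n}"

definition lattices :: "nat \<Rightarrow> nat \<Rightarrow> (int \<Rightarrow> nat) set" where
  "lattices n N = {c\<in>cols N {1..int n}. lattice N {1..int n} c}"

definition rows_of :: "nat \<Rightarrow> nat \<Rightarrow> (int \<Rightarrow> nat) \<Rightarrow> tableau" where
  "rows_of n N c = map (map nat) (filter (\<lambda>r. r \<noteq> []) (map (crow {1..int n} c) [0..<N]))"

lemma rows_of_props:
  assumes c: "c \<in> lattices n N"
  shows "rows_of n N c \<in> standards n" "map int (reading_word (rows_of n N c)) = cword N {1..int n} c"
    "cexp N {1..int n} c = shift (pad N (shape (rows_of n N c)))"
    "shape (rows_of n N c) \<in> partitions n" "length (shape (rows_of n N c)) \<le> N"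
proof -
  let ?Z = "{1..int n}" and ?S = "rows_of n N c"
  let ?T = "map (crow ?Z c) [0..<N]"
  let ?F = "filter (\<lambda>r. r \<noteq> []) ?T"
  have cc: "c \<in> cols N ?Z" "ctab ?T" using c by (auto simp: lattices_def lattice_def)
  have split: "?T = ?F @ replicate (length ?T - length ?F) []" by (rule ctab_split[OF cc(2)])
  have cF: "ctab ?F" using cc(2) split ctab_append by metis
  have pos: "0 < a" if "r \<in> set ?F" "a \<in> set r" for r a using that by (auto simp: set_crow)
  have mm: "map (map int) ?S = ?F"
    unfolding rows_of_def map_map comp_def
  proof (rule map_idI, rule map_idI)
    fix r a assume "r \<in> set ?F" "a \<in> set r"
    then show "int (nat a) = a" using pos[of r a] by simp
  qed
  have cS: "ctab ?S" using cF mm ctab_map[OF strict_mono_int, of ?S] by simp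
  have neS: "[] \<notin> set ?S" by (auto simp: rows_of_def)
  have "map int (rword ?S) = rword ?F" using rword_map[of int ?S] mm by simp
  then have w: "map int (rword ?S) = cword N ?Z c" by (simp add: rword_filter cword_def)
  then show "map int (reading_word ?S) = cword N ?Z c" by (simp add: reading_word_eq)
  have dw: "distinct (cword N ?Z c)" by (rule distinct_cword) simp
  have sw: "set (cword N ?Z c) = ?Z" by (rule set_cword[OF _ cc(1)]) simp
  have d: "distinct (rword ?S)" using dw unfolding w[symmetric] by (simp add: distinct_map)
  have "int ` set (rword ?S) = ?Z" using sw unfolding w[symmetric] by simp
  then have "int ` set (rword ?S) = int ` {1..n}" by (simp add: image_int_atLeastAtMost)
  then have s: "set (rword ?S) = {1..n}" by (simp add: inj_image_eq_iff)
  then have l: "length (rword ?S) = n" using distinct_card[OF d] by simp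
  show st: "?S \<in> standards n"
    using column_strict_ctab[OF d] cS neS d s l by (simp add: standards_def standard_def reading_word_eq)
  have lS: "length ?S = length ?F" by (simp add: rows_of_def)
  have lF: "length ?F \<le> N" using length_filter_le[of _ ?T] by simp
  show lN: "length (shape ?S) \<le> N" using lS lF by (simp add: shape_def)
  have sz: "csize ?Z c i = pad N (shape ?S) ! i" if "i < N" for i
  proof -
    have "csize ?Z c i = length (?T ! i)" using that by (simp add: length_crow)
    also have "?T ! i = (if i < length ?F then ?F ! i else [])"
      by (subst split) (use that in \<open>simp add: nth_append del: map_append\<close>)
    also have "length \<dots> = pad N (shape ?S) ! i"
    proof (cases "i < length ?F")
      case True
      then have "length (?F ! i) = length (?S ! i)" unfolding mm[symmetric] using lS by simp
      then show ?thesis using True lS that by (simp add: nth_pad nth_default_def shape_def)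
    next
      case False
      then show ?thesis using lS that by (simp add: nth_pad nth_default_def shape_def)
    qed
    finally show ?thesis .
  qed
  show "cexp N ?Z c = shift (pad N (shape ?S))"
    by (rule nth_equalityI) (use sz length_pad[OF lN] in \<open>auto simp: nth_shift\<close>)
  have "is_partition (shape ?S)" using st by (simp add: standards_def standard_def column_strict_def)
  moreover have "sum_list (shape ?S) = n" using l by (simp add: shape_def rword_def length_concat sum_list_rev flip: rev_map)
  ultimately show "shape ?S \<in> partitions n" by (simp add: partitions_def)
qed

lemma rows_of_bij:
  assumes N: "n \<le> N"
  shows "bij_betw (rows_of n N) (lattices n N) (standards n)"
  unfolding bij_betw_def
proof
  let ?Z = "{1..int n}"
  show "inj_on (rows_of n N) (lattices n N)"
  proof (rule inj_onI)
    fix c c' assume c: "c \<in> lattices n N" "c' \<in> lattices n N" "rows_of n N c = rows_of n N c'"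
    then have "cword N ?Z c = cword N ?Z c'" using rows_of_props(2) by metis
    then show "c = c'" using lattice_unique[of ?Z c N c'] c(1,2) by (auto simp: lattices_def)
  qed
  show "rows_of n N ` lattices n N = standards n"
  proof (intro equalityI subsetI)
    fix S assume "S \<in> rows_of n N ` lattices n N"
    then show "S \<in> standards n" using rows_of_props(1) by blast
  next
    fix S assume "S \<in> standards n"
    then have S: "standard S" "length (rword S) = n" by (auto simp: standards_def reading_word_eq)
    have d: "distinct (rword S)" "set (rword S) = {1..n}" using S by (auto simp: standard_def reading_word_eq)
    have cs: "ctab S" "[] \<notin> set S" using S(1) column_strict_ctab[OF d(1)] by (auto simp: standard_def)
    define w where "w = map int (rword S)"
    have dw: "distinct w" using d(1) by (simp add: w_def distinct_map)
    have sw: "set w = ?Z" using d(2) by (simp add: w_def image_int_atLeastAtMost)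
    obtain U where U: "U \<in> cols N ?Z" "lattice N ?Z U" "cword N ?Z U \<simeq> w"
      using lattice_exists[of ?Z N w] sw dw N by auto
    have "length S \<le> length (rword S)" using cs(2)
    proof (induction S)
      case (Cons x S)
      then have "1 \<le> length x" by (cases x) auto
      then show ?case using Cons by simp
    qed simp
    then have lS: "length S \<le> N" using S(2) N by simp
    define T where "T = map (map int) S @ replicate (N - length S) []"
    have rT: "rword T = w" by (simp add: T_def w_def rword_map) (simp add: rword_def)
    have "ctab T"
    proof -
      have c: "ctab (map (map int) S)" using cs(1) ctab_map[OF strict_mono_int] by blast
      have "nrm (T ! Suc i) (T ! i)" if "Suc i < N" for i
      proof (cases "Suc i < length S")
        case True
        then show ?thesis using c unfolding ctab_nth by (simp add: T_def nth_append)
      next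
        case False
        then have "T ! Suc i = []" using that by (simp add: T_def nth_append)
        then show ?thesis by simp
      qed
      then show ?thesis using c lS unfolding ctab_nth by (auto simp: T_def)
    qed
    have "map (crow ?Z U) [0..<N] = T"
      by (rule ctab_unique) (use U \<open>ctab T\<close> rT dw distinct_cword[of ?Z N U] lS in \<open>simp_all add: lattice_def cword_def T_def\<close>)
    then have "rows_of n N U = map (map nat) (filter (\<lambda>r. r \<noteq> []) T)" by (simp add: rows_of_def)
    also have "filter (\<lambda>r. r \<noteq> []) T = map (map int) S"
      using cs(2) by (auto simp: T_def filter_id_conv)
    also have "map (map nat) (map (map int) S) = S" by (simp add: comp_def)
    finally show "S \<in> rows_of n N ` lattices n N" using U by (force simp: lattices_def)
  qed
qed

text \<open>The tableau sum before q is inverted, which is to be recognised as the polynomial K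
  itself.\<close>

definition kf :: "nat list \<Rightarrow> nat list \<Rightarrow> int poly" where
  "kf lam mu = (\<Sum>S\<in>{S\<in>standard_tableaux lam. dominates (cattype S) (nth_default 0 mu)}.
     [:0, 1:] ^ (n_stat mu - cocharge S))"

lemma finite_partitions: "finite (partitions n)"
proof (rule finite_subset)
  have "length la \<le> sum_list la" if "0 \<notin> set la" for la :: "nat list"
    using that by (induction la) auto
  then show "partitions n \<subseteq> {la. set la \<subseteq> {..n} \<and> length la \<le> n}"
    using member_le_sum_list by (fastforce simp: partitions_def is_partition_def)
qed (simp add: finite_lists_length_le)

lemma partition_length: "la \<in> partitions n \<Longrightarrow> length la \<le> n"
proof -
  assume la: "la \<in> partitions n"
  have "length la \<le> sum_list la" if "0 \<notin> set la" for la :: "nat list"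
    using that by (induction la) auto
  then show ?thesis using la by (auto simp: partitions_def is_partition_def)
qed

lemma standard_tableaux_standards:
  assumes "lam \<in> partitions n"
  shows "standard_tableaux lam = {S\<in>standards n. shape S = lam}"
proof -
  have "length (reading_word S) = sum_list (shape S)" for S :: tableau
    by (simp add: shape_def reading_word_def length_concat sum_list_rev flip: rev_map)
  then show ?thesis using assms by (auto simp: standard_tableaux_def standards_def partitions_def)
qed

lemma sorted_pad: "mu \<in> partitions n \<Longrightarrow> sorted_wrt (\<ge>) (pad N mu)"
proof -
  have "sorted_wrt (\<ge>) (replicate k (0 :: nat))" for k by (induction k) auto
  then show "mu \<in> partitions n \<Longrightarrow> sorted_wrt (\<ge>) (pad N mu)"
    by (auto simp: pad_def partitions_def is_partition_def sorted_wrt_append)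
qed

lemma sum_list_pad: "sum_list (pad N mu) = sum_list mu"
  by (simp add: pad_def sum_list_replicate)

lemma latsum_kf:
  fixes g :: "nat list \<Rightarrow> int poly"
  assumes mu: "mu \<in> partitions n" and N: "n \<le> N"
  shows "latsum [:0, 1:] 0 (pad N mu) g = (\<Sum>lam\<in>partitions n. kf lam mu * g (shift (pad N lam)))"
proof -
  let ?t = "[:0, 1:] :: int poly" and ?Z = "{1..int n}"
  have lp: "length (pad N mu) = N" using partition_length[OF mu] N by (simp add: length_pad)
  have sp: "sum_list (pad N mu) = n" using mu by (simp add: sum_list_pad partitions_def)
  let ?C = "\<lambda>S. catable mu (map int (reading_word S))"
  let ?h = "\<lambda>S. ?t ^ (n_stat mu - cocharge S) * g (shift (pad N (shape S)))"
  have "latsum ?t 0 (pad N mu) g = (\<Sum>c\<in>{c\<in>lattices n N. ?C (rows_of n N c)}. ?h (rows_of n N c))"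
    unfolding latsum_def Let_def lp sp n_stat_pad catable_pad
  proof (rule sum.cong)
    show "{c \<in> cols N {0 + 1..0 + int n}. lattice N {0 + 1..0 + int n} c \<and> catable mu (cword N {0 + 1..0 + int n} c)} =
      {c \<in> lattices n N. ?C (rows_of n N c)}"
      using rows_of_props(2)[of _ n N] by (auto simp: lattices_def)
    fix c assume "c \<in> {c \<in> lattices n N. ?C (rows_of n N c)}"
    then have c: "c \<in> lattices n N" by simp
    note p = rows_of_props[OF c]
    have "coch 0 (int n) (cword N ?Z c) = int (cocharge (rows_of n N c))"
      using cocharge_coch[of "rows_of n N c" n] p(1,2) by (simp add: standards_def)
    then show "?t ^ nat (int (n_stat mu) - coch 0 (0 + int n) (cword N {0 + 1..0 + int n} c)) * g (cexp N {0 + 1..0 + int n} c) =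
      ?h (rows_of n N c)" using p(3) by (simp add: nat_minus_as_int)
  qed
  also have "\<dots> = (\<Sum>S\<in>{S\<in>standards n. ?C S}. ?h S)"
  proof (rule sum.reindex_bij_betw)
    show "bij_betw (rows_of n N) {c\<in>lattices n N. ?C (rows_of n N c)} {S\<in>standards n. ?C S}"
      using rows_of_bij[OF N] unfolding bij_betw_def by (auto intro: inj_on_subset)
  qed
  also have "\<dots> = (\<Sum>lam\<in>partitions n. \<Sum>S\<in>{S\<in>{S\<in>standards n. ?C S}. shape S = lam}. ?h S)"
  proof (rule sum.group[symmetric])
    have "finite (lattices n N)"
      by (rule finite_subset[of _ "cols N ?Z"]) (auto simp: lattices_def intro!: finite_PiE)
    then have "finite (standards n)" using bij_betw_finite[OF rows_of_bij[OF N]] by simp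
    then show "finite {S\<in>standards n. ?C S}" by simp
    have "shape S \<in> partitions n" if S: "S \<in> standards n" for S
    proof -
      have "S \<in> rows_of n N ` lattices n N" using S rows_of_bij[OF N] by (simp add: bij_betw_def)
      then show ?thesis using rows_of_props(4) by blast
    qed
    then show "shape ` {S\<in>standards n. ?C S} \<subseteq> partitions n" by blast
  qed (rule finite_partitions)
  also have "\<dots> = (\<Sum>lam\<in>partitions n. kf lam mu * g (shift (pad N lam)))"
  proof (rule sum.cong[OF refl])
    fix lam assume lam: "lam \<in> partitions n"
    have "{S\<in>{S\<in>standards n. ?C S}. shape S = lam} = {S\<in>standard_tableaux lam. dominates (cattype S) (nth_default 0 mu)}"
      using dominates_cattype_iff mu unfolding standard_tableaux_standards[OF lam] by (auto simp: standards_def)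
    then show "(\<Sum>S\<in>{S\<in>{S\<in>standards n. ?C S}. shape S = lam}. ?h S) = kf lam mu * g (shift (pad N lam))"
      unfolding kf_def sum_distrib_right
      by (intro sum.cong) (auto simp: standard_tableaux_def)
  qed
  finally show ?thesis .
qed

lemma pad_inj: "mu \<in> partitions n \<Longrightarrow> nu \<in> partitions n \<Longrightarrow> pad N mu = pad N nu \<Longrightarrow> mu = nu"
proof -
  assume mu: "mu \<in> partitions n" "nu \<in> partitions n" "pad N mu = pad N nu"
  have "filter (\<lambda>a. a \<noteq> 0) (pad N la) = la" if "la \<in> partitions n" for la
    using that by (auto simp: pad_def partitions_def is_partition_def filter_id_conv intro!: gr0I)
  then show "mu = nu" using mu by metis
qed

text \<open>Testing the recursion on \<open>creas\<close> combines \<open>latsum_annihs\<close> with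
  \<open>annihs_creas\<close>: the tableau sums and the coefficients of the Hall--Littlewood
  functions are inverse matrices up to the diagonal of norms.\<close>

lemma kf_orthogonal:
  assumes mu: "mu \<in> partitions n" and nu: "nu \<in> partitions n" and N: "n \<le> N"
  shows "(\<Sum>lam\<in>partitions n. kf lam nu * creas [:0, 1:] (pad N mu) (shift (pad N lam))) =
    (if nu = mu then vnorm [:0, 1:] (pad N mu) else 0)"
proof -
  have l: "length (pad N nu) = N" "length (pad N mu) = N"
    using partition_length[OF mu] partition_length[OF nu] N by (auto simp: length_pad)
  have "sum_list (pad N nu) \<le> length (pad N nu)" using nu N l by (simp add: sum_list_pad partitions_def)
  from latsum_annihs[OF sorted_pad[OF nu] this alt_creas]
  have "latsum [:0, 1:] 0 (pad N nu) (creas ([:0, 1:] :: int poly) (pad N mu)) = annihs [:0, 1:] (pad N nu) (creas [:0, 1:] (pad N mu))" .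
  also have "\<dots> = (if pad N nu = pad N mu then vnorm [:0, 1:] (pad N mu) else 0)"
    by (rule annihs_creas) (simp_all only: l sorted_pad[OF nu] sorted_pad[OF mu])
  finally show ?thesis unfolding latsum_kf[OF nu N] using pad_inj[OF nu mu] by metis
qed

section \<open>Coefficient extension\<close>

text \<open>The operators are polynomial formulas in t and commute with ring homomorphisms. This
  carries them from integer polynomials in q to polynomials in the variables and on to the field of
  fractions.\<close>

definition hom1 :: "('a::comm_ring_1 \<Rightarrow> 'b::comm_ring_1) \<Rightarrow> bool" where
  "hom1 f \<longleftrightarrow> f 0 = 0 \<and> f 1 = 1 \<and> (\<forall>x y. f (x + y) = f x + f y) \<and> (\<forall>x y. f (x * y) = f x * f y)"

context
  fixes f :: "'a::comm_ring_1 \<Rightarrow> 'b::comm_ring_1"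
  assumes f: "hom1 f"
begin

lemma hom_simps: "f 0 = 0" "f 1 = 1" "f (x + y) = f x + f y" "f (x * y) = f x * f y"
  using f by (auto simp: hom1_def)

lemma hom_uminus: "f (- x) = - f x"
proof -
  have "f (- x) + f x = 0" unfolding hom_simps(3)[symmetric] by (simp add: hom_simps)
  then show ?thesis by (simp add: eq_neg_iff_add_eq_0)
qed

lemma hom_diff: "f (x - y) = f x - f y"
  using hom_simps(3)[of x "- y"] by (simp add: hom_uminus)

lemma hom_power: "f (x ^ k) = f x ^ k"
  by (induction k) (auto simp: hom_simps)

lemma hom_sum: "f (sum g A) = (\<Sum>x\<in>A. f (g x))"
  by (induction A rule: infinite_finite_induct) (auto simp: hom_simps)

lemma hom_prod: "f (prod g A) = (\<Prod>x\<in>A. f (g x))"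
  by (induction A rule: infinite_finite_induct) (auto simp: hom_simps)

lemma hom_ee: "f (ee t k g be) = ee (f t) k (\<lambda>x. f (g x)) be"
  by (induction be arbitrary: k g) (auto simp: hom_simps hom_diff)

lemma hom_creas: "f (creas t mu al) = creas (f t) mu al"
proof (induction mu arbitrary: al)
  case (Cons m mu)
  then show ?case by (simp add: crea_def hom_sum hom_simps hom_power hom_uminus hom_ee)
qed (simp add: hom_simps)

lemma hom_upsum: "f (upsum t F be) = upsum (f t) (\<lambda>k x. f (F k x)) be"
  by (induction be arbitrary: F) (auto simp: hom_simps hom_diff)

lemma hom_cocreas: "f (cocreas t mu g) = cocreas (f t) mu (\<lambda>x. f (g x))"
proof (induction mu arbitrary: g)
  case (Cons m mu)
  have "(\<lambda>x. f (cocrea t m g x)) = cocrea (f t) m (\<lambda>x. f (g x))"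
    by (rule ext) (simp add: cocrea_def hom_upsum)
  then show ?case using Cons by simp
qed simp

lemma hom_vnorm: "f (vnorm t mu) = vnorm (f t) mu"
  by (induction mu) (auto simp: hom_simps qnum_def hom_sum hom_power)

lemma hom_alternant: "f (alternant al y) = alternant al (\<lambda>i. f (y i))"
proof -
  have s: "f (of_int (sign w)) = of_int (sign w)" for w :: "nat \<Rightarrow> nat"
    by (simp add: sign_def hom_simps hom_uminus)
  show ?thesis by (simp add: alternant_def hom_sum hom_simps hom_prod hom_power s)
qed

end

definition cst :: "int poly \<Rightarrow> ((nat \<Rightarrow>\<^sub>0 nat) \<Rightarrow>\<^sub>0 int poly)" where
  "cst = Poly_Mapping.single 0"

lemma hom1_cst: "hom1 cst"
  by (simp add: hom1_def cst_def single_add mult_single)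

lemma hom1_to_fract: "hom1 (to_fract :: ((nat \<Rightarrow>\<^sub>0 nat) \<Rightarrow>\<^sub>0 int poly) \<Rightarrow> ratfun)"
  by (simp add: hom1_def)

lemma const_rf_cst: "const_rf p = to_fract (cst p)"
  by (simp add: const_rf_def cst_def)

lemma hom1_const_rf: "hom1 const_rf"
  using hom1_cst by (simp add: hom1_def const_rf_cst)

lemma var_rf_var: "var_rf i = to_fract (var i)"
  by (simp add: var_rf_def var_def)

lemma const_rf_eq_0: "const_rf p = 0 \<longleftrightarrow> p = 0"
proof -
  have "p = 0" if "cst p = 0" using arg_cong[OF that, of "\<lambda>q. Poly_Mapping.lookup q 0"] by (simp add: cst_def)
  then show ?thesis by (auto simp: const_rf_cst) (simp add: cst_def)
qed

lemma var_inj: "inj var"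
proof (rule injI)
  fix i j assume "var i = var j"
  then have "Poly_Mapping.single (Poly_Mapping.single i (1 :: nat)) (1 :: int poly) = Poly_Mapping.single (Poly_Mapping.single j 1) 1"
    by (simp add: var_def)
  from arg_cong[OF this, of "\<lambda>p. Poly_Mapping.lookup p (Poly_Mapping.single j 1)"]
  have "Poly_Mapping.single i (1 :: nat) = Poly_Mapping.single j 1"
    by (simp add: Poly_Mapping.lookup_single when_def split: if_splits)
  from arg_cong[OF this, of "\<lambda>p. Poly_Mapping.lookup p i"] show "i = j"
    by (simp add: Poly_Mapping.lookup_single when_def split: if_splits)
qed

section \<open>Inversion of the matrix identity\<close>

lemma weakly_decreasing_split:
  "sorted_wrt (\<ge>) la \<Longrightarrow> la = filter (\<lambda>a. a \<noteq> 0) la @ replicate (length la - length (filter (\<lambda>a. a \<noteq> 0) la)) (0 :: nat)"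
proof (induction la)
  case (Cons a la)
  show ?case
  proof (cases "a = 0")
    case True
    then have "\<forall>b\<in>set la. b = 0" using Cons.prems by simp
    then have "filter (\<lambda>a. a \<noteq> 0) (a # la) = []" "a # la = replicate (length (a # la)) 0"
      using True by (auto simp: filter_empty_conv intro!: replicate_eqI)
    then show ?thesis by (metis append_Nil diff_zero list.size(3))
  qed (use Cons in auto)
qed simp

lemma sum_list_shift: "sum_list (shift la) = sum_list la + (length la choose 2)"
proof -
  have "sum_list (shift la) = (\<Sum>i<length la. la ! i) + (\<Sum>i<length la. length la - 1 - i)"
    unfolding sum.distrib[symmetric] by (simp add: sum_list_sum_nth lessThan_atLeast0 nth_shift)
  also have "(\<Sum>i<length la. length la - 1 - i) = (\<Sum>i<length la. i)"
    by (rule sum.reindex_bij_witness[of _ "\<lambda>i. length la - 1 - i" "\<lambda>i. length la - 1 - i"]) auto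
  also have "(\<Sum>i<n. i) = n choose 2" for n by (induction n) (auto simp: numeral_2_eq_2)
  finally show ?thesis by (simp add: sum_list_sum_nth lessThan_atLeast0)
qed

lemma slists_partitions:
  assumes N: "n \<le> N"
  shows "slists N (n + (N choose 2)) = (\<lambda>lam. shift (pad N lam)) ` partitions n"
proof (intro equalityI subsetI)
  fix ka assume "ka \<in> slists N (n + (N choose 2))"
  then have ka: "length ka = N" "sorted_wrt (>) ka" "sum_list ka = n + (N choose 2)" by (auto simp: slists_def)
  have gap: "ka ! j + (j - i) \<le> ka ! i" if "i \<le> j" "j < N" for i j
    using that
  proof (induction j)
    case (Suc j)
    show ?case
    proof (cases "i = Suc j")
      case False
      then have "i \<le> j" using Suc.prems by simp
      moreover have "ka ! Suc j < ka ! j" using ka(1,2) Suc.prems by (simp add: sorted_wrt_iff_nth_less)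
      ultimately show ?thesis using Suc by simp
    qed simp
  qed simp
  define la where "la = map (\<lambda>i. ka ! i - (N - 1 - i)) [0..<N]"
  have ll: "length la = N" by (simp add: la_def)
  have ge: "N - 1 - i \<le> ka ! i" if "i < N" for i using gap[of i "N - 1"] that by linarith
  have kl: "ka = shift la"
  proof (rule nth_equalityI)
    fix i assume "i < length ka"
    then have i: "i < N" using ka(1) by simp
    have "shift la ! i = ka ! i - (N - 1 - i) + (N - 1 - i)" using i by (simp only: nth_shift ll) (simp add: la_def)
    then show "ka ! i = shift la ! i" using ge[OF i] by simp
  qed (simp add: ka(1) ll)
  have "la ! j \<le> la ! i" if "i < j" "j < N" for i j
    using gap[of i j] ge[of j] that by (simp add: la_def)
  then have sd: "sorted_wrt (\<ge>) la" by (simp add: sorted_wrt_iff_nth_less ll)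
  define lam where "lam = filter (\<lambda>a. a \<noteq> 0) la"
  have pl: "la = pad N lam"
    using weakly_decreasing_split[OF sd] by (simp add: pad_def lam_def ll)
  have "sum_list la = n" using ka(3) unfolding kl sum_list_shift ll by simp
  then have "sum_list lam = n" using pl by (simp add: sum_list_pad)
  moreover have "sorted_wrt (\<ge>) lam" unfolding lam_def using sd by (rule sorted_wrt_filter)
  ultimately have "lam \<in> partitions n" by (auto simp: partitions_def is_partition_def lam_def)
  then show "ka \<in> (\<lambda>lam. shift (pad N lam)) ` partitions n" using kl pl by blast
next
  fix ka assume "ka \<in> (\<lambda>lam. shift (pad N lam)) ` partitions n"
  then obtain lam where lam: "lam \<in> partitions n" "ka = shift (pad N lam)" by blast
  have l: "length (pad N lam) = N" using partition_length[OF lam(1)] N by (simp add: length_pad)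
  have "sorted_wrt (>) ka"
    unfolding sorted_wrt_iff_nth_less
  proof (intro allI impI)
    fix i j assume ij: "i < j" "j < length ka"
    have "pad N lam ! j \<le> pad N lam ! i"
      using sorted_pad[OF lam(1), of N] ij l lam(2) by (simp add: sorted_wrt_iff_nth_less)
    then show "ka ! j < ka ! i" using ij l unfolding lam(2) by (simp add: nth_shift)
  qed
  then show "ka \<in> slists N (n + (N choose 2))"
    using lam l by (simp add: slists_def sum_list_shift sum_list_pad partitions_def)
qed

lemma vnorm_nonzero: "vnorm [:0, 1:] mu \<noteq> (0 :: int poly)"
proof (induction mu)
  case (Cons m mu)
  have "qnum [:0, 1:] (Suc k) \<noteq> (0 :: int poly)" for k
  proof
    assume "qnum [:0, 1:] (Suc k) = (0 :: int poly)"
    \<comment> \<open>At q = 1 the value is k + 1.\<close>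
    from arg_cong[OF this, of "\<lambda>p. poly p 1"] show False by (simp add: qnum_def poly_sum poly_power)
  qed
  then show ?case using Cons by simp
qed simp

text \<open>The orthogonality relation sums over shapes, whereas the expansion of a Schur function
  sums over \<mu>; the passage is that from a left to a right inverse of a square matrix.\<close>

lemma finite_left_right_inverse:
  fixes A B :: "'i \<Rightarrow> 'i \<Rightarrow> 'a::field"
  assumes fin: "finite I" and AB: "\<And>i j. i \<in> I \<Longrightarrow> j \<in> I \<Longrightarrow> (\<Sum>k\<in>I. A i k * B k j) = (if i = j then 1 else 0)"
    and ij: "i \<in> I" "j \<in> I"
  shows "(\<Sum>k\<in>I. B i k * A k j) = (if i = j then 1 else 0)"
proof -
  let ?n = "card I"
  obtain h where h: "bij_betw h {0..<?n} I" using ex_bij_betw_nat_finite[OF fin] by blast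
  let ?M = "\<lambda>X. mat ?n ?n (\<lambda>(r, s). X (h r) (h s))"
  have hI: "h r \<in> I" if "r < ?n" for r using h that by (auto simp: bij_betw_def)
  have hinj: "h r = h s \<longleftrightarrow> r = s" if "r < ?n" "s < ?n" for r s
    using h that by (auto simp: bij_betw_def inj_on_def)
  have mult: "(?M X * ?M Y) $$ (r, s) = (\<Sum>k\<in>I. X (h r) k * Y k (h s))" if "r < ?n" "s < ?n" for X Y r s
  proof -
    have "(?M X * ?M Y) $$ (r, s) = (\<Sum>k\<in>{0..<?n}. X (h r) (h k) * Y (h k) (h s))"
      using that by (simp add: scalar_prod_def)
    then show ?thesis using sum.reindex_bij_betw[OF h, of "\<lambda>k. X (h r) k * Y k (h s)"] by simp
  qed
  have "?M A * ?M B = 1\<^sub>m ?n"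
    by (rule eq_matI) (use mult[of _ _ A B] AB hI hinj in \<open>auto simp del: index_mult_mat(1)\<close>)
  then have BA: "?M B * ?M A = 1\<^sub>m ?n" by (rule mat_mult_left_right_inverse[OF mat_carrier mat_carrier])
  have "h ` {0..<?n} = I" using h by (simp add: bij_betw_def)
  then have "i \<in> h ` {0..<?n}" "j \<in> h ` {0..<?n}" using ij by simp_all
  then obtain r s where rs: "r < ?n" "s < ?n" "i = h r" "j = h s" by (elim imageE) simp
  have "(\<Sum>k\<in>I. B i k * A k j) = (?M B * ?M A) $$ (r, s)" using mult[OF rs(1,2), of B A] rs by simp
  then show ?thesis unfolding BA using rs hinj by simp
qed

context
  fixes n N :: nat
  assumes N: "n \<le> N"
begin

abbreviation (input) "t0 \<equiv> [:0, 1:] :: int poly"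
abbreviation (input) "alt_rf la \<equiv> to_fract (alternant (shift (pad N la)) var) :: ratfun"
abbreviation (input) "delta \<equiv> to_fract (alternant (stair N) var) :: ratfun"
abbreviation (input) "coef mu la \<equiv> creas t0 (pad N mu) (shift (pad N la))"
abbreviation (input) "nrm0 mu \<equiv> vnorm t0 (pad N mu)"

lemma inj_var_rf: "inj_on var_rf {..<N}"
  using var_inj by (auto simp: inj_on_def var_rf_var)

lemma delta_eq: "delta = alternant (stair N) var_rf"
  using hom_alternant[OF hom1_to_fract, of "stair N" var] by (simp add: var_rf_var[abs_def])

lemma delta_nonzero: "delta \<noteq> 0"
proof -
  have "finite {(i, j). i < j \<and> j < N}"
    by (rule finite_subset[of _ "{..<N} \<times> {..<N}"]) auto
  then show ?thesis unfolding delta_eq alternant_stair using inj_var_rf by (auto simp: inj_on_def dest: injD[OF var_inj])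
qed

lemma schur_delta:
  assumes "lam \<in> partitions n"
  shows "schur N lam var_rf * delta = alt_rf lam"
proof -
  have "schur N lam var_rf * alternant (stair N) var_rf = alternant (shift (pad N lam)) var_rf"
    using assms partition_length[OF assms] N by (intro schur_alternant) (auto simp: partitions_def)
  then show ?thesis using delta_eq hom_alternant[OF hom1_to_fract, of "shift (pad N lam)" var] by (simp add: var_rf_var[abs_def])
qed

lemma hl_delta:
  assumes mu: "mu \<in> partitions n"
  shows "hall_littlewood_P N mu var_rf q_rf * const_rf (nrm0 mu) * delta =
    (\<Sum>la\<in>partitions n. const_rf (coef mu la) * alt_rf la)"
proof -
  have lmu: "length mu \<le> N" using partition_length[OF mu] N by simp
  have lp: "length (pad N mu) = N" by (rule length_pad[OF lmu])
  have q1: "q_rf \<noteq> 1"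
  proof
    assume "q_rf = 1"
    then have "const_rf (t0 - 1) = 0" by (simp add: hom_diff[OF hom1_const_rf] hom_simps[OF hom1_const_rf] q_rf_def)
    then show False unfolding const_rf_eq_0 by (simp add: one_pCons)
  qed
  have nm: "hl_norm N mu q_rf = const_rf (nrm0 mu)"
    using hl_norm_vnorm[OF q1, of mu N] mu
    by (simp add: hom_vnorm[OF hom1_const_rf] q_rf_def partitions_def is_partition_def)
  have nz: "hl_norm N mu q_rf \<noteq> 0" unfolding nm const_rf_eq_0 by (rule vnorm_nonzero)
  have sp: "sum_list (pad N mu) = n" using mu by (simp add: sum_list_pad partitions_def)
  have inj: "inj_on (\<lambda>lam. shift (pad N lam)) (partitions n)"
    by (rule inj_onI) (metis injD[OF inj_shift] pad_inj)
  have "hall_littlewood_P N mu var_rf q_rf * const_rf (nrm0 mu) * delta =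
    cocreas q_rf (pad N mu) (\<lambda>al. alternant al var_rf)"
    using hall_littlewood_alternant[OF lmu inj_var_rf nz] unfolding nm delta_eq .
  also have "\<dots> = to_fract (cocreas (cst t0) (pad N mu) (\<lambda>al. alternant al var))"
    unfolding hom_cocreas[OF hom1_to_fract] hom_alternant[OF hom1_to_fract]
    by (simp add: q_rf_def const_rf_cst var_rf_var[abs_def])
  also have "cocreas (cst t0) (pad N mu) (\<lambda>al. alternant al var) =
    (\<Sum>ka\<in>slists N (n + (N choose 2)). creas (cst t0) (pad N mu) ka * alternant ka var)"
    using cocreas_dual[OF alt_alternant, of "cst t0" "pad N mu" var] unfolding lp sp .
  also have "\<dots> = (\<Sum>la\<in>partitions n. cst (coef mu la) * alternant (shift (pad N la)) var)"
    unfolding slists_partitions[OF N] sum.reindex[OF inj] by (simp add: hom_creas[OF hom1_cst])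
  finally show ?thesis by (simp add: const_rf_cst)
qed

text \<open>After multiplication by the Vandermonde determinant, the matrix \<open>B\<close>
  expresses the Hall--Littlewood functions in alternants, and the tableau sums form its
  inverse.\<close>

lemma schur_expansion:
  assumes lam: "lam \<in> partitions n"
  shows "schur N lam var_rf = (\<Sum>mu\<in>partitions n. const_rf (kf lam mu) * hall_littlewood_P N mu var_rf q_rf)"
proof -
  let ?c = const_rf and ?I = "partitions n"
  define B where "B la mu = ?c (coef mu la) / ?c (nrm0 mu)" for la mu
  have nz: "?c (nrm0 mu) \<noteq> 0" for mu unfolding const_rf_eq_0 by (rule vnorm_nonzero)
  have P: "hall_littlewood_P N mu var_rf q_rf * delta = (\<Sum>la\<in>?I. B la mu * alt_rf la)" if "mu \<in> ?I" for mu
  proof -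
    have "hall_littlewood_P N mu var_rf q_rf * delta =
      (hall_littlewood_P N mu var_rf q_rf * ?c (nrm0 mu) * delta) / ?c (nrm0 mu)" using nz[of mu] by simp
    also have "\<dots> = (\<Sum>la\<in>?I. B la mu * alt_rf la)"
      unfolding hl_delta[OF that] sum_divide_distrib B_def by (simp add: field_simps)
    finally show ?thesis .
  qed
  have AB: "(\<Sum>la\<in>?I. ?c (kf la nu) * B la mu) = (if nu = mu then 1 else 0)" if "nu \<in> ?I" "mu \<in> ?I" for nu mu
  proof -
    have "(\<Sum>la\<in>?I. ?c (kf la nu) * B la mu) = ?c (\<Sum>la\<in>?I. kf la nu * coef mu la) / ?c (nrm0 mu)"
      unfolding hom_sum[OF hom1_const_rf] hom_simps(4)[OF hom1_const_rf] sum_divide_distrib B_def by simp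
    then show ?thesis unfolding kf_orthogonal[OF that(2,1) N] using nz[of mu] by (simp add: hom_simps[OF hom1_const_rf])
  qed
  have BA: "(\<Sum>mu\<in>?I. B la mu * ?c (kf lam mu)) = (if la = lam then 1 else 0)" if "la \<in> ?I" for la
    by (rule finite_left_right_inverse[where A = "\<lambda>nu la. ?c (kf la nu)" and B = B])
      (use AB that lam finite_partitions in auto)
  have "(\<Sum>mu\<in>?I. ?c (kf lam mu) * hall_littlewood_P N mu var_rf q_rf) * delta =
    (\<Sum>mu\<in>?I. ?c (kf lam mu) * (\<Sum>la\<in>?I. B la mu * alt_rf la))"
    unfolding sum_distrib_right by (rule sum.cong[OF refl]) (simp add: P mult.assoc)
  also have "\<dots> = (\<Sum>la\<in>?I. (\<Sum>mu\<in>?I. B la mu * ?c (kf lam mu)) * alt_rf la)"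
    unfolding sum_distrib_left sum_distrib_right by (subst sum.swap) (simp add: mult_ac)
  also have "\<dots> = (\<Sum>la\<in>?I. if la = lam then alt_rf la else 0)"
    by (rule sum.cong[OF refl]) (simp add: BA)
  also have "\<dots> = schur N lam var_rf * delta"
    unfolding schur_delta[OF lam] using lam finite_partitions by simp
  finally show ?thesis using delta_nonzero by simp
qed

text \<open>Clearing denominators turns a vanishing combination into one of alternants with integer
  polynomial coefficients, which must all be 0. Pairing these coefficients with the tableau sums
  isolates a single \<open>d nu\<close>.\<close>

lemma hl_independent:
  assumes z: "(\<Sum>mu\<in>partitions n. const_rf (d mu) * hall_littlewood_P N mu var_rf q_rf) = 0"
    and nu: "nu \<in> partitions n"
  shows "d nu = 0"
proof -
  let ?c = const_rf and ?I = "partitions n"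
  \<comment> \<open>The common denominator of all norms divided by the norm of
    \<open>mu\<close>.\<close>
  define W where "W mu = (\<Prod>mu'\<in>?I - {mu}. nrm0 mu')" for mu
  have Wn: "W mu * nrm0 mu = (\<Prod>mu'\<in>?I. nrm0 mu')" if "mu \<in> ?I" for mu
    unfolding W_def using prod.remove[OF finite_partitions that, of nrm0] by (simp add: mult.commute)
  have W0: "W mu \<noteq> 0" for mu unfolding W_def using vnorm_nonzero finite_partitions by simp
  have "0 = ?c (\<Prod>mu'\<in>?I. nrm0 mu') * (\<Sum>mu\<in>?I. ?c (d mu) * hall_littlewood_P N mu var_rf q_rf) * delta"
    unfolding z by simp
  also have "\<dots> = (\<Sum>mu\<in>?I. ?c (d mu * W mu) * (hall_littlewood_P N mu var_rf q_rf * ?c (nrm0 mu) * delta))"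
    unfolding sum_distrib_left sum_distrib_right
  proof (rule sum.cong[OF refl])
    fix mu assume "mu \<in> ?I"
    then have "?c (\<Prod>mu'\<in>?I. nrm0 mu') = ?c (W mu) * ?c (nrm0 mu)"
      using arg_cong[OF Wn, of mu ?c] by (simp add: hom_simps[OF hom1_const_rf])
    then show "?c (\<Prod>mu'\<in>?I. nrm0 mu') * (?c (d mu) * hall_littlewood_P N mu var_rf q_rf) * delta =
      ?c (d mu * W mu) * (hall_littlewood_P N mu var_rf q_rf * ?c (nrm0 mu) * delta)"
      by (simp add: hom_simps[OF hom1_const_rf] mult_ac)
  qed
  also have "\<dots> = (\<Sum>mu\<in>?I. \<Sum>la\<in>?I. ?c (d mu * W mu * coef mu la) * alt_rf la)"
    by (rule sum.cong[OF refl], simp only: hl_delta) (simp add: sum_distrib_left hom_simps[OF hom1_const_rf] mult_ac)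
  also have "\<dots> = (\<Sum>la\<in>?I. ?c (\<Sum>mu\<in>?I. d mu * W mu * coef mu la) * alt_rf la)"
    unfolding hom_sum[OF hom1_const_rf] sum_distrib_right by (rule sum.swap)
  also have "\<dots> = to_fract (\<Sum>la\<in>?I. cst (\<Sum>mu\<in>?I. d mu * W mu * coef mu la) * alternant (shift (pad N la)) var)"
    by (simp add: const_rf_cst)
  finally have zero: "(\<Sum>la\<in>?I. cst (\<Sum>mu\<in>?I. d mu * W mu * coef mu la) * alternant (shift (pad N la)) var) = 0"
    unfolding eq_commute[of "0 :: ratfun"] to_fract_eq_0_iff .
  define a where "a ka = (\<Sum>mu\<in>?I. d mu * W mu * creas t0 (pad N mu) ka)" for ka
  have inj: "inj_on (\<lambda>lam. shift (pad N lam)) ?I"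
    by (rule inj_onI) (metis injD[OF inj_shift] pad_inj)
  have "(\<Sum>ka\<in>slists N (n + (N choose 2)). Poly_Mapping.single 0 (a ka) * alternant ka var) = 0"
    unfolding slists_partitions[OF N] sum.reindex[OF inj] using zero by (simp add: a_def cst_def)
  then have "a ka = 0" if "ka \<in> slists N (n + (N choose 2))" for ka
    using alternants_independent[OF finite_slists, of N "n + (N choose 2)" N a ka] that by (auto simp: slists_def)
  then have az: "a (shift (pad N la)) = 0" if "la \<in> ?I" for la
    using that unfolding slists_partitions[OF N] by blast
  have "0 = (\<Sum>la\<in>?I. kf la nu * a (shift (pad N la)))" using az by simp
  also have "\<dots> = (\<Sum>mu\<in>?I. d mu * W mu * (\<Sum>la\<in>?I. kf la nu * coef mu la))"
    unfolding a_def sum_distrib_left by (subst sum.swap) (simp add: mult_ac)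
  also have "\<dots> = (\<Sum>mu\<in>?I. if mu = nu then d mu * W mu * nrm0 mu else 0)"
    by (rule sum.cong[OF refl]) (use kf_orthogonal[OF _ nu N] in auto)
  also have "\<dots> = d nu * W nu * nrm0 nu" using nu finite_partitions by simp
  finally show ?thesis using W0[of nu] vnorm_nonzero[of "pad N nu"] by simp
qed

end

section \<open>Uniqueness of the coefficients and the passage from q to its inverse\<close>

lemma kostka_foulkes_kf:
  assumes lam: "lam \<in> partitions n" and mu: "mu \<in> partitions n"
  shows "kostka_foulkes lam mu = kf lam mu"
proof -
  have s: "sum_list lam = n" using lam by (simp add: partitions_def)
  define K where "K mu = (if mu \<in> partitions n then kf lam mu else 0)" for mu
  have "hl_expansion lam K"
    unfolding hl_expansion_def s using schur_expansion[OF _ lam] by (auto simp: K_def intro!: sum.cong)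
  moreover have "K' = K" if K': "hl_expansion lam K'" for K'
  proof
    fix nu
    show "K' nu = K nu"
    proof (cases "nu \<in> partitions n")
      case True
      \<comment> \<open>The two expansions are compared in n variables, where the Hall--Littlewood
        polynomials of all partitions of n are independent.\<close>
      have "(\<Sum>mu\<in>partitions n. const_rf (K' mu - kf lam mu) * hall_littlewood_P n mu var_rf q_rf) = 0"
        using K' schur_expansion[of n n lam] lam unfolding hl_expansion_def s
        by (simp add: hom_diff[OF hom1_const_rf] left_diff_distrib sum_subtractf)
      then have "K' nu - kf lam nu = 0" using hl_independent[of n n "\<lambda>mu. K' mu - kf lam mu" nu] True by simp
      then show ?thesis using True by (simp add: K_def)
    next
      case False
      then show ?thesis using K' by (simp add: K_def hl_expansion_def s)
    qed
  qed
  ultimately have "kostka_foulkes lam = K" unfolding kostka_foulkes_def by (rule the_equality)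
  then show ?thesis using mu by (simp add: K_def)
qed

lemma poly_map_of_int_sum:
  fixes x :: "'a::comm_ring_1"
  shows "poly (map_poly of_int (\<Sum>i\<in>A. [:0, 1:] ^ e i)) x = (\<Sum>i\<in>A. x ^ e i)"
proof -
  have add: "map_poly of_int (p + q) = (map_poly of_int p + map_poly of_int q :: 'a poly)" for p q
    by (rule poly_eqI) (simp add: coeff_map_poly)
  have pw: "[:0, 1:] ^ k = monom (1 :: int) k" for k by (simp add: monom_altdef)
  show ?thesis
    by (induction A rule: infinite_finite_induct) (simp_all add: add pw map_poly_monom poly_monom)
qed

theorem mainTheorem2:
  fixes n :: nat and lam mu :: "nat list"
  assumes "lam \<in> partitions n" and "mu \<in> partitions n"
  shows "cocharge_kostka_foulkes lam mu =
    (\<Sum>S \<in> {S \<in> standard_tableaux lam. dominates (cattype S) (nth_default 0 mu)}.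
       q_var ^ cocharge S)"
proof -
  let ?A = "{S \<in> standard_tableaux lam. dominates (cattype S) (nth_default 0 mu)}"
  have q: "q_var \<noteq> 0" by (simp add: q_var_def)
  \<comment> \<open>Dominance bounds the cocharge by n(\<mu>), so the subtraction of natural numbers
    in \<open>kf\<close> does not truncate.\<close>
  have le: "cocharge S \<le> n_stat mu" if "S \<in> ?A" for S
  proof -
    have S: "standard S" "length (reading_word S) = n"
      using that assms(1) standard_tableaux_standards[OF assms(1)] by (auto simp: standards_def)
    have "set (map int (reading_word S)) = {1..int n}"
      using S by (simp add: standard_def image_int_atLeastAtMost)
    moreover have "catable mu (map int (reading_word S))"
      using dominates_cattype_iff[OF S(1), of mu] S(2) assms(2) that by simp
    ultimately have "coch 0 (int n) (map int (reading_word S)) \<le> int (n_stat mu)"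
      using coch_le_n_stat[of mu "map int (reading_word S)" 0] assms(2) by (simp add: partitions_def is_partition_def)
    then show ?thesis using cocharge_coch[OF S] by simp
  qed
  have "cocharge_kostka_foulkes lam mu = (\<Sum>S\<in>?A. q_var ^ n_stat mu * inverse q_var ^ (n_stat mu - cocharge S))"
    unfolding cocharge_kostka_foulkes_def kostka_foulkes_kf[OF assms] kf_def poly_map_of_int_sum sum_distrib_left ..
  also have "\<dots> = (\<Sum>S\<in>?A. q_var ^ cocharge S)"
  proof (rule sum.cong[OF refl])
    fix S assume "S \<in> ?A"
    then have "q_var ^ n_stat mu = q_var ^ cocharge S * q_var ^ (n_stat mu - cocharge S)"
      using le by (simp flip: power_add)
    then show "q_var ^ n_stat mu * inverse q_var ^ (n_stat mu - cocharge S) = q_var ^ cocharge S"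
      using q by (simp add: mult.assoc power_mult_distrib[symmetric])
  qed
  finally show ?thesis .
qed

end
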